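(* If $0\le m,n\le p-1$ and $q\ge0$, then $$\operatorname{Ext}^q(W_m,W_n)=\begin{cases}k&\text{if }(n=m\text{ and }q=0)\text{ or }(n<m\text{ and }(q=m-n-1\text{ or }q=m-n)),\\0&\text{otherwise.}\end{cases}$$
   Context: $k$ is a field of characteristic $p>0$; $\mathcal{P}_e$ is the abelian category of homogeneous strict polynomial functors of degree $e$ over $k$ (Friedlander–Suslin; functors from finite-dimensional $k$-vector spaces to finite-dimensional $k$-vector spaces). For a partition (Young diagram) $\lambda=(\lambda_1,\dots,\lambda_n)$ of $e$ with conjugate $\widetilde\lambda$, put $\Lambda^\lambda=\Lambda^{\lambda_1}\otimes\dots\otimes\Lambda^{\lambda_n}$, $S^\lambda=S^{\lambda_1}\otimes\dots\otimes S^{\lambda_n}$ (tensor products of exterior, resp. symmetric, powers). The Schur functor $S_\lambda$ is the image of the composite $\Lambda^\lambda\hookrightarrow I^{\otimes e}\to I^{\otimes e}\twoheadrightarrow S^{\widetilde\lambda}$ of the natural monomorphism, the permutation of tensor factors that passes from the row reading to the column reading of the boxes of $\lambda$, and the natural epimorphism. The Kuhn dual is $G^\#(V)=G(V^* )^*$; the Weyl functor is $W_\lambda=(S_\lambda)^\#$. For $0\le i\le p-1$ put $W_i=W_{(i+1,1^{p-i-1})}$ in $\mathcal{P}_p$. $\operatorname{Ext}$-groups are computed in $\mathcal{P}_p$ (equivalently in its block $\mathcal{P}_p^\varnothing$ corresponding to hooks). *)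

theory Defs
  imports
    "HOL-Library.Poly_Mapping"
    "HOL-Combinatorics.Permutations"
    "HOL-Algebra.AbelCoset"
    "Jordan_Normal_Form.VS_Connect"
    "Jordan_Normal_Form.Matrix_Kernel"
begin

section \<open>Polynomials in matrix entries\<close>

text \<open>Polynomials over 'k in variables indexed by pairs; the variable (i, j) stands for the
  (i, j)-entry of a matrix, i.e. for a coordinate function on Hom(k^m, k^n).\<close>

type_synonym 'k entry_poly = "((nat \<times> nat) \<Rightarrow>\<^sub>0 nat) \<Rightarrow>\<^sub>0 'k"

definition cnst :: "'k::zero \<Rightarrow> 'k entry_poly" where
  "cnst c = Poly_Mapping.single 0 c"

definition entry_var :: "nat \<times> nat \<Rightarrow> 'k::zero_neq_one entry_poly" where
  "entry_var v = Poly_Mapping.single (Poly_Mapping.single v 1) 1"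

definition generic_mat :: "nat \<Rightarrow> nat \<Rightarrow> 'k::zero_neq_one entry_poly mat" where
  "generic_mat nr nc = mat nr nc entry_var"

definition cmat :: "'k::zero mat \<Rightarrow> 'k entry_poly mat" where
  "cmat A = map_mat cnst A"

definition peval :: "'k::comm_ring_1 entry_poly mat \<Rightarrow> 'k entry_poly \<Rightarrow> 'k entry_poly" where
  "peval A f = (\<Sum>\<alpha>\<in>Poly_Mapping.keys f. cnst (Poly_Mapping.lookup f \<alpha>) *
     (\<Prod>v\<in>Poly_Mapping.keys \<alpha>. A $$ v ^ Poly_Mapping.lookup \<alpha> v))"

definition homogeneous_in :: "nat \<Rightarrow> nat \<Rightarrow> nat \<Rightarrow> 'k::zero entry_poly \<Rightarrow> bool" where
  "homogeneous_in e nr nc f \<longleftrightarrow> (\<forall>\<alpha>\<in>Poly_Mapping.keys f.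
     Poly_Mapping.keys \<alpha> \<subseteq> {..<nr} \<times> {..<nc} \<and>
     (\<Sum>v\<in>Poly_Mapping.keys \<alpha>. Poly_Mapping.lookup \<alpha> v) = e)"


section \<open>Homogeneous strict polynomial functors\<close>

text \<open>Finite-dimensional vector spaces are represented by the skeleton consisting of the spaces
  k^n with matrices as morphisms. A functor F sends k^n to k^(fdim F n), and the polynomial
  map Hom(k^m, k^n) \<rightarrow> Hom(F k^m, F k^n), an element of
  S(Hom(k^m, k^n)^*) \<otimes> Hom(F k^m, F k^n), is the matrix fpoly F m n of polynomials in the
  entries of an n-by-m matrix.\<close>

record (overloaded) ('k::zero) spf =
  fdim :: "nat \<Rightarrow> nat"
  fpoly :: "nat \<Rightarrow> nat \<Rightarrow> 'k entry_poly mat"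

definition act :: "'k::comm_ring_1 spf \<Rightarrow> 'k entry_poly mat \<Rightarrow> 'k entry_poly mat" where
  "act F A = map_mat (peval A) (fpoly F (dim_col A) (dim_row A))"

text \<open>Functoriality is required for matrices over the polynomial ring, not just over k: applied to
  two generic matrices with disjoint sets of entries, it is the identity of polynomial maps demanded
  by Friedlander and Suslin, which over a finite field is stronger than the identity of
  values.\<close>

definition strict_poly_functor :: "nat \<Rightarrow> 'k::field spf \<Rightarrow> bool" where
  "strict_poly_functor e F \<longleftrightarrow>
     (\<forall>m n. fpoly F m n \<in> carrier_mat (fdim F n) (fdim F m)) \<and>
     (\<forall>m n. \<forall>i<fdim F n. \<forall>j<fdim F m. homogeneous_in e n m (fpoly F m n $$ (i, j))) \<and>
     (\<forall>n. act F (1\<^sub>m n) = 1\<^sub>m (fdim F n)) \<and>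
     (\<forall>l m n A B. A \<in> carrier_mat n m \<longrightarrow> B \<in> carrier_mat m l \<longrightarrow>
        act F (A * B) = act F A * act F B)"

definition nat_trans :: "'k::field spf \<Rightarrow> 'k spf \<Rightarrow> (nat \<Rightarrow> 'k mat) set" where
  "nat_trans F G = {f.
     (\<forall>n. f n \<in> carrier_mat (fdim G n) (fdim F n)) \<and>
     (\<forall>m n. fpoly G m n * cmat (f m) = cmat (f n) * fpoly F m n)}"

definition comp_nt :: "(nat \<Rightarrow> 'k::field mat) \<Rightarrow> (nat \<Rightarrow> 'k mat) \<Rightarrow> (nat \<Rightarrow> 'k mat)" where
  "comp_nt g f = (\<lambda>n. g n * f n)"

text \<open>Kernels, images and cokernels in the category of homogeneous strict polynomial functors
  are formed objectwise.\<close>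

definition mat_image :: "'k::field mat \<Rightarrow> 'k vec set" where
  "mat_image A = (\<lambda>v. A *\<^sub>v v) ` carrier_vec (dim_col A)"

definition mono_nt :: "(nat \<Rightarrow> 'k::field mat) \<Rightarrow> bool" where
  "mono_nt f \<longleftrightarrow> (\<forall>n. mat_kernel (f n) = {0\<^sub>v (dim_col (f n))})"

definition epi_nt :: "(nat \<Rightarrow> 'k::field mat) \<Rightarrow> bool" where
  "epi_nt f \<longleftrightarrow> (\<forall>n. mat_image (f n) = carrier_vec (dim_row (f n)))"

definition exact_nt :: "(nat \<Rightarrow> 'k::field mat) \<Rightarrow> (nat \<Rightarrow> 'k mat) \<Rightarrow> bool" where
  "exact_nt f g \<longleftrightarrow> (\<forall>n. mat_image (f n) = mat_kernel (g n))"


section \<open>Tensor products and tensor, exterior and symmetric powers\<close>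

definition kron :: "'a::times mat \<Rightarrow> 'a mat \<Rightarrow> 'a mat" where
  "kron A B = mat (dim_row A * dim_row B) (dim_col A * dim_col B)
     (\<lambda>(i, j). A $$ (i div dim_row B, j div dim_col B) * B $$ (i mod dim_row B, j mod dim_col B))"

definition tensor_unit :: "'k::field spf" where
  "tensor_unit = \<lparr>fdim = (\<lambda>n. 1), fpoly = (\<lambda>m n. 1\<^sub>m 1)\<rparr>"

definition tensor :: "'k::field spf \<Rightarrow> 'k spf \<Rightarrow> 'k spf" where
  "tensor F G = \<lparr>fdim = (\<lambda>n. fdim F n * fdim G n),
                 fpoly = (\<lambda>m n. kron (fpoly F m n) (fpoly G m n))\<rparr>"

definition tensor_list :: "'k::field spf list \<Rightarrow> 'k spf" where
  "tensor_list Fs = foldr tensor Fs tensor_unit"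

definition tensor_list_nt :: "(nat \<Rightarrow> 'k::field mat) list \<Rightarrow> (nat \<Rightarrow> 'k mat)" where
  "tensor_list_nt fs = (\<lambda>n. foldr (\<lambda>f A. kron (f n) A) fs (1\<^sub>m 1))"

definition id_functor :: "'k::field spf" where
  "id_functor = \<lparr>fdim = (\<lambda>n. n), fpoly = (\<lambda>m n. generic_mat n m)\<rparr>"

definition tensor_power :: "nat \<Rightarrow> 'k::field spf" where
  "tensor_power d = tensor_list (replicate d id_functor)"

definition labelled_mat :: "'b list \<Rightarrow> 'c list \<Rightarrow> ('b \<Rightarrow> 'c \<Rightarrow> 'a) \<Rightarrow> 'a mat" where
  "labelled_mat rs cs f = mat (length rs) (length cs) (\<lambda>(i, j). f (rs ! i) (cs ! j))"

text \<open>Words w of length d label the basis e_(w!0) \<otimes> ... \<otimes> e_(w!(d-1)) of the d-th tensor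
  power of k^n. They are in lexicographic order, as in the iterated Kronecker product.\<close>

definition words :: "nat \<Rightarrow> nat \<Rightarrow> nat list list" where
  "words d n = product_lists (replicate d [0..<n])"

text \<open>Strictly increasing words label the basis e_(J!0) \<and> ... \<and> e_(J!(d-1)) of the exterior
  power; weakly increasing words label the monomial basis of the symmetric power.\<close>

definition ext_words :: "nat \<Rightarrow> nat \<Rightarrow> nat list list" where
  "ext_words d n = filter (sorted_wrt (<)) (words d n)"

definition sym_words :: "nat \<Rightarrow> nat \<Rightarrow> nat list list" where
  "sym_words d n = filter sorted (words d n)"

definition ext_power :: "nat \<Rightarrow> 'k::field spf" where
  "ext_power d = \<lparr>fdim = (\<lambda>n. length (ext_words d n)),
     fpoly = (\<lambda>m n. labelled_mat (ext_words d n) (ext_words d m)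
       (\<lambda>I J. det (mat d d (\<lambda>(a, b). entry_var (I ! a, J ! b)))))\<rparr>"

text \<open>The matrix entry is the coefficient of the monomial labelled by I in the product over b of
  the images (\<Sum>i. x_(i, J!b) e_i) of the vectors e_(J!b).\<close>

definition sym_power :: "nat \<Rightarrow> 'k::field spf" where
  "sym_power d = \<lparr>fdim = (\<lambda>n. length (sym_words d n)),
     fpoly = (\<lambda>m n. labelled_mat (sym_words d n) (sym_words d m)
       (\<lambda>I J. \<Sum>w | w \<in> set (words d n) \<and> sort w = I. \<Prod>b<d. entry_var (w ! b, J ! b)))\<rparr>"

text \<open>v_0 \<and> ... \<and> v_(d-1) \<mapsto> \<Sum>\<sigma>. sign \<sigma> v_(\<sigma> 0) \<otimes> ... \<otimes> v_(\<sigma> (d-1))\<close>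

definition ext_to_tensor :: "nat \<Rightarrow> (nat \<Rightarrow> 'k::field mat)" where
  "ext_to_tensor d = (\<lambda>n. labelled_mat (words d n) (ext_words d n)
     (\<lambda>w J. \<Sum>\<sigma> | \<sigma> permutes {..<d} \<and> w = map (\<lambda>t. J ! \<sigma> t) [0..<d]. of_int (sign \<sigma>)))"

definition tensor_to_sym :: "nat \<Rightarrow> (nat \<Rightarrow> 'k::field mat)" where
  "tensor_to_sym d = (\<lambda>n. labelled_mat (sym_words d n) (words d n)
     (\<lambda>I w. if sort w = I then 1 else 0))"


section \<open>Schur and Weyl functors\<close>

text \<open>Partitions are weakly decreasing lists of row lengths.\<close>

definition conj_partition :: "nat list \<Rightarrow> nat list" where
  "conj_partition \<mu> = map (\<lambda>c. length (filter (\<lambda>a. c < a) \<mu>)) [0..<foldr max \<mu> 0]"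

definition column_boxes :: "nat list \<Rightarrow> (nat \<times> nat) list" where
  "column_boxes \<mu> =
     [(r, c). c \<leftarrow> [0..<length (conj_partition \<mu>)], r \<leftarrow> [0..<conj_partition \<mu> ! c]]"

text \<open>The box in row r and column c (both counted from 0) is number sum_list (take r \<mu>) + c in
  the row reading.\<close>

definition row_to_column :: "nat list \<Rightarrow> (nat \<Rightarrow> 'k::field mat)" where
  "row_to_column \<mu> = (\<lambda>n. labelled_mat (words (sum_list \<mu>) n) (words (sum_list \<mu>) n)
     (\<lambda>w' w. if w' = map (\<lambda>(r, c). w ! (sum_list (take r \<mu>) + c)) (column_boxes \<mu>)
             then 1 else 0))"

definition schur_map :: "nat list \<Rightarrow> (nat \<Rightarrow> 'k::field mat)" where
  "schur_map \<mu> =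
     comp_nt (tensor_list_nt (map tensor_to_sym (conj_partition \<mu>)))
       (comp_nt (row_to_column \<mu>) (tensor_list_nt (map ext_to_tensor \<mu>)))"

definition is_image_of :: "nat \<Rightarrow> 'k::field spf \<Rightarrow> 'k spf \<Rightarrow> (nat \<Rightarrow> 'k mat) \<Rightarrow> 'k spf \<Rightarrow> bool" where
  "is_image_of e F G f S \<longleftrightarrow> strict_poly_functor e S \<and>
     (\<exists>a\<in>nat_trans F S. \<exists>b\<in>nat_trans S G. epi_nt a \<and> mono_nt b \<and> comp_nt b a = f)"

text \<open>The image is determined only up to isomorphism, since its value on k^n has to be identified
  with some k^d. In this convention the one-row partition (e) gives the e-th exterior power
  and the one-column partition gives the e-th symmetric power.\<close>

definition schur_functor :: "nat list \<Rightarrow> 'k::field spf" where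
  "schur_functor \<mu> = (SOME S. is_image_of (sum_list \<mu>)
     (tensor_list (map ext_power \<mu>)) (tensor_list (map sym_power (conj_partition \<mu>)))
     (schur_map \<mu>) S)"

text \<open>In dual bases, passing to dual spaces transposes matrices: the dual functor sends A to
  the transpose of G(transpose of A).\<close>

definition kuhn_dual :: "'k::field spf \<Rightarrow> 'k spf" where
  "kuhn_dual G = \<lparr>fdim = fdim G,
     fpoly = (\<lambda>m n. transpose_mat (act G (transpose_mat (generic_mat n m))))\<rparr>"

definition weyl_functor :: "nat list \<Rightarrow> 'k::field spf" where
  "weyl_functor \<mu> = kuhn_dual (schur_functor \<mu>)"

definition hook_weyl :: "nat \<Rightarrow> nat \<Rightarrow> 'k::field spf" where
  "hook_weyl p i = weyl_functor ((i + 1) # replicate (p - i - 1) 1)"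


section \<open>Ext groups\<close>

definition hom_space :: "'k::field spf \<Rightarrow> 'k spf \<Rightarrow> ('k, nat \<Rightarrow> 'k mat) module" where
  "hom_space F G = \<lparr>carrier = nat_trans F G, mult = undefined, one = undefined,
     zero = (\<lambda>n. 0\<^sub>m (fdim G n) (fdim F n)), add = (\<lambda>f g n. f n + g n),
     smult = (\<lambda>c f n. c \<cdot>\<^sub>m f n)\<rparr>"

definition quotient_space :: "('k, 'v) module \<Rightarrow> 'v set \<Rightarrow> ('k, 'v set) module" where
  "quotient_space V B = \<lparr>carrier = a_rcosets\<^bsub>V\<^esub> B, mult = undefined, one = undefined,
     zero = B, add = set_add V,
     smult = (\<lambda>c X. \<Union>x\<in>X. B +>\<^bsub>V\<^esub> (c \<odot>\<^bsub>V\<^esub> x))\<rparr>"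

definition projective_functor :: "nat \<Rightarrow> 'k::field spf \<Rightarrow> bool" where
  "projective_functor e P \<longleftrightarrow> strict_poly_functor e P \<and>
     (\<forall>G H. strict_poly_functor e G \<longrightarrow> strict_poly_functor e H \<longrightarrow>
       (\<forall>g\<in>nat_trans G H. epi_nt g \<longrightarrow>
         (\<forall>f\<in>nat_trans P H. \<exists>h\<in>nat_trans P G. comp_nt g h = f)))"

definition projective_resolution ::
  "nat \<Rightarrow> (nat \<Rightarrow> 'k::field spf) \<Rightarrow> (nat \<Rightarrow> nat \<Rightarrow> 'k mat) \<Rightarrow> (nat \<Rightarrow> 'k mat) \<Rightarrow> 'k spf \<Rightarrow> bool"
  where
  "projective_resolution e P d \<epsilon> M \<longleftrightarrow>
     (\<forall>i. projective_functor e (P i)) \<and>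
     (\<forall>i. d i \<in> nat_trans (P (Suc i)) (P i)) \<and> \<epsilon> \<in> nat_trans (P 0) M \<and>
     epi_nt \<epsilon> \<and> exact_nt (d 0) \<epsilon> \<and> (\<forall>i. exact_nt (d (Suc i)) (d i))"

definition cocycles ::
  "(nat \<Rightarrow> 'k::field spf) \<Rightarrow> (nat \<Rightarrow> nat \<Rightarrow> 'k mat) \<Rightarrow> 'k spf \<Rightarrow> nat \<Rightarrow> (nat \<Rightarrow> 'k mat) set" where
  "cocycles P d N q =
     {f \<in> nat_trans (P q) N. comp_nt f (d q) = \<zero>\<^bsub>hom_space (P (Suc q)) N\<^esub>}"

fun coboundaries ::
  "(nat \<Rightarrow> 'k::field spf) \<Rightarrow> (nat \<Rightarrow> nat \<Rightarrow> 'k mat) \<Rightarrow> 'k spf \<Rightarrow> nat \<Rightarrow> (nat \<Rightarrow> 'k mat) set" where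
  "coboundaries P d N 0 = {\<zero>\<^bsub>hom_space (P 0) N\<^esub>}"
| "coboundaries P d N (Suc q) = (\<lambda>f. comp_nt f (d q)) ` nat_trans (P q) N"

definition hom_cohomology ::
  "(nat \<Rightarrow> 'k::field spf) \<Rightarrow> (nat \<Rightarrow> nat \<Rightarrow> 'k mat) \<Rightarrow> 'k spf \<Rightarrow> nat \<Rightarrow> ('k, (nat \<Rightarrow> 'k mat) set) module"
  where
  "hom_cohomology P d N q =
     quotient_space ((hom_space (P q) N)\<lparr>carrier := cocycles P d N q\<rparr>) (coboundaries P d N q)"

text \<open>The q-th right derived functor of Hom(-, N) at M in the category of homogeneous functors of
  degree e, computed from a chosen projective resolution of M.\<close>

definition Ext :: "nat \<Rightarrow> nat \<Rightarrow> 'k::field spf \<Rightarrow> 'k spf \<Rightarrow> ('k, (nat \<Rightarrow> 'k mat) set) module" where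
  "Ext e q M N =
     (let (P, d) = (SOME (P, d). \<exists>\<epsilon>. projective_resolution e P d \<epsilon> M)
      in hom_cohomology P d N q)"

definition isomorphic_spaces :: "('k::field, 'v) module \<Rightarrow> ('k, 'w) module \<Rightarrow> bool" where
  "isomorphic_spaces V W \<longleftrightarrow>
     (\<exists>T. linear_map class_ring V W T \<and> bij_betw T (carrier V) (carrier W))"

definition ground_field :: "('k::field, 'k) module" where
  "ground_field = \<lparr>carrier = UNIV, mult = (*), one = 1, zero = 0, add = (+), smult = (*)\<rparr>"

definition zero_space :: "('k::field, unit) module" where
  "zero_space = \<lparr>carrier = UNIV, mult = undefined, one = undefined, zero = (), add = (\<lambda>_ _. ()),
     smult = (\<lambda>_ _. ())\<rparr>"

end

theory Submission
  imports Defs "HOL-Combinatorics.Multiset_Permutations"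
begin

text \<open>Let \<open>P\<^sub>i = \<Gamma>\<^sup>p\<^sup>-\<^sup>i \<otimes> \<Lambda>\<^sup>i\<close>, realized inside \<open>I\<^sup>\<otimes>\<^sup>p\<close> as the tensors that are alternating in the first \<open>i\<close> and
  symmetric in the remaining positions. For \<open>i < p\<close> it is projective, being a summand of
  \<open>\<Gamma>\<^sup>p\<^sup>-\<^sup>i \<otimes> I\<^sup>\<otimes>\<^sup>i\<close>. The hook Weyl functor \<open>W\<^sub>i\<close> is the image of the Koszul differential
  \<open>P\<^sub>i \<rightarrow> P\<^sub>i\<^sub>+\<^sub>1\<close>, and the Koszul complex is exact, so \<open>P\<^sub>0 \<rightarrow> \<dots> \<rightarrow> P\<^sub>m \<rightarrow> W\<^sub>m\<close> is a projective
  resolution. A weight argument on the generator of \<open>P\<^sub>i\<close> shows that \<open>Hom(P\<^sub>i, P\<^sub>j)\<close> vanishes for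
  \<open>\<bar>i - j\<bar> \<ge> 2\<close> and is spanned by the Koszul differential or codifferential for \<open>\<bar>i - j\<bar> = 1\<close>. Hence
  \<open>Hom(P\<^sub>i, W\<^sub>n)\<close> is one-dimensional for \<open>i = n\<close> and \<open>i = n + 1\<close> and zero otherwise. The complex
  computing \<open>Ext(W\<^sub>m, W\<^sub>n)\<close> has zero differentials: the only one between nonzero spaces sends the
  generator of \<open>Hom(P\<^sub>n\<^sub>+\<^sub>1, W\<^sub>n)\<close> to \<open>p = 0\<close> times the generator of \<open>Hom(P\<^sub>n, W\<^sub>n)\<close>.\<close>

section \<open>Polynomials in matrix entries\<close>

text \<open>Every functor is handled inside the tensor power: an element of
  \<open>\<Gamma>\<^sup>p\<^sup>-\<^sup>i \<otimes> \<Lambda>\<^sup>i\<close> is a function on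
  words, and the Koszul maps are combinations of place permutations. Functoriality and naturality
  are inherited from the tensor power. The Schur functor is an image fixed only up to isomorphism,
  so the Weyl functor is reached solely through a cover and an embedding whose composite is the
  Koszul differential. The numbers that matter are few. The factorial of \<open>i\<close>,
  invertible for \<open>i < p\<close>, is the price of splitting off an alternation over
  \<open>i\<close> positions. On the generator, differential after codifferential after differential
  gives \<open>(p - n) + n\<close>, which is the \<open>p\<close> that kills the differential of the
  Hom complex. In characteristic two a sign is invisible; there vanishing on repeated letters is
  demanded separately, and \<open>i < p\<close> forces \<open>i \<le> 1\<close>. A map out of a
  Koszul term is recovered from the image of one generator by comparing coefficients of polynomials
  rather than values, because the field may be finite.\<close>

lemma cnst_simps [simp]:
  "cnst (0::'k::comm_ring_1) = 0" "cnst (1::'k) = 1"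
  by (simp_all add: cnst_def)

lemma cnst_add: "cnst (a + b :: 'k::comm_ring_1) = cnst a + cnst b"
  by (simp add: cnst_def single_add)

lemma cnst_mult: "cnst (a * b :: 'k::comm_ring_1) = cnst a * cnst b"
  by (simp add: cnst_def mult_single)

lemma comm_ring_hom_cnst: "comm_ring_hom (cnst :: 'k::comm_ring_1 \<Rightarrow> _)"
  by unfold_locales (simp_all add: cnst_add cnst_mult)

lemma poly_mapping_sum_monomials:
  "(\<Sum>\<alpha>\<in>Poly_Mapping.keys f. Poly_Mapping.single \<alpha> (Poly_Mapping.lookup f \<alpha>)) = f"
proof (rule poly_mapping_eqI)
  fix k
  show "Poly_Mapping.lookup (\<Sum>\<alpha>\<in>Poly_Mapping.keys f. Poly_Mapping.single \<alpha> (Poly_Mapping.lookup f \<alpha>)) k =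
      Poly_Mapping.lookup f k"
    by (simp add: lookup_sum lookup_single when_def in_keys_iff)
qed

abbreviation monom_eval :: "'k::comm_ring_1 entry_poly mat \<Rightarrow> (nat \<times> nat \<Rightarrow>\<^sub>0 nat) \<Rightarrow> 'k entry_poly" where
  "monom_eval A \<alpha> \<equiv> \<Prod>v\<in>Poly_Mapping.keys \<alpha>. A $$ v ^ Poly_Mapping.lookup \<alpha> v"

lemma monom_eval_superset:
  assumes "finite S" "Poly_Mapping.keys \<alpha> \<subseteq> S"
  shows "monom_eval A \<alpha> = (\<Prod>v\<in>S. A $$ v ^ Poly_Mapping.lookup \<alpha> v)"
  by (rule prod.mono_neutral_left) (use assms in \<open>auto simp: in_keys_iff\<close>)

lemma monom_eval_add: "monom_eval A (\<alpha> + \<beta>) = monom_eval A \<alpha> * monom_eval A \<beta>"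
proof -
  let ?S = "Poly_Mapping.keys \<alpha> \<union> Poly_Mapping.keys \<beta>"
  have "monom_eval A (\<alpha> + \<beta>) = (\<Prod>v\<in>?S. A $$ v ^ Poly_Mapping.lookup (\<alpha> + \<beta>) v)"
    by (rule monom_eval_superset) (use keys_add[of \<alpha> \<beta>] in auto)
  also have "\<dots> = (\<Prod>v\<in>?S. A $$ v ^ Poly_Mapping.lookup \<alpha> v) * (\<Prod>v\<in>?S. A $$ v ^ Poly_Mapping.lookup \<beta> v)"
    by (simp add: lookup_add power_add prod.distrib)
  finally show ?thesis
    by (simp add: monom_eval_superset[of ?S])
qed

lemma peval_superset:
  assumes "finite S" "Poly_Mapping.keys f \<subseteq> S"
  shows "peval A f = (\<Sum>\<alpha>\<in>S. cnst (Poly_Mapping.lookup f \<alpha>) * monom_eval A \<alpha>)"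
  unfolding peval_def by (rule sum.mono_neutral_left) (use assms in \<open>auto simp: in_keys_iff\<close>)

lemma peval_add: "peval A (f + g) = peval A f + peval A g"
proof -
  let ?S = "Poly_Mapping.keys f \<union> Poly_Mapping.keys g"
  have "peval A (f + g) = (\<Sum>\<alpha>\<in>?S. cnst (Poly_Mapping.lookup (f + g) \<alpha>) * monom_eval A \<alpha>)"
    by (rule peval_superset) (use keys_add[of f g] in auto)
  then show ?thesis
    by (simp add: peval_superset[of ?S] lookup_add cnst_add ring_distribs sum.distrib)
qed

lemma peval_0 [simp]: "peval A 0 = 0"
  by (simp add: peval_def)

lemma peval_sum: "peval A (\<Sum>i\<in>I. f i) = (\<Sum>i\<in>I. peval A (f i))"
  by (induction I rule: infinite_finite_induct) (simp_all add: peval_add)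

lemma peval_single: "peval A (Poly_Mapping.single \<alpha> c) = cnst c * monom_eval A \<alpha>"
  by (cases "c = 0") (auto simp: peval_def)

lemma peval_mult: "peval A (f * g) = peval A f * peval A g"
proof -
  have *: "f = (\<Sum>\<alpha>\<in>Poly_Mapping.keys f. Poly_Mapping.single \<alpha> (Poly_Mapping.lookup f \<alpha>))"
    for f :: "'a entry_poly"
    by (simp add: poly_mapping_sum_monomials)
  have "peval A (f * g) = peval A (\<Sum>\<alpha>\<in>Poly_Mapping.keys f. \<Sum>\<beta>\<in>Poly_Mapping.keys g.
      Poly_Mapping.single (\<alpha> + \<beta>) (Poly_Mapping.lookup f \<alpha> * Poly_Mapping.lookup g \<beta>))"
    by (subst (1) *[of f], subst (1) *[of g]) (simp add: sum_product mult_single)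
  also have "\<dots> = peval A f * peval A g"
    unfolding peval_sum peval_single monom_eval_add cnst_mult
    by (simp add: peval_def sum_product mult_ac)
  finally show ?thesis .
qed

lemma peval_cnst [simp]: "peval A (cnst c) = cnst c"
  by (simp add: cnst_def peval_single[unfolded cnst_def])

lemma peval_1 [simp]: "peval A 1 = 1"
  using peval_cnst[of A 1] by simp

lemma peval_var [simp]: "peval A (entry_var v) = A $$ v"
  by (simp add: entry_var_def peval_single)

lemma comm_ring_hom_peval: "comm_ring_hom (peval A)"
  by unfold_locales (simp_all add: peval_add peval_mult)

lemma prod_entry_var:
  "(\<Prod>v\<in>Poly_Mapping.keys \<alpha>. entry_var v ^ Poly_Mapping.lookup \<alpha> v) =
     (Poly_Mapping.single \<alpha> 1 :: 'k::comm_ring_1 entry_poly)"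
proof -
  have pow: "(entry_var v :: 'k entry_poly) ^ j = Poly_Mapping.single (Poly_Mapping.single v j) 1" for v j
    by (induction j) (simp_all add: entry_var_def mult_single flip: single_add)
  have "(\<Prod>v\<in>S. Poly_Mapping.single (f v) 1 :: 'k entry_poly) = Poly_Mapping.single (\<Sum>v\<in>S. f v) 1" for S :: "(nat \<times> nat) set" and f
    by (induction S rule: infinite_finite_induct) (simp_all add: mult_single)
  then show ?thesis
    by (simp add: pow poly_mapping_sum_monomials)
qed

text \<open>The generic matrix replaces each variable by itself as long as its index lies inside the
  matrix. Hence \<open>act\<close> on a generic matrix returns the polynomials of the functor
  (\<open>act_generic\<close>).\<close>

lemma peval_generic:
  assumes "homogeneous_in e nr nc f"
  shows "peval (generic_mat nr nc) f = f"
proof -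
  have "peval (generic_mat nr nc) f =
      (\<Sum>\<alpha>\<in>Poly_Mapping.keys f. cnst (Poly_Mapping.lookup f \<alpha>) * Poly_Mapping.single \<alpha> 1)"
    unfolding peval_def
  proof (rule sum.cong)
    fix \<alpha> assume "\<alpha> \<in> Poly_Mapping.keys f"
    with assms have "Poly_Mapping.keys \<alpha> \<subseteq> {..<nr} \<times> {..<nc}"
      by (auto simp: homogeneous_in_def)
    then have "monom_eval (generic_mat nr nc) \<alpha> =
        (\<Prod>v\<in>Poly_Mapping.keys \<alpha>. entry_var v ^ Poly_Mapping.lookup \<alpha> v :: 'a entry_poly)"
      by (intro prod.cong) (auto simp: generic_mat_def)
    then show "cnst (Poly_Mapping.lookup f \<alpha>) * monom_eval (generic_mat nr nc) \<alpha> =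
        cnst (Poly_Mapping.lookup f \<alpha>) * Poly_Mapping.single \<alpha> 1"
      by (simp add: prod_entry_var)
  qed simp
  also have "\<dots> = f"
    by (simp add: cnst_def mult_single poly_mapping_sum_monomials)
  finally show ?thesis .
qed

text \<open>Homogeneity supplies the bound on the variables: outside the dimensions of
  \<open>B\<close> an entry is unspecified and need not commute with \<open>map_mat\<close>.\<close>

lemma peval_peval:
  assumes "homogeneous_in e nr nc f" "B \<in> carrier_mat nr nc"
  shows "peval A (peval B f) = peval (map_mat (peval A) B) f"
proof -
  interpret p: comm_ring_hom "peval A" by (rule comm_ring_hom_peval)
  show ?thesis
    unfolding peval_def[of B] peval_def[of "map_mat (peval A) B"]
    unfolding p.hom_sum p.hom_mult p.hom_prod p.hom_power peval_cnst
    by (intro sum.cong prod.cong arg_cong2[of _ _ _ _ "(*)"] refl)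
       (use assms in \<open>force simp: homogeneous_in_def\<close>)
qed

definition degm :: "(nat \<times> nat \<Rightarrow>\<^sub>0 nat) \<Rightarrow> nat" where
  "degm \<alpha> = (\<Sum>v\<in>Poly_Mapping.keys \<alpha>. Poly_Mapping.lookup \<alpha> v)"

lemma degm_superset:
  "finite S \<Longrightarrow> Poly_Mapping.keys \<alpha> \<subseteq> S \<Longrightarrow> degm \<alpha> = (\<Sum>v\<in>S. Poly_Mapping.lookup \<alpha> v)"
  unfolding degm_def by (rule sum.mono_neutral_left) (auto simp: in_keys_iff)

lemma degm_add: "degm (\<alpha> + \<beta>) = degm \<alpha> + degm \<beta>"
proof -
  let ?S = "Poly_Mapping.keys \<alpha> \<union> Poly_Mapping.keys \<beta>"
  have "degm (\<alpha> + \<beta>) = (\<Sum>v\<in>?S. Poly_Mapping.lookup (\<alpha> + \<beta>) v)"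
    by (rule degm_superset) (use keys_add[of \<alpha> \<beta>] in auto)
  then show ?thesis
    by (simp add: degm_superset[of ?S] lookup_add sum.distrib)
qed

lemma homogeneous_in_alt:
  "homogeneous_in e nr nc f \<longleftrightarrow>
     (\<forall>\<alpha>\<in>Poly_Mapping.keys f. Poly_Mapping.keys \<alpha> \<subseteq> {..<nr} \<times> {..<nc} \<and> degm \<alpha> = e)"
  by (simp add: homogeneous_in_def degm_def)

lemma homogeneous_in_0 [simp]: "homogeneous_in e nr nc 0"
  by (simp add: homogeneous_in_def)

lemma homogeneous_in_1 [simp]: "homogeneous_in 0 nr nc (1 :: 'k::comm_ring_1 entry_poly)"
  by (simp add: homogeneous_in_def)

lemma homogeneous_in_add:
  "homogeneous_in e nr nc f \<Longrightarrow> homogeneous_in e nr nc g \<Longrightarrow>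
     homogeneous_in e nr nc (f + g :: 'k::comm_ring_1 entry_poly)"
  using keys_add[of f g] by (auto simp: homogeneous_in_def)

lemma homogeneous_in_sum:
  "(\<And>i. i \<in> I \<Longrightarrow> homogeneous_in e nr nc (f i)) \<Longrightarrow>
     homogeneous_in e nr nc (\<Sum>i\<in>I. f i :: 'k::comm_ring_1 entry_poly)"
  by (induction I rule: infinite_finite_induct) (auto intro: homogeneous_in_add)

lemma homogeneous_in_mult:
  assumes "homogeneous_in d nr nc f" "homogeneous_in e nr nc g"
  shows "homogeneous_in (d + e) nr nc (f * g :: 'k::comm_ring_1 entry_poly)"
  unfolding homogeneous_in_alt
proof
  fix \<gamma> assume "\<gamma> \<in> Poly_Mapping.keys (f * g)"
  then obtain \<alpha> \<beta> where *: "\<alpha> \<in> Poly_Mapping.keys f" "\<beta> \<in> Poly_Mapping.keys g" "\<gamma> = \<alpha> + \<beta>"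
    using keys_mult[of f g] by blast
  show "Poly_Mapping.keys \<gamma> \<subseteq> {..<nr} \<times> {..<nc} \<and> degm \<gamma> = d + e"
    using assms * keys_add[of \<alpha> \<beta>] by (force simp: homogeneous_in_alt degm_add)
qed

lemma homogeneous_in_prod:
  "(\<And>i. i \<in> I \<Longrightarrow> homogeneous_in (d i) nr nc (f i)) \<Longrightarrow>
     homogeneous_in (\<Sum>i\<in>I. d i) nr nc (\<Prod>i\<in>I. f i :: 'k::comm_ring_1 entry_poly)"
  by (induction I rule: infinite_finite_induct) (auto intro: homogeneous_in_mult)

lemma homogeneous_in_cnst: "homogeneous_in 0 nr nc (cnst c :: 'k::comm_ring_1 entry_poly)"
  by (simp add: homogeneous_in_def cnst_def)

lemma homogeneous_in_var:
  "i < nr \<Longrightarrow> j < nc \<Longrightarrow> homogeneous_in 1 nr nc (entry_var (i, j) :: 'k::comm_ring_1 entry_poly)"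
  by (simp add: homogeneous_in_def entry_var_def)

lemma homogeneous_in_cnst_mult:
  "homogeneous_in e nr nc f \<Longrightarrow> homogeneous_in e nr nc (cnst c * f :: 'k::comm_ring_1 entry_poly)"
  using homogeneous_in_mult[of 0 nr nc "cnst c" e f] homogeneous_in_cnst by auto

section \<open>Matrix factorizations\<close>

lemma index_mult_mat_sum:
  assumes "A \<in> carrier_mat n m" "B \<in> carrier_mat m l" "i < n" "j < l"
  shows "(A * B) $$ (i, j) = (\<Sum>k<m. A $$ (i, k) * B $$ (k, j))"
  using assms by (simp add: scalar_prod_def atLeast0LessThan)

text \<open>Gaussian elimination, one pivot at a time, by induction on the number of nonzero rows.
  The one-sided inverses are carried along because they turn statements on kernels and images into
  matrix identities, which survive the passage to polynomial matrices.\<close>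

lemma rank_factorization:
  assumes "A \<in> carrier_mat r c"
  shows "\<exists>k b a b' a'. b \<in> carrier_mat r k \<and> a \<in> carrier_mat k c \<and> b' \<in> carrier_mat k r \<and>
    a' \<in> carrier_mat c k \<and> (A :: 'k::field mat) = b * a \<and> b' * b = 1\<^sub>m k \<and> a * a' = 1\<^sub>m k"
  using assms
proof (induction "card {i \<in> {..<r}. \<exists>j<c. A $$ (i, j) \<noteq> 0}" arbitrary: A rule: less_induct)
  case less
  note A = less.prems
  show ?case
  proof (cases "\<exists>i<r. \<exists>j<c. A $$ (i, j) \<noteq> 0")
    case False
    then have "A = 0\<^sub>m r c"
      using A by (intro eq_matI) auto
    then show ?thesis
      by (intro exI[of _ 0] exI[of _ "0\<^sub>m r 0"] exI[of _ "0\<^sub>m 0 c"] exI[of _ "0\<^sub>m 0 r"] exI[of _ "0\<^sub>m c 0"])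
         (auto intro!: eq_matI simp: scalar_prod_def)
  next
    case True
    then obtain i0 j0 where ij: "i0 < r" "j0 < c" "A $$ (i0, j0) \<noteq> 0" by blast
    define d where "d = A $$ (i0, j0)"
    have d: "d \<noteq> 0" using ij by (simp add: d_def)
    \<comment> \<open>Subtracting the rank-one matrix of the pivot clears row \<open>i0\<close> and
      column \<open>j0\<close> and leaves zero rows zero, so the number of nonzero rows
      drops.\<close>
    define A' where "A' = mat r c (\<lambda>(i, j). A $$ (i, j) - A $$ (i, j0) * A $$ (i0, j) / d)"
    have A': "A' \<in> carrier_mat r c" by (simp add: A'_def)
    have "{i \<in> {..<r}. \<exists>j<c. A' $$ (i, j) \<noteq> 0} \<subset> {i \<in> {..<r}. \<exists>j<c. A $$ (i, j) \<noteq> 0}"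
    proof
      show "{i \<in> {..<r}. \<exists>j<c. A' $$ (i, j) \<noteq> 0} \<subseteq> {i \<in> {..<r}. \<exists>j<c. A $$ (i, j) \<noteq> 0}"
        using ij by (auto simp: A'_def) (metis div_0 mult_zero_left)
      have "i0 \<notin> {i \<in> {..<r}. \<exists>j<c. A' $$ (i, j) \<noteq> 0}"
        using ij by (auto simp: A'_def d_def)
      then show "{i \<in> {..<r}. \<exists>j<c. A' $$ (i, j) \<noteq> 0} \<noteq> {i \<in> {..<r}. \<exists>j<c. A $$ (i, j) \<noteq> 0}"
        using ij by blast
    qed
    then have "card {i \<in> {..<r}. \<exists>j<c. A' $$ (i, j) \<noteq> 0} < card {i \<in> {..<r}. \<exists>j<c. A $$ (i, j) \<noteq> 0}"
      by (intro psubset_card_mono) auto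
    from less.hyps[OF this A'] obtain k b a b' a' where f:
      "b \<in> carrier_mat r k" "a \<in> carrier_mat k c" "b' \<in> carrier_mat k r" "a' \<in> carrier_mat c k"
      "A' = b * a" "b' * b = 1\<^sub>m k" "a * a' = 1\<^sub>m k" by blast
    \<comment> \<open>Row \<open>i0\<close> and column \<open>j0\<close> of \<open>A'\<close>
      vanish; the one-sided inverses hand this on to row \<open>i0\<close> of \<open>b\<close> and
      column \<open>j0\<close> of \<open>a\<close>.\<close>
    have "b = A' * a'" using f by (simp add: assoc_mult_mat[of b r k a c a' k])
    then have b0: "b $$ (i0, x) = 0" if "x < k" for x
      using that ij f(4) by (simp add: index_mult_mat_sum[OF A' f(4)]) (simp add: A'_def d_def)
    have "a = b' * A'" using f by (simp flip: assoc_mult_mat[of b' k r b k a c])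
    then have a0: "a $$ (x, j0) = 0" if "x < k" for x
      using that ij f(3) by (simp add: index_mult_mat_sum[OF f(3) A']) (simp add: A'_def d_def)
    have ba: "(\<Sum>x<k. b $$ (i, x) * a $$ (x, j)) = A $$ (i, j) - A $$ (i, j0) * A $$ (i0, j) / d"
      if "i < r" "j < c" for i j
      using index_mult_mat_sum[OF f(1,2) that] that by (simp flip: f(5)) (simp add: A'_def)
    have bb: "(\<Sum>i<r. b' $$ (x, i) * b $$ (i, y)) = (if x = y then 1 else 0)" if "x < k" "y < k" for x y
      using index_mult_mat_sum[OF f(3,1) that] that by (simp add: f(6))
    have aa: "(\<Sum>j<c. a $$ (x, j) * a' $$ (j, y)) = (if x = y then 1 else 0)" if "x < k" "y < k" for x y
      using index_mult_mat_sum[OF f(2,4) that] that by (simp add: f(7))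
    \<comment> \<open>Row \<open>i0\<close> of the enlarged factor \<open>b1\<close> is the first
      unit vector. Subtracting \<open>\<beta>\<close> at position \<open>i0\<close> therefore makes
      the rows of \<open>b'\<close> annihilate the new column without changing their products with
      the old ones; \<open>\<gamma>\<close> does the same for \<open>a'\<close>.\<close>
    define \<beta> where "\<beta> x = (\<Sum>i<r. b' $$ (x, i) * (A $$ (i, j0) / d))" for x
    define \<gamma> where "\<gamma> y = (\<Sum>j<c. A $$ (i0, j) * a' $$ (j, y))" for y
    define b1 where "b1 = mat r (Suc k) (\<lambda>(i, x). if x = 0 then A $$ (i, j0) / d else b $$ (i, x - 1))"
    define a1 where "a1 = mat (Suc k) c (\<lambda>(x, j). if x = 0 then A $$ (i0, j) else a $$ (x - 1, j))"
    define b2 where "b2 = mat (Suc k) r (\<lambda>(x, i). if x = 0 then (if i = i0 then 1 else 0)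
       else b' $$ (x - 1, i) - (if i = i0 then \<beta> (x - 1) else 0))"
    define a2 where "a2 = mat c (Suc k) (\<lambda>(j, x). if x = 0 then (if j = j0 then 1 / d else 0)
       else a' $$ (j, x - 1) - (if j = j0 then \<gamma> (x - 1) / d else 0))"
    have c: "b1 \<in> carrier_mat r (Suc k)" "a1 \<in> carrier_mat (Suc k) c"
      "b2 \<in> carrier_mat (Suc k) r" "a2 \<in> carrier_mat c (Suc k)"
      by (simp_all add: b1_def a1_def b2_def a2_def)
    have "A = b1 * a1"
    proof (rule eq_matI)
      fix i j assume "i < dim_row (b1 * a1)" "j < dim_col (b1 * a1)"
      then have "i < r" "j < c" using c by auto
      then show "A $$ (i, j) = (b1 * a1) $$ (i, j)"
        unfolding index_mult_mat_sum[OF c(1,2) \<open>i < r\<close> \<open>j < c\<close>] sum.lessThan_Suc_shift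
        by (simp add: b1_def a1_def ba)
    qed (use A c in auto)
    moreover have "b2 * b1 = 1\<^sub>m (Suc k)"
    proof (rule eq_matI)
      fix x y assume xy: "x < dim_row (1\<^sub>m (Suc k))" "y < dim_col (1\<^sub>m (Suc k))"
      have "(b2 * b1) $$ (x, y) = (\<Sum>i<r. b2 $$ (x, i) * b1 $$ (i, y))"
        using index_mult_mat_sum[OF c(3,1)] xy by simp
      also have "\<dots> = (if x = y then 1 else 0)"
      proof (cases x)
        case 0
        then have "(\<Sum>i<r. b2 $$ (x, i) * b1 $$ (i, y)) = (\<Sum>i<r. if i = i0 then b1 $$ (i, y) else 0)"
          by (intro sum.cong) (auto simp: b2_def)
        also have "\<dots> = b1 $$ (i0, y)" using ij by (simp add: sum.delta)
        finally show ?thesis using 0 xy ij d b0 by (auto simp: b1_def d_def)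
      next
        case (Suc x')
        then have "(\<Sum>i<r. b2 $$ (x, i) * b1 $$ (i, y)) =
            (\<Sum>i<r. b' $$ (x', i) * b1 $$ (i, y) - (if i = i0 then \<beta> x' * b1 $$ (i, y) else 0))"
          using xy by (intro sum.cong) (auto simp: b2_def algebra_simps)
        also have "\<dots> = (\<Sum>i<r. b' $$ (x', i) * b1 $$ (i, y)) - \<beta> x' * b1 $$ (i0, y)"
          using ij by (simp add: sum_subtractf sum.delta)
        also have "\<dots> = (if x = y then 1 else 0)"
          using xy ij d b0 bb[of x' "y - 1"] Suc by (cases y) (simp_all add: b1_def \<beta>_def d_def)
        finally show ?thesis .
      qed
      finally show "(b2 * b1) $$ (x, y) = 1\<^sub>m (Suc k) $$ (x, y)"
        using xy by simp
    qed (use c in auto)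
    moreover have "a1 * a2 = 1\<^sub>m (Suc k)"
    proof (rule eq_matI)
      fix x y assume xy: "x < dim_row (1\<^sub>m (Suc k))" "y < dim_col (1\<^sub>m (Suc k))"
      have "(a1 * a2) $$ (x, y) = (\<Sum>j<c. a1 $$ (x, j) * a2 $$ (j, y))"
        using index_mult_mat_sum[OF c(2,4)] xy by simp
      also have "\<dots> = (if x = y then 1 else 0)"
      proof (cases y)
        case 0
        then have "(\<Sum>j<c. a1 $$ (x, j) * a2 $$ (j, y)) = (\<Sum>j<c. if j = j0 then a1 $$ (x, j) / d else 0)"
          by (intro sum.cong) (auto simp: a2_def)
        also have "\<dots> = a1 $$ (x, j0) / d" using ij by (simp add: sum.delta)
        finally show ?thesis using 0 xy ij d a0 by (auto simp: a1_def d_def)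
      next
        case (Suc y')
        then have "(\<Sum>j<c. a1 $$ (x, j) * a2 $$ (j, y)) =
            (\<Sum>j<c. a1 $$ (x, j) * a' $$ (j, y') - (if j = j0 then a1 $$ (x, j) * \<gamma> y' / d else 0))"
          using xy by (intro sum.cong) (auto simp: a2_def algebra_simps)
        also have "\<dots> = (\<Sum>j<c. a1 $$ (x, j) * a' $$ (j, y')) - a1 $$ (x, j0) * \<gamma> y' / d"
          using ij by (simp add: sum_subtractf sum.delta)
        also have "\<dots> = (if x = y then 1 else 0)"
          using xy ij d a0 aa[of "x - 1" y'] Suc by (cases x) (simp_all add: a1_def \<gamma>_def d_def)
        finally show ?thesis .
      qed
      finally show "(a1 * a2) $$ (x, y) = 1\<^sub>m (Suc k) $$ (x, y)"
        using xy by simp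
    qed (use c in auto)
    ultimately show ?thesis using c by blast
  qed
qed

lemma mat_zero_vec: "A \<in> carrier_mat n m \<Longrightarrow> A *\<^sub>v 0\<^sub>v m = (0\<^sub>v n :: 'k::comm_ring_1 vec)"
  by (rule eq_vecI) auto

lemma mat_unit_vec_col:
  "A \<in> carrier_mat n m \<Longrightarrow> j < m \<Longrightarrow> A *\<^sub>v unit_vec m j = col (A :: 'k::comm_ring_1 mat) j"
  by (rule eq_vecI) auto

lemma mat_eq_by_cols:
  assumes "A \<in> carrier_mat n m" "B \<in> carrier_mat n m" "\<And>j. j < m \<Longrightarrow> col A j = col B j"
  shows "A = B"
  by (rule eq_matI) (use assms in \<open>auto simp flip: index_col\<close>)

lemma mat_image_iff:
  "A \<in> carrier_mat n m \<Longrightarrow> v \<in> mat_image A \<longleftrightarrow> (\<exists>u\<in>carrier_vec m. v = A *\<^sub>v u)"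
  by (auto simp: mat_image_def)

lemma factor_through_image:
  assumes A: "A \<in> carrier_mat n m" and B: "B \<in> carrier_mat n l"
    and im: "\<And>j. j < l \<Longrightarrow> col B j \<in> mat_image (A :: 'k::field mat)"
  shows "\<exists>X\<in>carrier_mat m l. B = A * X"
proof -
  obtain u where u: "\<And>j. j < l \<Longrightarrow> u j \<in> carrier_vec m \<and> col B j = A *\<^sub>v u j"
    using im unfolding mat_image_iff[OF A] by metis
  let ?X = "mat_of_cols m (map u [0..<l])"
  have X: "?X \<in> carrier_mat m l"
    using mat_of_cols_carrier(1)[of m "map u [0..<l]"] by simp
  have "B = A * ?X"
  proof (rule mat_eq_by_cols[OF B])
    show "A * ?X \<in> carrier_mat n l" using A X by simp
    fix j assume j: "j < l"
    then have "col ?X j = u j" using u[OF j] by (subst col_mat_of_cols) auto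
    then show "col B j = col (A * ?X) j"
      using u[OF j] col_mult2[OF A X j] by simp
  qed
  then show ?thesis using X by blast
qed

text \<open>For a rank factorization \<open>A = b * a\<close> the columns of
  \<open>a' * a - 1\<close> are killed by \<open>a\<close>, hence lie in the kernel of
  \<open>A\<close> and vanish. So \<open>a' * b'\<close> is a left inverse.\<close>

lemma left_inverse_of_trivial_kernel:
  assumes A: "A \<in> carrier_mat n m" and ker: "mat_kernel A = {0\<^sub>v m}"
  shows "\<exists>B\<in>carrier_mat m n. B * (A :: 'k::field mat) = 1\<^sub>m m"
proof -
  obtain k b a b' a' where f:
    "b \<in> carrier_mat n k" "a \<in> carrier_mat k m" "b' \<in> carrier_mat k n" "a' \<in> carrier_mat m k"
    "A = b * a" "b' * b = 1\<^sub>m k" "a * a' = 1\<^sub>m k" using rank_factorization[OF A] by blast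
  have "a' * a = 1\<^sub>m m"
  proof (rule mat_eq_by_cols)
    show "a' * a \<in> carrier_mat m m" "1\<^sub>m m \<in> carrier_mat m m" using f by auto
    fix j assume j: "j < m"
    let ?v = "col (a' * a) j - unit_vec m j"
    have v: "?v \<in> carrier_vec m"
      using f j by (intro minus_carrier_vec col_carrier_vec[of j m _ m]) auto
    have "a *\<^sub>v col (a' * a) j = a *\<^sub>v (a' *\<^sub>v col a j)"
      by (simp only: col_mult2[OF f(4,2) j])
    also have "\<dots> = (a * a') *\<^sub>v col a j"
      using f j by (subst assoc_mult_mat_vec[of a k m a' k]) (auto simp: carrier_vecI)
    also have "\<dots> = col a j" using f by (simp add: carrier_vecI)
    also have "\<dots> = a *\<^sub>v unit_vec m j" using f j by (simp add: mat_unit_vec_col)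
    finally have "a *\<^sub>v ?v = 0\<^sub>v k"
      using f by (subst mult_minus_distrib_mat_vec[of a k m]) (auto simp: carrier_vecI)
    then have "A *\<^sub>v ?v = 0\<^sub>v n"
      using f v by (simp add: assoc_mult_mat_vec[of b n k a m] mat_zero_vec)
    then have "?v \<in> mat_kernel A" using A v by (auto simp: mat_kernel_def)
    then have "?v = 0\<^sub>v m" using ker by simp
    then have "col (a' * a) j = unit_vec m j"
      using f by (auto simp: vec_eq_iff)
    then show "col (a' * a) j = col (1\<^sub>m m) j" using j by simp
  qed
  moreover have "(a' * b') * A = a' * a"
  proof -
    have "(a' * b') * A = a' * (b' * (b * a))"
      using f by (simp add: assoc_mult_mat[of a' m k b' n "b * a" m])
    also have "b' * (b * a) = (b' * b) * a"
      by (simp only: assoc_mult_mat[OF f(3,1,2)])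
    finally show ?thesis using f by simp
  qed
  ultimately show ?thesis using f by (intro bexI[of _ "a' * b'"]) auto
qed

lemma trivial_kernel_of_left_inverse:
  assumes A: "A \<in> carrier_mat n m" and B: "B \<in> carrier_mat m n" "B * (A :: 'k::field mat) = 1\<^sub>m m"
  shows "mat_kernel A = {0\<^sub>v m}"
proof -
  have "v = 0\<^sub>v m" if "v \<in> carrier_vec m" "A *\<^sub>v v = 0\<^sub>v n" for v
  proof -
    have "v = (B * A) *\<^sub>v v" using that B by simp
    also have "\<dots> = B *\<^sub>v (A *\<^sub>v v)" using A B that by (subst assoc_mult_mat_vec[of B m n A m]) auto
    finally show ?thesis using that B by (auto simp: mult_mat_vec_def)
  qed
  moreover have "A *\<^sub>v 0\<^sub>v m = 0\<^sub>v n" using A by auto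
  ultimately show ?thesis using A by (auto simp: mat_kernel_def)
qed

lemma right_inverse_of_full_image:
  assumes A: "A \<in> carrier_mat n m" and im: "mat_image A = carrier_vec n"
  shows "\<exists>B\<in>carrier_mat m n. (A :: 'k::field mat) * B = 1\<^sub>m n"
  using factor_through_image[OF A, of "1\<^sub>m n" n] im by fastforce

lemma full_image_of_right_inverse:
  assumes A: "A \<in> carrier_mat n m" and B: "B \<in> carrier_mat m n" "(A :: 'k::field mat) * B = 1\<^sub>m n"
  shows "mat_image A = carrier_vec n"
proof -
  have "v \<in> mat_image A" if "v \<in> carrier_vec n" for v
  proof -
    have "v = A *\<^sub>v (B *\<^sub>v v)" using that A B by (simp flip: assoc_mult_mat_vec[of A n m B n])
    moreover have "B *\<^sub>v v \<in> carrier_vec m" using that B by auto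
    ultimately show ?thesis using A by (auto simp: mat_image_iff)
  qed
  then show ?thesis using A by (auto simp: mat_image_def)
qed

section \<open>The category of strict polynomial functors\<close>

lemma mult_mat_assoc:
  "dim_col A = dim_row B \<Longrightarrow> dim_col B = dim_row C \<Longrightarrow> A * B * C = A * (B * C)"
  by (rule assoc_mult_mat) auto

lemma cmat_carrier [simp]: "cmat A \<in> carrier_mat n m \<longleftrightarrow> A \<in> carrier_mat n m"
  by (simp add: cmat_def)

lemma cmat_dim [simp]: "dim_row (cmat A) = dim_row A" "dim_col (cmat A) = dim_col A"
  by (auto simp: cmat_def)

lemma cmat_index [simp]: "i < dim_row A \<Longrightarrow> j < dim_col A \<Longrightarrow> cmat A $$ (i, j) = cnst (A $$ (i, j))"
  by (simp add: cmat_def)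

lemma cmat_mult:
  "dim_col A = dim_row B \<Longrightarrow> cmat (A * B) = cmat A * cmat (B :: 'k::comm_ring_1 mat)"
  unfolding cmat_def using comm_ring_hom_cnst[where ?'k = 'k]
  by (metis carrier_matI comm_ring_hom.axioms(1) comm_semiring_hom.axioms(1) ring_hom_def semiring_hom.mat_hom_mult)

lemma cmat_one [simp]: "cmat (1\<^sub>m n) = (1\<^sub>m n :: 'k::comm_ring_1 entry_poly mat)"
  by (rule eq_matI) auto

lemma cmat_add: "A \<in> carrier_mat n m \<Longrightarrow> B \<in> carrier_mat n m \<Longrightarrow>
    cmat (A + B) = cmat A + cmat (B :: 'k::comm_ring_1 mat)"
  by (rule eq_matI) (auto simp: cnst_add)

lemma cmat_smult: "cmat (c \<cdot>\<^sub>m A) = cnst c \<cdot>\<^sub>m cmat (A :: 'k::comm_ring_1 mat)"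
  by (rule eq_matI) (auto simp: cnst_mult)

lemma cmat_zero [simp]: "cmat (0\<^sub>m n m) = (0\<^sub>m n m :: 'k::comm_ring_1 entry_poly mat)"
  by (rule eq_matI) auto

lemma map_peval_cmat [simp]: "map_mat (peval A) (cmat B) = cmat B"
  by (rule eq_matI) auto

lemma map_peval_mult:
  "dim_col B = dim_row C \<Longrightarrow> map_mat (peval A) (B * C) = map_mat (peval A) B * map_mat (peval A) C"
  using comm_ring_hom_peval[of A]
  by (metis carrier_matI comm_ring_hom.axioms(1) comm_semiring_hom.axioms(1) ring_hom_def semiring_hom.mat_hom_mult)

text \<open>The condition on dimensions alone, on which the calculus of natural transformations
  rests.\<close>

definition spf_carrier :: "'k::zero spf \<Rightarrow> bool" where
  "spf_carrier F \<longleftrightarrow> (\<forall>m n. fpoly F m n \<in> carrier_mat (fdim F n) (fdim F m))"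

lemma fpoly_dim: "spf_carrier F \<Longrightarrow> dim_row (fpoly F m n) = fdim F n"
  "spf_carrier F \<Longrightarrow> dim_col (fpoly F m n) = fdim F m"
  by (auto simp: spf_carrier_def)

lemma strict_poly_functorD:
  assumes "strict_poly_functor e F"
  shows "spf_carrier F" "fpoly F m n \<in> carrier_mat (fdim F n) (fdim F m)"
    "i < fdim F n \<Longrightarrow> j < fdim F m \<Longrightarrow> homogeneous_in e n m (fpoly F m n $$ (i, j))"
    "act F (1\<^sub>m n) = 1\<^sub>m (fdim F n)"
    "A \<in> carrier_mat n m \<Longrightarrow> B \<in> carrier_mat m l \<Longrightarrow> act F (A * B) = act F A * act F B"
  using assms unfolding strict_poly_functor_def spf_carrier_def by blast+

lemma act_carrier: "spf_carrier F \<Longrightarrow> A \<in> carrier_mat n m \<Longrightarrow> act F A \<in> carrier_mat (fdim F n) (fdim F m)"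
  unfolding act_def spf_carrier_def using carrier_matD by auto

lemma act_dim:
  "spf_carrier F \<Longrightarrow> dim_row (act F A) = fdim F (dim_row A)"
  "spf_carrier F \<Longrightarrow> dim_col (act F A) = fdim F (dim_col A)"
  using act_carrier[of F A "dim_row A" "dim_col A"] by auto

lemma act_generic:
  assumes "strict_poly_functor e F"
  shows "act F (generic_mat n m) = fpoly F m n"
proof -
  have d: "dim_row (generic_mat n m) = n" "dim_col (generic_mat n m) = m"
    by (simp_all add: generic_mat_def)
  note D = strict_poly_functorD(1,3)[OF assms]
  show ?thesis
    unfolding act_def d
    by (rule eq_matI) (auto simp: fpoly_dim[OF D(1)] peval_generic[OF D(2)])
qed

lemma nat_transD:
  assumes "f \<in> nat_trans F G"
  shows "f n \<in> carrier_mat (fdim G n) (fdim F n)" "dim_row (f n) = fdim G n" "dim_col (f n) = fdim F n"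
    "fpoly G m n * cmat (f m) = cmat (f n) * fpoly F m n"
  using assms unfolding nat_trans_def by auto

lemma nat_transI:
  assumes "\<And>n. f n \<in> carrier_mat (fdim G n) (fdim F n)"
    "\<And>m n. fpoly G m n * cmat (f m) = cmat (f n) * fpoly F m n"
  shows "f \<in> nat_trans F G"
  using assms unfolding nat_trans_def by auto

text \<open>Naturality is an identity between matrices of polynomials, so any \<open>A\<close> may
  be substituted for the variables; the constant matrices of \<open>f\<close> stay fixed.\<close>

lemma nat_trans_act:
  assumes "f \<in> nat_trans F G" "spf_carrier F" "spf_carrier G" "A \<in> carrier_mat n m"
  shows "act G A * cmat (f m) = cmat (f n) * act F A"
proof -
  have "map_mat (peval A) (fpoly G m n * cmat (f m)) = map_mat (peval A) (cmat (f n) * fpoly F m n)"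
    by (simp add: nat_transD[OF assms(1)])
  then show ?thesis
    using assms(4) by (simp add: map_peval_mult fpoly_dim[OF assms(2)] fpoly_dim[OF assms(3)]
        nat_transD(2,3)[OF assms(1)] act_def)
qed

text \<open>Conjugation by \<open>b\<close> and a left inverse \<open>b'\<close> expresses
  \<open>S\<close> through \<open>T\<close> as \<open>b' T b\<close>. Constant matrices do not
  affect degrees, and \<open>b' b = 1\<close> carries the functor laws over. No naturality is asked
  of \<open>b'\<close>.\<close>

lemma strict_poly_functor_sub:
  assumes T: "strict_poly_functor e T" and b: "b \<in> nat_trans S T"
    and inv: "\<And>n. \<exists>b'\<in>carrier_mat (fdim S n) (fdim T n). b' * b n = 1\<^sub>m (fdim S n)"
    and S: "spf_carrier S"
  shows "strict_poly_functor e S"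
proof -
  note T' = strict_poly_functorD[OF T]
  obtain b' where b': "\<And>n. b' n \<in> carrier_mat (fdim S n) (fdim T n)" "\<And>n. b' n * b n = 1\<^sub>m (fdim S n)"
    using inv by metis
  have b'd: "dim_row (b' n) = fdim S n" "dim_col (b' n) = fdim T n" for n
    using b'(1)[of n] by auto
  have canc: "cmat (b' n) * (cmat (b n) * X) = X" if "dim_row X = fdim S n" for X n
  proof -
    have "cmat (b' n) * (cmat (b n) * X) = cmat (b' n * b n) * X"
      using that by (simp add: b'd nat_transD(2,3)[OF b] cmat_mult mult_mat_assoc)
    then show ?thesis using that by (simp add: b'(2))
  qed
  note dims = b'd nat_transD(2,3)[OF b] act_dim[OF S] act_dim[OF T'(1)] fpoly_dim[OF S] fpoly_dim[OF T'(1)]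
  have actS: "act S A = cmat (b' n) * (act T A * cmat (b m))" if "A \<in> carrier_mat n m" for A n m
    using that by (subst nat_trans_act[OF b S T'(1) that]) (auto simp: canc dims)
  have poly: "fpoly S m n = cmat (b' n) * (fpoly T m n * cmat (b m))" for m n
    by (subst nat_transD(4)[OF b]) (simp add: canc dims)
  show ?thesis
    unfolding strict_poly_functor_def
  proof (intro conjI allI impI)
    show "fpoly S m n \<in> carrier_mat (fdim S n) (fdim S m)" for m n
      using S by (simp add: spf_carrier_def)
    show "homogeneous_in e n m (fpoly S m n $$ (i, j))" if "i < fdim S n" "j < fdim S m" for m n i j
    proof -
      have "fpoly S m n $$ (i, j) = (\<Sum>x<fdim T n. cnst (b' n $$ (i, x)) *
          (\<Sum>y<fdim T m. fpoly T m n $$ (x, y) * cnst (b m $$ (y, j))))"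
      proof -
        have c: "cmat (b' n) \<in> carrier_mat (fdim S n) (fdim T n)" "cmat (b m) \<in> carrier_mat (fdim T m) (fdim S m)"
          using b'(1) nat_transD(1)[OF b] by simp_all
        have "(fpoly T m n * cmat (b m)) $$ (x, j) = (\<Sum>y<fdim T m. fpoly T m n $$ (x, y) * cnst (b m $$ (y, j)))"
          if "x < fdim T n" for x
          unfolding index_mult_mat_sum[OF T'(2) c(2) that \<open>j < fdim S m\<close>]
          using \<open>j < fdim S m\<close> by (simp add: dims)
        then show ?thesis
          unfolding poly index_mult_mat_sum[OF c(1) mult_carrier_mat[OF T'(2) c(2)] that]
          using that(1) by (simp add: dims)
      qed
      moreover have "homogeneous_in e n m (cnst (b' n $$ (i, x)) *
          (\<Sum>y<fdim T m. fpoly T m n $$ (x, y) * cnst (b m $$ (y, j))))" if "x < fdim T n" for x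
        using that T'(3)
        by (intro homogeneous_in_cnst_mult homogeneous_in_sum) (simp add: mult.commute homogeneous_in_cnst_mult)
      ultimately show ?thesis by (auto intro!: homogeneous_in_sum)
    qed
    show "act S (1\<^sub>m n) = 1\<^sub>m (fdim S n)" for n
      using b'(2)[of n] by (simp add: actS[of _ n n] T'(4) dims left_mult_one_mat' flip: cmat_mult)
    show "act S (A * B) = act S A * act S B" if "A \<in> carrier_mat n m" "B \<in> carrier_mat m l" for l m n A B
    proof -
      have "act S (A * B) = cmat (b' n) * (act T A * (act T B * cmat (b l)))"
        using that by (simp add: actS[of "A * B" n l] T'(5)[OF that] dims mult_mat_assoc)
      also have "act T B * cmat (b l) = cmat (b m) * act S B"
        by (rule nat_trans_act[OF b S T'(1) that(2)])
      also have "act T A * (cmat (b m) * act S B) = cmat (b n) * (act S A * act S B)"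
        using that nat_trans_act[OF b S T'(1) that(1)] by (simp add: dims flip: mult_mat_assoc)
      finally show ?thesis using that by (simp add: canc dims)
    qed
  qed
qed

lemma nat_trans_comp:
  assumes f: "f \<in> nat_trans F G" and g: "g \<in> nat_trans G H"
    and "spf_carrier F" "spf_carrier G" "spf_carrier H"
  shows "comp_nt g f \<in> nat_trans F H"
proof (rule nat_transI)
  note d = nat_transD(2,3)[OF f] nat_transD(2,3)[OF g]
  show "comp_nt g f n \<in> carrier_mat (fdim H n) (fdim F n)" for n
    using mult_carrier_mat[OF nat_transD(1)[OF g] nat_transD(1)[OF f]] by (simp add: comp_nt_def)
  show "fpoly H m n * cmat (comp_nt g f m) = cmat (comp_nt g f n) * fpoly F m n" for m n
  proof -
    have "fpoly H m n * cmat (comp_nt g f m) = (fpoly H m n * cmat (g m)) * cmat (f m)"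
      using assms by (simp add: comp_nt_def cmat_mult d fpoly_dim mult_mat_assoc)
    also have "\<dots> = cmat (g n) * (fpoly G m n * cmat (f m))"
      unfolding nat_transD(4)[OF g] using assms by (simp add: d fpoly_dim mult_mat_assoc)
    also have "\<dots> = cmat (comp_nt g f n) * fpoly F m n"
      unfolding nat_transD(4)[OF f] using assms by (simp add: comp_nt_def cmat_mult d fpoly_dim mult_mat_assoc)
    finally show ?thesis .
  qed
qed

lemma comp_nt_assoc:
  assumes "f \<in> nat_trans F G" "g \<in> nat_trans G H" "h \<in> nat_trans H K"
  shows "comp_nt (comp_nt h g) f = comp_nt h (comp_nt g f)"
  by (simp add: comp_nt_def mult_mat_assoc nat_transD(2,3)[OF assms(1)] nat_transD(2,3)[OF assms(2)]
      nat_transD(2,3)[OF assms(3)])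

definition zero_nt :: "'k::field spf \<Rightarrow> 'k spf \<Rightarrow> nat \<Rightarrow> 'k mat" where
  "zero_nt F G = (\<lambda>n. 0\<^sub>m (fdim G n) (fdim F n))"

definition id_nt :: "'k::field spf \<Rightarrow> nat \<Rightarrow> 'k mat" where
  "id_nt F = (\<lambda>n. 1\<^sub>m (fdim F n))"

definition add_nt :: "(nat \<Rightarrow> 'k::field mat) \<Rightarrow> (nat \<Rightarrow> 'k mat) \<Rightarrow> (nat \<Rightarrow> 'k mat)" where
  "add_nt f g = (\<lambda>n. f n + g n)"

definition smult_nt :: "'k::field \<Rightarrow> (nat \<Rightarrow> 'k mat) \<Rightarrow> (nat \<Rightarrow> 'k mat)" where
  "smult_nt c f = (\<lambda>n. c \<cdot>\<^sub>m f n)"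

lemma nat_trans_zero: "spf_carrier F \<Longrightarrow> spf_carrier G \<Longrightarrow> zero_nt F G \<in> nat_trans F G"
  by (rule nat_transI)
     (auto simp: zero_nt_def spf_carrier_def right_mult_zero_mat' left_mult_zero_mat' fpoly_dim)

lemma nat_trans_id: "spf_carrier F \<Longrightarrow> id_nt F \<in> nat_trans F F"
  by (rule nat_transI)
     (auto simp: id_nt_def spf_carrier_def right_mult_one_mat' left_mult_one_mat' fpoly_dim)

lemma nat_trans_add:
  assumes f: "f \<in> nat_trans F G" and g: "g \<in> nat_trans F G" and "spf_carrier F" "spf_carrier G"
  shows "add_nt f g \<in> nat_trans F G"
proof (rule nat_transI)
  show "add_nt f g n \<in> carrier_mat (fdim G n) (fdim F n)" for n
    using nat_transD(1)[OF f] nat_transD(1)[OF g] by (auto simp: add_nt_def)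
  have c: "fpoly F m n \<in> carrier_mat (fdim F n) (fdim F m)" "fpoly G m n \<in> carrier_mat (fdim G n) (fdim G m)" for m n
    using assms by (auto simp: spf_carrier_def)
  show "fpoly G m n * cmat (add_nt f g m) = cmat (add_nt f g n) * fpoly F m n" for m n
    unfolding add_nt_def
    using nat_transD(1)[OF f, of m] nat_transD(1)[OF g, of m] nat_transD(1)[OF f, of n] nat_transD(1)[OF g, of n] c[of m n]
    by (simp add: cmat_add[of _ "fdim G m" "fdim F m"] cmat_add[of _ "fdim G n" "fdim F n"]
        mult_add_distrib_mat[of _ "fdim G n" "fdim G m" _ "fdim F m"]
        add_mult_distrib_mat[of _ "fdim G n" "fdim F n" _ _ "fdim F m"]
        nat_transD(4)[OF f] nat_transD(4)[OF g])
qed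

lemma nat_trans_smult:
  assumes f: "f \<in> nat_trans F G" and "spf_carrier F" "spf_carrier G"
  shows "smult_nt c f \<in> nat_trans F G"
proof (rule nat_transI)
  show "smult_nt c f n \<in> carrier_mat (fdim G n) (fdim F n)" for n
    using nat_transD(1)[OF f] by (auto simp: smult_nt_def)
  have c: "fpoly F m n \<in> carrier_mat (fdim F n) (fdim F m)" "fpoly G m n \<in> carrier_mat (fdim G n) (fdim G m)" for m n
    using assms by (auto simp: spf_carrier_def)
  show "fpoly G m n * cmat (smult_nt c f m) = cmat (smult_nt c f n) * fpoly F m n" for m n
    unfolding smult_nt_def
    using nat_transD(1)[OF f, of m] nat_transD(1)[OF f, of n] c[of m n]
    by (simp add: cmat_smult mult_smult_distrib[of _ "fdim G n" "fdim G m" _ "fdim F m"]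
        mult_smult_assoc_mat[of _ "fdim G n" "fdim F n" _ "fdim F m"] nat_transD(4)[OF f])
qed

lemma comp_add_left:
  assumes "f \<in> nat_trans F G" "g \<in> nat_trans G H" "h \<in> nat_trans G H"
  shows "comp_nt (add_nt g h) f = add_nt (comp_nt g f) (comp_nt h f)"
  by (simp add: comp_nt_def add_nt_def fun_eq_iff add_mult_distrib_mat[OF nat_transD(1)[OF assms(2)]
      nat_transD(1)[OF assms(3)] nat_transD(1)[OF assms(1)]])

lemma comp_add_right:
  assumes "f \<in> nat_trans F G" "g \<in> nat_trans F G" "h \<in> nat_trans G H"
  shows "comp_nt h (add_nt f g) = add_nt (comp_nt h f) (comp_nt h g)"
  by (simp add: comp_nt_def add_nt_def fun_eq_iff mult_add_distrib_mat[OF nat_transD(1)[OF assms(3)]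
      nat_transD(1)[OF assms(1)] nat_transD(1)[OF assms(2)]])

lemma comp_smult_left:
  assumes "f \<in> nat_trans F G" "g \<in> nat_trans G H"
  shows "comp_nt (smult_nt c g) f = smult_nt c (comp_nt g f)"
  by (simp add: comp_nt_def smult_nt_def fun_eq_iff mult_smult_assoc_mat[OF nat_transD(1)[OF assms(2)]
      nat_transD(1)[OF assms(1)]])

lemma comp_smult_right:
  assumes "f \<in> nat_trans F G" "g \<in> nat_trans G H"
  shows "comp_nt g (smult_nt c f) = smult_nt c (comp_nt g f)"
  by (simp add: comp_nt_def smult_nt_def fun_eq_iff mult_smult_distrib[OF nat_transD(1)[OF assms(2)]
      nat_transD(1)[OF assms(1)]])

lemma comp_zero_left: "f \<in> nat_trans F G \<Longrightarrow> comp_nt (zero_nt G H) f = zero_nt F H"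
  by (auto simp: comp_nt_def zero_nt_def dest: nat_transD(1) intro!: ext left_mult_zero_mat)

lemma comp_zero_right: "g \<in> nat_trans G H \<Longrightarrow> comp_nt g (zero_nt F G) = zero_nt F H"
  by (auto simp: comp_nt_def zero_nt_def dest: nat_transD(1) intro!: ext right_mult_zero_mat)

lemma comp_id_left: "f \<in> nat_trans F G \<Longrightarrow> comp_nt (id_nt G) f = f"
  by (auto simp: comp_nt_def id_nt_def dest: nat_transD(1) intro!: ext left_mult_one_mat)

lemma comp_id_right: "f \<in> nat_trans F G \<Longrightarrow> comp_nt f (id_nt F) = f"
  by (auto simp: comp_nt_def id_nt_def dest: nat_transD(1) intro!: ext right_mult_one_mat)

lemma nt_eqI:
  assumes "f \<in> nat_trans F G" "g \<in> nat_trans F G"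
    "\<And>n i j. i < fdim G n \<Longrightarrow> j < fdim F n \<Longrightarrow> f n $$ (i, j) = g n $$ (i, j)"
  shows "f = g"
  using assms(3) by (auto intro!: ext eq_matI simp: nat_transD(2,3)[OF assms(1)] nat_transD(2,3)[OF assms(2)])

lemma nt_index:
  assumes "f \<in> nat_trans F G" "i < fdim G n" "j < fdim F n"
  shows "zero_nt F G n $$ (i, j) = 0" "smult_nt c f n $$ (i, j) = c * f n $$ (i, j)"
    "g \<in> nat_trans F G \<Longrightarrow> add_nt f g n $$ (i, j) = f n $$ (i, j) + g n $$ (i, j)"
proof -
  show "zero_nt F G n $$ (i, j) = 0" "smult_nt c f n $$ (i, j) = c * f n $$ (i, j)"
    using assms(2,3) by (auto simp: zero_nt_def smult_nt_def nat_transD(2,3)[OF assms(1)])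
  show "add_nt f g n $$ (i, j) = f n $$ (i, j) + g n $$ (i, j)" if "g \<in> nat_trans F G"
    using assms(2,3) by (simp add: add_nt_def nat_transD(2,3)[OF that])
qed

lemma mono_nt_left_inverse:
  assumes "f \<in> nat_trans F G" "mono_nt f"
  shows "\<exists>h\<in>carrier_mat (fdim F n) (fdim G n). h * f n = 1\<^sub>m (fdim F n)"
  using assms left_inverse_of_trivial_kernel[OF nat_transD(1)[OF assms(1), of n]]
  by (simp add: mono_nt_def nat_transD(2,3)[OF assms(1)])

lemma mono_nt_cancel:
  assumes f: "f \<in> nat_trans F G" "mono_nt f" and g: "g \<in> nat_trans H F" "h \<in> nat_trans H F"
    and eq: "comp_nt f g = comp_nt f h"
  shows "g = h"
proof
  fix n
  obtain k where k: "k \<in> carrier_mat (fdim F n) (fdim G n)" "k * f n = 1\<^sub>m (fdim F n)"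
    using mono_nt_left_inverse[OF f] by blast
  have "k * (f n * g n) = k * (f n * h n)"
    using eq by (simp add: comp_nt_def fun_eq_iff)
  then have "(k * f n) * g n = (k * f n) * h n"
    using k(1) by (simp add: mult_mat_assoc nat_transD(2,3)[OF f(1)] nat_transD(2,3)[OF g(1)] nat_transD(2,3)[OF g(2)])
  then show "g n = h n" 
    by (simp add: k(2) left_mult_one_mat[OF nat_transD(1)[OF g(1)]] left_mult_one_mat[OF nat_transD(1)[OF g(2)]])
qed

text \<open>A rank factorization of \<open>f\<close> is chosen for each \<open>n\<close> separately;
  that the intermediate spaces form a functor and that both factors are natural then follows from
  the naturality of \<open>f\<close>.\<close>

lemma image_exists:
  assumes F: "strict_poly_functor e F" and G: "strict_poly_functor e G" and f: "f \<in> nat_trans F G"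
  shows "\<exists>S. is_image_of e F G f S"
proof -
  note F' = strict_poly_functorD[OF F] and G' = strict_poly_functorD[OF G]
  have "\<forall>n. \<exists>k b a b' a'. b \<in> carrier_mat (fdim G n) k \<and> a \<in> carrier_mat k (fdim F n) \<and>
    b' \<in> carrier_mat k (fdim G n) \<and> a' \<in> carrier_mat (fdim F n) k \<and>
    f n = b * a \<and> b' * b = 1\<^sub>m k \<and> a * a' = 1\<^sub>m k"
    using rank_factorization nat_transD(1)[OF f] by blast
  then obtain k b a b' a' where c: "\<And>n. b n \<in> carrier_mat (fdim G n) (k n)"
    "\<And>n. a n \<in> carrier_mat (k n) (fdim F n)" "\<And>n. b' n \<in> carrier_mat (k n) (fdim G n)"
    "\<And>n. a' n \<in> carrier_mat (fdim F n) (k n)"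
    and eq: "\<And>n. f n = b n * a n" "\<And>n. b' n * b n = 1\<^sub>m (k n)" "\<And>n. a n * a' n = 1\<^sub>m (k n)"
    by metis
  \<comment> \<open>The restriction of \<open>G\<close> to the image of \<open>b\<close>, written in
    the coordinates given by \<open>b'\<close>.\<close>
  define S where "S = \<lparr>fdim = k, fpoly = (\<lambda>m n. cmat (b' n) * (fpoly G m n * cmat (b m)))\<rparr>"
  note d = carrier_matD[OF c(1)] carrier_matD[OF c(2)] carrier_matD[OF c(3)] carrier_matD[OF c(4)]
    fpoly_dim[OF F'(1)] fpoly_dim[OF G'(1)]
  have S: "spf_carrier S" using d by (auto simp: S_def spf_carrier_def)
  have nat: "fpoly G m n * (cmat (b m) * cmat (a m)) = cmat (b n) * (cmat (a n) * fpoly F m n)" for m n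
    using nat_transD(4)[OF f, of m n] by (simp add: eq(1) cmat_mult d mult_mat_assoc)
  have bb: "cmat (b' n) * (cmat (b n) * X) = X" if "dim_row X = k n" for X n
    using that eq(2)[of n] by (simp add: d flip: mult_mat_assoc cmat_mult)
  have aa: "cmat (a n) * cmat (a' n) = 1\<^sub>m (k n)" for n
    using eq(3)[of n] by (simp add: d flip: cmat_mult)
  \<comment> \<open>\<open>G\<close> preserves the image of \<open>b\<close>: inserting
    \<open>a a' = 1\<close> completes \<open>b\<close> to \<open>f\<close>, across which
    \<open>G\<close> can be exchanged for \<open>F\<close>.\<close>
  have Gb: "fpoly G m n * cmat (b m) = cmat (b n) * (cmat (a n) * (fpoly F m n * cmat (a' m)))" for m n
  proof -
    have "fpoly G m n * cmat (b m) = fpoly G m n * (cmat (b m) * (cmat (a m) * cmat (a' m)))"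
      by (simp add: aa d right_mult_one_mat')
    also have "\<dots> = (fpoly G m n * (cmat (b m) * cmat (a m))) * cmat (a' m)"
      by (simp add: d mult_mat_assoc)
    also have "\<dots> = cmat (b n) * (cmat (a n) * (fpoly F m n * cmat (a' m)))"
      by (simp only: nat) (simp add: d mult_mat_assoc)
    finally show ?thesis .
  qed
  have b: "b \<in> nat_trans S G"
    by (rule nat_transI) (simp_all add: c S_def Gb bb d)
  have a: "a \<in> nat_trans F S"
  proof (rule nat_transI)
    show "a n \<in> carrier_mat (fdim S n) (fdim F n)" for n by (simp add: c S_def)
    show "fpoly S m n * cmat (a m) = cmat (a n) * fpoly F m n" for m n
      using nat[of m n] by (simp add: S_def d mult_mat_assoc bb)
  qed
  have "strict_poly_functor e S"
    using strict_poly_functor_sub[OF G b _ S] c(3) eq(2) by (auto simp: S_def)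
  moreover have "mono_nt b"
    unfolding mono_nt_def using trivial_kernel_of_left_inverse[OF c(1) c(3) eq(2)] by (simp add: d)
  moreover have "epi_nt a"
    unfolding epi_nt_def using full_image_of_right_inverse[OF c(2) c(4) eq(3)] by (simp add: d)
  moreover have "comp_nt b a = f" by (auto simp: comp_nt_def eq(1))
  ultimately show ?thesis using a b unfolding is_image_of_def by blast
qed

text \<open>The factor \<open>x\<close> at each \<open>n\<close> is unique because \<open>b\<close>
  has a left inverse, and uniqueness makes it natural.\<close>

lemma factor_through_mono:
  assumes b: "b \<in> nat_trans S B" "mono_nt b" and h: "h \<in> nat_trans P B"
    and S: "spf_carrier S" and B: "spf_carrier B" and P: "spf_carrier P"
    and fact: "\<And>n. \<exists>x\<in>carrier_mat (fdim S n) (fdim P n). h n = b n * x"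
  shows "\<exists>h'\<in>nat_trans P S. comp_nt b h' = h"
proof -
  obtain x where x: "\<And>n. x n \<in> carrier_mat (fdim S n) (fdim P n)" "\<And>n. h n = b n * x n"
    using fact by metis
  note d = carrier_matD[OF x(1)] nat_transD(2,3)[OF b(1)] fpoly_dim[OF S] fpoly_dim[OF P] fpoly_dim[OF B]
  have "x \<in> nat_trans P S"
  proof (rule nat_transI)
    fix m n
    obtain k where k: "k \<in> carrier_mat (fdim S n) (fdim B n)" "k * b n = 1\<^sub>m (fdim S n)"
      using mono_nt_left_inverse[OF b] by blast
    have kb: "cmat k * (cmat (b n) * X) = X" if "dim_row X = fdim S n" for X
      using that k by (simp add: d flip: mult_mat_assoc cmat_mult)
    have "cmat (b n) * (fpoly S m n * cmat (x m)) = (fpoly B m n * cmat (b m)) * cmat (x m)"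
      by (simp add: nat_transD(4)[OF b(1)] d mult_mat_assoc)
    also have "\<dots> = cmat (h n) * fpoly P m n"
      using nat_transD(4)[OF h, of m n] by (simp add: x(2) cmat_mult d mult_mat_assoc)
    also have "\<dots> = cmat (b n) * (cmat (x n) * fpoly P m n)"
      by (simp add: x(2) cmat_mult d mult_mat_assoc)
    finally have "cmat k * (cmat (b n) * (fpoly S m n * cmat (x m))) =
        cmat k * (cmat (b n) * (cmat (x n) * fpoly P m n))" by simp
    then show "fpoly S m n * cmat (x m) = cmat (x n) * fpoly P m n"
      by (simp add: kb d)
  qed (simp add: x)
  moreover have "comp_nt b x = h" by (auto simp: comp_nt_def x(2))
  ultimately show ?thesis by blast
qed

lemma exact_comp_zero:
  assumes "f \<in> nat_trans A B" "g \<in> nat_trans B C" "exact_nt f g"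
  shows "comp_nt g f = zero_nt A C"
proof
  fix n
  note c = nat_transD(1)[OF assms(1), of n] nat_transD(1)[OF assms(2), of n]
  show "comp_nt g f n = zero_nt A C n"
  proof (rule mat_eq_by_cols)
    show "comp_nt g f n \<in> carrier_mat (fdim C n) (fdim A n)" "zero_nt A C n \<in> carrier_mat (fdim C n) (fdim A n)"
      using c by (auto simp: comp_nt_def zero_nt_def)
    fix j assume j: "j < fdim A n"
    have "col (f n) j = f n *\<^sub>v unit_vec (fdim A n) j" using c j by (simp add: mat_unit_vec_col)
    then have "col (f n) j \<in> mat_image (f n)" using c by (auto simp: mat_image_iff)
    then have "col (f n) j \<in> mat_kernel (g n)" using assms(3) by (simp add: exact_nt_def)
    then have "g n *\<^sub>v col (f n) j = 0\<^sub>v (fdim C n)" using c by (auto simp: mat_kernel_def)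
    then show "col (comp_nt g f n) j = col (zero_nt A C n) j"
      unfolding comp_nt_def col_mult2[OF c(2,1) j] using j by (simp add: zero_nt_def)
  qed
qed

text \<open>Projectivity lifts along epimorphisms only. Exactness puts \<open>h\<close> into the
  image of \<open>f\<close>, so \<open>h\<close> first factors through that image and is then lifted
  along the epimorphism onto it.\<close>

lemma projective_lift_exact:
  assumes P: "projective_functor e P" and A: "strict_poly_functor e A" and B: "strict_poly_functor e B"
    and f: "f \<in> nat_trans A B" and g: "g \<in> nat_trans B C" and ex: "exact_nt f g"
    and h: "h \<in> nat_trans P B" and gh: "comp_nt g h = zero_nt P C"
  shows "\<exists>h'\<in>nat_trans P A. comp_nt f h' = h"
proof -
  have Ps: "strict_poly_functor e P" using P by (simp add: projective_functor_def)
  obtain S where "is_image_of e A B f S" using image_exists[OF A B f] by blast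
  then obtain a b where S: "strict_poly_functor e S" and a: "a \<in> nat_trans A S" "epi_nt a"
    and b: "b \<in> nat_trans S B" "mono_nt b" and fba: "comp_nt b a = f"
    unfolding is_image_of_def by blast
  note sc = strict_poly_functorD(1)[OF A] strict_poly_functorD(1)[OF B] strict_poly_functorD(1)[OF S]
    strict_poly_functorD(1)[OF Ps]
  have "\<exists>x\<in>carrier_mat (fdim S n) (fdim P n). h n = b n * x" for n
  proof -
    note c = nat_transD(1)[OF f, of n] nat_transD(1)[OF g, of n] nat_transD(1)[OF h, of n]
      nat_transD(1)[OF a(1), of n] nat_transD(1)[OF b(1), of n]
    have "col (h n) j \<in> mat_image (f n)" if j: "j < fdim P n" for j
    proof -
      have "g n *\<^sub>v col (h n) j = col (comp_nt g h n) j"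
        by (simp only: comp_nt_def col_mult2[OF c(2,3) j])
      also have "\<dots> = 0\<^sub>v (fdim C n)" using j by (simp add: gh zero_nt_def)
      finally have "col (h n) j \<in> mat_kernel (g n)" using c j by (auto simp: mat_kernel_def)
      then show ?thesis using ex by (simp add: exact_nt_def)
    qed
    then obtain y where y: "y \<in> carrier_mat (fdim A n) (fdim P n)" "h n = f n * y"
      using factor_through_image[OF c(1) c(3)] by blast
    then have "h n = b n * (a n * y)" using c
      by (simp flip: fba add: comp_nt_def mult_mat_assoc)
    then show ?thesis using y c by (intro bexI[of _ "a n * y"]) auto
  qed
  from factor_through_mono[OF b h sc(3) sc(2) sc(4) this]
  obtain h1 where h1: "h1 \<in> nat_trans P S" "comp_nt b h1 = h" by blast
  obtain h' where h': "h' \<in> nat_trans P A" "comp_nt a h' = h1"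
    using P A S a h1(1) unfolding projective_functor_def by blast
  have "comp_nt f h' = h"
    using comp_nt_assoc[OF h'(1) a(1) b(1)] by (simp add: fba h' h1)
  then show ?thesis using h' by blast
qed

section \<open>Ext from a projective resolution\<close>

text \<open>Transport of structure: the axioms for \<open>V\<close> are pulled back along
  \<open>T\<close>. A coset space is only a record of operations, so its being a vector space has to
  come from somewhere.\<close>

lemma vectorspace_by_bij:
  fixes V :: "('k::field, 'v) module"
  assumes W: "vectorspace class_ring W" and T: "bij_betw T (carrier V) (carrier W)"
    and cl: "\<And>x y. x \<in> carrier V \<Longrightarrow> y \<in> carrier V \<Longrightarrow> x \<oplus>\<^bsub>V\<^esub> y \<in> carrier V"
      "\<And>c x. x \<in> carrier V \<Longrightarrow> c \<odot>\<^bsub>V\<^esub> x \<in> carrier V" "\<zero>\<^bsub>V\<^esub> \<in> carrier V"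
    and hom: "\<And>x y. x \<in> carrier V \<Longrightarrow> y \<in> carrier V \<Longrightarrow> T (x \<oplus>\<^bsub>V\<^esub> y) = T x \<oplus>\<^bsub>W\<^esub> T y"
      "\<And>c x. x \<in> carrier V \<Longrightarrow> T (c \<odot>\<^bsub>V\<^esub> x) = c \<odot>\<^bsub>W\<^esub> T x" "T \<zero>\<^bsub>V\<^esub> = \<zero>\<^bsub>W\<^esub>"
  shows "isomorphic_spaces V W"
proof -
  interpret W: vectorspace class_ring W by (rule W)
  have TW: "T x \<in> carrier W" if "x \<in> carrier V" for x
    using T that by (auto simp: bij_betw_def)
  have inj: "x = y" if "T x = T y" "x \<in> carrier V" "y \<in> carrier V" for x y
    using T that by (auto simp: bij_betw_def inj_on_def)
  have "abelian_group V"
  proof (rule abelian_groupI)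
    fix x assume x: "x \<in> carrier V"
    then have "\<ominus>\<^bsub>W\<^esub> T x \<in> carrier W" by (simp add: TW)
    then obtain y where "y \<in> carrier V" "T y = \<ominus>\<^bsub>W\<^esub> T x"
      using T unfolding bij_betw_def by (metis imageE)
    then show "\<exists>y\<in>carrier V. y \<oplus>\<^bsub>V\<^esub> x = \<zero>\<^bsub>V\<^esub>"
      using x by (intro bexI[of _ y] inj) (simp_all add: hom cl TW W.l_neg)
  qed (auto intro!: inj cl simp: hom cl TW W.a_ac)
  then have "Module.module class_ring V"
    unfolding Module.module_def Module.module_axioms_def using class_cring.cring_axioms
    by (auto intro!: inj cl simp: hom cl TW W.smult_l_distr[simplified] W.smult_r_distr[simplified]
        W.smult_assoc1[simplified] W.smult_one[simplified])
  then have V: "vectorspace class_ring V"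
    using W by (simp add: vectorspace_def)
  have "linear_map class_ring V W T"
    unfolding linear_map_def mod_hom_def mod_hom_axioms_def LinearCombinations.module_hom_def
    using V W \<open>Module.module class_ring V\<close> by (auto simp: hom TW vectorspace_def)
  then show ?thesis using T by (auto simp: isomorphic_spaces_def)
qed

text \<open>The first isomorphism theorem, in the form in which Ext groups are identified: an onto
  linear map whose kernel is the space of coboundaries.\<close>

lemma quotient_space_isomorphic:
  fixes V :: "('k::field, 'v) module"
  assumes V: "Module.module class_ring V" and W: "vectorspace class_ring W"
    and \<phi>: "\<phi> \<in> LinearCombinations.module_hom class_ring V W" and onto: "\<phi> ` carrier V = carrier W"
    and ker: "B = {x \<in> carrier V. \<phi> x = \<zero>\<^bsub>W\<^esub>}"
  shows "isomorphic_spaces (quotient_space V B) W"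
proof -
  interpret V: Module.module class_ring V by (rule V)
  interpret W: vectorspace class_ring W by (rule W)
  interpret mod_hom class_ring V W \<phi>
    using V W \<phi> by (simp add: mod_hom_def mod_hom_axioms_def vectorspace_def)
  \<comment> \<open>The cosets of the kernel are the fibres of \<open>\<phi>\<close>, and every
    operation on cosets becomes one on values of \<open>\<phi>\<close>.\<close>
  define fib where "fib x = {z \<in> carrier V. \<phi> z = \<phi> x}" for x
  have coset: "B +>\<^bsub>V\<^esub> x = fib x" if x: "x \<in> carrier V" for x
  proof (intro equalityI subsetI)
    fix z assume "z \<in> B +>\<^bsub>V\<^esub> x"
    then obtain b where "b \<in> B" "z = b \<oplus>\<^bsub>V\<^esub> x" by (auto simp: a_r_coset_def r_coset_def)
    then show "z \<in> fib x" using x by (auto simp: fib_def ker)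
  next
    fix z assume z: "z \<in> fib x"
    then have "z \<ominus>\<^bsub>V\<^esub> x \<in> B" using x by (auto simp: fib_def ker W.r_neg V.minus_eq W.minus_eq)
    moreover have "z = (z \<ominus>\<^bsub>V\<^esub> x) \<oplus>\<^bsub>V\<^esub> x"
      using x z by (simp add: fib_def V.minus_eq V.a_assoc V.l_neg)
    ultimately show "z \<in> B +>\<^bsub>V\<^esub> x" by (auto simp: a_r_coset_def r_coset_def)
  qed
  have car: "carrier (quotient_space V B) = fib ` carrier V"
    by (auto simp: quotient_space_def A_RCOSETS_def RCOSETS_def a_r_coset_def[symmetric] coset)
  have fib_mem: "x \<in> fib x" if "x \<in> carrier V" for x using that by (simp add: fib_def)
  have fib_eq: "fib x = fib y \<longleftrightarrow> \<phi> x = \<phi> y" if "x \<in> carrier V" "y \<in> carrier V" for x y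
    using that fib_mem[of x] by (auto simp: fib_def)
  have zero: "\<zero>\<^bsub>quotient_space V B\<^esub> = fib \<zero>\<^bsub>V\<^esub>"
    by (simp add: quotient_space_def fib_def ker)
  have add: "fib x \<oplus>\<^bsub>quotient_space V B\<^esub> fib y = fib (x \<oplus>\<^bsub>V\<^esub> y)" if "x \<in> carrier V" "y \<in> carrier V" for x y
  proof (intro equalityI subsetI)
    fix z assume "z \<in> fib x \<oplus>\<^bsub>quotient_space V B\<^esub> fib y"
    then show "z \<in> fib (x \<oplus>\<^bsub>V\<^esub> y)"
      using that by (auto simp: quotient_space_def set_add_def set_mult_def fib_def)
  next
    fix z assume z: "z \<in> fib (x \<oplus>\<^bsub>V\<^esub> y)"
    then have "z \<ominus>\<^bsub>V\<^esub> x \<in> fib y"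
      using that W.a_lcomm[of "\<phi> x" "\<phi> y" "\<ominus>\<^bsub>W\<^esub> \<phi> x"]
      by (auto simp: fib_def V.minus_eq W.minus_eq W.a_assoc W.r_neg)
    moreover have "z = x \<oplus>\<^bsub>V\<^esub> (z \<ominus>\<^bsub>V\<^esub> x)"
      using that z V.a_lcomm[of x z "\<ominus>\<^bsub>V\<^esub> x"] by (auto simp: fib_def V.minus_eq V.r_neg)
    ultimately show "z \<in> fib x \<oplus>\<^bsub>quotient_space V B\<^esub> fib y"
      using fib_mem[OF that(1)] by (auto simp: quotient_space_def set_add_def set_mult_def)
  qed
  \<comment> \<open>The scalar multiple of a coset is a union over its representatives; each of them
    contributes the same fibre.\<close>
  have smult: "c \<odot>\<^bsub>quotient_space V B\<^esub> fib x = fib (c \<odot>\<^bsub>V\<^esub> x)" if "x \<in> carrier V" for c x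
  proof -
    have "c \<odot>\<^bsub>quotient_space V B\<^esub> fib x = (\<Union>x'\<in>fib x. fib (c \<odot>\<^bsub>V\<^esub> x'))"
      unfolding quotient_space_def by (auto simp: fib_def coset V.smult_closed)
    also have "\<dots> = fib (c \<odot>\<^bsub>V\<^esub> x)"
      using that fib_mem[OF that] by (auto simp: fib_def V.smult_closed)
    finally show ?thesis .
  qed
  define T where "T X = the_elem (\<phi> ` X)" for X
  have T: "T (fib x) = \<phi> x" if "x \<in> carrier V" for x
  proof -
    have "\<phi> ` fib x = {\<phi> x}" using fib_mem[OF that] by (auto simp: fib_def)
    then show ?thesis by (simp add: T_def)
  qed
  show ?thesis
  proof (rule vectorspace_by_bij[OF W, of T])
    show "bij_betw T (carrier (quotient_space V B)) (carrier W)"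
      unfolding bij_betw_def inj_on_def car using onto by (auto simp: T fib_eq image_image)
  qed (auto simp: car add smult zero T V.smult_closed)
qed

lemma vectorspace_ground_field: "vectorspace class_ring (ground_field :: ('k::field, 'k) module)"
proof -
  have "abelian_group (ground_field :: ('k, 'k) module)"
    by (rule abelian_groupI) (auto simp: ground_field_def intro!: exI[of _ "- _"])
  then have "Module.module class_ring (ground_field :: ('k, 'k) module)"
    unfolding Module.module_def Module.module_axioms_def using class_cring.cring_axioms
    by (auto simp: ground_field_def algebra_simps)
  then show ?thesis
    by (simp add: vectorspace_def class_field.field_axioms)
qed

lemma vectorspace_zero_space: "vectorspace class_ring (zero_space :: ('k::field, unit) module)"
proof -
  have "abelian_group (zero_space :: ('k, unit) module)"
    by (rule abelian_groupI) (auto simp: zero_space_def)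
  then have "Module.module class_ring (zero_space :: ('k, unit) module)"
    unfolding Module.module_def Module.module_axioms_def using class_cring.cring_axioms
    by (auto simp: zero_space_def)
  then show ?thesis
    by (simp add: vectorspace_def class_field.field_axioms)
qed

section \<open>Hom spaces and cocycles as modules\<close>

lemma hom_space_simps [simp]:
  "carrier (hom_space F G) = nat_trans F G" "\<zero>\<^bsub>hom_space F G\<^esub> = zero_nt F G"
  "f \<oplus>\<^bsub>hom_space F G\<^esub> g = add_nt f g" "c \<odot>\<^bsub>hom_space F G\<^esub> f = smult_nt c f"
  "\<zero>\<^bsub>hom_space F G\<lparr>carrier := C\<rparr>\<^esub> = zero_nt F G"
  "f \<oplus>\<^bsub>hom_space F G\<lparr>carrier := C\<rparr>\<^esub> g = add_nt f g"
  "c \<odot>\<^bsub>hom_space F G\<lparr>carrier := C\<rparr>\<^esub> f = smult_nt c f"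
  by (simp_all add: hom_space_def zero_nt_def add_nt_def smult_nt_def fun_eq_iff)

lemma hom_subspace_module:
  fixes F G :: "'k::field spf"
  assumes F: "spf_carrier F" and G: "spf_carrier G" and C: "C \<subseteq> nat_trans F G"
    and cl: "zero_nt F G \<in> C" "\<And>f g. f \<in> C \<Longrightarrow> g \<in> C \<Longrightarrow> add_nt f g \<in> C"
      "\<And>c f. f \<in> C \<Longrightarrow> smult_nt c f \<in> C"
  shows "Module.module class_ring (hom_space F G\<lparr>carrier := C\<rparr>)"
proof -
  have NT: "f \<in> C \<Longrightarrow> f \<in> nat_trans F G" for f using C by auto
  note intr = nat_trans_add[OF _ _ F G] nat_trans_smult[OF _ F G] nat_trans_zero[OF F G]
  have "abelian_group (hom_space F G\<lparr>carrier := C\<rparr>)"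
  proof (rule abelian_groupI)
    fix f assume "f \<in> carrier (hom_space F G\<lparr>carrier := C\<rparr>)"
    then have f: "f \<in> C" by simp
    have "add_nt (smult_nt (- 1) f) f = zero_nt F G"
      using NT[OF f] by (intro nt_eqI[of _ F G] intr) (simp_all add: nt_index[of _ F G] intr)
    then show "\<exists>y\<in>carrier (hom_space F G\<lparr>carrier := C\<rparr>).
        y \<oplus>\<^bsub>hom_space F G\<lparr>carrier := C\<rparr>\<^esub> f = \<zero>\<^bsub>hom_space F G\<lparr>carrier := C\<rparr>\<^esub>"
      using cl(3)[OF f, of "- 1"] by auto
  next
    fix f g h assume "f \<in> carrier (hom_space F G\<lparr>carrier := C\<rparr>)" "g \<in> carrier (hom_space F G\<lparr>carrier := C\<rparr>)"
      "h \<in> carrier (hom_space F G\<lparr>carrier := C\<rparr>)"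
    then have *: "f \<in> nat_trans F G" "g \<in> nat_trans F G" "h \<in> nat_trans F G" by (simp_all add: NT)
    have "add_nt (add_nt f g) h = add_nt f (add_nt g h)"
      using * by (intro nt_eqI[of _ F G] intr) (simp_all add: nt_index[of _ F G] intr algebra_simps)
    then show "f \<oplus>\<^bsub>hom_space F G\<lparr>carrier := C\<rparr>\<^esub> g \<oplus>\<^bsub>hom_space F G\<lparr>carrier := C\<rparr>\<^esub> h =
        f \<oplus>\<^bsub>hom_space F G\<lparr>carrier := C\<rparr>\<^esub> (g \<oplus>\<^bsub>hom_space F G\<lparr>carrier := C\<rparr>\<^esub> h)" by simp
  next
    fix f g assume "f \<in> carrier (hom_space F G\<lparr>carrier := C\<rparr>)" "g \<in> carrier (hom_space F G\<lparr>carrier := C\<rparr>)"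
    then have *: "f \<in> nat_trans F G" "g \<in> nat_trans F G" by (simp_all add: NT)
    have "add_nt f g = add_nt g f"
      using * by (intro nt_eqI[of _ F G] intr) (simp_all add: nt_index[of _ F G] intr algebra_simps)
    then show "f \<oplus>\<^bsub>hom_space F G\<lparr>carrier := C\<rparr>\<^esub> g = g \<oplus>\<^bsub>hom_space F G\<lparr>carrier := C\<rparr>\<^esub> f" by simp
  next
    fix f assume "f \<in> carrier (hom_space F G\<lparr>carrier := C\<rparr>)"
    then have *: "f \<in> nat_trans F G" by (simp_all add: NT)
    have "add_nt (zero_nt F G) f = f"
      using * by (intro nt_eqI[of _ F G] intr) (simp_all add: nt_index[of _ F G] intr)
    then show "\<zero>\<^bsub>hom_space F G\<lparr>carrier := C\<rparr>\<^esub> \<oplus>\<^bsub>hom_space F G\<lparr>carrier := C\<rparr>\<^esub> f = f" by simp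
  qed (auto simp: cl)
  moreover have "smult_nt (a + b) f = add_nt (smult_nt a f) (smult_nt b f)"
    "smult_nt a (add_nt f g) = add_nt (smult_nt a f) (smult_nt a g)"
    "smult_nt (a * b) f = smult_nt a (smult_nt b f)" "smult_nt 1 f = f"
    if "f \<in> C" "g \<in> C" for a b f g
    using NT[OF that(1)] NT[OF that(2)]
    by (auto intro!: nt_eqI[of _ F G] intr simp: nt_index[of _ F G] intr algebra_simps)
  ultimately show ?thesis
    unfolding Module.module_def Module.module_axioms_def using class_cring.cring_axioms by (auto simp: cl)
qed

lemma cocyclesD:
  assumes "f \<in> cocycles P d N q"
  shows "f \<in> nat_trans (P q) N" "comp_nt f (d q) = zero_nt (P (Suc q)) N"
  using assms by (auto simp: cocycles_def)

lemma cocycles_module: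
  assumes P: "\<And>i. spf_carrier (P i)" and N: "spf_carrier N" and d: "\<And>i. d i \<in> nat_trans (P (Suc i)) (P i)"
  shows "Module.module class_ring (hom_space (P q) N\<lparr>carrier := cocycles P d N q\<rparr>)"
    and "zero_nt (P q) N \<in> cocycles P d N q"
    and "\<And>f g. f \<in> cocycles P d N q \<Longrightarrow> g \<in> cocycles P d N q \<Longrightarrow> add_nt f g \<in> cocycles P d N q"
    and "\<And>c f. f \<in> cocycles P d N q \<Longrightarrow> smult_nt c f \<in> cocycles P d N q"
proof -
  have z: "add_nt (zero_nt F N) (zero_nt F N) = zero_nt F N" "smult_nt c (zero_nt F N) = zero_nt F N"
    if "spf_carrier F" for c F
    by (auto simp: add_nt_def zero_nt_def smult_nt_def)
  show 1: "zero_nt (P q) N \<in> cocycles P d N q"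
    using nat_trans_zero[OF P N] comp_zero_left[OF d] by (auto simp: cocycles_def)
  show 2: "add_nt f g \<in> cocycles P d N q" if "f \<in> cocycles P d N q" "g \<in> cocycles P d N q" for f g
    using cocyclesD[OF that(1)] cocyclesD[OF that(2)] nat_trans_add[OF _ _ P N]
    by (auto simp: cocycles_def comp_add_left[OF d] z P)
  show 3: "smult_nt c f \<in> cocycles P d N q" if "f \<in> cocycles P d N q" for c f
    using cocyclesD[OF that] nat_trans_smult[OF _ P N]
    by (auto simp: cocycles_def comp_smult_left[OF d] z P)
  show "Module.module class_ring (hom_space (P q) N\<lparr>carrier := cocycles P d N q\<rparr>)"
    by (rule hom_subspace_module[OF P N _ 1 2 3]) (auto simp: cocycles_def)
qed

section \<open>Chain maps and homotopies between projective resolutions\<close>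

definition sub_nt :: "(nat \<Rightarrow> 'k::field mat) \<Rightarrow> (nat \<Rightarrow> 'k mat) \<Rightarrow> (nat \<Rightarrow> 'k mat)" where
  "sub_nt f g = add_nt f (smult_nt (- 1) g)"

lemma nat_trans_sub:
  "f \<in> nat_trans F G \<Longrightarrow> g \<in> nat_trans F G \<Longrightarrow> spf_carrier F \<Longrightarrow> spf_carrier G \<Longrightarrow> sub_nt f g \<in> nat_trans F G"
  by (simp add: sub_nt_def nat_trans_add nat_trans_smult)

lemma comp_sub_left:
  assumes "f \<in> nat_trans F G" "g \<in> nat_trans G H" "h \<in> nat_trans G H" "spf_carrier G" "spf_carrier H"
  shows "comp_nt (sub_nt g h) f = sub_nt (comp_nt g f) (comp_nt h f)"
  using assms by (simp add: sub_nt_def comp_add_left[of _ F G _ H] comp_smult_left[of _ F G _ H] nat_trans_smult)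

lemma comp_sub_right:
  assumes "f \<in> nat_trans F G" "g \<in> nat_trans F G" "h \<in> nat_trans G H" "spf_carrier F" "spf_carrier G"
  shows "comp_nt h (sub_nt f g) = sub_nt (comp_nt h f) (comp_nt h g)"
  using assms by (simp add: sub_nt_def comp_add_right[of _ F G _ _ H] comp_smult_right[of _ F G _ H] nat_trans_smult)

lemma nt_index_sub:
  assumes "f \<in> nat_trans F G" "g \<in> nat_trans F G" "i < fdim G n" "j < fdim F n"
  shows "sub_nt f g n $$ (i, j) = f n $$ (i, j) - g n $$ (i, j)"
  using assms(3,4) by (simp add: sub_nt_def add_nt_def smult_nt_def nat_transD(2,3)[OF assms(1)] nat_transD(2,3)[OF assms(2)])

lemma sub_nt_self:
  assumes "f \<in> nat_trans F G"
  shows "sub_nt f f = zero_nt F G"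
  by (auto intro!: ext eq_matI simp: sub_nt_def add_nt_def smult_nt_def zero_nt_def nat_transD(2,3)[OF assms])

lemma sub_nt_zero_iff:
  assumes "f \<in> nat_trans F G" "g \<in> nat_trans F G" "spf_carrier F" "spf_carrier G"
  shows "sub_nt f g = zero_nt F G \<longleftrightarrow> f = g"
proof
  assume eq: "sub_nt f g = zero_nt F G"
  show "f = g"
  proof (rule nt_eqI[OF assms(1,2)])
    fix n i j assume ij: "i < fdim G n" "j < fdim F n"
    have "sub_nt f g n $$ (i, j) = 0" using eq ij by (simp add: zero_nt_def)
    then show "f n $$ (i, j) = g n $$ (i, j)" using nt_index_sub[OF assms(1,2) ij] by simp
  qed
qed (use sub_nt_self assms in auto)

text \<open>Objects of the augmented complex, shifted by one, so that
  \<open>aug_diff \<epsilon> d i\<close> is the map out of \<open>P i\<close>. The augmentation then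
  counts as a differential and exactness at \<open>P i\<close> has the same form for all
  \<open>i\<close>.\<close>

fun aug_obj :: "'k::field spf \<Rightarrow> (nat \<Rightarrow> 'k spf) \<Rightarrow> nat \<Rightarrow> 'k spf" where
  "aug_obj M P 0 = M" | "aug_obj M P (Suc i) = P i"

fun aug_diff :: "(nat \<Rightarrow> 'k::field mat) \<Rightarrow> (nat \<Rightarrow> nat \<Rightarrow> 'k mat) \<Rightarrow> nat \<Rightarrow> nat \<Rightarrow> 'k mat" where
  "aug_diff \<epsilon> d 0 = \<epsilon>" | "aug_diff \<epsilon> d (Suc i) = d i"

lemma projective_resolutionD:
  assumes "projective_resolution e P d \<epsilon> M"
  shows "projective_functor e (P i)" "strict_poly_functor e (P i)" "spf_carrier (P i)"
    "d i \<in> nat_trans (P (Suc i)) (P i)" "\<epsilon> \<in> nat_trans (P 0) M" "epi_nt \<epsilon>"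
    "aug_diff \<epsilon> d i \<in> nat_trans (P i) (aug_obj M P i)" "exact_nt (d i) (aug_diff \<epsilon> d i)"
    "comp_nt (aug_diff \<epsilon> d i) (d i) = zero_nt (P (Suc i)) (aug_obj M P i)"
proof -
  show "\<epsilon> \<in> nat_trans (P 0) M" "epi_nt \<epsilon>"
    using assms by (auto simp: projective_resolution_def)
  show "projective_functor e (P i)" and d: "d i \<in> nat_trans (P (Suc i)) (P i)"
    using assms by (auto simp: projective_resolution_def)
  then show "strict_poly_functor e (P i)" "spf_carrier (P i)"
    using strict_poly_functorD(1) by (auto simp: projective_functor_def)
  show 1: "aug_diff \<epsilon> d i \<in> nat_trans (P i) (aug_obj M P i)" "exact_nt (d i) (aug_diff \<epsilon> d i)"
    using assms by (cases i; auto simp: projective_resolution_def)+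
  show "comp_nt (aug_diff \<epsilon> d i) (d i) = zero_nt (P (Suc i)) (aug_obj M P i)"
    by (rule exact_comp_zero[OF d 1])
qed

text \<open>The maps are chosen degree by degree. The invariant \<open>I\<close> records that the
  next composite is killed by the differential of \<open>Q\<close>, which is the condition under
  which projectivity of \<open>P\<close> gives the next map.\<close>

lemma comparison_map:
  assumes P: "projective_resolution e P d \<epsilon> M" and Q: "projective_resolution e Q d' \<epsilon>' M"
    and M: "strict_poly_functor e M"
  shows "\<exists>\<phi>. (\<forall>i. \<phi> i \<in> nat_trans (P i) (Q i)) \<and> comp_nt \<epsilon>' (\<phi> 0) = \<epsilon> \<and>
    (\<forall>i. comp_nt (d' i) (\<phi> (Suc i)) = comp_nt (\<phi> i) (d i))"
proof -
  note P' = projective_resolutionD[OF P] and Q' = projective_resolutionD[OF Q]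
  note Mc = strict_poly_functorD(1)[OF M]
  define I where "I n x \<longleftrightarrow> x \<in> nat_trans (P n) (Q n) \<and> (n = 0 \<longrightarrow> comp_nt \<epsilon>' x = \<epsilon>) \<and>
    comp_nt (aug_diff \<epsilon>' d' n) (comp_nt x (d n)) = zero_nt (P (Suc n)) (aug_obj M Q n)" for n x
  have "\<exists>\<phi>. \<forall>n. I n (\<phi> n) \<and> comp_nt (d' n) (\<phi> (Suc n)) = comp_nt (\<phi> n) (d n)"
  proof (rule dependent_nat_choice)
    have "\<exists>x\<in>nat_trans (P 0) (Q 0). comp_nt \<epsilon>' x = \<epsilon>"
      using P'(1)[of 0] Q'(2)[of 0] M Q'(5,6) P'(5) by (auto simp: projective_functor_def)
    then obtain x where x: "x \<in> nat_trans (P 0) (Q 0)" "comp_nt \<epsilon>' x = \<epsilon>" by blast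
    have "comp_nt \<epsilon>' (comp_nt x (d 0)) = zero_nt (P (Suc 0)) M"
      using comp_nt_assoc[OF P'(4)[of 0] x(1) Q'(5)] P'(9)[of 0] x(2) by simp
    then show "\<exists>x. I 0 x" using x by (auto simp: I_def)
  next
    fix x n assume I: "I n x"
    have x: "x \<in> nat_trans (P n) (Q n)" using I by (simp add: I_def)
    have xd: "comp_nt x (d n) \<in> nat_trans (P (Suc n)) (Q n)"
      by (rule nat_trans_comp[OF P'(4) x P'(3) P'(3) Q'(3)])
    obtain y where y: "y \<in> nat_trans (P (Suc n)) (Q (Suc n))" "comp_nt (d' n) y = comp_nt x (d n)"
      using projective_lift_exact[OF P'(1) Q'(2) Q'(2) Q'(4) Q'(7) Q'(8) xd] I by (auto simp: I_def)
    have "comp_nt (d' n) (comp_nt y (d (Suc n))) = comp_nt (comp_nt x (d n)) (d (Suc n))"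
      using comp_nt_assoc[OF P'(4)[of "Suc n"] y(1) Q'(4)[of n]] y(2) by simp
    also have "\<dots> = comp_nt x (zero_nt (P (Suc (Suc n))) (P n))"
      using comp_nt_assoc[OF P'(4)[of "Suc n"] P'(4)[of n] x] P'(9)[of "Suc n"] by simp
    also have "\<dots> = zero_nt (P (Suc (Suc n))) (Q n)"
      by (rule comp_zero_right[OF x])
    finally show "\<exists>y. I (Suc n) y \<and> comp_nt (d' n) y = comp_nt x (d n)"
      using y by (auto simp: I_def)
  qed
  then show ?thesis by (auto simp: I_def)
qed

text \<open>The invariant \<open>d' s d = \<phi> d\<close> makes \<open>\<phi> (Suc n) - s d\<close>
  a map into the kernel of the differential, so exactness and projectivity provide the next
  \<open>s\<close>.\<close>

lemma null_homotopy:
  assumes P: "projective_resolution e P d \<epsilon> M" and Q: "projective_resolution e Q d' \<epsilon>' M"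
    and M: "strict_poly_functor e M"
    and \<phi>: "\<And>i. \<phi> i \<in> nat_trans (P i) (Q i)" and \<phi>0: "comp_nt \<epsilon>' (\<phi> 0) = zero_nt (P 0) M"
    and ch: "\<And>i. comp_nt (d' i) (\<phi> (Suc i)) = comp_nt (\<phi> i) (d i)"
  shows "\<exists>s. (\<forall>i. s i \<in> nat_trans (P i) (Q (Suc i))) \<and> comp_nt (d' 0) (s 0) = \<phi> 0 \<and>
    (\<forall>i. comp_nt (d' (Suc i)) (s (Suc i)) = sub_nt (\<phi> (Suc i)) (comp_nt (s i) (d i)))"
proof -
  note P' = projective_resolutionD[OF P] and Q' = projective_resolutionD[OF Q]
  define I where "I n x \<longleftrightarrow> x \<in> nat_trans (P n) (Q (Suc n)) \<and> (n = 0 \<longrightarrow> comp_nt (d' 0) x = \<phi> 0) \<and>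
    comp_nt (d' n) (comp_nt x (d n)) = comp_nt (\<phi> n) (d n)" for n x
  have "\<exists>s. \<forall>n. I n (s n) \<and> comp_nt (d' (Suc n)) (s (Suc n)) = sub_nt (\<phi> (Suc n)) (comp_nt (s n) (d n))"
  proof (rule dependent_nat_choice)
    obtain x where x: "x \<in> nat_trans (P 0) (Q (Suc 0))" "comp_nt (d' 0) x = \<phi> 0"
      using projective_lift_exact[OF P'(1) Q'(2) Q'(2) Q'(4) Q'(7) Q'(8) \<phi>] \<phi>0 by force
    then show "\<exists>x. I 0 x"
      using comp_nt_assoc[OF P'(4)[of 0] x(1) Q'(4)] by (auto simp: I_def)
  next
    fix x n assume I: "I n x"
    have x: "x \<in> nat_trans (P n) (Q (Suc n))" using I by (simp add: I_def)
    have xd: "comp_nt x (d n) \<in> nat_trans (P (Suc n)) (Q (Suc n))"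
      by (rule nat_trans_comp[OF P'(4) x P'(3) P'(3) Q'(3)])
    have h: "sub_nt (\<phi> (Suc n)) (comp_nt x (d n)) \<in> nat_trans (P (Suc n)) (Q (Suc n))"
      by (rule nat_trans_sub[OF \<phi> xd P'(3) Q'(3)])
    have \<phi>d: "comp_nt (\<phi> n) (d n) \<in> nat_trans (P (Suc n)) (Q n)"
      by (rule nat_trans_comp[OF P'(4) \<phi> P'(3) P'(3) Q'(3)])
    have "comp_nt (d' n) (sub_nt (\<phi> (Suc n)) (comp_nt x (d n))) = zero_nt (P (Suc n)) (Q n)"
      using I by (simp add: comp_sub_right[OF \<phi> xd Q'(4) P'(3) Q'(3)] ch I_def sub_nt_self[OF \<phi>d])
    then obtain y where y: "y \<in> nat_trans (P (Suc n)) (Q (Suc (Suc n)))"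
      "comp_nt (d' (Suc n)) y = sub_nt (\<phi> (Suc n)) (comp_nt x (d n))"
      using projective_lift_exact[OF P'(1) Q'(2) Q'(2) Q'(4) Q'(7) Q'(8) h] by auto
    have "comp_nt (d' (Suc n)) (comp_nt y (d (Suc n))) =
        sub_nt (comp_nt (\<phi> (Suc n)) (d (Suc n))) (comp_nt (comp_nt x (d n)) (d (Suc n)))"
      using comp_nt_assoc[OF P'(4)[of "Suc n"] y(1) Q'(4)[of "Suc n"]] y(2)
      by (simp add: comp_sub_left[OF P'(4) \<phi> xd P'(3) Q'(3)])
    also have "comp_nt (comp_nt x (d n)) (d (Suc n)) = zero_nt (P (Suc (Suc n))) (Q (Suc n))"
      using comp_nt_assoc[OF P'(4)[of "Suc n"] P'(4)[of n] x] P'(9)[of "Suc n"] comp_zero_right[OF x] by simp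
    also have "sub_nt (comp_nt (\<phi> (Suc n)) (d (Suc n))) (zero_nt (P (Suc (Suc n))) (Q (Suc n))) =
        comp_nt (\<phi> (Suc n)) (d (Suc n))" (is "sub_nt ?f ?z = ?f")
    proof -
      have f: "?f \<in> nat_trans (P (Suc (Suc n))) (Q (Suc n))"
        by (rule nat_trans_comp[OF P'(4) \<phi> P'(3) P'(3) Q'(3)])
      note z = nat_trans_zero[OF P'(3)[of "Suc (Suc n)"] Q'(3)[of "Suc n"]]
      show ?thesis
        by (rule nt_eqI[OF nat_trans_sub[OF f z P'(3) Q'(3)] f])
           (simp add: nt_index_sub[OF f z] nt_index(1)[OF f])
    qed
    finally show "\<exists>y. I (Suc n) y \<and> comp_nt (d' (Suc n)) y = sub_nt (\<phi> (Suc n)) (comp_nt x (d n))"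
      using y by (auto simp: I_def)
  qed
  then show ?thesis by (auto simp: I_def)
qed

lemma coboundaries_subset_cocycles:
  assumes P: "projective_resolution e P d \<epsilon> M" and N: "spf_carrier N"
  shows "coboundaries P d N q \<subseteq> cocycles P d N q"
proof
  note P' = projective_resolutionD[OF P]
  fix f assume f: "f \<in> coboundaries P d N q"
  show "f \<in> cocycles P d N q"
  proof (cases q)
    case 0
    then show ?thesis using f cocycles_module(2)[where P = P and d = d, OF P'(3) N P'(4)] by simp
  next
    case (Suc r)
    then obtain g where g: "g \<in> nat_trans (P r) N" "f = comp_nt g (d r)" using f by auto
    have "comp_nt f (d (Suc r)) = zero_nt (P (Suc (Suc r))) N"
      using comp_nt_assoc[OF P'(4)[of "Suc r"] P'(4)[of r] g(1)] P'(9)[of "Suc r"] comp_zero_right[OF g(1)]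
      by (simp add: g(2))
    moreover have "f \<in> nat_trans (P (Suc r)) N"
      unfolding g(2) by (rule nat_trans_comp[OF P'(4) g(1) P'(3) P'(3) N])
    ultimately show ?thesis by (simp add: cocycles_def Suc)
  qed
qed

lemma coboundaries_sub:
  assumes P: "projective_resolution e P d \<epsilon> M" and N: "spf_carrier N"
    and "f \<in> coboundaries P d N q" "g \<in> coboundaries P d N q"
  shows "sub_nt f g \<in> coboundaries P d N q"
proof (cases q)
  case 0
  then show ?thesis
    using assms(3,4) sub_nt_self[OF nat_trans_zero[OF projective_resolutionD(3)[OF P] N]] by simp
next
  case (Suc r)
  note P' = projective_resolutionD[OF P]
  obtain f' g' where fg: "f' \<in> nat_trans (P r) N" "g' \<in> nat_trans (P r) N"
    "f = comp_nt f' (d r)" "g = comp_nt g' (d r)"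
    using assms(3,4) Suc by auto
  have "sub_nt f g = comp_nt (sub_nt f' g') (d r)"
    unfolding fg(3,4) by (rule comp_sub_left[OF P'(4) fg(1,2) P'(3) N, symmetric])
  then show ?thesis
    using Suc nat_trans_sub[OF fg(1,2) P'(3) N] by simp
qed

text \<open>\<open>\<eta> - id\<close> lifts the zero map and so is homotopic to zero, say
  \<open>d s + s d\<close>. Since \<open>z d = 0\<close>, the difference \<open>z \<eta> - z\<close>
  is \<open>(z s) d\<close>, a coboundary (zero in degree 0).\<close>

lemma cocycle_pullback_homotopic:
  assumes P: "projective_resolution e P d \<epsilon> M" and M: "strict_poly_functor e M" and N: "spf_carrier N"
    and \<eta>: "\<And>i. \<eta> i \<in> nat_trans (P i) (P i)" "comp_nt \<epsilon> (\<eta> 0) = \<epsilon>"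
      "\<And>i. comp_nt (d i) (\<eta> (Suc i)) = comp_nt (\<eta> i) (d i)"
    and z: "z \<in> cocycles P d N q"
  shows "sub_nt (comp_nt z (\<eta> q)) z \<in> coboundaries P d N q"
proof -
  note P' = projective_resolutionD[OF P]
  note zD = cocyclesD[OF z]
  have i: "id_nt (P i) \<in> nat_trans (P i) (P i)" for i by (rule nat_trans_id[OF P'(3)])
  define \<phi> where "\<phi> i = sub_nt (\<eta> i) (id_nt (P i))" for i
  have \<phi>: "\<phi> i \<in> nat_trans (P i) (P i)" for i
    unfolding \<phi>_def by (rule nat_trans_sub[OF \<eta>(1) i P'(3) P'(3)])
  have "comp_nt \<epsilon> (\<phi> 0) = zero_nt (P 0) M"
    unfolding \<phi>_def comp_sub_right[OF \<eta>(1) i P'(5) P'(3) P'(3)] \<eta>(2) comp_id_right[OF P'(5)]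
    by (rule sub_nt_self[OF P'(5)])
  moreover have "comp_nt (d i) (\<phi> (Suc i)) = comp_nt (\<phi> i) (d i)" for i
    unfolding \<phi>_def comp_sub_right[OF \<eta>(1) i P'(4) P'(3) P'(3)]
      comp_sub_left[OF P'(4) \<eta>(1) i P'(3) P'(3)]
    by (simp add: \<eta>(3) comp_id_right[OF P'(4)] comp_id_left[OF P'(4)])
  ultimately obtain s where s: "\<And>i. s i \<in> nat_trans (P i) (P (Suc i))" "comp_nt (d 0) (s 0) = \<phi> 0"
    "\<And>i. comp_nt (d (Suc i)) (s (Suc i)) = sub_nt (\<phi> (Suc i)) (comp_nt (s i) (d i))"
    using null_homotopy[OF P P M \<phi>] by metis
  have eq: "sub_nt (comp_nt z (\<eta> q)) z = comp_nt z (\<phi> q)"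
    unfolding \<phi>_def comp_sub_right[OF \<eta>(1) i zD(1) P'(3) P'(3)] comp_id_right[OF zD(1)] ..
  have zds: "comp_nt z (comp_nt (d q) (s q)) = zero_nt (P q) N"
    using comp_nt_assoc[OF s(1)[of q] P'(4)[of q] zD(1)] comp_zero_left[OF s(1)[of q], of N] by (simp add: zD(2))
  show ?thesis
  proof (cases q)
    case 0
    then show ?thesis using zds eq s(2) by (simp add: 0)
  next
    case (Suc r)
    have sd: "comp_nt (s r) (d r) \<in> nat_trans (P q) (P q)"
      unfolding Suc by (rule nat_trans_comp[OF P'(4) s(1) P'(3) P'(3) P'(3)])
    note z1 = nat_trans_comp[OF \<phi> zD(1) P'(3) P'(3) N] nat_trans_comp[OF sd zD(1) P'(3) P'(3) N]
    have "sub_nt (comp_nt z (\<phi> q)) (comp_nt z (comp_nt (s r) (d r))) = zero_nt (P q) N"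
      using zds s(3)[of r] comp_sub_right[OF \<phi>[of q] sd zD(1) P'(3) P'(3)] by (simp add: Suc)
    then have "comp_nt z (\<phi> q) = comp_nt z (comp_nt (s r) (d r))"
      using sub_nt_zero_iff[OF z1 P'(3) N] by simp
    also have "\<dots> = comp_nt (comp_nt z (s r)) (d r)"
      using comp_nt_assoc[OF P'(4)[of r] s(1)[of r]] zD(1) Suc by simp
    finally show ?thesis
      unfolding eq using nat_trans_comp[OF s(1)[of r] _ P'(3) P'(3) N, of z] zD(1) Suc by simp
  qed
qed

lemma cocycle_pullback:
  assumes P: "projective_resolution e P d \<epsilon> M" and Q: "projective_resolution e Q d' \<epsilon>' M'" and N: "spf_carrier N"
    and \<phi>: "\<And>i. \<phi> i \<in> nat_trans (P i) (Q i)"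
      "\<And>i. comp_nt (d' i) (\<phi> (Suc i)) = comp_nt (\<phi> i) (d i)"
  shows "z \<in> cocycles Q d' N q \<Longrightarrow> comp_nt z (\<phi> q) \<in> cocycles P d N q"
    and "z \<in> coboundaries Q d' N q \<Longrightarrow> comp_nt z (\<phi> q) \<in> coboundaries P d N q"
proof -
  note P' = projective_resolutionD[OF P] and Q' = projective_resolutionD[OF Q]
  show "comp_nt z (\<phi> q) \<in> cocycles P d N q" if z: "z \<in> cocycles Q d' N q"
  proof -
    note zD = cocyclesD[OF z]
    have "comp_nt (comp_nt z (\<phi> q)) (d q) = comp_nt z (comp_nt (d' q) (\<phi> (Suc q)))"
      using comp_nt_assoc[OF P'(4) \<phi>(1) zD(1)] by (simp add: \<phi>(2))
    also have "\<dots> = zero_nt (P (Suc q)) N"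
      using comp_nt_assoc[OF \<phi>(1)[of "Suc q"] Q'(4) zD(1)] comp_zero_left[OF \<phi>(1)[of "Suc q"]] by (simp add: zD(2))
    finally show ?thesis
      using nat_trans_comp[OF \<phi>(1) zD(1) P'(3) Q'(3) N] by (simp add: cocycles_def)
  qed
  show "comp_nt z (\<phi> q) \<in> coboundaries P d N q" if z: "z \<in> coboundaries Q d' N q"
  proof (cases q)
    case 0
    then show ?thesis using z comp_zero_left[OF \<phi>(1)[of 0]] by simp
  next
    case (Suc r)
    then obtain g where g: "g \<in> nat_trans (Q r) N" "z = comp_nt g (d' r)" using z by auto
    have "comp_nt z (\<phi> q) = comp_nt (comp_nt g (\<phi> r)) (d r)"
      using comp_nt_assoc[OF \<phi>(1)[of "Suc r"] Q'(4)[of r] g(1)] comp_nt_assoc[OF P'(4)[of r] \<phi>(1)[of r] g(1)]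
      by (simp add: g(2) Suc \<phi>(2))
    then show ?thesis
      using nat_trans_comp[OF \<phi>(1) g(1) P'(3) Q'(3) N] Suc by simp
  qed
qed

text \<open>\<open>Ext\<close> is computed from a resolution picked by choice. Any resolution
  \<open>Q\<close> may be used instead: cocycles travel back and forth along comparison maps, and
  \<open>\<psi>\<close> is pulled back to the chosen resolution.\<close>

lemma Ext_by_resolution:
  fixes M N :: "'k::field spf"
  assumes Q: "projective_resolution e Q d' \<epsilon>' M" and M: "strict_poly_functor e M" and N: "spf_carrier N"
    and W: "vectorspace class_ring W"
    and \<psi>: "\<psi> \<in> LinearCombinations.module_hom class_ring (hom_space (Q q) N\<lparr>carrier := cocycles Q d' N q\<rparr>) W"
    and onto: "\<psi> ` cocycles Q d' N q = carrier W"
    and ker: "coboundaries Q d' N q = {f \<in> cocycles Q d' N q. \<psi> f = \<zero>\<^bsub>W\<^esub>}"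
  shows "isomorphic_spaces (Ext e q M N) W"
proof -
  interpret W: vectorspace class_ring W by (rule W)
  \<comment> \<open>The existence of \<open>Q\<close> makes the choice in \<open>Ext\<close> a
    genuine resolution.\<close>
  define X where "X = (SOME (P, d). \<exists>\<epsilon>. projective_resolution e P d \<epsilon> M)"
  have "case X of (P, d) \<Rightarrow> \<exists>\<epsilon>. projective_resolution e P d \<epsilon> M"
    unfolding X_def by (rule someI[of _ "(Q, d')"]) (use Q in auto)
  then obtain P d \<epsilon> where X: "X = (P, d)" and P: "projective_resolution e P d \<epsilon> M" by (cases X) auto
  note P' = projective_resolutionD[OF P] and Q' = projective_resolutionD[OF Q]
  have Ext: "Ext e q M N = hom_cohomology P d N q"
    unfolding Ext_def X_def[symmetric] X by simp
  obtain \<phi> where \<phi>: "\<And>i. \<phi> i \<in> nat_trans (P i) (Q i)" "comp_nt \<epsilon>' (\<phi> 0) = \<epsilon>"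
    "\<And>i. comp_nt (d' i) (\<phi> (Suc i)) = comp_nt (\<phi> i) (d i)" using comparison_map[OF P Q M] by blast
  obtain \<gamma> where \<gamma>: "\<And>i. \<gamma> i \<in> nat_trans (Q i) (P i)" "comp_nt \<epsilon> (\<gamma> 0) = \<epsilon>'"
    "\<And>i. comp_nt (d i) (\<gamma> (Suc i)) = comp_nt (\<gamma> i) (d' i)" using comparison_map[OF Q P M] by blast
  note pbP = cocycle_pullback[OF P Q N \<phi>(1,3)] and pbQ = cocycle_pullback[OF Q P N \<gamma>(1,3)]
  \<comment> \<open>The composite \<open>\<phi> \<gamma>\<close> is an endomorphism of the
    resolution \<open>Q\<close> over \<open>M\<close>, so it acts on cocycles as the identity up to
    coboundaries.\<close>
  have hQ: "sub_nt (comp_nt (comp_nt z (\<phi> q)) (\<gamma> q)) z \<in> coboundaries Q d' N q" if z: "z \<in> cocycles Q d' N q" for z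
  proof -
    have "comp_nt (d' i) (comp_nt (\<phi> (Suc i)) (\<gamma> (Suc i))) = comp_nt (comp_nt (\<phi> i) (\<gamma> i)) (d' i)" for i
      using comp_nt_assoc[OF \<gamma>(1)[of "Suc i"] \<phi>(1)[of "Suc i"] Q'(4)[of i]]
        comp_nt_assoc[OF \<gamma>(1)[of "Suc i"] P'(4)[of i] \<phi>(1)[of i]]
        comp_nt_assoc[OF Q'(4)[of i] \<gamma>(1)[of i] \<phi>(1)[of i]] by (simp add: \<phi>(3) \<gamma>(3))
    moreover have "comp_nt \<epsilon>' (comp_nt (\<phi> 0) (\<gamma> 0)) = \<epsilon>'"
      using comp_nt_assoc[OF \<gamma>(1)[of 0] \<phi>(1)[of 0] Q'(5)] by (simp add: \<phi>(2) \<gamma>(2))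
    ultimately have "sub_nt (comp_nt z (comp_nt (\<phi> q) (\<gamma> q))) z \<in> coboundaries Q d' N q"
      using cocycle_pullback_homotopic[OF Q M N nat_trans_comp[OF \<gamma>(1) \<phi>(1) Q'(3) P'(3) Q'(3)] _ _ z] by simp
    then show ?thesis
      using comp_nt_assoc[OF \<gamma>(1)[of q] \<phi>(1)[of q] cocyclesD(1)[OF z]] by simp
  qed
  have hP: "sub_nt (comp_nt (comp_nt z (\<gamma> q)) (\<phi> q)) z \<in> coboundaries P d N q" if z: "z \<in> cocycles P d N q" for z
  proof -
    have "comp_nt (d i) (comp_nt (\<gamma> (Suc i)) (\<phi> (Suc i))) = comp_nt (comp_nt (\<gamma> i) (\<phi> i)) (d i)" for i
      using comp_nt_assoc[OF \<phi>(1)[of "Suc i"] \<gamma>(1)[of "Suc i"] P'(4)[of i]]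
        comp_nt_assoc[OF \<phi>(1)[of "Suc i"] Q'(4)[of i] \<gamma>(1)[of i]]
        comp_nt_assoc[OF P'(4)[of i] \<phi>(1)[of i] \<gamma>(1)[of i]] by (simp add: \<phi>(3) \<gamma>(3))
    moreover have "comp_nt \<epsilon> (comp_nt (\<gamma> 0) (\<phi> 0)) = \<epsilon>"
      using comp_nt_assoc[OF \<phi>(1)[of 0] \<gamma>(1)[of 0] P'(5)] by (simp add: \<phi>(2) \<gamma>(2))
    ultimately have "sub_nt (comp_nt z (comp_nt (\<gamma> q) (\<phi> q))) z \<in> coboundaries P d N q"
      using cocycle_pullback_homotopic[OF P M N nat_trans_comp[OF \<phi>(1) \<gamma>(1) P'(3) Q'(3) P'(3)] _ _ z] by simp
    then show ?thesis
      using comp_nt_assoc[OF \<phi>(1)[of q] \<gamma>(1)[of q] cocyclesD(1)[OF z]] by simp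
  qed
  have \<psi>W: "\<psi> f \<in> carrier W" and \<psi>add: "g \<in> cocycles Q d' N q \<Longrightarrow> \<psi> (add_nt f g) = \<psi> f \<oplus>\<^bsub>W\<^esub> \<psi> g"
    and \<psi>smult: "\<psi> (smult_nt c f) = c \<odot>\<^bsub>W\<^esub> \<psi> f"
    if "f \<in> cocycles Q d' N q" for f g c
    using \<psi> that by (auto simp: LinearCombinations.module_hom_def)
  have sub_add: "add_nt (sub_nt f g) g = f" "sub_nt f (sub_nt f g) = g" "sub_nt g (zero_nt (R) N) = g"
    if "f \<in> nat_trans R N" "g \<in> nat_trans R N" "spf_carrier R" for f g R
  proof -
    note m = nat_trans_sub[OF that(1,2,3) N] nat_trans_zero[OF that(3) N]
    note m' = nat_trans_add[OF m(1) that(2,3) N] nat_trans_sub[OF that(1) m(1) that(3) N] nat_trans_sub[OF that(2) m(2) that(3) N]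
    show "add_nt (sub_nt f g) g = f" "sub_nt f (sub_nt f g) = g" "sub_nt g (zero_nt (R) N) = g"
      by (rule nt_eqI[of _ R N], use that m m' in \<open>simp_all add: nt_index[of _ R N] nt_index_sub[of _ R N]\<close>)+
  qed
  \<comment> \<open>Composition with \<open>\<gamma>\<close>, which maps \<open>Q\<close> to
    \<open>P\<close>, turns a cocycle on \<open>P\<close> into one on \<open>Q\<close>, where
    \<open>\<psi>\<close> is defined.\<close>
  define \<psi>' where "\<psi>' z = \<psi> (comp_nt z (\<gamma> q))" for z
  have "isomorphic_spaces (quotient_space (hom_space (P q) N\<lparr>carrier := cocycles P d N q\<rparr>) (coboundaries P d N q)) W"
  proof (rule quotient_space_isomorphic[OF cocycles_module(1)[where P = P and d = d, OF P'(3) N P'(4)] W, of \<psi>'])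
    show "\<psi>' \<in> LinearCombinations.module_hom class_ring (hom_space (P q) N\<lparr>carrier := cocycles P d N q\<rparr>) W"
    proof -
      have 1: "\<psi>' (add_nt f g) = \<psi>' f \<oplus>\<^bsub>W\<^esub> \<psi>' g" if "f \<in> cocycles P d N q" "g \<in> cocycles P d N q" for f g
        unfolding \<psi>'_def comp_add_left[OF \<gamma>(1) cocyclesD(1)[OF that(1)] cocyclesD(1)[OF that(2)]]
        by (rule \<psi>add[OF pbQ(1)[OF that(1)] pbQ(1)[OF that(2)]])
      have 2: "\<psi>' (smult_nt c f) = c \<odot>\<^bsub>W\<^esub> \<psi>' f" if "f \<in> cocycles P d N q" for c f
        unfolding \<psi>'_def comp_smult_left[OF \<gamma>(1) cocyclesD(1)[OF that(1)]]
        by (rule \<psi>smult[OF pbQ(1)[OF that]])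
      have 3: "\<psi>' f \<in> carrier W" if "f \<in> cocycles P d N q" for f
        unfolding \<psi>'_def by (rule \<psi>W[OF pbQ(1)[OF that]])
      have car: "carrier (hom_space (P q) N\<lparr>carrier := cocycles P d N q\<rparr>) = cocycles P d N q"
        by simp
      show ?thesis
        unfolding LinearCombinations.module_hom_def car hom_space_simps using 1 2 3 by blast
    qed
    show "\<psi>' ` carrier (hom_space (P q) N\<lparr>carrier := cocycles P d N q\<rparr>) = carrier W"
    proof -
      have "w \<in> \<psi>' ` cocycles P d N q" if "w \<in> carrier W" for w
      proof -
        have "w \<in> \<psi> ` cocycles Q d' N q" using that by (simp only: onto)
        then obtain z where z: "z \<in> cocycles Q d' N q" "\<psi> z = w" by (elim imageE) simp
        let ?a = "comp_nt (comp_nt z (\<phi> q)) (\<gamma> q)"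
        have a: "?a \<in> cocycles Q d' N q" by (rule pbQ(1)[OF pbP(1)[OF z(1)]])
        have s: "sub_nt ?a z \<in> cocycles Q d' N q" "\<psi> (sub_nt ?a z) = \<zero>\<^bsub>W\<^esub>"
          using hQ[OF z(1)] by (simp_all add: ker)
        have "\<psi> ?a = \<psi> (sub_nt ?a z) \<oplus>\<^bsub>W\<^esub> \<psi> z"
          using \<psi>add[OF s(1) z(1)] sub_add(1)[OF cocyclesD(1)[OF a] cocyclesD(1)[OF z(1)] Q'(3)] by simp
        then have "\<psi>' (comp_nt z (\<phi> q)) = w" using s z(2) that by (simp add: \<psi>'_def)
        then show ?thesis using pbP(1)[OF z(1)] by blast
      qed
      moreover have "\<psi>' f \<in> carrier W" if "f \<in> cocycles P d N q" for f
        unfolding \<psi>'_def by (rule \<psi>W[OF pbQ(1)[OF that]])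
      ultimately show ?thesis by auto
    qed
    show "coboundaries P d N q = {x \<in> carrier (hom_space (P q) N\<lparr>carrier := cocycles P d N q\<rparr>). \<psi>' x = \<zero>\<^bsub>W\<^esub>}"
    proof (intro equalityI subsetI)
      fix z assume z: "z \<in> coboundaries P d N q"
      then have "comp_nt z (\<gamma> q) \<in> coboundaries Q d' N q" by (rule pbQ(2))
      then show "z \<in> {x \<in> carrier (hom_space (P q) N\<lparr>carrier := cocycles P d N q\<rparr>). \<psi>' x = \<zero>\<^bsub>W\<^esub>}"
        using coboundaries_subset_cocycles[OF P N] z by (auto simp: ker \<psi>'_def)
    next
      fix z assume "z \<in> {x \<in> carrier (hom_space (P q) N\<lparr>carrier := cocycles P d N q\<rparr>). \<psi>' x = \<zero>\<^bsub>W\<^esub>}"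
      then have z: "z \<in> cocycles P d N q" and "\<psi> (comp_nt z (\<gamma> q)) = \<zero>\<^bsub>W\<^esub>" by (simp_all add: \<psi>'_def)
      then have "comp_nt z (\<gamma> q) \<in> coboundaries Q d' N q" using pbQ(1)[OF z] by (simp add: ker)
      then have 1: "comp_nt (comp_nt z (\<gamma> q)) (\<phi> q) \<in> coboundaries P d N q" (is "?a \<in> _") by (rule pbP(2))
      \<comment> \<open>This writes \<open>z\<close> as a difference of two coboundaries: the round
        trip of \<open>z\<close>, and the deviation of the round trip from \<open>z\<close>.\<close>
      have "sub_nt ?a (sub_nt ?a z) = z"
        by (rule sub_add(2)[OF cocyclesD(1)[OF pbP(1)[OF pbQ(1)[OF z]]] cocyclesD(1)[OF z] P'(3)])
      then show "z \<in> coboundaries P d N q"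
        using coboundaries_sub[OF P N 1 hP[OF z]] by simp
    qed
  qed
  then show ?thesis by (simp add: Ext hom_cohomology_def)
qed

section \<open>Tensors with symmetry conditions\<close>

lemma labelled_mat_carrier [simp]: "labelled_mat rs cs f \<in> carrier_mat (length rs) (length cs)"
  by (simp add: labelled_mat_def)

lemma labelled_mat_dim [simp]: "dim_row (labelled_mat rs cs f) = length rs" "dim_col (labelled_mat rs cs f) = length cs"
  by (simp_all add: labelled_mat_def)

lemma labelled_mat_index [simp]:
  "i < length rs \<Longrightarrow> j < length cs \<Longrightarrow> labelled_mat rs cs f $$ (i, j) = f (rs ! i) (cs ! j)"
  by (simp add: labelled_mat_def)

lemma labelled_mat_cong:
  "(\<And>r c. r \<in> set rs \<Longrightarrow> c \<in> set cs \<Longrightarrow> f r c = g r c) \<Longrightarrow> labelled_mat rs cs f = labelled_mat rs cs g"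
  by (rule eq_matI) auto

lemma labelled_mat_eqD:
  assumes "labelled_mat rs cs f = labelled_mat rs cs g" "r \<in> set rs" "c \<in> set cs"
  shows "f r c = g r c"
proof -
  obtain i j where "i < length rs" "j < length cs" "rs ! i = r" "cs ! j = c"
    using assms(2,3) by (auto simp: in_set_conv_nth)
  then show ?thesis using assms(1) by (metis labelled_mat_index)
qed

lemma labelled_mat_surj:
  assumes "A \<in> carrier_mat (length rs) (length cs)" "distinct rs" "distinct cs"
  shows "\<exists>f. A = labelled_mat rs cs f"
proof -
  let ?f = "\<lambda>r c. A $$ (THE i. i < length rs \<and> rs ! i = r, THE j. j < length cs \<and> cs ! j = c)"
  have the: "(THE i. i < length xs \<and> xs ! i = xs ! k) = k" if "distinct xs" "k < length xs" for xs :: "'x list" and k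
    using that by (intro the_equality) (auto simp: nth_eq_iff_index_eq)
  have "A = labelled_mat rs cs ?f"
    using assms the[of rs] the[of cs] by (intro eq_matI) auto
  then show ?thesis by blast
qed

lemma sum_nth_distinct: "distinct cs \<Longrightarrow> (\<Sum>k<length cs. h (cs ! k)) = (\<Sum>c\<in>set cs. h c)"
  by (simp add: sum.reindex_bij_betw[OF bij_betw_nth[of cs "{..<length cs}" "set cs"]])

lemma labelled_mat_mult:
  assumes "distinct cs"
  shows "labelled_mat rs cs f * labelled_mat cs ds g = labelled_mat rs ds (\<lambda>r d. \<Sum>c\<in>set cs. f r c * g c d)"
proof (rule eq_matI)
  fix i j assume "i < dim_row (labelled_mat rs ds (\<lambda>r d. \<Sum>c\<in>set cs. f r c * g c d))"
    "j < dim_col (labelled_mat rs ds (\<lambda>r d. \<Sum>c\<in>set cs. f r c * g c d))"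
  then have ij: "i < length rs" "j < length ds" by simp_all
  show "(labelled_mat rs cs f * labelled_mat cs ds g) $$ (i, j) =
      labelled_mat rs ds (\<lambda>r d. \<Sum>c\<in>set cs. f r c * g c d) $$ (i, j)"
    unfolding index_mult_mat_sum[OF labelled_mat_carrier labelled_mat_carrier ij]
    using ij by (simp flip: sum_nth_distinct[OF assms])
qed simp_all

lemma labelled_mat_one:
  "distinct rs \<Longrightarrow> labelled_mat rs rs (\<lambda>r c. if r = c then 1 else 0) = 1\<^sub>m (length rs)"
  by (rule eq_matI) (auto simp: nth_eq_iff_index_eq)

lemma map_labelled_mat: "map_mat h (labelled_mat rs cs f) = labelled_mat rs cs (\<lambda>r c. h (f r c))"
  by (rule eq_matI) auto

lemma cmat_labelled_mat: "cmat (labelled_mat rs cs f) = labelled_mat rs cs (\<lambda>r c. cnst (f r c))"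
  by (simp add: cmat_def map_labelled_mat)

lemma transpose_labelled_mat: "transpose_mat (labelled_mat rs cs f) = labelled_mat cs rs (\<lambda>c r. f r c)"
  by (rule eq_matI) auto

section \<open>Words and tensor powers of matrices\<close>

lemma in_words_iff: "w \<in> set (words d n) \<longleftrightarrow> length w = d \<and> (\<forall>x\<in>set w. x < n)"
  by (auto simp: words_def product_lists_set list_all2_conv_all_nth all_set_conv_all_nth)

lemma distinct_words: "distinct (words d n)"
  unfolding words_def
proof (induction d)
  case (Suc d)
  have "distinct (concat (map (\<lambda>x. map (Cons x) ys) xs))" if "distinct xs" "distinct ys" for xs and ys :: "nat list list"
    using that by (induction xs) (auto simp: distinct_map)
  then show ?case using Suc by simp
qed simp

lemma sum_words_append:
  "(\<Sum>v\<in>set (words (a + b) n). f v) = (\<Sum>v\<in>set (words a n). \<Sum>v'\<in>set (words b n). f (v @ v'))"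
proof -
  have "(\<Sum>v\<in>set (words a n). \<Sum>v'\<in>set (words b n). f (v @ v')) =
      (\<Sum>(v, v')\<in>set (words a n) \<times> set (words b n). f (v @ v'))"
    by (simp add: sum.cartesian_product)
  also have "\<dots> = (\<Sum>v\<in>set (words (a + b) n). f v)"
    by (rule sum.reindex_bij_witness[of _ "\<lambda>v. (take a v, drop a v)" "\<lambda>(v, v'). v @ v'"])
       (auto simp: in_words_iff dest: in_set_takeD in_set_dropD)
  finally show ?thesis ..
qed

text \<open>The entry in row \<open>w\<close> and column \<open>v\<close> of the tensor power of the
  matrix \<open>f\<close>.\<close>

definition wprod :: "('b \<times> 'c \<Rightarrow> 'r::comm_ring_1) \<Rightarrow> 'b list \<Rightarrow> 'c list \<Rightarrow> 'r" where
  "wprod f w v = prod_list (map f (zip w v))"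

lemma wprod_Nil [simp]: "wprod f [] v = 1" "wprod f w [] = 1"
  by (simp_all add: wprod_def)

lemma wprod_Cons [simp]: "wprod f (x # w) (y # v) = f (x, y) * wprod f w v"
  by (simp add: wprod_def)

lemma wprod_append: "length w = length v \<Longrightarrow> wprod f (w @ w') (v @ v') = wprod f w v * wprod f w' v'"
  by (simp add: wprod_def)

lemma wprod_conv_prod: "length w = length v \<Longrightarrow> wprod f w v = (\<Prod>i<length w. f (w ! i, v ! i))"
  by (simp add: wprod_def prod.list_conv_set_nth atLeast0LessThan)

lemma wprod_permute:
  assumes "\<sigma> permutes {..<length w}" "length w = length v"
  shows "wprod f (permute_list \<sigma> w) (permute_list \<sigma> v) = wprod f w v"
proof -
  have "mset (map f (zip (permute_list \<sigma> w) (permute_list \<sigma> v))) = mset (map f (zip w v))"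
    using assms by (subst permute_list_zip[of \<sigma> "{..<length w}", symmetric]) auto
  then show ?thesis by (metis wprod_def prod_mset_prod_list)
qed

lemma wprod_hom:
  assumes "comm_ring_hom h"
  shows "h (wprod f w v) = wprod (\<lambda>p. h (f p)) w v"
proof -
  interpret comm_ring_hom h by (rule assms)
  show ?thesis by (simp add: wprod_def hom_prod_list o_def)
qed

lemma sum_words_wprod:
  "(\<Sum>v\<in>set (words d n). wprod f w v * wprod g v u) =
     wprod (\<lambda>(x, y). \<Sum>s<n. f (x, s) * g (s, y)) w u" if "length w = d" "length u = d"
  using that
proof (induction d arbitrary: w u)
  case 0
  then show ?case by (simp add: words_def)
next
  case (Suc d)
  then obtain x w' y u' where *: "w = x # w'" "u = y # u'" "length w' = d" "length u' = d"
    by (metis length_Suc_conv)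
  have w1: "set (words 1 n) = (\<lambda>s. [s]) ` {..<n}" by (auto simp: words_def)
  have "(\<Sum>v\<in>set (words (1 + d) n). wprod f w v * wprod g v u) =
      (\<Sum>s<n. f (x, s) * g (s, y)) * (\<Sum>v\<in>set (words d n). wprod f w' v * wprod g v u')"
    unfolding sum_words_append w1
    by (subst sum.reindex) (auto simp: inj_on_def * sum_product mult_ac)
  then show ?case using Suc.IH[OF *(3,4)] by (simp add: *)
qed

text \<open>The \<open>e\<close>-th tensor power written directly in the word basis;
  \<open>tensor_list_replicate_tens\<close> identifies it with the iterated tensor product.\<close>

definition tens :: "nat \<Rightarrow> 'k::field spf" where
  "tens e = \<lparr>fdim = (\<lambda>n. length (words e n)),
     fpoly = (\<lambda>m n. labelled_mat (words e n) (words e m) (wprod entry_var))\<rparr>"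

lemma spf_carrier_tens: "spf_carrier (tens e)"
  by (simp add: spf_carrier_def tens_def)

lemma act_tens:
  assumes "A \<in> carrier_mat n m"
  shows "act (tens e) A = labelled_mat (words e n) (words e m) (wprod (\<lambda>p. A $$ p))"
  using assms by (auto simp: act_def tens_def map_labelled_mat wprod_hom[OF comm_ring_hom_peval])

lemma strict_tens: "strict_poly_functor e (tens e :: 'k::field spf)"
  unfolding strict_poly_functor_def
proof (intro conjI allI impI)
  let ?T = "tens e :: 'k spf"
  show "fpoly ?T m n \<in> carrier_mat (fdim ?T n) (fdim ?T m)" for m n
    using spf_carrier_tens by (auto simp: spf_carrier_def)
  show "homogeneous_in e n m (fpoly ?T m n $$ (i, j))" if "i < fdim ?T n" "j < fdim ?T m" for m n i j
  proof -
    let ?w = "words e n ! i" and ?v = "words e m ! j"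
    have w: "?w \<in> set (words e n)" "?v \<in> set (words e m)" using that by (simp_all add: tens_def)
    then have "homogeneous_in (\<Sum>i<e. 1) n m (\<Prod>i<e. entry_var (?w ! i, ?v ! i) :: 'k entry_poly)"
      by (intro homogeneous_in_prod homogeneous_in_var) (auto simp: in_words_iff)
    moreover have "fpoly ?T m n $$ (i, j) = (\<Prod>i<e. entry_var (?w ! i, ?v ! i))"
      using that w by (simp add: tens_def wprod_conv_prod in_words_iff)
    ultimately show ?thesis by simp
  qed
  show "act ?T (1\<^sub>m n) = 1\<^sub>m (fdim ?T n)" for n
  proof -
    have "wprod (\<lambda>p. 1\<^sub>m n $$ p) w v = (if w = v then 1 else 0 :: 'k entry_poly)"
      if "w \<in> set (words e n)" "v \<in> set (words e n)" for w v
    proof -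
      have "length w = length v" using that by (simp add: in_words_iff)
      then show ?thesis using that by (induction w v arbitrary: e rule: list_induct2) (auto simp: in_words_iff)
    qed
    then show ?thesis
      unfolding act_tens[OF one_carrier_mat]
      by (simp add: tens_def labelled_mat_one[OF distinct_words, symmetric] cong: labelled_mat_cong)
  qed
  show "act ?T (A * B) = act ?T A * act ?T B" if AB: "A \<in> carrier_mat n m" "B \<in> carrier_mat m l" for l m n A B
  proof -
    have "wprod (\<lambda>p. (A * B) $$ p) w u = (\<Sum>v\<in>set (words e m). wprod (\<lambda>p. A $$ p) w v * wprod (\<lambda>p. B $$ p) v u)"
      if "w \<in> set (words e n)" "u \<in> set (words e l)" for w u
    proof -
      have "length w = length u" using that by (simp add: in_words_iff)
      then have "wprod (\<lambda>p. (A * B) $$ p) w u = wprod (\<lambda>(x, y). \<Sum>s<m. A $$ (x, s) * B $$ (s, y)) w u"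
        using that AB
        by (induction w u arbitrary: e rule: list_induct2)
           (auto simp: in_words_iff simp del: index_mult_mat simp add: index_mult_mat_sum)
      then show ?thesis using that by (subst sum_words_wprod) (auto simp: in_words_iff)
    qed
    then show ?thesis
      unfolding act_tens[OF AB(1)] act_tens[OF AB(2)] act_tens[OF mult_carrier_mat[OF AB]]
        labelled_mat_mult[OF distinct_words]
      by (rule labelled_mat_cong)
  qed
qed

text \<open>\<open>altsym a b e t\<close>: as a tensor of degree \<open>e\<close>, given by its coordinates, \<open>t\<close> is alternating in
  the first \<open>a\<close> positions and symmetric in the following \<open>b\<close>.\<close>

definition altsym :: "nat \<Rightarrow> nat \<Rightarrow> nat \<Rightarrow> (nat list \<Rightarrow> 'r::comm_ring_1) \<Rightarrow> bool" where
  "altsym a b e t \<longleftrightarrow>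
     (\<forall>J u \<sigma>. length J = a \<longrightarrow> length u = e - a \<longrightarrow> \<sigma> permutes {..<a} \<longrightarrow>
        t (permute_list \<sigma> J @ u) = of_int (sign \<sigma>) * t (J @ u)) \<and>
     (\<forall>J u. length J = a \<longrightarrow> length u = e - a \<longrightarrow> \<not> distinct J \<longrightarrow> t (J @ u) = 0) \<and>
     (\<forall>J K K' u. length J = a \<longrightarrow> length K = b \<longrightarrow> length u = e - a - b \<longrightarrow> mset K = mset K' \<longrightarrow>
        t (J @ K @ u) = t (J @ K' @ u))"

section \<open>Basis tensors that are alternating, then symmetric\<close>

lemma altsymD:
  assumes "altsym a b e t" "length J = a"
  shows "length u = e - a \<Longrightarrow> \<sigma> permutes {..<a} \<Longrightarrow> t (permute_list \<sigma> J @ u) = of_int (sign \<sigma>) * t (J @ u)"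
    "length u = e - a \<Longrightarrow> \<not> distinct J \<Longrightarrow> t (J @ u) = 0"
    "length K = b \<Longrightarrow> length v = e - a - b \<Longrightarrow> mset K = mset K' \<Longrightarrow> t (J @ K @ v) = t (J @ K' @ v)"
  using assms unfolding altsym_def by blast+

text \<open>The coordinate at \<open>v\<close> of the antisymmetrized word \<open>J\<close>. For
  distinct letters it is the sign of the rearrangement from \<open>J\<close> to \<open>v\<close>, or
  zero if there is none.\<close>

definition perm_sgn :: "nat list \<Rightarrow> nat list \<Rightarrow> 'r::comm_ring_1" where
  "perm_sgn J v = (\<Sum>\<sigma> | \<sigma> permutes {..<length J} \<and> v = permute_list \<sigma> J. of_int (sign \<sigma>))"

lemma permute_list_distinct_inj:
  assumes "distinct J" "\<sigma> permutes {..<length J}" "\<tau> permutes {..<length J}"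
    "permute_list \<sigma> J = permute_list \<tau> J"
  shows "\<sigma> = \<tau>"
proof
  fix i
  show "\<sigma> i = \<tau> i"
  proof (cases "i < length J")
    case True
    then have "J ! \<sigma> i = J ! \<tau> i" using assms by (metis permute_list_nth)
    then show ?thesis
      using assms(1) True permutes_in_image[OF assms(2), of i] permutes_in_image[OF assms(3), of i]
      by (simp add: nth_eq_iff_index_eq)
  next
    case False
    then show ?thesis using assms(2,3) by (simp add: permutes_def)
  qed
qed

lemma perm_sgn_permute:
  assumes "distinct J" "\<sigma> permutes {..<length J}"
  shows "perm_sgn J (permute_list \<sigma> J) = of_int (sign \<sigma>)"
proof -
  have "{\<tau>. \<tau> permutes {..<length J} \<and> permute_list \<sigma> J = permute_list \<tau> J} = {\<sigma>}"
    using permute_list_distinct_inj[OF assms(1)] assms(2) by blast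
  then show ?thesis by (simp add: perm_sgn_def)
qed

lemma perm_sgn_self [simp]: "distinct J \<Longrightarrow> perm_sgn J J = 1"
  using perm_sgn_permute[of J id] by (simp add: permutes_id)

lemma perm_sgn_nonzero:
  assumes "perm_sgn J v \<noteq> 0"
  shows "\<exists>\<sigma>. \<sigma> permutes {..<length J} \<and> v = permute_list \<sigma> J" "mset v = mset J"
proof -
  show "\<exists>\<sigma>. \<sigma> permutes {..<length J} \<and> v = permute_list \<sigma> J"
    using assms unfolding perm_sgn_def by (metis (mono_tags, lifting) empty_Collect_eq sum.empty)
  then show "mset v = mset J" by auto
qed

lemma perm_sgn_act:
  assumes "distinct J" "length v = length J" "\<tau> permutes {..<length J}"
  shows "perm_sgn J (permute_list \<tau> v) = of_int (sign \<tau>) * perm_sgn J v"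
proof (cases "mset v = mset J")
  case True
  then obtain \<sigma> where \<sigma>: "\<sigma> permutes {..<length J}" "v = permute_list \<sigma> J"
    by (metis mset_eq_permutation)
  have "permute_list \<tau> v = permute_list (\<sigma> \<circ> \<tau>) J"
    using assms(3) \<sigma>(2) by (subst permute_list_compose) auto
  moreover have "sign (\<sigma> \<circ> \<tau>) = sign \<sigma> * sign \<tau>"
    using \<sigma>(1) assms(3) by (intro sign_compose) (metis finite_lessThan permutation_permutes)+
  ultimately show ?thesis
    using perm_sgn_permute[OF assms(1) permutes_compose[OF assms(3) \<sigma>(1)]] perm_sgn_permute[OF assms(1) \<sigma>(1), where ?'a = 'a]
    by (simp add: \<sigma>(2) mult.commute)
next
  case False
  then have "mset (permute_list \<tau> v) \<noteq> mset J" using assms by auto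
  then have "perm_sgn J (permute_list \<tau> v) = (0 :: 'a)" "perm_sgn J v = (0 :: 'a)"
    using False perm_sgn_nonzero(2) by blast+
  then show ?thesis by simp
qed

text \<open>The coordinate at \<open>w\<close> of the basis tensor labelled \<open>l\<close>: a
  wedge product in the first \<open>a\<close> positions, the sum over the distinct rearrangements of
  the next \<open>b\<close> letters, and a pure tensor in the rest. Taking each rearrangement once
  gives a monomial of the divided power and a basis in every characteristic.\<close>

definition aext :: "nat \<Rightarrow> nat \<Rightarrow> nat list \<Rightarrow> nat list \<Rightarrow> 'r::comm_ring_1" where
  "aext a b l w = perm_sgn (take a l) (take a w) *
     (if mset (take b (drop a w)) = mset (take b (drop a l)) \<and> drop (a + b) w = drop (a + b) l then 1 else 0)"

text \<open>One label per basis tensor: strict order in the alternating block excludes repeated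
  letters, weak order in the symmetric block picks one word from each orbit.\<close>

definition awords :: "nat \<Rightarrow> nat \<Rightarrow> nat \<Rightarrow> nat \<Rightarrow> nat list list" where
  "awords a b e n = filter (\<lambda>w. sorted_wrt (<) (take a w) \<and> sorted (take b (drop a w))) (words e n)"

lemma distinct_awords: "distinct (awords a b e n)"
  by (simp add: awords_def distinct_words)

lemma in_awords_iff:
  "w \<in> set (awords a b e n) \<longleftrightarrow>
     w \<in> set (words e n) \<and> sorted_wrt (<) (take a w) \<and> sorted (take b (drop a w))"
  by (auto simp: awords_def)

lemma sorted_wrt_less_eq: "sorted_wrt (<) (xs :: nat list) \<Longrightarrow> sorted_wrt (<) ys \<Longrightarrow> mset xs = mset ys \<Longrightarrow> xs = ys"
  by (metis properties_for_sort strict_sorted_imp_sorted)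

lemma aext_append:
  assumes "length J = a" "length K = b" "length J' = a" "length K' = b"
  shows "aext a b (J @ K @ u) (J' @ K' @ u') = perm_sgn J J' * (if mset K' = mset K \<and> u' = u then 1 else 0)"
  using assms by (simp add: aext_def)

lemma split_word:
  assumes "length w = e" "a + b \<le> e"
  obtains J K u where "w = J @ K @ u" "length J = a" "length K = b" "length u = e - a - b"
proof
  show "w = take a w @ take b (drop a w) @ drop (a + b) w"
    by (metis append_take_drop_id drop_drop add.commute)
qed (use assms in auto)

lemma length_awords: "l \<in> set (awords a b e n) \<Longrightarrow> length l = e"
  by (simp add: in_awords_iff in_words_iff)

text \<open>Coordinates with respect to the basis tensors are therefore just the values at the
  labels.\<close>

lemma aext_awords:
  assumes "l \<in> set (awords a b e n)" "l' \<in> set (awords a b e n)" "a + b \<le> e"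
  shows "aext a b l l' = (if l = l' then 1 else 0)"
proof -
  obtain J K u where l: "l = J @ K @ u" "length J = a" "length K = b" "length u = e - a - b"
    by (rule split_word[OF length_awords[OF assms(1)] assms(3)])
  obtain J' K' u' where l': "l' = J' @ K' @ u'" "length J' = a" "length K' = b" "length u' = e - a - b"
    by (rule split_word[OF length_awords[OF assms(2)] assms(3)])
  have s: "sorted_wrt (<) J" "sorted K" "sorted_wrt (<) J'" "sorted K'"
    using assms l l' by (auto simp: in_awords_iff)
  show ?thesis
  proof (cases "l = l'")
    case True
    then show ?thesis using l l' s by (simp add: aext_append strict_sorted_iff)
  next
    case False
    have "perm_sgn J J' * (if mset K' = mset K \<and> u' = u then 1 else 0) = (0 :: 'a)"
    proof (rule ccontr)
      assume nz: "\<not> ?thesis"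
      then have "mset K' = mset K" "u' = u" by (auto split: if_splits)
      moreover have "perm_sgn J J' \<noteq> (0 :: 'a)" using nz by auto
      then have "mset J' = mset J" by (rule perm_sgn_nonzero(2))
      ultimately show False
        using False s l l' sorted_wrt_less_eq[of J J'] by (metis properties_for_sort)
    qed
    then show ?thesis using False l l' by (simp add: aext_append)
  qed
qed

text \<open>Sorting the two blocks of \<open>w\<close> changes the value of \<open>t\<close> by a
  sign only, and the same sign is the coefficient of the basis tensor of the sorted word. A repeated
  letter in the alternating block makes both sides zero.\<close>

lemma altsym_expand:
  assumes t: "altsym a b e t" and w: "w \<in> set (words e n)" and ab: "a + b \<le> e"
  shows "t w = (\<Sum>l\<in>set (awords a b e n). aext a b l w * t l)"
proof -
  have lw: "length w = e" using w by (simp add: in_words_iff)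
  obtain J K u where s: "w = J @ K @ u" "length J = a" "length K = b" "length u = e - a - b"
    by (rule split_word[OF lw ab])
  have spl: "\<exists>J' K' u'. l = J' @ K' @ u' \<and> length J' = a \<and> length K' = b \<and> sorted_wrt (<) J' \<and> sorted K'"
    if l: "l \<in> set (awords a b e n)" for l
  proof -
    obtain J' K' u' where "l = J' @ K' @ u'" "length J' = a" "length K' = b" "length u' = e - a - b"
      by (rule split_word[OF length_awords[OF l] ab])
    then show ?thesis using l by (auto simp: in_awords_iff)
  qed
  show ?thesis
  proof (cases "distinct J")
    case False
    have "aext a b l w * t l = 0" if l: "l \<in> set (awords a b e n)" for l
    proof -
      obtain J' K' u' where l': "l = J' @ K' @ u'" "length J' = a" "length K' = b" "sorted_wrt (<) J'"
        using spl[OF l] by blast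
      have "perm_sgn J' J = (0 :: 'a)"
        using False l'(4) perm_sgn_nonzero(2)[of J' J] by (metis mset_eq_imp_distinct_iff strict_sorted_iff)
      then show ?thesis using s l' by (simp add: aext_append)
    qed
    moreover have "t w = 0" using altsymD(2)[OF t s(2), of "K @ u"] False s ab by auto
    ultimately show ?thesis by simp
  next
    case True
    define J0 where "J0 = sort J"
    \<comment> \<open>The sorted form of \<open>w\<close>, the only label whose basis tensor
      contributes at \<open>w\<close>.\<close>
    define l0 where "l0 = J0 @ sort K @ u"
    have J0: "sorted_wrt (<) J0" "mset J0 = mset J" "length J0 = a" "distinct J0"
      using True s by (auto simp: J0_def strict_sorted_iff)
    have l0: "l0 \<in> set (awords a b e n)"
      using w s J0 ab by (auto simp: l0_def in_awords_iff in_words_iff J0_def)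
    obtain \<sigma> where \<sigma>: "\<sigma> permutes {..<a}" "permute_list \<sigma> J0 = J"
      using mset_eq_permutation[of J J0] J0 by auto
    have H: "aext a b l w * t l = (if l = l0 then aext a b l0 w * t l0 else 0)" if l: "l \<in> set (awords a b e n)" for l
    proof (cases "aext a b l w = (0 :: 'a)")
      case True
      then show ?thesis by auto
    next
      case False
      obtain J' K' u' where l': "l = J' @ K' @ u'" "length J' = a" "length K' = b" "sorted_wrt (<) J'" "sorted K'"
        using spl[OF l] by blast
      have nz: "perm_sgn J' J \<noteq> (0 :: 'a)" "mset K = mset K'" "u = u'"
        using False s l' by (auto simp: aext_append split: if_splits)
      have "J' = J0" using perm_sgn_nonzero(2)[OF nz(1)] J0 l'(4) by (intro sorted_wrt_less_eq) auto
      moreover have "K' = sort K" using nz(2) l'(5) by (metis properties_for_sort)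
      ultimately show ?thesis using nz(3) by (simp add: l0_def l')
    qed
    have "(\<Sum>l\<in>set (awords a b e n). aext a b l w * t l) =
        (\<Sum>l\<in>set (awords a b e n). if l = l0 then aext a b l0 w * t l0 else 0)"
      by (rule sum.cong[OF refl H])
    also have "\<dots> = aext a b l0 w * t l0"
      using l0 by (simp add: sum.delta)
    finally have "(\<Sum>l\<in>set (awords a b e n). aext a b l w * t l) = aext a b l0 w * t l0" .
    also have "aext a b l0 w = (of_int (sign \<sigma>) :: 'a)"
      using \<sigma> J0(3) s(2,3) perm_sgn_permute[OF J0(4), of \<sigma>, where ?'a = 'a]
      by (simp add: l0_def s(1) aext_append[OF J0(3)])
    also have "of_int (sign \<sigma>) * t l0 = t (J @ sort K @ u)"
      using altsymD(1)[OF t J0(3), of "sort K @ u" \<sigma>] \<sigma> s ab by (simp add: l0_def)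
    also have "\<dots> = t w"
      using altsymD(3)[OF t s(2), of "sort K" u K] s by simp
    finally show ?thesis by simp
  qed
qed

lemma altsym_aext:
  assumes l: "l \<in> set (awords a b e n)" and ab: "a + b \<le> e"
  shows "altsym a b e (aext a b l)"
proof -
  obtain L M x where s: "l = L @ M @ x" "length L = a" "length M = b" "length x = e - a - b"
    by (rule split_word[OF length_awords[OF l] ab])
  have d: "distinct L" using l s by (auto simp: in_awords_iff strict_sorted_iff)
  have e: "aext a b l (J @ u) = perm_sgn L J *
      (if mset (take b u) = mset M \<and> drop b u = x then 1 else 0 :: 'a)" if "length J = a" for J u
    using s that by (simp add: aext_def)
  show ?thesis
    unfolding altsym_def
  proof (intro conjI allI impI)
    fix J u :: "nat list" and \<sigma> assume "length J = a" "\<sigma> permutes {..<a}"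
    then show "aext a b l (permute_list \<sigma> J @ u) = of_int (sign \<sigma>) * (aext a b l (J @ u) :: 'a)"
      using s(2) by (simp add: e perm_sgn_act[OF d])
  next
    fix J u :: "nat list" assume "length J = a" "\<not> distinct J"
    then show "aext a b l (J @ u) = (0 :: 'a)"
      using d perm_sgn_nonzero(2)[of L J] by (metis e mset_eq_imp_distinct_iff mult_zero_left)
  next
    fix J K K' u :: "nat list" assume "length J = a" "length K = b" "mset K = mset K'"
    then show "aext a b l (J @ K @ u) = (aext a b l (J @ K' @ u) :: 'a)"
      using mset_eq_length[of K K'] by (simp add: e)
  qed
qed

section \<open>Matrix entries of exterior and divided powers\<close>

definition wdet :: "(nat \<times> nat \<Rightarrow> 'r::comm_ring_1) \<Rightarrow> nat list \<Rightarrow> nat list \<Rightarrow> 'r" where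
  "wdet f J L = det (mat (length L) (length L) (\<lambda>(i, j). f (J ! i, L ! j)))"

text \<open>Each distinct rearrangement of \<open>M\<close> counts once, which is the matrix entry
  of a divided power; a permanent, summing over all permutations, would carry
  multiplicities.\<close>

definition wperm :: "(nat \<times> nat \<Rightarrow> 'r::comm_ring_1) \<Rightarrow> nat list \<Rightarrow> nat list \<Rightarrow> 'r" where
  "wperm f K M = (\<Sum>v | mset v = mset M. wprod f K v)"

text \<open>The coefficient at label \<open>w\<close> of the image of the basis tensor
  \<open>l\<close> under the matrix \<open>f\<close>: a minor, a divided power entry and a tensor
  power entry.\<close>

definition afun :: "(nat \<times> nat \<Rightarrow> 'r::comm_ring_1) \<Rightarrow> nat \<Rightarrow> nat \<Rightarrow> nat list \<Rightarrow> nat list \<Rightarrow> 'r" where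
  "afun f a b l w = wdet f (take a w) (take a l) * wperm f (take b (drop a w)) (take b (drop a l)) *
     wprod f (drop (a + b) w) (drop (a + b) l)"

lemma wdet_conv_sum:
  assumes "length J = length L"
  shows "wdet f J L = (\<Sum>\<sigma> | \<sigma> permutes {..<length L}. of_int (sign \<sigma>) * wprod f J (permute_list \<sigma> L))"
  unfolding wdet_def
  by (subst det_def'[of _ "length L"])
     (auto intro!: sum.cong prod.cong simp: wprod_conv_prod assms atLeast0LessThan permute_list_nth permutes_in_image[of _ "{..<length L}", simplified])

lemma sum_words_perm_sgn:
  assumes "L \<in> set (words a n)" "length J = a"
  shows "(\<Sum>v\<in>set (words a n). wprod f J v * perm_sgn L v) = wdet f J L"
proof -
  have L: "length L = a" "\<And>x. x \<in> set L \<Longrightarrow> x < n" using assms by (auto simp: in_words_iff)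
  have "(\<Sum>v\<in>set (words a n). wprod f J v * perm_sgn L v) =
      (\<Sum>v\<in>set (words a n). \<Sum>\<sigma> | \<sigma> permutes {..<a} \<and> v = permute_list \<sigma> L. of_int (sign \<sigma>) * wprod f J (permute_list \<sigma> L))"
    by (auto simp: perm_sgn_def L sum_distrib_left mult.commute intro!: sum.cong)
  also have "\<dots> = (\<Sum>v\<in>set (words a n). \<Sum>\<sigma> | \<sigma> permutes {..<a} \<and> permute_list \<sigma> L = v. of_int (sign \<sigma>) * wprod f J (permute_list \<sigma> L))"
    by (intro sum.cong refl) auto
  also have "\<dots> = (\<Sum>v\<in>set (words a n). \<Sum>\<sigma>\<in>{\<sigma> \<in> {\<sigma>. \<sigma> permutes {..<a}}. permute_list \<sigma> L = v}. of_int (sign \<sigma>) * wprod f J (permute_list \<sigma> L))"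
    by simp
  also have "\<dots> = (\<Sum>\<sigma> | \<sigma> permutes {..<a}. of_int (sign \<sigma>) * wprod f J (permute_list \<sigma> L))"
    by (rule sum.group) (use L in \<open>auto simp: finite_permutations in_words_iff\<close>)
  finally show ?thesis using wdet_conv_sum[of J L f] assms(2) L by simp
qed

text \<open>The sum over words factors along the three blocks. This identifies \<open>afun\<close>
  with the action of the ambient tensor power on the basis tensors.\<close>

lemma tens_aext:
  assumes l: "l \<in> set (awords a b e m)" and w: "length w = e" and ab: "a + b \<le> e"
  shows "(\<Sum>v\<in>set (words e m). wprod f w v * aext a b l v) = afun f a b l w"
proof -
  obtain L M x where s: "l = L @ M @ x" "length L = a" "length M = b" "length x = e - a - b"
    by (rule split_word[OF length_awords[OF l] ab])
  obtain J K u where s': "w = J @ K @ u" "length J = a" "length K = b" "length u = e - a - b"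
    by (rule split_word[OF w ab])
  have mem: "L \<in> set (words a m)" "M \<in> set (words b m)" "x \<in> set (words (e - a - b) m)"
    using l s by (auto simp: in_awords_iff in_words_iff)
  have e: "a + (b + (e - a - b)) = e" using ab by simp
  have "(\<Sum>v\<in>set (words (a + (b + (e - a - b))) m). wprod f w v * aext a b l v) =
    (\<Sum>v1\<in>set (words a m). \<Sum>v2\<in>set (words b m). \<Sum>v3\<in>set (words (e - a - b) m).
      (wprod f J v1 * perm_sgn L v1) * ((if mset v2 = mset M then wprod f K v2 else 0) *
      (if v3 = x then wprod f u v3 else 0)))"
    unfolding sum_words_append
    by (intro sum.cong refl) (auto simp: in_words_iff s s' aext_append wprod_append)
  also have "\<dots> = (\<Sum>v1\<in>set (words a m). wprod f J v1 * perm_sgn L v1) *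
      ((\<Sum>v2\<in>set (words b m). if mset v2 = mset M then wprod f K v2 else 0) *
      (\<Sum>v3\<in>set (words (e - a - b) m). if v3 = x then wprod f u v3 else 0))"
    unfolding sum_product by (simp only: sum_distrib_left)
  also have "(\<Sum>v1\<in>set (words a m). wprod f J v1 * perm_sgn L v1) = wdet f J L"
    by (rule sum_words_perm_sgn[OF mem(1) s'(2)])
  also have "(\<Sum>v2\<in>set (words b m). if mset v2 = mset M then wprod f K v2 else 0) = wperm f K M"
  proof -
    have "{v \<in> set (words b m). mset v = mset M} = {v. mset v = mset M}"
      using mem(2) by (auto simp: in_words_iff dest: mset_eq_length mset_eq_setD)
    then show ?thesis
      unfolding wperm_def by (subst sum.inter_filter[symmetric]) auto
  qed
  also have "(\<Sum>v3\<in>set (words (e - a - b) m). if v3 = x then wprod f u v3 else 0) = wprod f u x"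
    using mem(3) by simp
  finally show ?thesis unfolding e by (simp add: afun_def s s' mult.assoc)
qed

lemma altsym_afun:
  assumes l: "length l = e" and ab: "a + b \<le> e"
  shows "altsym a b e (afun f a b l)"
proof -
  obtain L M x where s: "l = L @ M @ x" "length L = a" "length M = b" "length x = e - a - b"
    by (rule split_word[OF l ab])
  have e: "afun f a b l (J @ u) = wdet f J L * (wperm f (take b u) M * wprod f (drop b u) x)"
    if "length J = a" for J u using s that by (simp add: afun_def mult.assoc)
  show ?thesis
    unfolding altsym_def
  proof (intro conjI allI impI)
    fix J u :: "nat list" and \<sigma> assume J: "length J = a" and \<sigma>: "\<sigma> permutes {..<a}"
    have *: "mat a a (\<lambda>(i, j). mat a a (\<lambda>(i, j). f (J ! i, L ! j)) $$ (\<sigma> i, j)) =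
        mat a a (\<lambda>(i, j). f (permute_list \<sigma> J ! i, L ! j))"
      using \<sigma> J permutes_in_image[OF \<sigma>] by (intro eq_matI) (auto simp: permute_list_nth)
    have "wdet f (permute_list \<sigma> J) L = of_int (sign \<sigma>) * wdet f J L"
      unfolding wdet_def s(2)
      by (subst det_permute_rows[of _ a, symmetric]) (use \<sigma> in \<open>auto simp: * atLeast0LessThan\<close>)
    then show "afun f a b l (permute_list \<sigma> J @ u) = of_int (sign \<sigma>) * afun f a b l (J @ u)"
      using J by (simp add: e)
  next
    fix J u :: "nat list" assume J: "length J = a" "\<not> distinct J"
    then obtain i j where ij: "i < a" "j < a" "i \<noteq> j" "J ! i = J ! j"
      by (auto simp: distinct_conv_nth)
    have "wdet f J L = 0"
      unfolding wdet_def s(2)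
      by (rule det_identical_rows[of _ a i j]) (use ij in auto)
    then show "afun f a b l (J @ u) = 0" using J by (simp add: e)
  next
    fix J K K' u :: "nat list" assume J: "length J = a" and K: "length K = b" "mset K = mset K'"
    have len: "length K' = b" using K mset_eq_length by metis
    \<comment> \<open>The same rearrangement \<open>\<pi>\<close> can be applied to every summation
      word \<open>v\<close>, so permuting the rows merely reindexes the sum.\<close>
    obtain \<pi> where \<pi>: "\<pi> permutes {..<length K'}" "permute_list \<pi> K' = K"
      using mset_eq_permutation[OF K(2)] by blast
    have "wperm f K M = wperm f K' M"
      unfolding wperm_def
    proof (rule sum.reindex_bij_witness[of _ "permute_list \<pi>" "permute_list (Hilbert_Choice.inv \<pi>)"])
      have lv: "length v = b" if "mset v = mset M" for v using mset_eq_length[OF that] s by simp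
      note p = \<pi>(1)[unfolded len] permutes_inv[OF \<pi>(1)[unfolded len]]
      fix v assume "v \<in> {v. mset v = mset M}"
      then have v: "mset v = mset M" "length v = b" using lv by auto
      show "permute_list \<pi> (permute_list (Hilbert_Choice.inv \<pi>) v) = v" "permute_list (Hilbert_Choice.inv \<pi>) (permute_list \<pi> v) = v"
        using p v by (simp_all flip: permute_list_compose add: permutes_inv_o)
      show "permute_list (Hilbert_Choice.inv \<pi>) v \<in> {v. mset v = mset M}" "permute_list \<pi> v \<in> {v. mset v = mset M}"
        using p v by simp_all
      show "wprod f K' (permute_list (Hilbert_Choice.inv \<pi>) v) = wprod f K v"
        using wprod_permute[of \<pi> K' "permute_list (Hilbert_Choice.inv \<pi>) v" f] \<pi> p v len
        by (simp flip: permute_list_compose add: permutes_inv_o)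
    qed
    then show "afun f a b l (J @ K @ u) = afun f a b l (J @ K' @ u)"
      using J K len by (simp add: e)
  qed
qed

text \<open>The functor \<open>\<Lambda>\<^sup>a \<otimes> \<Gamma>\<^sup>b\<close> followed by a
  tensor power filling up degree \<open>e\<close>. With \<open>b = 0\<close> or \<open>a = 0\<close>
  it also covers the two ends of the dualized Schur map.\<close>

definition aspf :: "nat \<Rightarrow> nat \<Rightarrow> nat \<Rightarrow> 'k::field spf" where
  "aspf a b e = \<lparr>fdim = (\<lambda>n. length (awords a b e n)),
     fpoly = (\<lambda>m n. labelled_mat (awords a b e n) (awords a b e m) (\<lambda>l' l. afun entry_var a b l l'))\<rparr>"

definition aemb :: "nat \<Rightarrow> nat \<Rightarrow> nat \<Rightarrow> nat \<Rightarrow> 'k::field mat" where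
  "aemb a b e = (\<lambda>n. labelled_mat (words e n) (awords a b e n) (\<lambda>w l. aext a b l w))"

text \<open>Selecting the coordinates at the labels: a left inverse of \<open>aemb\<close>, given
  for each \<open>n\<close> separately.\<close>

definition arestr :: "nat \<Rightarrow> nat \<Rightarrow> nat \<Rightarrow> nat \<Rightarrow> 'k::field mat" where
  "arestr a b e n = labelled_mat (awords a b e n) (words e n) (\<lambda>l w. if l = w then 1 else 0)"

lemma arestr_aemb: "a + b \<le> e \<Longrightarrow> arestr a b e n * aemb a b e n = 1\<^sub>m (length (awords a b e n))"
proof -
  assume ab: "a + b \<le> e"
  have "(\<Sum>c\<in>set (words e n). (if r = c then 1 else 0) * aext a b d c) = (if r = d then 1 else 0 :: 'a)"
    if "r \<in> set (awords a b e n)" "d \<in> set (awords a b e n)" for r d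
  proof -
    have "(\<Sum>c\<in>set (words e n). (if r = c then 1 else 0) * aext a b d c) =
        (\<Sum>c\<in>set (words e n). if r = c then aext a b d r else 0 :: 'a)"
      by (intro sum.cong) auto
    also have "\<dots> = aext a b d r" using that by (simp add: in_awords_iff)
    finally show ?thesis using aext_awords[OF that(2,1) ab] by auto
  qed
  then show ?thesis
    unfolding arestr_def aemb_def labelled_mat_mult[OF distinct_words] labelled_mat_one[OF distinct_awords, symmetric]
    by (rule labelled_mat_cong)
qed

lemma perm_sgn_cnst: "cnst (perm_sgn J v :: 'k::comm_ring_1) = perm_sgn J v"
proof -
  interpret comm_ring_hom "cnst :: 'k \<Rightarrow> _" by (rule comm_ring_hom_cnst)
  show ?thesis by (simp add: perm_sgn_def hom_sum hom_of_int)
qed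

lemma aext_cnst: "cnst (aext a b l w :: 'k::comm_ring_1) = aext a b l w"
  by (simp add: aext_def cnst_mult perm_sgn_cnst)

lemma spf_carrier_aspf: "spf_carrier (aspf a b e)"
  by (simp add: spf_carrier_def aspf_def)

lemma aemb_nat_trans:
  assumes ab: "a + b \<le> e"
  shows "aemb a b e \<in> nat_trans (aspf a b e) (tens e :: 'k::field spf)"
proof (rule nat_transI)
  show "aemb a b e n \<in> carrier_mat (fdim (tens e) n) (fdim (aspf a b e) n)" for n
    by (simp add: aemb_def tens_def aspf_def)
  show "fpoly (tens e) m n * cmat (aemb a b e m) = cmat (aemb a b e n) * (fpoly (aspf a b e) m n :: 'k entry_poly mat)" for m n
    unfolding tens_def aspf_def aemb_def spf.simps cmat_labelled_mat
      labelled_mat_mult[OF distinct_words] labelled_mat_mult[OF distinct_awords] aext_cnst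
  proof (rule labelled_mat_cong)
    fix w l assume w: "w \<in> set (words e n)" and l: "l \<in> set (awords a b e m)"
    have "(\<Sum>c\<in>set (words e m). wprod entry_var w c * aext a b l c) = (afun entry_var a b l w :: 'k entry_poly)"
      using w by (intro tens_aext[OF l _ ab]) (simp add: in_words_iff)
    also have "\<dots> = (\<Sum>c\<in>set (awords a b e n). aext a b c w * afun entry_var a b l c)"
      using l by (intro altsym_expand[OF altsym_afun w ab] ab) (simp add: in_awords_iff in_words_iff)
    finally show "(\<Sum>c\<in>set (words e m). wprod entry_var w c * aext a b l c) =
      (\<Sum>c\<in>set (awords a b e n). aext a b c w * (afun entry_var a b l c :: 'k entry_poly))" .
  qed
qed

lemma aemb_mono: "a + b \<le> e \<Longrightarrow> mono_nt (aemb a b e :: nat \<Rightarrow> 'k::field mat)"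
proof -
  assume ab: "a + b \<le> e"
  have "mat_kernel (aemb a b e n :: 'k mat) = {0\<^sub>v (length (awords a b e n))}" for n
    by (rule trivial_kernel_of_left_inverse[OF _ _ arestr_aemb[OF ab, of n], of "length (words e n)"])
       (simp_all add: aemb_def arestr_def)
  then show ?thesis by (simp add: mono_nt_def) (simp add: aemb_def)
qed

text \<open>The functor laws are inherited from the tensor power along \<open>aemb\<close>, which
  replaces a Cauchy-Binet argument for minors and its analogue for divided powers.\<close>

lemma strict_aspf:
  assumes ab: "a + b \<le> e"
  shows "strict_poly_functor e (aspf a b e :: 'k::field spf)"
  by (rule strict_poly_functor_sub[OF strict_tens aemb_nat_trans[OF ab] _ spf_carrier_aspf])
     (use arestr_aemb[OF ab] in \<open>auto intro!: bexI[of _ "arestr a b e _"] simp: aspf_def tens_def arestr_def\<close>)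

section \<open>Kuhn duals\<close>

lemma generic_mat_index [simp]:
  "dim_row (generic_mat n m) = n" "dim_col (generic_mat n m) = m"
  "i < n \<Longrightarrow> j < m \<Longrightarrow> generic_mat n m $$ (i, j) = entry_var (i, j)"
  by (simp_all add: generic_mat_def)

lemma generic_mat_carrier: "generic_mat n m \<in> carrier_mat n m"
  by (simp add: generic_mat_def)

lemma homogeneous_in_peval:
  assumes f: "homogeneous_in e nr nc f"
    and B: "\<And>i j. i < nr \<Longrightarrow> j < nc \<Longrightarrow> homogeneous_in 1 nr' nc' (B $$ (i, j))"
  shows "homogeneous_in e nr' nc' (peval B (f :: 'k::field entry_poly))"
  unfolding peval_def
proof (intro homogeneous_in_sum homogeneous_in_cnst_mult)
  fix \<alpha> assume \<alpha>: "\<alpha> \<in> Poly_Mapping.keys f"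
  have pow: "homogeneous_in j nr' nc' (g ^ j)" if "homogeneous_in 1 nr' nc' g" for g :: "'k entry_poly" and j
  proof (induction j)
    case (Suc j)
    then show ?case using homogeneous_in_mult[OF that Suc] by simp
  qed simp
  have "homogeneous_in (\<Sum>v\<in>Poly_Mapping.keys \<alpha>. Poly_Mapping.lookup \<alpha> v) nr' nc' (monom_eval B \<alpha>)"
  proof (rule homogeneous_in_prod)
    fix v assume "v \<in> Poly_Mapping.keys \<alpha>"
    then obtain i j where "v = (i, j)" "i < nr" "j < nc"
      using f \<alpha> by (force simp: homogeneous_in_def)
    then show "homogeneous_in (Poly_Mapping.lookup \<alpha> v) nr' nc' (B $$ v ^ Poly_Mapping.lookup \<alpha> v)"
      using B pow by blast
  qed
  then show "homogeneous_in e nr' nc' (monom_eval B \<alpha>)"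
    using f \<alpha> by (simp add: homogeneous_in_def)
qed

lemma kuhn_dual_simps [simp]:
  "fdim (kuhn_dual F) = fdim F"
  "fpoly (kuhn_dual F) m n = transpose_mat (act F (transpose_mat (generic_mat n m)))"
  by (simp_all add: kuhn_dual_def)

lemma spf_carrier_kuhn_dual: "spf_carrier F \<Longrightarrow> spf_carrier (kuhn_dual F)"
  using act_carrier[of F "transpose_mat (generic_mat _ _)"] generic_mat_carrier
  by (fastforce simp: spf_carrier_def)

lemma act_kuhn_dual:
  assumes F: "strict_poly_functor e F" and A: "A \<in> carrier_mat n m"
  shows "act (kuhn_dual F) A = transpose_mat (act F (transpose_mat A))"
proof -
  note D = strict_poly_functorD[OF F]
  have t: "map_mat (peval A) (transpose_mat (generic_mat n m)) = transpose_mat A"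
    using A by (intro eq_matI) auto
  have "peval A (peval (transpose_mat (generic_mat n m)) (fpoly F n m $$ (i, j))) =
      peval (transpose_mat A) (fpoly F n m $$ (i, j))" if "i < fdim F m" "j < fdim F n" for i j
  proof -
    have "transpose_mat (generic_mat n m :: 'a entry_poly mat) \<in> carrier_mat m n" by (simp add: generic_mat_carrier)
    from peval_peval[OF D(3)[OF that] this] show ?thesis by (simp only: t)
  qed
  then show ?thesis
    using A by (intro eq_matI) (auto simp: act_def fpoly_dim[OF D(1)])
qed

lemma strict_kuhn_dual:
  assumes F: "strict_poly_functor e F"
  shows "strict_poly_functor e (kuhn_dual F)"
  unfolding strict_poly_functor_def
proof (intro conjI allI impI)
  note D = strict_poly_functorD[OF F]
  show "fpoly (kuhn_dual F) m n \<in> carrier_mat (fdim (kuhn_dual F) n) (fdim (kuhn_dual F) m)" for m n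
    using spf_carrier_kuhn_dual[OF D(1)] by (simp add: spf_carrier_def)
  show "homogeneous_in e n m (fpoly (kuhn_dual F) m n $$ (i, j))"
    if "i < fdim (kuhn_dual F) n" "j < fdim (kuhn_dual F) m" for m n i j
  proof -
    have "fpoly (kuhn_dual F) m n $$ (i, j) = peval (transpose_mat (generic_mat n m)) (fpoly F n m $$ (j, i))"
      using that by (simp add: act_def fpoly_dim[OF D(1)])
    moreover have "homogeneous_in e n m (peval (transpose_mat (generic_mat n m)) (fpoly F n m $$ (j, i)))"
      using that by (intro homogeneous_in_peval[OF D(3)]) (simp_all add: homogeneous_in_var[simplified])
    ultimately show ?thesis by simp
  qed
  show "act (kuhn_dual F) (1\<^sub>m n) = 1\<^sub>m (fdim (kuhn_dual F) n)" for n
    by (simp add: act_kuhn_dual[OF F, of _ n n] D(4))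
  show "act (kuhn_dual F) (A * B) = act (kuhn_dual F) A * act (kuhn_dual F) B"
    if "A \<in> carrier_mat n m" "B \<in> carrier_mat m l" for l m n A B
  proof -
    have t: "transpose_mat B \<in> carrier_mat l m" "transpose_mat A \<in> carrier_mat m n" using that by auto
    show ?thesis
      unfolding act_kuhn_dual[OF F that(1)] act_kuhn_dual[OF F that(2)] act_kuhn_dual[OF F mult_carrier_mat[OF that]]
      by (simp only: transpose_mult[OF that] D(5)[OF t] transpose_mult[OF act_carrier[OF D(1) t(1)] act_carrier[OF D(1) t(2)]])
  qed
qed

definition dual_nt :: "(nat \<Rightarrow> 'k::field mat) \<Rightarrow> nat \<Rightarrow> 'k mat" where
  "dual_nt f = (\<lambda>n. transpose_mat (f n))"

lemma cmat_transpose: "cmat (transpose_mat A) = transpose_mat (cmat A)"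
  by (rule eq_matI) auto

lemma dual_nat_trans:
  assumes f: "f \<in> nat_trans F G" and F: "spf_carrier F" and G: "spf_carrier G"
  shows "dual_nt f \<in> nat_trans (kuhn_dual G) (kuhn_dual F)"
proof (rule nat_transI)
  show "dual_nt f n \<in> carrier_mat (fdim (kuhn_dual F) n) (fdim (kuhn_dual G) n)" for n
    using nat_transD(1)[OF f] by (simp add: dual_nt_def)
  show "fpoly (kuhn_dual F) m n * cmat (dual_nt f m) = cmat (dual_nt f n) * fpoly (kuhn_dual G) m n" for m n
  proof -
    have g: "transpose_mat (generic_mat n m) \<in> carrier_mat m n" by (simp add: generic_mat_carrier)
    have c: "cmat (f m) \<in> carrier_mat (fdim G m) (fdim F m)" "cmat (f n) \<in> carrier_mat (fdim G n) (fdim F n)"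
      using nat_transD(1)[OF f] by simp_all
    show ?thesis
      using arg_cong[OF nat_trans_act[OF f F G g], of transpose_mat]
      unfolding transpose_mult[OF act_carrier[OF G g] c(2)] transpose_mult[OF c(1) act_carrier[OF F g]]
      by (simp add: dual_nt_def cmat_transpose)
  qed
qed

text \<open>Over a field, mono and epi mean left and right inverses at each \<open>n\<close>, and
  transposition exchanges the two.\<close>

lemma dual_mono_epi:
  assumes f: "f \<in> nat_trans F G"
  shows "epi_nt f \<Longrightarrow> mono_nt (dual_nt f)" "mono_nt f \<Longrightarrow> epi_nt (dual_nt f)"
proof -
  note c = nat_transD(1)[OF f] and d = nat_transD(2,3)[OF f]
  show "mono_nt (dual_nt f)" if e: "epi_nt f"
    unfolding mono_nt_def
  proof
    fix n
    obtain B where B: "B \<in> carrier_mat (fdim F n) (fdim G n)" "f n * B = 1\<^sub>m (fdim G n)"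
      using right_inverse_of_full_image[OF c, of n] e by (auto simp: epi_nt_def d)
    have "transpose_mat B * transpose_mat (f n) = 1\<^sub>m (fdim G n)"
      using arg_cong[OF B(2), of transpose_mat] by (simp add: transpose_mult[OF c B(1)])
    then show "mat_kernel (dual_nt f n) = {0\<^sub>v (dim_col (dual_nt f n))}"
      using trivial_kernel_of_left_inverse[of "transpose_mat (f n)" "fdim F n" "fdim G n" "transpose_mat B"] B(1) c
      by (simp add: dual_nt_def d)
  qed
  show "epi_nt (dual_nt f)" if m: "mono_nt f"
    unfolding epi_nt_def
  proof
    fix n
    obtain B where B: "B \<in> carrier_mat (fdim F n) (fdim G n)" "B * f n = 1\<^sub>m (fdim F n)"
      using left_inverse_of_trivial_kernel[OF c, of n] m by (auto simp: mono_nt_def d)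
    have "transpose_mat (f n) * transpose_mat B = 1\<^sub>m (fdim F n)"
      using arg_cong[OF B(2), of transpose_mat] by (simp add: transpose_mult[OF B(1) c])
    then show "mat_image (dual_nt f n) = carrier_vec (dim_row (dual_nt f n))"
      using full_image_of_right_inverse[of "transpose_mat (f n)" "fdim F n" "fdim G n" "transpose_mat B"] B(1) c
      by (simp add: dual_nt_def d)
  qed
qed

lemma spf_eqI:
  fixes F G :: "'k::field spf"
  assumes "\<And>n. fdim F n = fdim G n" "\<And>m n. fpoly F m n = fpoly G m n"
  shows "F = G"
  using assms by (intro spf.equality) (auto simp: fun_eq_iff)

text \<open>An equality rather than an isomorphism, since dual spaces are identified with the
  original ones by dual bases.\<close>

lemma kuhn_dual_kuhn_dual:
  assumes F: "strict_poly_functor e F"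
  shows "kuhn_dual (kuhn_dual F) = F"
proof (rule spf_eqI)
  fix m n
  have "transpose_mat (generic_mat n m) \<in> carrier_mat m n" by (simp add: generic_mat_carrier)
  from act_kuhn_dual[OF F this] show "fpoly (kuhn_dual (kuhn_dual F)) m n = fpoly F m n"
    by (simp add: act_generic[OF F])
qed simp

section \<open>Tensor products and their duals in the word basis\<close>

lemma wprod_cong:
  "(\<And>x y. (x, y) \<in> set (zip w v) \<Longrightarrow> f (x, y) = g (x, y)) \<Longrightarrow> wprod f w v = wprod g w v"
  unfolding wprod_def by (rule arg_cong[where f = prod_list]) (auto intro!: map_cong)

lemma wprod_swap: "length w = length v \<Longrightarrow> wprod (\<lambda>(x, y). f (y, x)) w v = wprod f v w"
  by (induction w v rule: list_induct2) auto

lemma wprod_generic_transpose: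
  assumes "length w = length v" "\<forall>x\<in>set w. x < m" "\<forall>x\<in>set v. x < n"
  shows "wprod (\<lambda>p. transpose_mat (generic_mat n m) $$ p) w v = wprod entry_var v w"
proof -
  have "wprod (\<lambda>p. transpose_mat (generic_mat n m) $$ p) w v = wprod (\<lambda>(x, y). entry_var (y, x)) w v"
  proof (rule wprod_cong)
    fix x y assume "(x, y) \<in> set (zip w v)"
    then have "x < m" "y < n" using assms by (auto dest: set_zip_leftD set_zip_rightD)
    then show "transpose_mat (generic_mat n m) $$ (x, y) = (case (x, y) of (x, y) \<Rightarrow> entry_var (y, x))"
      by simp
  qed
  then show ?thesis by (simp add: wprod_swap[OF assms(1)])
qed

lemma kuhn_dual_tens: "kuhn_dual (tens e) = (tens e :: 'k::field spf)"
proof (rule spf_eqI)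
  fix m n
  have g: "transpose_mat (generic_mat n m) \<in> carrier_mat m n" by (simp add: generic_mat_carrier)
  show "fpoly (kuhn_dual (tens e :: 'k spf)) m n = fpoly (tens e) m n"
    unfolding kuhn_dual_simps act_tens[OF g] transpose_labelled_mat
    by (simp add: tens_def) (rule labelled_mat_cong, auto simp: in_words_iff wprod_generic_transpose)
qed simp

lemma act_aspf:
  assumes "A \<in> carrier_mat n m"
  shows "act (aspf a b e) A =
    labelled_mat (awords a b e n) (awords a b e m) (\<lambda>l' l. afun (\<lambda>p. A $$ p) a b l l')"
proof -
  interpret comm_ring_hom "peval A" by (rule comm_ring_hom_peval)
  have 1: "peval A (wdet entry_var J L) = wdet (\<lambda>p. A $$ p) J L" for J L
    unfolding wdet_def hom_det[symmetric] by (intro arg_cong[where f = det] eq_matI) auto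
  have 2: "peval A (wperm entry_var J L) = wperm (\<lambda>p. A $$ p) J L" for J L
    unfolding wperm_def hom_sum wprod_hom[OF comm_ring_hom_peval] by simp
  show ?thesis
    using assms by (simp add: act_def aspf_def map_labelled_mat afun_def hom_mult 1 2
        wprod_hom[OF comm_ring_hom_peval])
qed

text \<open>The labels of a Kronecker product: concatenated words in lexicographic order match the
  \<open>div\<close> and \<open>mod\<close> arithmetic of \<open>kron\<close>.\<close>

definition append_prod :: "'a list list \<Rightarrow> 'a list list \<Rightarrow> 'a list list" where
  "append_prod xs ys = concat (map (\<lambda>x. map ((@) x) ys) xs)"

lemma length_append_prod [simp]: "length (append_prod xs ys) = length xs * length ys"
  by (induction xs) (auto simp: append_prod_def)

lemma append_prod_nth:
  "i < length xs * length ys \<Longrightarrow> append_prod xs ys ! i = xs ! (i div length ys) @ ys ! (i mod length ys)"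
proof (induction xs arbitrary: i)
  case (Cons x xs)
  have e: "append_prod (x # xs) ys = map ((@) x) ys @ append_prod xs ys" by (simp add: append_prod_def)
  show ?case
  proof (cases "i < length ys")
    case True
    then show ?thesis by (simp add: e nth_append)
  next
    case False
    then have "i - length ys < length xs * length ys" using Cons.prems by auto
    moreover have "i div length ys = Suc ((i - length ys) div length ys)"
      using False Cons.prems by (intro le_div_geq) (auto intro: Nat.gr0I)
    moreover have "i mod length ys = (i - length ys) mod length ys"
      using False by (simp add: le_mod_geq)
    ultimately show ?thesis using False Cons.IH[of "i - length ys"] by (simp add: e nth_append)
  qed
qed simp

lemma kron_labelled:
  assumes "\<And>r. r \<in> set rs \<Longrightarrow> length r = a" "\<And>c. c \<in> set cs \<Longrightarrow> length c = a'"
  shows "kron (labelled_mat rs cs f) (labelled_mat rs' cs' g) =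
    labelled_mat (append_prod rs rs') (append_prod cs cs')
      (\<lambda>r c. f (take a r) (take a' c) * g (drop a r) (drop a' c))"
proof (rule eq_matI)
  fix i j
  assume "i < dim_row (labelled_mat (append_prod rs rs') (append_prod cs cs')
      (\<lambda>r c. f (take a r) (take a' c) * g (drop a r) (drop a' c)))"
    "j < dim_col (labelled_mat (append_prod rs rs') (append_prod cs cs')
      (\<lambda>r c. f (take a r) (take a' c) * g (drop a r) (drop a' c)))"
  then have ij: "i < length rs * length rs'" "j < length cs * length cs'" by simp_all
  then have "i div length rs' < length rs" "j div length cs' < length cs"
    "i mod length rs' < length rs'" "j mod length cs' < length cs'"
    by (auto simp: less_mult_imp_div_less intro!: mod_less_divisor Nat.gr0I)
  then show "kron (labelled_mat rs cs f) (labelled_mat rs' cs' g) $$ (i, j) =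
      labelled_mat (append_prod rs rs') (append_prod cs cs')
      (\<lambda>r c. f (take a r) (take a' c) * g (drop a r) (drop a' c)) $$ (i, j)"
    using ij assms(1)[OF nth_mem] assms(2)[OF nth_mem] by (simp add: kron_def append_prod_nth)
qed (simp_all add: kron_def)

lemma words_append: "words (a + b) n = append_prod (words a n) (words b n)"
proof (induction a)
  case 0
  then show ?case by (simp add: words_def append_prod_def map_idI)
next
  case (Suc a)
  have S: "words (Suc d) n = concat (map (\<lambda>x. map ((#) x) (words d n)) [0..<n])" for d
    by (simp add: words_def)
  have 1: "append_prod (map ((#) x) ws) vs = map ((#) x) (append_prod ws vs)" for x :: nat and ws vs
    by (induction ws) (auto simp: append_prod_def)
  have 2: "append_prod (us @ ws) vs = append_prod us vs @ append_prod ws vs" for us ws vs :: "nat list list"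
    by (simp add: append_prod_def)
  have "append_prod (concat (map (\<lambda>x. map ((#) x) ws) xs)) vs = concat (map (\<lambda>x. map ((#) x) (append_prod ws vs)) xs)"
    for ws vs and xs :: "nat list"
    by (induction xs) (simp_all add: 1 2, simp add: append_prod_def)
  then show ?case by (simp add: S Suc)
qed

lemma filter_append_prod:
  assumes "\<And>x. x \<in> set xs \<Longrightarrow> length x = a"
  shows "filter (\<lambda>w. P (take a w) \<and> Q (drop a w)) (append_prod xs ys) = append_prod (filter P xs) (filter Q ys)"
  using assms
proof (induction xs)
  case (Cons x xs)
  have "filter (\<lambda>w. P (take a w) \<and> Q (drop a w)) (map ((@) x) ys) = (if P x then map ((@) x) (filter Q ys) else [])"
    using Cons.prems by (simp add: filter_map o_def)
  then show ?case using Cons by (simp add: append_prod_def)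
qed (simp add: append_prod_def)

lemma length_in_words: "w \<in> set (words d n) \<Longrightarrow> length w = d"
  by (simp add: in_words_iff)

lemma awords_eq_ext: "awords a 0 (a + k) n = append_prod (ext_words a n) (words k n)"
  using filter_append_prod[of "words a n" a "sorted_wrt (<)" "\<lambda>_. True" "words k n"]
  by (simp add: awords_def words_append ext_words_def length_in_words)

lemma awords_eq_sym: "awords 0 b (b + c) n = append_prod (sym_words b n) (words c n)"
  using filter_append_prod[of "words b n" b sorted "\<lambda>_. True" "words c n"]
  by (simp add: awords_def words_append sym_words_def length_in_words)

lemma tensor_tens: "tensor (tens a) (tens b) = tens (a + b)"
proof (rule spf_eqI)
  show "fpoly (tensor (tens a) (tens b)) m n = (fpoly (tens (a + b)) m n :: 'a entry_poly mat)" for m n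
    unfolding tensor_def tens_def spf.simps words_append
    by (subst kron_labelled[of _ a _ a])
       (auto simp: in_words_iff wprod_append[symmetric] simp flip: words_append intro!: labelled_mat_cong)
qed (simp add: tensor_def tens_def words_append)

lemma tens_0: "tensor_unit = (tens 0 :: 'k::field spf)"
proof (rule spf_eqI)
  show "fpoly tensor_unit m n = (fpoly (tens 0) m n :: 'k entry_poly mat)" for m n
    by (intro eq_matI) (auto simp: tensor_unit_def tens_def words_def)
qed (simp add: tensor_unit_def tens_def words_def)

lemma in_words_1: "w \<in> set (words (Suc 0) n) \<longleftrightarrow> (\<exists>x<n. w = [x])"
  by (auto simp: in_words_iff length_Suc_conv)

lemma ext_words_1: "ext_words (Suc 0) n = words (Suc 0) n"
  unfolding ext_words_def by (rule filter_True) (auto simp: in_words_1)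

lemma sym_words_1: "sym_words (Suc 0) n = words (Suc 0) n"
  unfolding sym_words_def by (rule filter_True) (auto simp: in_words_1)

lemma in_ext_words_length: "w \<in> set (ext_words d n) \<Longrightarrow> length w = d"
  by (simp add: ext_words_def in_words_iff)

lemma in_sym_words_length: "w \<in> set (sym_words d n) \<Longrightarrow> length w = d"
  by (simp add: sym_words_def in_words_iff)

lemma fpoly_ext_power:
  "fpoly (ext_power d) m n = labelled_mat (ext_words d n) (ext_words d m) (wdet entry_var)"
  unfolding ext_power_def spf.simps wdet_def
  by (rule labelled_mat_cong) (simp add: in_ext_words_length)

lemma fpoly_sym_power:
  "fpoly (sym_power d) m n =
     labelled_mat (sym_words d n) (sym_words d m) (\<lambda>I J. \<Sum>w | mset w = mset I. wprod entry_var w J)"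
  unfolding sym_power_def spf.simps
proof (rule labelled_mat_cong)
  fix I J assume IJ: "I \<in> set (sym_words d n)" "J \<in> set (sym_words d m)"
  have e: "{w. w \<in> set (words d n) \<and> sort w = I} = {w. mset w = mset I}"
  proof -
    have I: "length I = d" "sorted I" "\<forall>x\<in>set I. x < n"
      using IJ(1) by (simp_all add: sym_words_def in_words_iff)
    have "w \<in> set (words d n) \<and> sort w = I \<longleftrightarrow> mset w = mset I" for w
    proof
      assume "mset w = mset I"
      then show "w \<in> set (words d n) \<and> sort w = I"
        using I mset_eq_length[where xs = w and ys = I] mset_eq_setD[where xs = w and ys = I]
        by (auto simp: in_words_iff intro!: properties_for_sort)
    next
      assume "w \<in> set (words d n) \<and> sort w = I"
      then show "mset w = mset I" by (metis mset_sort)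
    qed
    then show ?thesis by simp
  qed
  show "(\<Sum>w | w \<in> set (words d n) \<and> sort w = I. \<Prod>b<d. entry_var (w ! b, J ! b)) =
      (\<Sum>w | mset w = mset I. wprod entry_var w J)"
    unfolding e
  proof (rule sum.cong[OF refl])
    fix w assume "w \<in> {w. mset w = mset I}"
    then have "mset w = mset I" by simp
    then show "(\<Prod>b<d. entry_var (w ! b, J ! b)) = wprod entry_var w J"
      using mset_eq_length[of w I] in_sym_words_length[OF IJ(1)] in_sym_words_length[OF IJ(2)]
      by (simp add: wprod_conv_prod)
  qed
qed

lemma ext_power_1: "ext_power 1 = (tens 1 :: 'k::field spf)"
proof (rule spf_eqI)
  show "fpoly (ext_power 1) m n = (fpoly (tens 1) m n :: 'k entry_poly mat)" for m n
    unfolding fpoly_ext_power tens_def spf.simps One_nat_def ext_words_1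
    by (rule labelled_mat_cong) (auto simp: in_words_1 wdet_def det_single)
qed (simp add: ext_power_def tens_def ext_words_1)

lemma sym_power_1: "sym_power 1 = (tens 1 :: 'k::field spf)"
proof (rule spf_eqI)
  show "fpoly (sym_power 1) m n = (fpoly (tens 1) m n :: 'k entry_poly mat)" for m n
    unfolding fpoly_sym_power tens_def spf.simps One_nat_def sym_words_1
    by (rule labelled_mat_cong) (auto simp: in_words_1)
qed (simp add: sym_power_def tens_def sym_words_1)

lemma tensor_list_replicate_tens: "tensor_list (replicate k (tens 1)) = (tens k :: 'k::field spf)"
proof (induction k)
  case (Suc k)
  then show ?case using tensor_tens[of 1 k, where ?'a = 'k] by (simp add: tensor_list_def)
qed (simp add: tensor_list_def tens_0)

lemma tensor_list_Cons: "tensor_list (F # Fs) = tensor F (tensor_list Fs)"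
  by (simp add: tensor_list_def)

lemma wperm_Nil [simp]: "wperm f [] [] = 1"
  by (simp add: wperm_def)

lemma wdet_Nil [simp]: "wdet f J [] = 1"
  by (simp add: wdet_def)

text \<open>This is the source of the Schur map for a hook with first row \<open>a\<close> and
  \<open>k\<close> further rows of length one.\<close>

lemma tensor_list_ext:
  "tensor_list (map ext_power (a # replicate k 1)) = (aspf a 0 (a + k) :: 'k::field spf)"
proof -
  have "tensor_list (map ext_power (a # replicate k 1)) = tensor (ext_power a) (tens k :: 'k spf)"
    by (simp add: tensor_list_Cons ext_power_1[simplified] tensor_list_replicate_tens[simplified])
  also have "\<dots> = aspf a 0 (a + k)"
  proof (rule spf_eqI)
    show "fpoly (tensor (ext_power a) (tens k :: 'k spf)) m n = fpoly (aspf a 0 (a + k)) m n" for m n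
      unfolding tensor_def spf.simps fpoly_ext_power tens_def aspf_def awords_eq_ext
      by (subst kron_labelled[of _ a _ a]) (auto simp: in_ext_words_length afun_def intro!: labelled_mat_cong)
  qed (simp add: tensor_def ext_power_def tens_def aspf_def awords_eq_ext)
  finally show ?thesis .
qed

text \<open>Determinants are invariant under transposition, so exterior powers are their own duals
  in these bases. Divided powers are not; theirs are the symmetric powers of
  \<open>tensor_list_sym\<close>.\<close>

lemma kuhn_dual_aspf_ext: "kuhn_dual (aspf a 0 (a + k)) = (aspf a 0 (a + k) :: 'k::field spf)"
proof (rule spf_eqI)
  fix m n
  have g: "transpose_mat (generic_mat n m :: 'k entry_poly mat) \<in> carrier_mat m n" by (simp add: generic_mat_carrier)
  have det: "wdet (\<lambda>p. transpose_mat (generic_mat n m) $$ p) J L = (wdet entry_var L J :: 'k entry_poly)"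
    if "length J = a" "length L = a" "\<forall>x\<in>set J. x < m" "\<forall>x\<in>set L. x < n" for J L
  proof -
    have "wdet (\<lambda>p. transpose_mat (generic_mat n m) $$ p) J L =
        det (transpose_mat (mat a a (\<lambda>(i, j). entry_var (L ! i, J ! j) :: 'k entry_poly)))"
      unfolding wdet_def using that by (intro arg_cong[where f = det] eq_matI) auto
    also have "\<dots> = wdet entry_var L J" unfolding wdet_def that(1) by (rule det_transpose[of _ a]) simp
    finally show ?thesis .
  qed
  show "fpoly (kuhn_dual (aspf a 0 (a + k) :: 'k spf)) m n = fpoly (aspf a 0 (a + k)) m n"
    unfolding kuhn_dual_simps act_aspf[OF g] transpose_labelled_mat
    unfolding aspf_def spf.simps
  proof (rule labelled_mat_cong)
    fix l' l assume l: "l' \<in> set (awords a 0 (a + k) n)" "l \<in> set (awords a 0 (a + k) m)"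
    then have "length l' = a + k" "length l = a + k" "\<forall>x\<in>set l'. x < n" "\<forall>x\<in>set l. x < m"
      by (simp_all add: in_awords_iff in_words_iff)
    then show "afun (\<lambda>p. transpose_mat (generic_mat n m) $$ p) a 0 l' l = (afun entry_var a 0 l l' :: 'k entry_poly)"
      unfolding afun_def
      by (subst det, simp, simp, (auto dest: in_set_takeD)[1], (auto dest: in_set_takeD)[1],
          subst wprod_generic_transpose) (auto dest: in_set_dropD)
  qed
qed simp

text \<open>The coefficient of a monomial in a product of linear forms sums over the distinct
  rearrangements of that monomial, as does \<open>wperm\<close> with rows and columns
  exchanged.\<close>

lemma tensor_list_sym:
  "tensor_list (map sym_power (b # replicate c 1)) = kuhn_dual (aspf 0 b (b + c) :: 'k::field spf)"
proof -
  have "tensor_list (map sym_power (b # replicate c 1)) = tensor (sym_power b) (tens c :: 'k spf)"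
    by (simp add: tensor_list_Cons sym_power_1[simplified] tensor_list_replicate_tens[simplified])
  also have "\<dots> = kuhn_dual (aspf 0 b (b + c))"
  proof (rule spf_eqI)
    fix m n
    have g: "transpose_mat (generic_mat n m :: 'k entry_poly mat) \<in> carrier_mat m n" by (simp add: generic_mat_carrier)
    have "fpoly (tensor (sym_power b) (tens c :: 'k spf)) m n =
        labelled_mat (append_prod (sym_words b n) (words c n)) (append_prod (sym_words b m) (words c m))
          (\<lambda>I J. (\<Sum>w | mset w = mset (take b I). wprod entry_var w (take b J)) * wprod entry_var (drop b I) (drop b J))"
      unfolding tensor_def spf.simps fpoly_sym_power tens_def
      by (rule kron_labelled) (simp_all add: in_sym_words_length)
    also have "\<dots> = fpoly (kuhn_dual (aspf 0 b (b + c))) m n"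
      unfolding kuhn_dual_simps act_aspf[OF g] transpose_labelled_mat awords_eq_sym[symmetric]
    proof (rule labelled_mat_cong)
      fix I J assume "I \<in> set (awords 0 b (b + c) n)" "J \<in> set (awords 0 b (b + c) m)"
      then have IJ: "length I = b + c" "length J = b + c" "\<forall>x\<in>set I. x < n" "\<forall>x\<in>set J. x < m"
        by (simp_all add: in_awords_iff in_words_iff)
      have "wperm (\<lambda>p. transpose_mat (generic_mat n m) $$ p) (take b J) (take b I) =
          (\<Sum>w | mset w = mset (take b I). wprod entry_var w (take b J) :: 'k entry_poly)"
        unfolding wperm_def
      proof (rule sum.cong[OF refl])
        fix w assume "w \<in> {w. mset w = mset (take b I)}"
        then have "length w = b" "set w = set (take b I)"
          using IJ by (auto dest: mset_eq_length mset_eq_setD)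
        then show "wprod (\<lambda>p. transpose_mat (generic_mat n m) $$ p) (take b J) w = (wprod entry_var w (take b J) :: 'k entry_poly)"
          using IJ by (intro wprod_generic_transpose) (auto dest: in_set_takeD)
      qed
      moreover have "wprod (\<lambda>p. transpose_mat (generic_mat n m) $$ p) (drop b J) (drop b I) =
          (wprod entry_var (drop b I) (drop b J) :: 'k entry_poly)"
        using IJ by (intro wprod_generic_transpose) (auto dest: in_set_dropD)
      ultimately show "(\<Sum>w | mset w = mset (take b I). wprod entry_var w (take b J)) * wprod entry_var (drop b I) (drop b J) =
          (afun (\<lambda>p. transpose_mat (generic_mat n m) $$ p) 0 b I J :: 'k entry_poly)"
        by (simp add: afun_def)
    qed
    finally show "fpoly (tensor (sym_power b) (tens c :: 'k spf)) m n = fpoly (kuhn_dual (aspf 0 b (b + c))) m n" .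
  qed (simp add: tensor_def sym_power_def tens_def aspf_def awords_eq_sym)
  finally show ?thesis .
qed

section \<open>Permutations of tensor positions\<close>

text \<open>Allows a place permutation to be given by the list of positions from which the letters
  are taken.\<close>

lemma exists_position_permutation:
  assumes "distinct Q" "set Q = {..<e}"
  shows "\<exists>\<sigma>. \<sigma> permutes {..<e} \<and> (\<forall>w. length w = e \<longrightarrow> permute_list \<sigma> w = map ((!) w) Q)"
proof -
  have len: "length Q = e" using distinct_card[OF assms(1)] assms(2) by simp
  let ?\<sigma> = "\<lambda>t. if t < e then Q ! t else t"
  have "bij_betw ((!) Q) {..<e} {..<e}"
    by (rule bij_betw_nth[OF assms(1)]) (simp_all add: len assms(2))
  moreover have "bij_betw ((!) Q) {..<e} {..<e} = bij_betw ?\<sigma> {..<e} {..<e}"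
    by (rule bij_betw_cong) simp
  ultimately have "bij_betw ?\<sigma> {..<e} {..<e}" by (rule iffD1[rotated])
  then have "?\<sigma> permutes {..<e}" by (rule bij_imp_permutes) auto
  moreover have "permute_list ?\<sigma> w = map ((!) w) Q" if "length w = e" for w :: "'a list"
    using that len by (intro nth_equalityI) (auto simp: permute_list_def)
  ultimately show ?thesis by blast
qed

lemma permute_list_append_left:
  assumes "\<sigma> permutes {..<length J}"
  shows "permute_list \<sigma> (J @ u) = permute_list \<sigma> J @ u"
proof (rule nth_equalityI)
  fix i assume i: "i < length (permute_list \<sigma> (J @ u))"
  have "\<sigma> i < length J" if "i < length J" using permutes_in_image[OF assms, of i] that by simp
  moreover have "\<sigma> i = i" if "\<not> i < length J" using assms that by (simp add: permutes_def)
  ultimately show "permute_list \<sigma> (J @ u) ! i = (permute_list \<sigma> J @ u) ! i"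
    using i by (auto simp: permute_list_def nth_append)
qed simp

lemma permutes_lessThan_mono: "\<sigma> permutes {..<a} \<Longrightarrow> a \<le> e \<Longrightarrow> \<sigma> permutes {..<e::nat}"
  by (rule permutes_subset) auto

lemma permute_list_in_words:
  "\<sigma> permutes {..<d} \<Longrightarrow> permute_list \<sigma> w \<in> set (words d n) \<longleftrightarrow> w \<in> set (words d n)"
  by (auto simp: in_words_iff)

lemma permute_list_inv:
  assumes "\<sigma> permutes {..<length w}"
  shows "permute_list \<sigma> (permute_list (Hilbert_Choice.inv \<sigma>) w) = w"
    "permute_list (Hilbert_Choice.inv \<sigma>) (permute_list \<sigma> w) = w"
  using assms permutes_inv[OF assms] by (simp_all flip: permute_list_compose add: permutes_inv_o)

text \<open>A linear combination of place permutations, acting on coordinates by pulling back: the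
  value at \<open>w\<close> is the sum of \<open>c j\<close> times the old value at
  \<open>permute_list (\<sigma> j) w\<close>.\<close>

definition posmat :: "nat \<Rightarrow> 'i set \<Rightarrow> ('i \<Rightarrow> nat \<Rightarrow> nat) \<Rightarrow> ('i \<Rightarrow> 'k) \<Rightarrow> nat \<Rightarrow> 'k::field mat" where
  "posmat e I \<sigma> c = (\<lambda>n. labelled_mat (words e n) (words e n)
     (\<lambda>w v. \<Sum>j\<in>I. if v = permute_list (\<sigma> j) w then c j else 0))"

lemma posmat_mult:
  assumes "\<And>j. j \<in> I \<Longrightarrow> \<sigma> j permutes {..<e}" "finite I"
  shows "posmat e I \<sigma> c n * labelled_mat (words e n) L m =
    labelled_mat (words e n) L (\<lambda>w l. \<Sum>j\<in>I. c j * m (permute_list (\<sigma> j) w) l)"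
  unfolding posmat_def labelled_mat_mult[OF distinct_words]
proof (rule labelled_mat_cong)
  fix w l assume w: "w \<in> set (words e n)"
  have "(\<Sum>v\<in>set (words e n). (\<Sum>j\<in>I. if v = permute_list (\<sigma> j) w then c j else 0) * m v l) =
      (\<Sum>j\<in>I. \<Sum>v\<in>set (words e n). if v = permute_list (\<sigma> j) w then c j * m v l else 0)"
    by (subst sum.swap) (auto simp: sum_distrib_right intro!: sum.cong)
  also have "\<dots> = (\<Sum>j\<in>I. c j * m (permute_list (\<sigma> j) w) l)"
    using w assms(1) by (intro sum.cong) (auto simp: permute_list_in_words)
  finally show "(\<Sum>v\<in>set (words e n). (\<Sum>j\<in>I. if v = permute_list (\<sigma> j) w then c j else 0) * m v l) =
      (\<Sum>j\<in>I. c j * m (permute_list (\<sigma> j) w) l)" .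
qed

text \<open>Place permutations commute with the diagonal action of matrices because permuting rows
  and columns of a \<open>wprod\<close> simultaneously does not change it. The inverse permutation
  moves the rearrangement from one index to the other.\<close>

lemma posmat_nat_trans:
  assumes \<sigma>: "\<And>j. j \<in> I \<Longrightarrow> \<sigma> j permutes {..<e}" and I: "finite I"
  shows "posmat e I \<sigma> c \<in> nat_trans (tens e) (tens e :: 'k::field spf)"
proof (rule nat_transI)
  interpret c: comm_ring_hom "cnst :: 'k \<Rightarrow> _" by (rule comm_ring_hom_cnst)
  show "posmat e I \<sigma> c n \<in> carrier_mat (fdim (tens e) n) (fdim (tens e) n)" for n
    by (simp add: posmat_def tens_def)
  show "fpoly (tens e) m n * cmat (posmat e I \<sigma> c m) = cmat (posmat e I \<sigma> c n) * fpoly (tens e) m n" for m n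
    unfolding posmat_def tens_def spf.simps cmat_labelled_mat labelled_mat_mult[OF distinct_words]
  proof (rule labelled_mat_cong)
    fix w u assume w: "w \<in> set (words e n)" and u: "u \<in> set (words e m)"
    let ?inv = "\<lambda>j. Hilbert_Choice.inv (\<sigma> j)"
    have len: "length w = e" "length u = e" using w u by (simp_all add: in_words_iff)
    have h: "cnst (\<Sum>j\<in>I. if P j then c j else 0) = (\<Sum>j\<in>I. if P j then cnst (c j) else 0)" for P
      unfolding c.hom_sum by (intro sum.cong) auto
    have eq: "u = permute_list (\<sigma> j) v \<longleftrightarrow> v = permute_list (?inv j) u" if "length v = e" "j \<in> I" for v j
      using permute_list_inv[of "\<sigma> j" v] permute_list_inv[of "\<sigma> j" u] that len \<sigma>[of j] by metis
    have "(\<Sum>v\<in>set (words e m). wprod entry_var w v * cnst (\<Sum>j\<in>I. if u = permute_list (\<sigma> j) v then c j else 0)) =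
        (\<Sum>j\<in>I. \<Sum>v\<in>set (words e m). if v = permute_list (?inv j) u then wprod entry_var w v * cnst (c j) else 0)"
      unfolding h sum_distrib_left
    proof (subst sum.swap, intro sum.cong refl)
      fix j v assume "j \<in> I" "v \<in> set (words e m)"
      then show "wprod entry_var w v * (if u = permute_list (\<sigma> j) v then cnst (c j) else 0) =
          (if v = permute_list (?inv j) u then wprod entry_var w v * cnst (c j) else 0)"
        using eq[of v j] by (simp only: in_words_iff) simp
    qed
    also have "\<dots> = (\<Sum>j\<in>I. wprod entry_var w (permute_list (?inv j) u) * cnst (c j))"
      using u \<sigma> by (intro sum.cong) (auto simp: permute_list_in_words permutes_inv)
    also have "\<dots> = (\<Sum>j\<in>I. cnst (c j) * wprod entry_var (permute_list (\<sigma> j) w) u)"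
    proof (rule sum.cong[OF refl])
      fix j assume j: "j \<in> I"
      have "wprod entry_var (permute_list (\<sigma> j) w) (permute_list (\<sigma> j) (permute_list (?inv j) u)) =
          (wprod entry_var w (permute_list (?inv j) u) :: 'k entry_poly)"
        using \<sigma>[OF j] len by (intro wprod_permute) auto
      then show "wprod entry_var w (permute_list (?inv j) u) * cnst (c j) =
          cnst (c j) * (wprod entry_var (permute_list (\<sigma> j) w) u :: 'k entry_poly)"
        using permute_list_inv(1)[of "\<sigma> j" u] \<sigma>[OF j] len by (simp add: mult.commute)
    qed
    also have "\<dots> = (\<Sum>j\<in>I. \<Sum>v\<in>set (words e n). if v = permute_list (\<sigma> j) w then cnst (c j) * wprod entry_var v u else 0)"
      using w \<sigma> by (intro sum.cong) (auto simp: permute_list_in_words)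
    also have "\<dots> = (\<Sum>v\<in>set (words e n). cnst (\<Sum>j\<in>I. if v = permute_list (\<sigma> j) w then c j else 0) * wprod entry_var v u)"
      unfolding h sum_distrib_right by (subst sum.swap) (auto intro!: sum.cong)
    finally show "(\<Sum>v\<in>set (words e m). wprod entry_var w v * cnst (\<Sum>j\<in>I. if u = permute_list (\<sigma> j) v then c j else 0)) =
      (\<Sum>v\<in>set (words e n). cnst (\<Sum>j\<in>I. if v = permute_list (\<sigma> j) w then c j else 0) * wprod entry_var v u)" .
  qed
qed

lemma aemb_arestr_mult:
  assumes "\<And>l. l \<in> set L \<Longrightarrow> altsym a b e (\<lambda>w. m w l)" "a + b \<le> e"
  shows "aemb a b e n * labelled_mat (awords a b e n) L m = labelled_mat (words e n) L (m :: _ \<Rightarrow> _ \<Rightarrow> 'k::field)"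
  unfolding aemb_def labelled_mat_mult[OF distinct_awords]
  by (rule labelled_mat_cong) (rule altsym_expand[OF assms(1) _ assms(2), symmetric])

text \<open>A map into the tensor power whose columns have the required symmetry lands in the
  subfunctor. All maps into Koszul terms other than composites are produced this way or by
  projectivity.\<close>

lemma lift_to_aspf:
  assumes h: "h \<in> nat_trans P (tens e :: 'k::field spf)" and P: "spf_carrier P" and ab: "a + b \<le> e"
    and m: "\<And>n. h n = labelled_mat (words e n) (L n) (m n)"
    and alt: "\<And>n l. l \<in> set (L n) \<Longrightarrow> altsym a b e (\<lambda>w. m n w l)"
  shows "\<exists>h'\<in>nat_trans P (aspf a b e). comp_nt (aemb a b e) h' = h"
proof (rule factor_through_mono[OF aemb_nat_trans[OF ab] aemb_mono[OF ab] h spf_carrier_aspf spf_carrier_tens P])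
  fix n
  have "fdim P n = length (L n)" using nat_transD(3)[OF h, of n] by (simp add: m)
  then show "\<exists>x\<in>carrier_mat (fdim (aspf a b e :: 'k spf) n) (fdim P n). h n = aemb a b e n * x"
    using alt by (intro bexI[of _ "labelled_mat (awords a b e n) (L n) (m n)"])
      (simp_all add: m aemb_arestr_mult ab, simp add: aspf_def)
qed

section \<open>Antisymmetrization over an initial block of positions\<close>

definition asum :: "nat \<Rightarrow> (nat list \<Rightarrow> 'r::comm_ring_1) \<Rightarrow> nat list \<Rightarrow> 'r" where
  "asum a g w = (\<Sum>\<sigma> | \<sigma> permutes {..<a}. of_int (sign \<sigma>) * g (permute_list \<sigma> w))"

lemma sign_comp:
  "\<sigma> permutes {..<a::nat} \<Longrightarrow> \<tau> permutes {..<a} \<Longrightarrow> sign (\<sigma> \<circ> \<tau>) = sign \<sigma> * sign \<tau>"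
  by (rule sign_compose) (metis finite_lessThan permutation_permutes)+

lemma of_int_sign_square: "of_int (sign \<sigma>) * (of_int (sign \<sigma>) * x) = (x :: 'r::comm_ring_1)"
  by (simp add: sign_def)

lemma asum_precompose:
  assumes \<tau>: "\<tau> permutes {..<a}" and w: "a \<le> length w"
  shows "asum a (\<lambda>w. g (permute_list \<tau> w)) w = of_int (sign \<tau>) * asum a g w"
proof -
  have "asum a g w = (\<Sum>\<sigma> | \<sigma> permutes {..<a}. of_int (sign (\<sigma> \<circ> \<tau>)) * g (permute_list (\<sigma> \<circ> \<tau>) w))"
    unfolding asum_def by (rule sum_permutations_compose_right[OF \<tau>])
  also have "\<dots> = (\<Sum>\<sigma> | \<sigma> permutes {..<a}. of_int (sign \<tau>) * (of_int (sign \<sigma>) * g (permute_list \<tau> (permute_list \<sigma> w))))"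
    using permutes_lessThan_mono[OF \<tau> w] \<tau>
    by (intro sum.cong) (auto simp: sign_comp permute_list_compose mult_ac)
  finally show ?thesis
    by (simp add: asum_def of_int_sign_square sum_distrib_left)
qed

lemma asum_act:
  assumes \<tau>: "\<tau> permutes {..<a}" and w: "a \<le> length w"
  shows "asum a g (permute_list \<tau> w) = of_int (sign \<tau>) * asum a g w"
proof -
  have "asum a g w = (\<Sum>\<sigma> | \<sigma> permutes {..<a}. of_int (sign (\<tau> \<circ> \<sigma>)) * g (permute_list (\<tau> \<circ> \<sigma>) w))"
    unfolding asum_def by (rule setum_permutations_compose_left[OF \<tau>])
  also have "\<dots> = (\<Sum>\<sigma> | \<sigma> permutes {..<a}. of_int (sign \<tau>) * (of_int (sign \<sigma>) * g (permute_list \<sigma> (permute_list \<tau> w))))"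
    using permutes_lessThan_mono[OF _ w] \<tau>
    by (intro sum.cong) (auto simp: sign_comp permute_list_compose mult_ac)
  finally show ?thesis
    by (simp add: asum_def of_int_sign_square sum_distrib_left)
qed

text \<open>Valid in characteristic 2 as well, because \<^const>\<open>perm_sgn\<close> is a determinant with two equal columns.\<close>

lemma perm_sgn_not_distinct:
  assumes "\<not> distinct J" "length u = length J"
  shows "perm_sgn J u = (0 :: 'r::comm_ring_1)"
proof -
  let ?f = "\<lambda>(x, y). if x = y then 1 else 0 :: 'r"
  have "perm_sgn J u = (\<Sum>\<sigma> | \<sigma> permutes {..<length J}. if u = permute_list \<sigma> J then of_int (sign \<sigma>) else 0 :: 'r)"
    unfolding perm_sgn_def by (subst sum.inter_filter[symmetric]) (auto simp: finite_permutations)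
  also have "\<dots> = (\<Sum>\<sigma> | \<sigma> permutes {..<length J}. of_int (sign \<sigma>) * wprod ?f u (permute_list \<sigma> J))"
  proof (rule sum.cong[OF refl])
    fix \<sigma>
    have "wprod ?f u v = (if u = v then 1 else 0)" if "length u = length v" for u v :: "nat list"
      using that by (induction u v rule: list_induct2) auto
    then show "(if u = permute_list \<sigma> J then of_int (sign \<sigma>) else 0 :: 'r) = of_int (sign \<sigma>) * wprod ?f u (permute_list \<sigma> J)"
      using assms(2) by simp
  qed
  also have "\<dots> = wdet ?f u J" by (rule wdet_conv_sum[OF assms(2), symmetric])
  also have "\<dots> = det (transpose_mat (mat (length J) (length J) (\<lambda>(i, j). ?f (u ! i, J ! j))))"
    unfolding wdet_def by (subst det_transpose[of _ "length J"]) simp_all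
  also have "\<dots> = 0"
  proof -
    obtain i j where "i < length J" "j < length J" "i \<noteq> j" "J ! i = J ! j"
      using assms(1) by (auto simp: distinct_conv_nth)
    then show ?thesis by (intro det_identical_rows[of _ "length J" i j]) auto
  qed
  finally show ?thesis .
qed

lemma asum_eq_sum_perm_sgn:
  assumes J: "J \<in> set (words a n)"
  shows "asum a g (J @ u) = (\<Sum>v\<in>set (words a n). perm_sgn J v * g (v @ u))"
proof -
  have len: "length J = a" using J by (simp add: in_words_iff)
  have "(\<Sum>v\<in>set (words a n). perm_sgn J v * g (v @ u)) =
      (\<Sum>v\<in>set (words a n). \<Sum>\<sigma>\<in>{\<sigma> \<in> {\<sigma>. \<sigma> permutes {..<a}}. permute_list \<sigma> J = v}. of_int (sign \<sigma>) * g (permute_list \<sigma> J @ u))"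
    unfolding perm_sgn_def sum_distrib_right len by (intro sum.cong) auto
  also have "\<dots> = (\<Sum>\<sigma> | \<sigma> permutes {..<a}. of_int (sign \<sigma>) * g (permute_list \<sigma> J @ u))"
    by (rule sum.group) (use J in \<open>auto simp: finite_permutations permute_list_in_words\<close>)
  also have "\<dots> = asum a g (J @ u)"
    unfolding asum_def by (intro sum.cong) (auto simp: permute_list_append_left len)
  finally show ?thesis ..
qed

lemma in_words_some_bound: "\<exists>n. w \<in> set (words (length w) n)"
  by (rule exI[of _ "Suc (Max (insert 0 (set w)))"]) (auto simp: in_words_iff less_Suc_eq_le)

lemma asum_not_distinct:
  assumes "\<not> distinct J" "length J = a"
  shows "asum a g (J @ u) = 0"
proof -
  obtain n where "J \<in> set (words a n)" using in_words_some_bound[of J] assms(2) by auto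
  from asum_eq_sum_perm_sgn[OF this] show ?thesis
    using assms by (auto intro!: sum.neutral simp: perm_sgn_not_distinct in_words_iff)
qed

lemma altsym_asum:
  assumes "\<And>J K K' u. length J = a \<Longrightarrow> length K = b \<Longrightarrow> length u = e - a - b \<Longrightarrow> mset K = mset K' \<Longrightarrow>
    g (J @ K @ u) = g (J @ K' @ u)" "a + b \<le> e"
  shows "altsym a b e (asum a g)"
  unfolding altsym_def
proof (intro conjI allI impI)
  fix J u :: "nat list" and \<sigma> assume "length J = a" "length u = e - a" "\<sigma> permutes {..<a}"
  then show "asum a g (permute_list \<sigma> J @ u) = of_int (sign \<sigma>) * asum a g (J @ u)"
    using asum_act[of \<sigma> a "J @ u" g] by (simp add: permute_list_append_left)
next
  fix J u :: "nat list" assume "length J = a" "length u = e - a" "\<not> distinct J"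
  then show "asum a g (J @ u) = 0" by (simp add: asum_not_distinct)
next
  fix J K K' u :: "nat list"
  assume *: "length J = a" "length K = b" "length u = e - a - b" "mset K = mset K'"
  show "asum a g (J @ K @ u) = asum a g (J @ K' @ u)"
    unfolding asum_def
    by (intro sum.cong refl arg_cong2[of _ _ _ _ "(*)"])
       (use * assms(1)[OF _ *(2,3,4)] in \<open>auto simp: permute_list_append_left\<close>)
qed

text \<open>The Koszul differential in coordinates. The identity and the transpositions of
  \<open>b\<close> and \<open>i\<close> represent the cosets of the permutations of the first
  \<open>i\<close> positions inside those of the first \<open>i + 1\<close>.\<close>

definition kdiff :: "nat \<Rightarrow> (nat list \<Rightarrow> 'r::comm_ring_1) \<Rightarrow> nat list \<Rightarrow> 'r" where
  "kdiff i t w = t w - (\<Sum>b<i. t (permute_list (transpose b i) w))"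

text \<open>On a tensor already alternating in \<open>i\<close> positions, each coset of the smaller
  permutation group contributes the same term \<open>i!\<close> times. Dividing by \<open>i!\<close>
  by hand, as \<open>kdiff\<close> does, keeps the map meaningful in every characteristic.\<close>

lemma asum_eq_kdiff:
  assumes t: "altsym i b e t" and w: "length w = e" "i < e"
  shows "asum (Suc i) t w = of_nat (fact i) * kdiff i t w"
proof -
  \<comment> \<open>A permutation of the first \<open>i + 1\<close> positions is a transposition
    moving \<open>i\<close> composed with some \<open>q\<close> fixing it; the sign of
    \<open>q\<close> cancels against the one produced by \<open>t\<close>.\<close>
  have inner: "(\<Sum>q | q permutes {..<i}. of_int (sign (transpose i b \<circ> q)) * t (permute_list (transpose i b \<circ> q) w)) =
      of_nat (fact i) * (of_int (sign (transpose i b)) * t (permute_list (transpose i b) w))" if b: "b \<le> i" for b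
  proof -
    have tr: "transpose i b permutes {..<Suc i}" using b by (intro permutes_swap_id) auto
    let ?w = "permute_list (transpose i b) w"
    have s: "?w = take i ?w @ drop i ?w" "length (take i ?w) = i" "length (drop i ?w) = e - i" using w by auto
    have "of_int (sign (transpose i b \<circ> q)) * t (permute_list (transpose i b \<circ> q) w) =
        of_int (sign (transpose i b)) * t ?w" if q: "q permutes {..<i}" for q
    proof -
      have q': "q permutes {..<Suc i}" "q permutes {..<length w}"
        using permutes_lessThan_mono[OF q] w by auto
      have "t (permute_list (transpose i b \<circ> q) w) = t (permute_list q (take i ?w @ drop i ?w))"
        using q' by (simp add: permute_list_compose)
      also have "\<dots> = of_int (sign q) * t (take i ?w @ drop i ?w)"
        using altsymD(1)[OF t s(2,3) q] permute_list_append_left[of q "take i ?w" "drop i ?w"] q s(2) by metis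
      finally show ?thesis
        using sign_comp[OF tr q'(1)] by (simp add: mult.assoc of_int_sign_square)
    qed
    then have "(\<Sum>q | q permutes {..<i}. of_int (sign (transpose i b \<circ> q)) * t (permute_list (transpose i b \<circ> q) w)) =
        (\<Sum>q | q permutes {..<i}. of_int (sign (transpose i b)) * t ?w)" by (intro sum.cong) auto
    then show ?thesis by (simp add: card_permutations[OF refl])
  qed
  have ins: "{..<Suc i} = insert i {..<i}" by auto
  have "asum (Suc i) t w = (\<Sum>b\<in>insert i {..<i}. \<Sum>q | q permutes {..<i}.
      of_int (sign (transpose i b \<circ> q)) * t (permute_list (transpose i b \<circ> q) w))"
    unfolding asum_def ins by (rule sum_over_permutations_insert) auto
  also have "\<dots> = (\<Sum>b\<in>insert i {..<i}. of_nat (fact i) * (of_int (sign (transpose i b)) * t (permute_list (transpose i b) w)))"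
    by (intro sum.cong refl inner) auto
  also have "\<dots> = of_nat (fact i) * (t w + (\<Sum>b<i. - t (permute_list (transpose b i) w)))"
  proof -
    have "(\<Sum>b<i. of_nat (fact i) * (of_int (sign (transpose i b)) * t (permute_list (transpose i b) w))) =
        (\<Sum>b<i. of_nat (fact i) * (- t (permute_list (transpose b i) w)))"
      by (intro sum.cong) (auto simp: sign_swap_id transpose_commute)
    then show ?thesis
      by (simp add: sign_swap_id distrib_left sum_distrib_left)
  qed
  finally show ?thesis by (simp add: kdiff_def sum_negf)
qed

text \<open>The transpose of the embedding of an exterior power is antisymmetrization; this is how
  \<open>asum\<close> enters after dualizing.\<close>

lemma sum_words_aext_left:
  assumes l: "l \<in> set (awords a 0 e n)" and a: "a \<le> e"
  shows "(\<Sum>v\<in>set (words e n). aext a 0 l v * g v) = asum a g l"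
proof -
  obtain J u where s: "l = J @ u" "length J = a" "length u = e - a"
    using length_awords[OF l] a by (metis append_take_drop_id length_drop length_take min.absorb2)
  have J: "J \<in> set (words a n)" "u \<in> set (words (e - a) n)" using l s by (auto simp: in_awords_iff in_words_iff)
  have e: "a + (e - a) = e" using a by simp
  have "(\<Sum>v\<in>set (words (a + (e - a)) n). aext a 0 l v * g v) =
      (\<Sum>v1\<in>set (words a n). \<Sum>v2\<in>set (words (e - a) n). if v2 = u then perm_sgn J v1 * g (v1 @ v2) else 0)"
    unfolding sum_words_append by (intro sum.cong refl) (auto simp: aext_def s in_words_iff)
  also have "\<dots> = (\<Sum>v1\<in>set (words a n). perm_sgn J v1 * g (v1 @ u))"
    using J(2) by simp
  also have "\<dots> = asum a g l" by (simp add: s asum_eq_sum_perm_sgn[OF J(1)])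
  finally show ?thesis by (simp add: e)
qed

section \<open>Hook Weyl functors as images of Koszul differentials\<close>

lemma altsym_cong:
  assumes "altsym a b e t" "a + b \<le> e" "\<And>w. length w = e \<Longrightarrow> t' w = t w"
  shows "altsym a b e t'"
proof -
  have eq: "t' (J @ u) = t (J @ u)" if "length J = a" "length u = e - a" for J u
    using assms(2,3) that by simp
  have eq3: "t' (J @ K @ u) = t (J @ K @ u)" if "length J = a" "length K = b" "length u = e - a - b" for J K u
    using assms(2,3) that by simp
  show ?thesis
    unfolding altsym_def
  proof (intro conjI allI impI)
    fix J u :: "nat list" and \<sigma> assume *: "length J = a" "length u = e - a" "\<sigma> permutes {..<a}"
    show "t' (permute_list \<sigma> J @ u) = of_int (sign \<sigma>) * t' (J @ u)"
      unfolding eq[OF *(1,2)] using altsymD(1)[OF assms(1) *] * by (simp add: eq)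
  next
    fix J u :: "nat list" assume *: "length J = a" "length u = e - a" "\<not> distinct J"
    show "t' (J @ u) = 0" unfolding eq[OF *(1,2)] by (rule altsymD(2)[OF assms(1) *])
  next
    fix J K K' u :: "nat list" assume *: "length J = a" "length K = b" "length u = e - a - b" "mset K = mset K'"
    then have l: "length K' = b" by (metis mset_eq_length)
    show "t' (J @ K @ u) = t' (J @ K' @ u)"
      unfolding eq3[OF *(1,2,3)] eq3[OF *(1) l *(3)] by (rule altsymD(3)[OF assms(1) *])
  qed
qed

lemma altsym_scale: "altsym a b e t \<Longrightarrow> altsym a b e (\<lambda>w. c * t w)"
  unfolding altsym_def by (auto simp: mult_ac)

lemma asum_scale: "asum a (\<lambda>w. c * g w) w = c * asum a g w"
  unfolding asum_def by (simp add: sum_distrib_left mult_ac)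

lemma asum_cong: "(\<And>v. length v = length w \<Longrightarrow> f v = g v) \<Longrightarrow> asum a f w = asum a g w"
  unfolding asum_def by (intro sum.cong) auto

text \<open>Each of the \<open>i!\<close> inner permutations is absorbed by the outer sum, its sign
  appearing twice.\<close>

lemma asum_asum:
  assumes "i \<le> a" "a \<le> length w"
  shows "asum a (asum i g) w = of_nat (fact i) * asum a g w"
proof -
  have "asum a (asum i g) w = (\<Sum>\<tau> | \<tau> permutes {..<i}. of_int (sign \<tau>) * asum a (\<lambda>v. g (permute_list \<tau> v)) w)"
    unfolding asum_def sum_distrib_left by (subst sum.swap) (simp add: mult_ac)
  also have "\<dots> = (\<Sum>\<tau> | \<tau> permutes {..<i}. asum a g w)"
    using assms by (intro sum.cong) (auto simp: asum_precompose permutes_lessThan_mono of_int_sign_square)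
  finally show ?thesis by (simp add: card_permutations[OF refl])
qed

lemma conj_partition_hook: "conj_partition (Suc i # replicate k 1) = Suc k # replicate i 1"
proof -
  have "foldr max (replicate k 1) 0 \<le> (1 :: nat)" by (induction k) auto
  then have m: "foldr max (Suc i # replicate k 1) 0 = Suc i" by simp
  show ?thesis
    unfolding conj_partition_def m
    by (rule nth_equalityI) (auto simp: nth_Cons' nth_append simp del: upt_Suc)
qed

text \<open>The corner, then the leg, whose boxes follow the whole first row in the row reading,
  then the remaining boxes of the first row.\<close>

lemma hook_column_positions:
  "map (\<lambda>(r, c). sum_list (take r (Suc i # replicate k 1)) + c) (column_boxes (Suc i # replicate k 1)) =
     0 # [Suc i..<Suc i + k] @ [1..<Suc i]"
proof -
  have cb: "column_boxes (Suc i # replicate k 1) =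
      map (\<lambda>r. (r, 0)) [0..<Suc k] @ map (\<lambda>c. (0, c)) [1..<Suc i]"
  proof -
    have u: "[0..<Suc i] = 0 # [1..<Suc i]" by (simp add: upt_conv_Cons)
    have "concat (map (\<lambda>c. map (\<lambda>r. (r, c)) [0..<(Suc k # replicate i 1) ! c]) [1..<Suc i]) =
        concat (map (\<lambda>c. [(0::nat, c)]) [1..<Suc i])"
      by (intro arg_cong[where f = concat] map_cong) (auto simp: nth_Cons' upt_conv_Cons simp del: upt_Suc)
    then show ?thesis
      unfolding column_boxes_def conj_partition_hook length_Cons length_replicate u
      by (simp del: upt_Suc)
  qed
  have 1: "map (\<lambda>r. sum_list (take r (Suc i # replicate k 1))) [0..<Suc k] = 0 # [Suc i..<Suc i + k]"
  proof (rule nth_equalityI)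
    fix r assume "r < length (map (\<lambda>r. sum_list (take r (Suc i # replicate k 1))) [0..<Suc k])"
    then show "map (\<lambda>r. sum_list (take r (Suc i # replicate k 1))) [0..<Suc k] ! r = (0 # [Suc i..<Suc i + k]) ! r"
      by (cases r) (auto simp del: upt_Suc simp: sum_list_replicate)
  qed simp
  have 2: "map ((\<lambda>(r, c). sum_list (take r (Suc i # replicate k 1)) + c) \<circ> (\<lambda>r. (r, 0))) [0..<Suc k] =
      map (\<lambda>r. sum_list (take r (Suc i # replicate k 1))) [0..<Suc k]" by simp
  have 3: "map ((\<lambda>(r, c). sum_list (take r (Suc i # replicate k 1)) + c) \<circ> (\<lambda>c. (0, c))) [1..<Suc i] = [1..<Suc i]"
    by (rule map_idI) simp
  show ?thesis
    unfolding cb map_append map_map 2 3 1 by simp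
qed

lemma perm_sgn_single: "perm_sgn [x] [y] = (if x = y then 1 else 0)"
proof (cases "x = y")
  case False
  then show ?thesis using perm_sgn_nonzero(2)[of "[x]" "[y]"] by auto
qed simp

lemma ext_to_tensor_eq: "ext_to_tensor d n = labelled_mat (words d n) (ext_words d n) (\<lambda>w J. perm_sgn J w)"
  unfolding ext_to_tensor_def
  by (rule labelled_mat_cong) (simp add: perm_sgn_def permute_list_def in_ext_words_length)

lemma ext_to_tensor_1: "ext_to_tensor (Suc 0) n = 1\<^sub>m (length (words (Suc 0) n))"
  unfolding ext_to_tensor_eq ext_words_1 labelled_mat_one[OF distinct_words, symmetric]
  by (rule labelled_mat_cong) (auto simp: in_words_1 perm_sgn_single split: if_splits)

lemma tensor_to_sym_1: "tensor_to_sym (Suc 0) n = 1\<^sub>m (length (words (Suc 0) n))"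
  unfolding tensor_to_sym_def sym_words_1 labelled_mat_one[OF distinct_words, symmetric]
  by (rule labelled_mat_cong) (auto simp: in_words_1)

lemma kron_one: "kron (1\<^sub>m a) (1\<^sub>m b) = (1\<^sub>m (a * b) :: 'k::field mat)"
proof (rule eq_matI)
  fix i j assume "i < dim_row (1\<^sub>m (a * b) :: 'k mat)" "j < dim_col (1\<^sub>m (a * b) :: 'k mat)"
  then have ij: "i < a * b" "j < a * b" by simp_all
  then have "b > 0" by (auto intro: Nat.gr0I)
  then have "i div b < a" "j div b < a" "i mod b < b" "j mod b < b" using ij by (auto simp: less_mult_imp_div_less)
  moreover have "i = j" if "i div b = j div b" "i mod b = j mod b" using that by (metis div_mult_mod_eq)
  ultimately show "kron (1\<^sub>m a) (1\<^sub>m b) $$ (i, j) = (1\<^sub>m (a * b) :: 'k mat) $$ (i, j)"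
    using ij by (auto simp: kron_def)
qed (simp_all add: kron_def)

lemma tensor_list_nt_ones:
  assumes "f n = 1\<^sub>m (length (words (Suc 0) n))"
  shows "tensor_list_nt (replicate k f) n = (1\<^sub>m (length (words k n)) :: 'k::field mat)"
proof (induction k)
  case (Suc k)
  have "length (words (Suc k) n) = length (words (Suc 0) n) * length (words k n)"
    using words_append[of "Suc 0" k n] by simp
  then show ?case using Suc by (simp add: tensor_list_nt_def assms kron_one)
qed (simp add: tensor_list_nt_def words_def)

lemma tensor_list_nt_Cons: "tensor_list_nt (f # fs) n = kron (f n) (tensor_list_nt fs n)"
  by (simp add: tensor_list_nt_def)

lemma tensor_list_nt_ext: "tensor_list_nt (map ext_to_tensor (a # replicate k 1)) = (aemb a 0 (a + k) :: nat \<Rightarrow> 'k::field mat)"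
proof
  fix n
  have "tensor_list_nt (map ext_to_tensor (a # replicate k 1)) n =
      kron (labelled_mat (words a n) (ext_words a n) (\<lambda>w J. perm_sgn J w))
        (labelled_mat (words k n) (words k n) (\<lambda>r c. if r = c then 1 else 0 :: 'k))"
    by (simp add: tensor_list_nt_Cons tensor_list_nt_ones[of "ext_to_tensor (Suc 0)", OF ext_to_tensor_1] ext_to_tensor_eq labelled_mat_one[OF distinct_words])
  also have "\<dots> = aemb a 0 (a + k) n"
    unfolding aemb_def awords_eq_ext words_append
    by (subst kron_labelled[of _ a _ a])
       (auto simp: in_ext_words_length length_in_words aext_def intro!: labelled_mat_cong)
  finally show "tensor_list_nt (map ext_to_tensor (a # replicate k 1)) n = (aemb a 0 (a + k) n :: 'k mat)" .
qed

lemma tensor_list_nt_sym: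
  "tensor_list_nt (map tensor_to_sym (b # replicate c 1)) = (dual_nt (aemb 0 b (b + c)) :: nat \<Rightarrow> 'k::field mat)"
proof
  fix n
  have "tensor_list_nt (map tensor_to_sym (b # replicate c 1)) n =
      kron (labelled_mat (sym_words b n) (words b n) (\<lambda>I w. if sort w = I then 1 else 0))
        (labelled_mat (words c n) (words c n) (\<lambda>r c. if r = c then 1 else 0 :: 'k))"
    by (simp add: tensor_list_nt_Cons tensor_list_nt_ones[of "tensor_to_sym (Suc 0)", OF tensor_to_sym_1]
        tensor_to_sym_def[of b] labelled_mat_one[OF distinct_words])
  also have "\<dots> = labelled_mat (append_prod (sym_words b n) (words c n)) (append_prod (words b n) (words c n))
     (\<lambda>r w. (if sort (take b w) = take b r then 1 else 0) * (if drop b r = drop b w then 1 else 0))"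
    by (rule kron_labelled) (auto simp: in_sym_words_length length_in_words)
  also have "\<dots> = dual_nt (aemb 0 b (b + c)) n"
    unfolding dual_nt_def aemb_def transpose_labelled_mat awords_eq_sym[symmetric] words_append[symmetric]
  proof (rule labelled_mat_cong)
    fix l w assume "l \<in> set (awords 0 b (b + c) n)"
    then have "sorted (take b l)" by (simp add: in_awords_iff)
    then have "sort (take b w) = take b l \<longleftrightarrow> mset (take b w) = mset (take b l)"
      by (metis mset_sort properties_for_sort)
    then show "(if sort (take b w) = take b l then 1 else 0) * (if drop b l = drop b w then 1 else 0) = (aext 0 b l w :: 'k)"
      by (auto simp: aext_def)
  qed
  finally show "tensor_list_nt (map tensor_to_sym (b # replicate c 1)) n = (dual_nt (aemb 0 b (b + c)) n :: 'k mat)" .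
qed

text \<open>Dualizing the image factorization of the Schur map exhibits \<open>W\<close> as the
  image of \<open>X = \<Gamma>\<^sup>k\<^sup>+\<^sup>1 \<otimes> I\<^sup>\<otimes>\<^sup>i\<close>
  in \<open>F = \<Lambda>\<^sup>i\<^sup>+\<^sup>1 \<otimes> I\<^sup>\<otimes>\<^sup>k\<close>, the
  map being an alternation over \<open>i + 1\<close> positions after a place permutation. Such an
  alternation absorbs one over \<open>i\<close> of the positions at the cost of \<open>i!\<close>,
  so the Koszul term \<open>P\<close> already covers \<open>W\<close>, and on it the map becomes
  \<open>kdiff i\<close>.\<close>

lemma hook_weyl_cover:
  fixes p i k :: nat
  assumes p: "p = Suc i + k" and fact: "of_nat (fact i) \<noteq> (0 :: 'k::field)"
  shows "strict_poly_functor p (hook_weyl p i :: 'k spf) \<and>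
    (\<exists>\<epsilon> \<iota>. \<epsilon> \<in> nat_trans (aspf i (Suc k) p) (hook_weyl p i :: 'k spf) \<and> epi_nt \<epsilon> \<and>
      \<iota> \<in> nat_trans (hook_weyl p i) (tens p) \<and> mono_nt \<iota> \<and>
      (\<forall>n. \<iota> n * \<epsilon> n = labelled_mat (words p n) (awords i (Suc k) p n) (\<lambda>w l. kdiff i (aext i (Suc k) l) w)))"
proof -
  define \<mu> where "\<mu> = Suc i # replicate k 1"
  define F where "F = (aspf (Suc i) 0 p :: 'k spf)"
  define X where "X = (aspf 0 (Suc k) p :: 'k spf)"
  define P where "P = (aspf i (Suc k) p :: 'k spf)"
  note le = p
  have leF: "Suc i + 0 \<le> p" and leX: "0 + Suc k \<le> p" and leP: "i + Suc k \<le> p" using p by simp_all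
  have sum\<mu>: "sum_list \<mu> = p" by (simp add: \<mu>_def p sum_list_replicate)
  have conj: "conj_partition \<mu> = Suc k # replicate i 1" unfolding \<mu>_def by (rule conj_partition_hook)
  have Fe: "tensor_list (map ext_power \<mu>) = F"
    unfolding \<mu>_def F_def p by (rule tensor_list_ext)
  have Ge: "tensor_list (map sym_power (conj_partition \<mu>)) = kuhn_dual X"
    unfolding conj X_def p using tensor_list_sym[of "Suc k" i, where ?'k = 'k] by (simp add: add.commute)
  have strict: "strict_poly_functor p F" "strict_poly_functor p X" "strict_poly_functor p P"
    unfolding F_def X_def P_def by (intro strict_aspf leF leX leP)+
  note sc = strict_poly_functorD(1)[OF strict(1)] strict_poly_functorD(1)[OF strict(2)]
    strict_poly_functorD(1)[OF strict(3)] spf_carrier_tens[of p, where ?'a = 'k]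
    strict_poly_functorD(1)[OF strict_kuhn_dual[OF strict(2)]]
  have E: "aemb (Suc i) 0 p \<in> nat_trans F (tens p)" and EX: "aemb 0 (Suc k) p \<in> nat_trans X (tens p)"
    and EP: "aemb i (Suc k) p \<in> nat_trans P (tens p)"
    unfolding F_def X_def P_def by (intro aemb_nat_trans leF leX leP)+
  \<comment> \<open>\<open>permute_list \<tau>\<close> will turn the row reading of a filling into
    its column reading.\<close>
  define Q where "Q = 0 # [Suc i..<Suc i + k] @ [1..<Suc i]"
  have "distinct Q" "set Q = {..<p}" by (auto simp: Q_def p)
  from exists_position_permutation[OF this] obtain \<tau> where
    \<tau>: "\<tau> permutes {..<p}" "\<And>w :: nat list. length w = p \<Longrightarrow> permute_list \<tau> w = map ((!) w) Q" by blast
  have rtc: "row_to_column \<mu> n = labelled_mat (words p n) (words p n) (\<lambda>w' w. if w' = permute_list \<tau> w then 1 else 0 :: 'k)" for n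
    unfolding row_to_column_def sum\<mu>
  proof (rule labelled_mat_cong)
    fix w' w :: "nat list" assume "w \<in> set (words p n)"
    then have "permute_list \<tau> w = map ((!) w) (map (\<lambda>(r, c). sum_list (take r \<mu>) + c) (column_boxes \<mu>))"
      unfolding \<mu>_def hook_column_positions using \<tau>(2)[of w] by (simp add: in_words_iff Q_def)
    then show "(if w' = map (\<lambda>(r, c). w ! (sum_list (take r \<mu>) + c)) (column_boxes \<mu>) then 1 else 0) =
        (if w' = permute_list \<tau> w then 1 else 0 :: 'k)"
      by (simp add: o_def case_prod_unfold)
  qed
  have rtc_nt: "row_to_column \<mu> \<in> nat_trans (tens p) (tens p :: 'k spf)"
  proof -
    \<comment> \<open>\<open>posmat\<close> pulls words back, so sending \<open>w\<close> to its
      rearrangement by \<open>\<tau>\<close> is the \<open>posmat\<close> of the inverse; the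
      transpose \<open>RT\<close> below is that of \<open>\<tau>\<close> itself.\<close>
    have "row_to_column \<mu> n = posmat p {()} (\<lambda>_. Hilbert_Choice.inv \<tau>) (\<lambda>_. 1 :: 'k) n" for n
      unfolding rtc posmat_def
    proof (rule labelled_mat_cong)
      fix w' w assume "w' \<in> set (words p n)" "w \<in> set (words p n)"
      then have "w' = permute_list \<tau> w \<longleftrightarrow> w = permute_list (Hilbert_Choice.inv \<tau>) w'"
        using permute_list_inv[of \<tau> w] permute_list_inv[of \<tau> w'] \<tau>(1) by (metis length_in_words)
      then show "(if w' = permute_list \<tau> w then 1 else 0) =
          (\<Sum>j\<in>{()}. if w = permute_list (Hilbert_Choice.inv \<tau>) w' then 1 else 0 :: 'k)" by simp
    qed
    then have "row_to_column \<mu> = posmat p {()} (\<lambda>_. Hilbert_Choice.inv \<tau>) (\<lambda>_. 1 :: 'k)" by blast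
    then show ?thesis using posmat_nat_trans[of "{()}" "\<lambda>_. Hilbert_Choice.inv \<tau>" p] permutes_inv[OF \<tau>(1)] by simp
  qed
  have dX: "dual_nt (aemb 0 (Suc k) p) \<in> nat_trans (tens p) (kuhn_dual X)"
    using dual_nat_trans[OF EX sc(2,4)] by (simp add: kuhn_dual_tens)
  have sm: "schur_map \<mu> = comp_nt (dual_nt (aemb 0 (Suc k) p)) (comp_nt (row_to_column \<mu>) (aemb (Suc i) 0 p :: nat \<Rightarrow> 'k mat))"
  proof -
    have 1: "tensor_list_nt (map ext_to_tensor \<mu>) = (aemb (Suc i) 0 p :: nat \<Rightarrow> 'k mat)"
      unfolding \<mu>_def p by (rule tensor_list_nt_ext)
    have 2: "tensor_list_nt (map tensor_to_sym (conj_partition \<mu>)) = (dual_nt (aemb 0 (Suc k) p) :: nat \<Rightarrow> 'k mat)"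
      unfolding conj p using tensor_list_nt_sym[of "Suc k" i, where ?'k = 'k] by (simp add: add.commute)
    show ?thesis unfolding schur_map_def 1 2 ..
  qed
  have sm_nt: "schur_map \<mu> \<in> nat_trans F (kuhn_dual X)"
    unfolding sm by (intro nat_trans_comp[OF nat_trans_comp[OF E rtc_nt sc(1,4,4)] dX sc(1,4,5)])
  \<comment> \<open>A chosen functor, of which only its being an image of the Schur map is
    known.\<close>
  define S where "S = (schur_functor \<mu> :: 'k spf)"
  have "is_image_of p F (kuhn_dual X) (schur_map \<mu>) S"
    using someI_ex[OF image_exists[OF strict(1) strict_kuhn_dual[OF strict(2)] sm_nt]]
    unfolding S_def schur_functor_def sum\<mu> Fe Ge .
  then obtain a b where S: "strict_poly_functor p S" and a: "a \<in> nat_trans F S" "epi_nt a"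
    and b: "b \<in> nat_trans S (kuhn_dual X)" "mono_nt b" and ba: "comp_nt b a = schur_map \<mu>"
    unfolding is_image_of_def by blast
  define W where "W = (hook_weyl p i :: 'k spf)"
  have W: "W = kuhn_dual S"
    unfolding W_def hook_weyl_def weyl_functor_def S_def \<mu>_def using p by simp
  note Sc = strict_poly_functorD(1)[OF S]
  have Ws: "strict_poly_functor p W" unfolding W by (rule strict_kuhn_dual[OF S])
  note Wc = strict_poly_functorD(1)[OF Ws]
  \<comment> \<open>Transposed, the inclusion of the image becomes the epimorphism from
    \<open>X\<close>, and the projection onto it becomes the embedding into
    \<open>F\<close>.\<close>
  define \<beta> where "\<beta> = dual_nt b"
  have \<beta>: "\<beta> \<in> nat_trans X W" "epi_nt \<beta>"
    using dual_nat_trans[OF b(1) Sc sc(5)] dual_mono_epi(2)[OF b]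
    by (simp_all add: \<beta>_def W kuhn_dual_kuhn_dual[OF strict(2)])
  have a': "dual_nt a \<in> nat_trans W F" "mono_nt (dual_nt a)"
  proof -
    have "kuhn_dual F = F" unfolding F_def p by (rule kuhn_dual_aspf_ext)
    then show "dual_nt a \<in> nat_trans W F" "mono_nt (dual_nt a)"
      using dual_nat_trans[OF a(1) sc(1) Sc] dual_mono_epi(1)[OF a] by (simp_all add: W)
  qed
  define \<iota> where "\<iota> = comp_nt (aemb (Suc i) 0 p) (dual_nt a)"
  have \<iota>: "\<iota> \<in> nat_trans W (tens p)"
    unfolding \<iota>_def by (rule nat_trans_comp[OF a'(1) E Wc sc(1,4)])
  have \<iota>mono: "mono_nt \<iota>"
    unfolding mono_nt_def
  proof
    fix n
    obtain B where B: "B \<in> carrier_mat (fdim W n) (fdim F n)" "B * dual_nt a n = 1\<^sub>m (fdim W n)"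
      by (rule bexE[OF mono_nt_left_inverse[OF a', of n]])
    obtain C where C: "C \<in> carrier_mat (fdim F n) (fdim (tens p :: 'k spf) n)" "C * (aemb (Suc i) 0 p n :: 'k mat) = 1\<^sub>m (fdim F n)"
      by (rule bexE[OF mono_nt_left_inverse[OF E aemb_mono[OF leF], of n]])
    have "(B * C) * \<iota> n = B * ((C * aemb (Suc i) 0 p n) * dual_nt a n)"
      using B(1) C(1) by (simp add: \<iota>_def comp_nt_def mult_mat_assoc nat_transD(2,3)[OF E] nat_transD(2,3)[OF a'(1)])
    also have "\<dots> = 1\<^sub>m (fdim W n)" by (simp add: C(2) left_mult_one_mat[OF nat_transD(1)[OF a'(1)]] B(2))
    finally have "(B * C) * \<iota> n = 1\<^sub>m (fdim W n)" .
    then show "mat_kernel (\<iota> n) = {0\<^sub>v (dim_col (\<iota> n))}"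
      using trivial_kernel_of_left_inverse[OF nat_transD(1)[OF \<iota>], of "B * C"] B(1) C(1)
      by (simp add: nat_transD(3)[OF \<iota>])
  qed
  define ET where "ET n = (labelled_mat (awords (Suc i) 0 p n) (words p n) (\<lambda>l w. aext (Suc i) 0 l w) :: 'k mat)" for n
  define RT where "RT = posmat p {()} (\<lambda>_. \<tau>) (\<lambda>_. 1 :: 'k)"
  have ETt: "transpose_mat (aemb (Suc i) 0 p n) = ET n" for n
    by (simp add: ET_def aemb_def transpose_labelled_mat)
  have RTt: "transpose_mat (row_to_column \<mu> n) = RT n" for n
    unfolding rtc RT_def posmat_def transpose_labelled_mat by (rule labelled_mat_cong) simp
  note dd = nat_transD(2,3)[OF E] nat_transD(2,3)[OF EX] nat_transD(2,3)[OF EP] nat_transD(2,3)[OF rtc_nt]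
    nat_transD(2,3)[OF a(1)] nat_transD(2,3)[OF b(1)] nat_transD(2,3)[OF \<beta>(1)] nat_transD(2,3)[OF \<iota>]
  have \<iota>\<beta>: "\<iota> n * \<beta> n = aemb (Suc i) 0 p n * (ET n * (RT n * aemb 0 (Suc k) p n))" for n
  proof -
    have "\<iota> n * \<beta> n = aemb (Suc i) 0 p n * (transpose_mat (a n) * transpose_mat (b n))"
      by (simp add: \<iota>_def \<beta>_def comp_nt_def dual_nt_def mult_mat_assoc dd)
    also have "transpose_mat (a n) * transpose_mat (b n) = transpose_mat (schur_map \<mu> n)"
      unfolding ba[symmetric] comp_nt_def by (rule transpose_mult[OF nat_transD(1)[OF b(1)] nat_transD(1)[OF a(1)], symmetric])
    also have "\<dots> = ET n * RT n * aemb 0 (Suc k) p n"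
      unfolding sm comp_nt_def dual_nt_def
      using transpose_mult[OF nat_transD(1)[OF dX, of n, unfolded dual_nt_def] mult_carrier_mat[OF nat_transD(1)[OF rtc_nt] nat_transD(1)[OF E]]]
        transpose_mult[OF nat_transD(1)[OF rtc_nt, of n] nat_transD(1)[OF E]] by (simp add: ETt RTt)
    finally show ?thesis
      by (simp add: mult_mat_assoc ET_def RT_def posmat_def aemb_def)
  qed
  have sortedL: "l \<in> set (awords a b p n) \<Longrightarrow> altsym a b p (aext a b l :: _ \<Rightarrow> 'k)" if "a + b \<le> p" for a b l n
    using altsym_aext that by blast
  have main: "aemb (Suc i) 0 p n * (ET n * (RT n * labelled_mat (words p n) L m)) =
      labelled_mat (words p n) L (\<lambda>w l. asum (Suc i) (\<lambda>v. m (permute_list \<tau> v) l) w)" for n and L :: "nat list list" and m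
  proof -
    have "RT n * labelled_mat (words p n) L m = labelled_mat (words p n) L (\<lambda>w l. m (permute_list \<tau> w) l)"
      unfolding RT_def using \<tau>(1) by (subst posmat_mult) auto
    then have "ET n * (RT n * labelled_mat (words p n) L m) =
        labelled_mat (awords (Suc i) 0 p n) L (\<lambda>l' l. asum (Suc i) (\<lambda>v. m (permute_list \<tau> v) l) l')"
      unfolding ET_def using p
      by (simp add: labelled_mat_mult[OF distinct_words]) (rule labelled_mat_cong, simp add: sum_words_aext_left)
    then show ?thesis
      using leF by (simp only:) (rule aemb_arestr_mult, auto intro!: altsym_asum)
  qed
  \<comment> \<open>\<open>r\<close> moves the leading symmetric block of a word in column reading
    to the back, where the Koszul term has it.\<close>
  obtain r where r: "r permutes {..<p}" "\<And>w :: nat list. length w = p \<Longrightarrow> permute_list r w = drop (Suc k) w @ take (Suc k) w"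
  proof -
    have "distinct ([Suc k..<p] @ [0..<Suc k])" "set ([Suc k..<p] @ [0..<Suc k]) = {..<p}" by (auto simp: p)
    from exists_position_permutation[OF this] obtain r where
      r: "r permutes {..<p}" "\<And>w :: nat list. length w = p \<Longrightarrow> permute_list r w = map ((!) w) ([Suc k..<p] @ [0..<Suc k])" by blast
    have eq: "map ((!) w) ([Suc k..<p] @ [0..<Suc k]) = drop (Suc k) w @ take (Suc k) w" if "length w = p" for w :: "nat list"
      using that p by (intro nth_equalityI) (auto simp: nth_append simp del: upt_Suc)
    show thesis by (rule that[OF r(1)]) (simp only: r(2) eq)
  qed
  \<comment> \<open>After \<open>\<tau>\<close> and \<open>r\<close> the only change left is a
    rotation of the first row that puts the corner box last. It stays inside the alternating
    positions, so it costs just the sign of \<open>z\<close>.\<close>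
  obtain z where z: "z permutes {..<Suc i}" "\<And>w :: nat list. length w = Suc i \<Longrightarrow> permute_list z w = drop 1 w @ take 1 w"
  proof -
    have "distinct ([1..<Suc i] @ [0])" "set ([1..<Suc i] @ [0]) = {..<Suc i}" by auto
    from exists_position_permutation[OF this] obtain z where
      z: "z permutes {..<Suc i}" "\<And>w :: nat list. length w = Suc i \<Longrightarrow> permute_list z w = map ((!) w) ([1..<Suc i] @ [0])" by blast
    have eq: "map ((!) w) ([1..<Suc i] @ [0]) = drop 1 w @ take 1 w" if "length w = Suc i" for w :: "nat list"
      using that by (intro nth_equalityI) (auto simp: nth_append simp del: upt_Suc)
    show thesis by (rule that[OF z(1)]) (simp only: z(2) eq)
  qed
  have split: "\<exists>x J u. w = x # J @ u \<and> length J = i \<and> length u = k" if lw: "length w = p" for w :: "nat list"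
  proof -
    obtain x v where "w = x # v" using lw p by (cases w) auto
    then show ?thesis
      using lw p by (intro exI[of _ x] exI[of _ "take i v"] exI[of _ "drop i v"]) auto
  qed
  have comb: "permute_list z w = J @ x # u" "permute_list \<tau> w = x # u @ J"
    if "w = x # J @ u" "length J = i" "length u = k" for w J u :: "nat list" and x
  proof -
    have "permute_list z ((x # J) @ u) = permute_list z (x # J) @ u"
      using z(1) that by (intro permute_list_append_left) simp
    then show "permute_list z w = J @ x # u" using z(2)[of "x # J"] that by simp
    have "map ((!) w) [Suc i..<Suc i + k] = u"
      using that by (intro nth_equalityI) (auto simp: nth_append simp del: upt_Suc)
    moreover have "map ((!) w) [1..<Suc i] = J"
      using that by (intro nth_equalityI) (auto simp: nth_append simp del: upt_Suc)
    moreover have "length w = p" using that p by simp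
    ultimately show "permute_list \<tau> w = x # u @ J" using \<tau>(2)[of w] that by (simp add: Q_def del: upt_Suc)
  qed
  have r\<tau>: "permute_list r (permute_list \<tau> w) = permute_list z w" if "length w = p" for w :: "nat list"
  proof -
    obtain x J u where *: "w = x # J @ u" "length J = i" "length u = k" using split[OF \<open>length w = p\<close>] by blast
    then show ?thesis using comb[OF *] r(2)[of "x # u @ J"] p by simp
  qed
  have \<tau>z: "permute_list \<tau> w = drop i (permute_list z w) @ take i (permute_list z w)" if "length w = p" for w :: "nat list"
  proof -
    obtain x J u where *: "w = x # J @ u" "length J = i" "length u = k" using split[OF \<open>length w = p\<close>] by blast
    then show ?thesis using comb[OF *] by simp
  qed
  define s where "s = (of_int (sign z) :: 'k)"
  have ss: "s * s = 1" by (simp add: s_def sign_def)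
  \<comment> \<open>Cancels the sign of \<open>z\<close> and the factorial coming from
    \<open>asum_eq_kdiff\<close>.\<close>
  define c where "c = s / of_nat (fact i)"
  \<comment> \<open>The Koszul term with its symmetric block moved to the front; forgetting that the
    other positions alternate makes it a map \<open>R\<close> into \<open>X\<close>.\<close>
  define h where "h = comp_nt (posmat p {()} (\<lambda>_. r) (\<lambda>_. c)) (aemb i (Suc k) p)"
  have h: "h \<in> nat_trans P (tens p)"
    unfolding h_def using r(1) by (intro nat_trans_comp[OF EP posmat_nat_trans] sc) auto
  have hm: "h n = labelled_mat (words p n) (awords i (Suc k) p n) (\<lambda>w l. c * aext i (Suc k) l (permute_list r w))" for n
    unfolding h_def comp_nt_def aemb_def using r(1) by (subst posmat_mult) auto
  have halt: "altsym 0 (Suc k) p (\<lambda>w. c * aext i (Suc k) l (permute_list r w))"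
    if "l \<in> set (awords i (Suc k) p n)" for l n
  proof (rule altsym_scale, unfold altsym_def, intro conjI allI impI)
    fix J K K' u :: "nat list"
    assume *: "length J = 0" "length K = Suc k" "length u = p - 0 - Suc k" "mset K = mset K'"
    then have "length K' = Suc k" "length u = i" using p mset_eq_length by fastforce+
    then show "aext i (Suc k) l (permute_list r (J @ K @ u)) = (aext i (Suc k) l (permute_list r (J @ K' @ u)) :: 'k)"
      using * p altsymD(3)[OF altsym_aext[OF that leP], of u K "[]" K'] by (simp add: r(2))
  qed auto
  have "\<exists>R\<in>nat_trans P X. comp_nt (aemb 0 (Suc k) p) R = h"
    unfolding X_def by (rule lift_to_aspf[OF h sc(3) leX hm]) (rule halt)
  then obtain R where R: "R \<in> nat_trans P X" "comp_nt (aemb 0 (Suc k) p) R = h" by blast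
  define \<epsilon> where "\<epsilon> = comp_nt \<beta> R"
  have \<epsilon>: "\<epsilon> \<in> nat_trans P W"
    unfolding \<epsilon>_def by (rule nat_trans_comp[OF R(1) \<beta>(1) sc(3,2) Wc])
  note dR = nat_transD(2,3)[OF R(1)]
  have \<iota>\<epsilon>: "\<iota> n * \<epsilon> n = aemb (Suc i) 0 p n * (ET n * (RT n * h n))" for n
  proof -
    have "\<iota> n * \<epsilon> n = (\<iota> n * \<beta> n) * R n"
      by (simp add: \<epsilon>_def comp_nt_def mult_mat_assoc dd dR)
    also have "\<dots> = aemb (Suc i) 0 p n * (ET n * (RT n * (aemb 0 (Suc k) p n * R n)))"
    proof -
      have d: "dim_row (ET n) = fdim F n" "dim_col (ET n) = fdim (tens p :: 'k spf) n"
        "dim_row (RT n) = fdim (tens p :: 'k spf) n" "dim_col (RT n) = fdim (tens p :: 'k spf) n"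
        by (simp_all add: ET_def RT_def F_def aspf_def tens_def posmat_def)
      show ?thesis unfolding \<iota>\<beta> by (simp add: mult_mat_assoc dd dR d)
    qed
    finally show ?thesis using R(2) by (simp add: comp_nt_def fun_eq_iff)
  qed
  have as: "asum (Suc i) (\<lambda>v. g (permute_list z v)) w = s * asum (Suc i) g w" if "length w = p" for g :: "nat list \<Rightarrow> 'k" and w
    using asum_precompose[OF z(1), of w g] that p by (simp add: s_def)
  have fin1: "\<iota> n * \<epsilon> n = labelled_mat (words p n) (awords i (Suc k) p n) (\<lambda>w l. kdiff i (aext i (Suc k) l) w)" for n
    unfolding \<iota>\<epsilon> hm main
  proof (rule labelled_mat_cong)
    fix w l assume w: "w \<in> set (words p n)" and l: "l \<in> set (awords i (Suc k) p n)"
    have len: "length w = p" using w by (rule length_in_words)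
    have "asum (Suc i) (\<lambda>v. c * aext i (Suc k) l (permute_list r (permute_list \<tau> v))) w =
        asum (Suc i) (\<lambda>v. c * aext i (Suc k) l (permute_list z v)) w"
      by (rule asum_cong) (simp add: r\<tau> len)
    also have "\<dots> = c * (s * (of_nat (fact i) * kdiff i (aext i (Suc k) l) w))"
      unfolding asum_scale as[OF len] using p by (subst asum_eq_kdiff[OF altsym_aext[OF l leP] len]) simp_all
    also have "\<dots> = (s * s) * kdiff i (aext i (Suc k) l) w" using fact by (simp add: c_def)
    finally show "asum (Suc i) (\<lambda>v. c * aext i (Suc k) l (permute_list r (permute_list \<tau> v))) w = kdiff i (aext i (Suc k) l) w"
      by (simp add: ss)
  qed
  have "epi_nt \<epsilon>"
    unfolding epi_nt_def
  proof
    fix n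
    define g where "g m v = (aext 0 (Suc k) m (drop i v @ take i v) :: 'k)" for m v
    \<comment> \<open>In the other direction, antisymmetrizing the \<open>i\<close> free positions
      maps \<open>X\<close> to \<open>P\<close>. This gives \<open>\<epsilon> Y = \<beta>\<close>,
      from which \<open>\<epsilon>\<close> inherits surjectivity.\<close>
    define Y where "Y = labelled_mat (awords i (Suc k) p n) (awords 0 (Suc k) p n) (\<lambda>l m. s * asum i (g m) l)"
    have Yc: "Y \<in> carrier_mat (fdim P n) (fdim X n)" by (simp add: Y_def P_def X_def aspf_def)
    have "aemb i (Suc k) p n * Y = labelled_mat (words p n) (awords 0 (Suc k) p n) (\<lambda>w m. s * asum i (g m) w)"
      unfolding Y_def
    proof (rule aemb_arestr_mult[OF altsym_scale[OF altsym_asum] leP])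
      fix m J K K' u :: "nat list"
      assume m: "m \<in> set (awords 0 (Suc k) p n)" and *: "length J = i" "length K = Suc k" "length u = p - i - Suc k" "mset K = mset K'"
      have "length K' = Suc k" "u = []" using * p mset_eq_length by fastforce+
      then show "g m (J @ K @ u) = g m (J @ K' @ u)"
        using * p altsymD(3)[OF altsym_aext[OF m leX], of "[]" K J K'] by (simp add: g_def)
    qed (use p in auto)
    then have "posmat p {()} (\<lambda>_. r) (\<lambda>_. c) n * (aemb i (Suc k) p n * Y) =
        labelled_mat (words p n) (awords 0 (Suc k) p n) (\<lambda>w m. c * (s * asum i (g m) (permute_list r w)))"
      using r(1) by (simp only:) (subst posmat_mult, auto)
    moreover have "h n * Y = posmat p {()} (\<lambda>_. r) (\<lambda>_. c) n * (aemb i (Suc k) p n * Y)"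
      unfolding h_def comp_nt_def
      by (rule mult_mat_assoc) (simp_all add: posmat_def aemb_def Y_def)
    ultimately have "h n * Y = labelled_mat (words p n) (awords 0 (Suc k) p n)
        (\<lambda>w m. c * (s * asum i (g m) (permute_list r w)))" by simp
    moreover have "\<iota> n * (\<epsilon> n * Y) = aemb (Suc i) 0 p n * (ET n * (RT n * (h n * Y)))"
    proof -
      have d: "dim_row (ET n) = fdim F n" "dim_col (ET n) = fdim (tens p :: 'k spf) n"
        "dim_row (RT n) = fdim (tens p :: 'k spf) n" "dim_col (RT n) = fdim (tens p :: 'k spf) n"
        by (simp_all add: ET_def RT_def F_def aspf_def tens_def posmat_def)
      have "\<iota> n * (\<epsilon> n * Y) = (\<iota> n * \<epsilon> n) * Y"
        using Yc by (simp add: mult_mat_assoc dd nat_transD(2,3)[OF \<epsilon>])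
      then show ?thesis unfolding \<iota>\<epsilon> using Yc by (simp add: mult_mat_assoc dd d nat_transD(2,3)[OF h])
    qed
    ultimately have "\<iota> n * (\<epsilon> n * Y) = labelled_mat (words p n) (awords 0 (Suc k) p n)
        (\<lambda>w m. asum (Suc i) (\<lambda>v. c * (s * asum i (g m) (permute_list r (permute_list \<tau> v)))) w)"
      by (simp add: main)
    also have "\<dots> = labelled_mat (words p n) (awords 0 (Suc k) p n)
        (\<lambda>w m. asum (Suc i) (\<lambda>v. aext 0 (Suc k) m (permute_list \<tau> v)) w)"
    proof (rule labelled_mat_cong)
      fix w m assume w: "w \<in> set (words p n)"
      have len: "length w = p" using w by (rule length_in_words)
      have "asum (Suc i) (\<lambda>v. c * (s * asum i (g m) (permute_list r (permute_list \<tau> v)))) w =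
          asum (Suc i) (\<lambda>v. c * (s * asum i (g m) (permute_list z v))) w"
        by (rule asum_cong) (simp add: r\<tau> len)
      also have "\<dots> = c * (s * (s * (of_nat (fact i) * asum (Suc i) (g m) w)))"
        unfolding asum_scale as[OF len] using len p by (simp add: asum_asum)
      also have "\<dots> = (s * s) * (s * asum (Suc i) (g m) w)" using fact by (simp add: c_def)
      also have "\<dots> = asum (Suc i) (\<lambda>v. g m (permute_list z v)) w" by (simp add: ss as[OF len])
      also have "\<dots> = asum (Suc i) (\<lambda>v. aext 0 (Suc k) m (permute_list \<tau> v)) w"
        by (rule asum_cong) (simp add: g_def \<tau>z len)
      finally show "asum (Suc i) (\<lambda>v. c * (s * asum i (g m) (permute_list r (permute_list \<tau> v)))) w =
          asum (Suc i) (\<lambda>v. aext 0 (Suc k) m (permute_list \<tau> v)) w" .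
    qed
    also have "\<dots> = \<iota> n * \<beta> n"
      unfolding \<iota>\<beta> unfolding aemb_def[of 0 "Suc k"] main ..
    finally have eq: "\<iota> n * (\<epsilon> n * Y) = \<iota> n * \<beta> n" .
    obtain C where C: "C \<in> carrier_mat (fdim W n) (fdim (tens p :: 'k spf) n)" "C * \<iota> n = 1\<^sub>m (fdim W n)"
      by (rule bexE[OF mono_nt_left_inverse[OF \<iota> \<iota>mono, of n]])
    have "C * \<iota> n * (\<epsilon> n * Y) = C * \<iota> n * \<beta> n"
      using eq C(1) Yc by (simp add: mult_mat_assoc dd nat_transD(2,3)[OF \<epsilon>])
    then have e\<beta>: "\<epsilon> n * Y = \<beta> n"
      using Yc nat_transD(1)[OF \<epsilon>, of n]
      by (simp add: C(2) left_mult_one_mat[OF nat_transD(1)[OF \<beta>(1)]] left_mult_one_mat[OF mult_carrier_mat[OF nat_transD(1)[OF \<epsilon>] Yc]])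
    have "mat_image (\<beta> n) = carrier_vec (fdim W n)" using \<beta>(2) by (simp add: epi_nt_def dd)
    from right_inverse_of_full_image[OF nat_transD(1)[OF \<beta>(1)] this]
    obtain B where B: "B \<in> carrier_mat (fdim X n) (fdim W n)" "\<beta> n * B = 1\<^sub>m (fdim W n)" by blast
    have "\<epsilon> n * (Y * B) = 1\<^sub>m (fdim W n)"
      using e\<beta> B Yc by (simp add: mult_mat_assoc[symmetric] nat_transD(2,3)[OF \<epsilon>])
    from full_image_of_right_inverse[OF nat_transD(1)[OF \<epsilon>] mult_carrier_mat[OF Yc B(1)] this]
    show "mat_image (\<epsilon> n) = carrier_vec (dim_row (\<epsilon> n))" by (simp add: nat_transD(2)[OF \<epsilon>])
  qed
  then show ?thesis using Ws \<epsilon> \<iota> \<iota>mono fin1 unfolding W_def P_def by blast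
qed

section \<open>Projectivity\<close>

text \<open>The exponent of the monomial \<open>wprod entry_var w v\<close>. It remembers only the
  multiset of pairs of letters, so permuting \<open>w\<close> and \<open>v\<close> simultaneously is
  invisible.\<close>

definition wmono :: "nat list \<Rightarrow> nat list \<Rightarrow> (nat \<times> nat \<Rightarrow>\<^sub>0 nat)" where
  "wmono w v = sum_list (map (\<lambda>p. Poly_Mapping.single p 1) (zip w v))"

lemma wprod_entry_var: "wprod entry_var w v = (Poly_Mapping.single (wmono w v) 1 :: 'k::comm_ring_1 entry_poly)"
proof -
  have "prod_list (map entry_var ps) = (Poly_Mapping.single (sum_list (map (\<lambda>p. Poly_Mapping.single p 1) ps)) 1 :: 'k entry_poly)" for ps
    by (induction ps) (simp_all add: entry_var_def mult_single)
  then show ?thesis by (simp add: wprod_def wmono_def)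
qed

lemma lookup_wmono: "Poly_Mapping.lookup (wmono w v) x = count (mset (zip w v)) x"
proof -
  have "Poly_Mapping.lookup (sum_list (map (\<lambda>p. Poly_Mapping.single p 1) ps)) x = count (mset ps) x" for ps :: "(nat \<times> nat) list"
    by (induction ps) (simp_all add: lookup_add lookup_single when_def)
  then show ?thesis by (simp add: wmono_def)
qed

lemma wmono_eq_iff: "wmono w v = wmono w' v' \<longleftrightarrow> mset (zip w v) = mset (zip w' v')"
  by (simp add: poly_mapping_eq_iff fun_eq_iff multiset_eq_iff lookup_wmono)

lemma keys_wmono: "Poly_Mapping.keys (wmono w v) = set (zip w v)"
  by (auto simp: in_keys_iff lookup_wmono)

lemma wmono_mset:
  assumes "wmono w v = wmono w' v'" "length w = length v" "length w' = length v'"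
  shows "mset w = mset w'" "mset v = mset v'"
proof -
  have *: "mset (zip w v) = mset (zip w' v')" using assms(1) by (simp add: wmono_eq_iff)
  show "mset w = mset w'" using arg_cong[OF *, of "image_mset fst"] assms(2,3) by (simp flip: mset_map)
  show "mset v = mset v'" using arg_cong[OF *, of "image_mset snd"] assms(2,3) by (simp flip: mset_map)
qed

lemma wmono_permute:
  assumes "\<sigma> permutes {..<length w}" "length w = length v"
  shows "wmono (permute_list \<sigma> w) (permute_list \<sigma> v) = wmono w v"
  using assms by (simp add: wmono_eq_iff flip: permute_list_zip[of \<sigma> "{..<length w}"])

lemma monomial_eq_wmono:
  assumes "Poly_Mapping.keys \<alpha> \<subseteq> {..<N} \<times> {..<m}" "degm \<alpha> = e"
  obtains u v where "u \<in> set (words e N)" "v \<in> set (words e m)" "\<alpha> = wmono u v"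
proof -
  define M where "M = (\<Sum>x\<in>Poly_Mapping.keys \<alpha>. replicate_mset (Poly_Mapping.lookup \<alpha> x) x)"
  have cM: "count M x = Poly_Mapping.lookup \<alpha> x" for x
    by (simp add: M_def count_sum in_keys_iff)
  have sM: "size M = e" using assms(2) by (simp add: M_def degm_def size_multiset_sum)
  obtain xs where xs: "mset xs = M" using ex_mset by blast
  have z: "zip (map fst xs) (map snd xs) = xs" by (rule zip_map_fst_snd)
  have set: "set xs \<subseteq> {..<N} \<times> {..<m}"
  proof
    fix x assume "x \<in> set xs"
    then have "count M x > 0" by (simp flip: xs)
    then show "x \<in> {..<N} \<times> {..<m}" using assms(1) by (auto simp: cM in_keys_iff)
  qed
  show thesis
  proof (rule that)
    show "map fst xs \<in> set (words e N)" "map snd xs \<in> set (words e m)"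
      using set sM xs by (auto simp: in_words_iff)
    show "\<alpha> = wmono (map fst xs) (map snd xs)"
      by (rule poly_mapping_eqI) (simp only: lookup_wmono z xs cM)
  qed
qed

lemma monom_eval_wmono: "monom_eval A (wmono w v) = wprod (\<lambda>p. A $$ p) w v"
proof -
  have "peval A (wprod entry_var w v) = wprod (\<lambda>p. A $$ p) w v"
    by (simp add: wprod_hom[OF comm_ring_hom_peval])
  then show ?thesis by (simp add: wprod_entry_var peval_single)
qed

section \<open>Extraction of coefficients\<close>

lemma lookup_cnst_mult: "Poly_Mapping.lookup (cnst c * f) \<alpha> = c * Poly_Mapping.lookup (f :: 'k::comm_ring_1 entry_poly) \<alpha>"
proof -
  have "cnst c * f = (\<Sum>\<beta>\<in>Poly_Mapping.keys f. Poly_Mapping.single \<beta> (c * Poly_Mapping.lookup f \<beta>))"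
    by (subst (1) poly_mapping_sum_monomials[of f, symmetric]) (simp add: cnst_def sum_distrib_left mult_single)
  then show ?thesis
    by (auto simp: lookup_sum lookup_single when_def in_keys_iff)
qed

lemma lookup_mult_cnst: "Poly_Mapping.lookup (f * cnst c) \<alpha> = Poly_Mapping.lookup (f :: 'k::comm_ring_1 entry_poly) \<alpha> * c"
  by (metis lookup_cnst_mult mult.commute)

text \<open>With variables in columns below \<open>M\<close> on one side and from \<open>M\<close>
  on the other, a monomial of the product determines both of its factors.\<close>

lemma lookup_mult_split_vars:
  fixes f g :: "'k::comm_ring_1 entry_poly"
  assumes f: "\<And>\<alpha>. \<alpha> \<in> Poly_Mapping.keys f \<Longrightarrow> snd ` Poly_Mapping.keys \<alpha> \<subseteq> {..<M}"
    and g: "\<And>\<alpha>. \<alpha> \<in> Poly_Mapping.keys g \<Longrightarrow> snd ` Poly_Mapping.keys \<alpha> \<subseteq> {M..}"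
    and \<beta>: "snd ` Poly_Mapping.keys \<beta> \<subseteq> {..<M}" and \<mu>: "snd ` Poly_Mapping.keys \<mu> \<subseteq> {M..}"
  shows "Poly_Mapping.lookup (f * g) (\<mu> + \<beta>) = Poly_Mapping.lookup f \<beta> * Poly_Mapping.lookup g \<mu>"
proof -
  have zero: "Poly_Mapping.lookup \<alpha> x = 0" if "snd ` Poly_Mapping.keys \<alpha> \<subseteq> S" "snd x \<notin> S"
    for \<alpha> :: "nat \<times> nat \<Rightarrow>\<^sub>0 nat" and x S
    using that by (metis image_subset_iff in_keys_iff)
  have sep: "\<alpha> + \<gamma> = \<mu> + \<beta> \<longleftrightarrow> \<alpha> = \<beta> \<and> \<gamma> = \<mu>"
    if "\<alpha> \<in> Poly_Mapping.keys f" "\<gamma> \<in> Poly_Mapping.keys g" for \<alpha> \<gamma>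
  proof
    assume eq: "\<alpha> + \<gamma> = \<mu> + \<beta>"
    have "Poly_Mapping.lookup \<alpha> x = Poly_Mapping.lookup \<beta> x \<and> Poly_Mapping.lookup \<gamma> x = Poly_Mapping.lookup \<mu> x" for x
    proof (cases "snd x < M")
      case True
      then show ?thesis
        using arg_cong[OF eq, of "\<lambda>\<alpha>. Poly_Mapping.lookup \<alpha> x"] zero[OF g[OF that(2)], of x] zero[OF \<mu>, of x]
        by (simp add: lookup_add)
    next
      case False
      then show ?thesis
        using arg_cong[OF eq, of "\<lambda>\<alpha>. Poly_Mapping.lookup \<alpha> x"] zero[OF f[OF that(1)], of x] zero[OF \<beta>, of x]
        by (simp add: lookup_add)
    qed
    then show "\<alpha> = \<beta> \<and> \<gamma> = \<mu>" by (simp add: poly_mapping_eq_iff fun_eq_iff)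
  qed (simp add: add.commute)
  have "f * g = (\<Sum>\<alpha>\<in>Poly_Mapping.keys f. \<Sum>\<gamma>\<in>Poly_Mapping.keys g.
      Poly_Mapping.single (\<alpha> + \<gamma>) (Poly_Mapping.lookup f \<alpha> * Poly_Mapping.lookup g \<gamma>))"
    by (subst (1) poly_mapping_sum_monomials[of f, symmetric], subst (1) poly_mapping_sum_monomials[of g, symmetric])
       (simp add: sum_product mult_single)
  then have "Poly_Mapping.lookup (f * g) (\<mu> + \<beta>) = (\<Sum>\<alpha>\<in>Poly_Mapping.keys f. \<Sum>\<gamma>\<in>Poly_Mapping.keys g.
      if \<alpha> + \<gamma> = \<mu> + \<beta> then Poly_Mapping.lookup f \<alpha> * Poly_Mapping.lookup g \<gamma> else 0)"
    by (simp add: lookup_sum lookup_single when_def)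
  also have "\<dots> = (\<Sum>\<alpha>\<in>Poly_Mapping.keys f. if \<alpha> = \<beta> then
      (\<Sum>\<gamma>\<in>Poly_Mapping.keys g. if \<gamma> = \<mu> then Poly_Mapping.lookup f \<alpha> * Poly_Mapping.lookup g \<gamma> else 0) else 0)"
    by (rule sum.cong[OF refl]) (auto intro!: sum.cong sum.neutral simp: sep)
  also have "\<dots> = Poly_Mapping.lookup f \<beta> * Poly_Mapping.lookup g \<mu>"
    by (auto simp: in_keys_iff)
  finally show ?thesis .
qed

text \<open>Labels the generator of \<open>\<Lambda>\<^sup>i \<otimes> \<Gamma>\<^sup>b\<close>: the
  wedge of the first \<open>i\<close> basis vectors of \<open>k\<^sup>i\<^sup>+\<^sup>1\<close>
  times the \<open>b\<close>-th divided power of the last one.\<close>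

definition gen_word :: "nat \<Rightarrow> nat \<Rightarrow> nat list" where
  "gen_word i b = [0..<i] @ replicate b i"

text \<open>One word for each orbit under permutations of the positions from \<open>i\<close> on.
  For \<open>p = i + b\<close> these index the monomials with column word
  \<open>gen_word i b\<close>, hence a basis of
  \<open>\<Gamma>\<^sup>b \<otimes> I\<^sup>\<otimes>\<^sup>i\<close>.\<close>

definition half_sorted :: "nat \<Rightarrow> nat \<Rightarrow> nat \<Rightarrow> nat list set" where
  "half_sorted i p N = {w \<in> set (words p N). sorted (drop i w)}"

lemma finite_half_sorted [simp]: "finite (half_sorted i p N)"
  by (simp add: half_sorted_def)

lemma length_gen_word [simp]: "length (gen_word i b) = i + b"
  by (simp add: gen_word_def)

lemma gen_word_awords: "gen_word i (Suc k) \<in> set (awords i (Suc k) (i + Suc k) (Suc i))"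
  by (auto simp: gen_word_def in_awords_iff in_words_iff)

text \<open>The first \<open>i\<close> letters of the generator word are distinct and record the
  position of each partner letter; the repeated letter \<open>i\<close> records the rest only as a
  multiset.\<close>

lemma wmono_gen_word_iff:
  assumes "length l = i + b" "length w = i + b"
  shows "wmono l (gen_word i b) = wmono w (gen_word i b) \<longleftrightarrow> take i l = take i w \<and> mset (drop i l) = mset (drop i w)"
proof -
  have z: "mset (zip l (gen_word i b)) = mset (zip (take i l) [0..<i]) + image_mset (\<lambda>x. (x, i)) (mset (drop i l))"
    if "length l = i + b" for l
  proof -
    have "zip l (gen_word i b) = zip (take i l) [0..<i] @ zip (drop i l) (replicate b i)"
      unfolding gen_word_def using that by (subst zip_append2) auto
    also have "zip (drop i l) (replicate b i) = map (\<lambda>x. (x, i)) (drop i l)"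
      using that by (simp add: zip_replicate2)
    finally show ?thesis by simp
  qed
  show ?thesis
  proof
    assume eq: "wmono l (gen_word i b) = wmono w (gen_word i b)"
    have f: "filter_mset (\<lambda>q. snd q = i) (mset (zip (take i l) [0..<i]) + image_mset (\<lambda>x. (x, i)) (mset (drop i l))) =
        image_mset (\<lambda>x. (x, i)) (mset (drop i l))" for l :: "nat list"
    proof -
      have 1: "filter_mset (\<lambda>q. snd q = i) (mset (zip (take i l) [0..<i])) = {#}"
        by (auto simp: filter_mset_eq_conv dest: set_zip_rightD)
      have 2: "filter_mset (\<lambda>q. snd q = i) (image_mset (\<lambda>x. (x, i)) A) = image_mset (\<lambda>x. (x, i)) A" for A :: "nat multiset"
        by (induction A) auto
      show ?thesis unfolding filter_union_mset 1 2 by simp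
    qed
    have "image_mset (\<lambda>x. (x, i)) (mset (drop i l)) = image_mset (\<lambda>x. (x, i)) (mset (drop i w))"
      using arg_cong[OF eq[unfolded wmono_eq_iff z[OF assms(1)] z[OF assms(2)]], of "filter_mset (\<lambda>q. snd q = i)"]
      by (simp only: f)
    from arg_cong[OF this, of "image_mset fst"] have d: "mset (drop i l) = mset (drop i w)"
      by (simp add: image_mset.compositionality o_def)
    have t: "mset (zip (take i l) [0..<i]) = mset (zip (take i w) [0..<i])"
      using eq d by (simp add: wmono_eq_iff z assms)
    have "take i l ! j = take i w ! j" if j: "j < i" for j
    proof -
      have "(take i l ! j, j) \<in> set (zip (take i l) [0..<i])"
        using j assms by (auto simp: set_zip intro!: exI[of _ j])
      then have "(take i l ! j, j) \<in> set (zip (take i w) [0..<i])" using t mset_eq_setD by blast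
      then show ?thesis using j assms by (auto simp: set_zip)
    qed
    then have "take i l = take i w" using assms by (intro nth_equalityI) auto
    with d show "take i l = take i w \<and> mset (drop i l) = mset (drop i w)" by simp
  next
    assume "take i l = take i w \<and> mset (drop i l) = mset (drop i w)"
    then show "wmono l (gen_word i b) = wmono w (gen_word i b)"
      using assms by (simp add: wmono_eq_iff z)
  qed
qed

lemma half_sorted_rep:
  assumes "t \<in> set (words (i + b) N)"
  shows "{w \<in> half_sorted i (i + b) N. wmono t (gen_word i b) = wmono w (gen_word i b)} = {take i t @ sort (drop i t)}"
proof -
  have len: "length t = i + b" using assms by (rule length_in_words)
  have "w = take i t @ sort (drop i t)"
    if "w \<in> half_sorted i (i + b) N" "wmono t (gen_word i b) = wmono w (gen_word i b)" for w
  proof -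
    have w: "length w = i + b" "sorted (drop i w)" using that(1) by (auto simp: half_sorted_def in_words_iff)
    have "take i t = take i w" "mset (drop i t) = mset (drop i w)"
      using that(2) by (simp_all add: wmono_gen_word_iff[OF len w(1)])
    then show ?thesis using w(2) by (metis append_take_drop_id properties_for_sort)
  qed
  moreover have "take i t @ sort (drop i t) \<in> half_sorted i (i + b) N"
    using assms len by (auto simp: half_sorted_def in_words_iff dest: in_set_takeD in_set_dropD)
  moreover have "wmono t (gen_word i b) = wmono (take i t @ sort (drop i t)) (gen_word i b)"
    using len by (subst wmono_gen_word_iff) auto
  ultimately show ?thesis by blast
qed

lemma altsym_sort:
  assumes "altsym i b (i + b) t" "length w = i + b"
  shows "t (take i w @ sort (drop i w)) = t w"
  using altsymD(3)[OF assms(1), of "take i w" "drop i w" "[]" "sort (drop i w)"] assms(2) by simp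

lemma altsym_permute:
  assumes "altsym a b e t" "length w = e" "\<sigma> permutes {..<a}" "a \<le> e"
  shows "t (permute_list \<sigma> w) = of_int (sign \<sigma>) * t w"
proof -
  have "permute_list \<sigma> (take a w @ drop a w) = permute_list \<sigma> (take a w) @ drop a w"
    using assms by (intro permute_list_append_left) auto
  then show ?thesis
    using altsymD(1)[OF assms(1), of "take a w" "drop a w" \<sigma>] assms by simp
qed

text \<open>The \<open>i!\<close> orders of the alternating block all contribute equally. This is
  the scalar by which \<open>\<Lambda>\<^sup>i\<close> splits off from the tensor power, and the
  place where \<open>i!\<close> must be invertible for projectivity.\<close>

lemma sum_half_sorted_aext:
  assumes g: "altsym i b (i + b) g" and l: "l \<in> set (awords i b (i + b) N)"
  shows "(\<Sum>w\<in>half_sorted i (i + b) N. aext i b l w * g w) = of_nat (fact i) * g l"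
proof -
  obtain J K u where s: "l = J @ K @ u" "length J = i" "length K = b" "length u = i + b - i - b"
    by (rule split_word[OF length_awords[OF l] le_refl])
  have l': "l = J @ K" and m: "J \<in> set (words i N)" "K \<in> set (words b N)" "sorted K"
    using s l by (auto simp: in_awords_iff in_words_iff)
  have "half_sorted i (i + b) N = {w \<in> set (words (i + b) N). sorted (drop i w)}" by (simp add: half_sorted_def)
  then have "(\<Sum>w\<in>half_sorted i (i + b) N. aext i b l w * g w) =
      (\<Sum>w\<in>set (words (i + b) N). if sorted (drop i w) then aext i b l w * g w else 0)"
    by (simp add: sum.inter_filter)
  also have "\<dots> = (\<Sum>v\<in>set (words i N). \<Sum>x\<in>set (words b N). if x = K then perm_sgn J v * g (v @ x) else 0)"
    unfolding sum_words_append
  proof (intro sum.cong refl)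
    fix v x assume "v \<in> set (words i N)" "x \<in> set (words b N)"
    then have len: "length v = i" "length x = b" by (simp_all add: in_words_iff)
    have "(sorted x \<and> mset x = mset K) = (x = K)" using m(3) by (metis properties_for_sort)
    then show "(if sorted (drop i (v @ x)) then aext i b l (v @ x) * g (v @ x) else 0) =
        (if x = K then perm_sgn J v * g (v @ x) else 0)"
      using len s l' by (auto simp: aext_def)
  qed
  also have "\<dots> = asum i g (J @ K)" using m by (simp add: asum_eq_sum_perm_sgn)
  also have "\<dots> = (\<Sum>\<sigma> | \<sigma> permutes {..<i}. g l)"
    unfolding asum_def l'[symmetric]
    by (intro sum.cong) (auto simp: altsym_permute[OF g length_awords[OF l]] of_int_sign_square)
  finally show ?thesis by (simp add: card_permutations[OF refl])
qed

text \<open>Applying a generic matrix to the generator produces every basis tensor: its coordinates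
  appear as coefficients of the monomials over the generator word.\<close>

lemma lookup_afun_gen:
  assumes l: "length l = i + b" and w: "length w = i + b"
  shows "Poly_Mapping.lookup (afun entry_var i b (gen_word i b) l :: 'k::comm_ring_1 entry_poly) (wmono w (gen_word i b)) = aext i b l w"
proof -
  define J where "J = take i l"
  have J: "length J = i" using l by (simp add: J_def)
  have rep: "wperm entry_var K (replicate b i) = (wprod entry_var K (replicate b i) :: 'k entry_poly)" for K
  proof -
    have "{v. mset v = mset (replicate b i)} = {replicate b i}"
      by (auto simp: replicate_length_same[symmetric] dest: mset_eq_length mset_eq_setD)
         (metis in_multiset_in_set in_replicate_mset mset_eq_length length_replicate mset_replicate replicate_eqI)
    then show ?thesis by (simp add: wperm_def)
  qed
  have "wdet entry_var J [0..<i] = (\<Sum>\<sigma> | \<sigma> permutes {..<i}. of_int (sign \<sigma>) * wprod entry_var J (permute_list \<sigma> [0..<i]) :: 'k entry_poly)"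
    using wdet_conv_sum[of J "[0..<i]" "entry_var :: _ \<Rightarrow> 'k entry_poly"] J by simp
  also have "\<dots> = (\<Sum>\<sigma> | \<sigma> permutes {..<i}. of_int (sign (Hilbert_Choice.inv \<sigma>)) * wprod entry_var J (permute_list (Hilbert_Choice.inv \<sigma>) [0..<i]))"
    by (rule sum_permutations_inverse)
  also have "\<dots> = (\<Sum>\<sigma> | \<sigma> permutes {..<i}. of_int (sign \<sigma>) * wprod entry_var (permute_list \<sigma> J) [0..<i])"
  proof (rule sum.cong[OF refl])
    fix \<sigma> assume "\<sigma> \<in> {\<sigma>. \<sigma> permutes {..<i}}"
    then have \<sigma>: "\<sigma> permutes {..<i}" by simp
    have "wprod entry_var (permute_list \<sigma> J) (permute_list \<sigma> (permute_list (Hilbert_Choice.inv \<sigma>) [0..<i])) =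
        (wprod entry_var J (permute_list (Hilbert_Choice.inv \<sigma>) [0..<i]) :: 'k entry_poly)"
      using \<sigma> J by (intro wprod_permute) auto
    moreover have "permute_list \<sigma> (permute_list (Hilbert_Choice.inv \<sigma>) [0..<i]) = [0..<i]"
      using \<sigma> by (intro permute_list_inv(1)) simp
    moreover have "sign (Hilbert_Choice.inv \<sigma>) = sign \<sigma>"
      by (rule sign_inverse) (metis \<sigma> finite_lessThan permutation_permutes)
    ultimately show "of_int (sign (Hilbert_Choice.inv \<sigma>)) * wprod entry_var J (permute_list (Hilbert_Choice.inv \<sigma>) [0..<i]) =
        of_int (sign \<sigma>) * (wprod entry_var (permute_list \<sigma> J) [0..<i] :: 'k entry_poly)" by simp
  qed
  finally have "afun entry_var i b (gen_word i b) l = (\<Sum>\<sigma> | \<sigma> permutes {..<i}.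
      of_int (sign \<sigma>) * wprod entry_var (permute_list \<sigma> J @ drop i l) (gen_word i b) :: 'k entry_poly)"
    using l J by (simp add: afun_def gen_word_def J_def[symmetric] rep wprod_append sum_distrib_right mult.assoc)
  then have "afun entry_var i b (gen_word i b) l = (\<Sum>\<sigma> | \<sigma> permutes {..<i}.
      cnst (of_int (sign \<sigma>)) * Poly_Mapping.single (wmono (permute_list \<sigma> J @ drop i l) (gen_word i b)) 1 :: 'k entry_poly)"
  proof -
    interpret comm_ring_hom "cnst :: 'k \<Rightarrow> 'k entry_poly" by (rule comm_ring_hom_cnst)
    assume "afun entry_var i b (gen_word i b) l = (\<Sum>\<sigma> | \<sigma> permutes {..<i}.
      of_int (sign \<sigma>) * wprod entry_var (permute_list \<sigma> J @ drop i l) (gen_word i b) :: 'k entry_poly)"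
    then show ?thesis by (simp add: wprod_entry_var hom_of_int)
  qed
  then have "Poly_Mapping.lookup (afun entry_var i b (gen_word i b) l :: 'k entry_poly) (wmono w (gen_word i b)) =
      (\<Sum>\<sigma> | \<sigma> permutes {..<i}. if permute_list \<sigma> J = take i w \<and> mset (drop i l) = mset (drop i w) then of_int (sign \<sigma>) else 0)"
    using l w J by (auto simp: lookup_sum lookup_cnst_mult lookup_single when_def wmono_gen_word_iff intro!: sum.cong)
  also have "\<dots> = aext i b l w"
  proof -
    have "(\<Sum>\<sigma> | \<sigma> permutes {..<i}. if permute_list \<sigma> J = take i w then of_int (sign \<sigma>) else 0) = (perm_sgn J (take i w) :: 'k)"
      unfolding perm_sgn_def J by (subst sum.inter_filter[symmetric]) (auto simp: finite_permutations intro!: sum.cong)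
    then show ?thesis using l w by (auto simp: aext_def J_def)
  qed
  finally show ?thesis .
qed

text \<open>Coordinate \<open>r\<close> of the vector obtained by applying \<open>G\<close> of the
  generic \<open>N\<close> by \<open>n\<close> matrix to \<open>y\<close>.\<close>

definition gpoly :: "'k::field spf \<Rightarrow> nat \<Rightarrow> (nat \<Rightarrow> 'k) \<Rightarrow> nat \<Rightarrow> nat \<Rightarrow> 'k entry_poly" where
  "gpoly G n y N r = (\<Sum>q<fdim G n. fpoly G n N $$ (r, q) * cnst (y q))"

text \<open>Naturality at the generic matrix, read off at the generator: the image of the generator
  determines \<open>f\<close> on all basis tensors.\<close>

lemma lookup_gpoly_nat_trans:
  fixes f :: "nat \<Rightarrow> 'k::field mat"
  assumes f: "f \<in> nat_trans (aspf i b (i + b)) G" and G: "spf_carrier G" and n: "j0 < length (awords i b (i + b) n)"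
    "awords i b (i + b) n ! j0 = gen_word i b" and r: "r < fdim G N" and w: "length w = i + b"
  shows "Poly_Mapping.lookup (gpoly G n (\<lambda>q. f n $$ (q, j0)) N r) (wmono w (gen_word i b)) =
    (\<Sum>j<length (awords i b (i + b) N). f N $$ (r, j) * aext i b (awords i b (i + b) N ! j) w)"
proof -
  let ?P = "aspf i b (i + b) :: 'k spf"
  have dP: "fdim ?P m = length (awords i b (i + b) m)" for m by (simp add: aspf_def)
  have Gc: "fpoly G n N \<in> carrier_mat (fdim G N) (fdim G n)" using G by (simp add: spf_carrier_def)
  have fc: "cmat (f m) \<in> carrier_mat (fdim G m) (fdim ?P m)" for m using nat_transD(1)[OF f] by simp
  have Pc: "fpoly ?P n N \<in> carrier_mat (fdim ?P N) (fdim ?P n)" using spf_carrier_aspf[of i b "i + b", where ?'a = 'k]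
    unfolding spf_carrier_def by blast
  have j0: "j0 < fdim ?P n" using n(1) by (simp add: dP)
  have "gpoly G n (\<lambda>q. f n $$ (q, j0)) N r = (fpoly G n N * cmat (f n)) $$ (r, j0)"
    unfolding index_mult_mat_sum[OF Gc fc r j0] gpoly_def
    using j0 nat_transD(2,3)[OF f] by (intro sum.cong) auto
  also have "\<dots> = (\<Sum>j<fdim ?P N. cnst (f N $$ (r, j)) * afun entry_var i b (gen_word i b) (awords i b (i + b) N ! j))"
    unfolding nat_transD(4)[OF f] index_mult_mat_sum[OF fc Pc r j0]
    using r j0 nat_transD(2,3)[OF f] n by (intro sum.cong) (auto simp: aspf_def)
  finally show ?thesis
    using w by (auto simp: lookup_sum lookup_cnst_mult dP lookup_afun_gen length_awords[OF nth_mem] intro!: sum.cong)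
qed

section \<open>Generic matrices in disjoint variables and the Yoneda map\<close>

lemma gpoly_homogeneous:
  assumes G: "strict_poly_functor e G" and r: "r < fdim G N"
  shows "homogeneous_in e N n (gpoly G n y N r)"
  unfolding gpoly_def using strict_poly_functorD(3)[OF G r]
  by (intro homogeneous_in_sum) (subst mult.commute, auto intro: homogeneous_in_cnst_mult)

lemma peval_gpoly_mult:
  assumes G: "strict_poly_functor e G" and r: "r < fdim G N" and A: "A \<in> carrier_mat M n"
  shows "peval (generic_mat N M * A) (gpoly G n y N r) =
    (\<Sum>s<fdim G M. fpoly G M N $$ (r, s) * peval A (gpoly G n y M s))"
proof -
  note D = strict_poly_functorD[OF G]
  have B: "generic_mat N M \<in> carrier_mat N M" by (rule generic_mat_carrier)
  have e: "peval (generic_mat N M * A) (fpoly G n N $$ (r, q)) =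
      (\<Sum>s<fdim G M. fpoly G M N $$ (r, s) * peval A (fpoly G n M $$ (s, q)))" if q: "q < fdim G n" for q
  proof -
    have "peval (generic_mat N M * A) (fpoly G n N $$ (r, q)) = act G (generic_mat N M * A) $$ (r, q)"
      using A B r q by (simp add: act_def fpoly_dim[OF D(1)])
    also have "\<dots> = (\<Sum>s<fdim G M. act G (generic_mat N M) $$ (r, s) * act G A $$ (s, q))"
      unfolding D(5)[OF B A] by (rule index_mult_mat_sum[OF act_carrier[OF D(1) B] act_carrier[OF D(1) A] r q])
    also have "\<dots> = (\<Sum>s<fdim G M. fpoly G M N $$ (r, s) * peval A (fpoly G n M $$ (s, q)))"
      unfolding act_generic[OF G] using A q by (intro sum.cong) (auto simp: act_def fpoly_dim[OF D(1)])
    finally show ?thesis .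
  qed
  have "peval (generic_mat N M * A) (gpoly G n y N r) =
      (\<Sum>q<fdim G n. \<Sum>s<fdim G M. fpoly G M N $$ (r, s) * peval A (fpoly G n M $$ (s, q)) * cnst (y q))"
    unfolding gpoly_def peval_sum peval_mult by (intro sum.cong) (auto simp: e sum_distrib_right)
  also have "\<dots> = (\<Sum>s<fdim G M. fpoly G M N $$ (r, s) * peval A (gpoly G n y M s))"
    unfolding gpoly_def peval_sum peval_mult sum_distrib_left by (subst sum.swap) (simp add: mult.assoc)
  finally show ?thesis .
qed

text \<open>The entries of \<open>shifted_mat M n\<close> are variables disjoint from those of \<open>generic_mat N M\<close>.\<close>

definition shifted_mat :: "nat \<Rightarrow> nat \<Rightarrow> 'k::field entry_poly mat" where
  "shifted_mat M n = mat M n (\<lambda>(s, c). entry_var (s, M + c))"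

lemma shifted_mat_carrier: "shifted_mat M n \<in> carrier_mat M n"
  by (simp add: shifted_mat_def)

lemma wprod_shifted:
  assumes "w \<in> set (words e M)" "v \<in> set (words e n)"
  shows "wprod (\<lambda>p. shifted_mat M n $$ p) w v = (wprod entry_var w (map ((+) M) v) :: 'k::field entry_poly)"
proof -
  have "length w = length v" using assms by (simp add: in_words_iff)
  then show ?thesis using assms
    by (induction w v arbitrary: e rule: list_induct2) (auto simp: in_words_iff shifted_mat_def)
qed

lemma wmono_shift_eq_iff: "wmono w (map ((+) M) v) = wmono w' (map ((+) M) v') \<longleftrightarrow> wmono w v = wmono w' v'"
proof -
  have z: "mset (zip w (map ((+) M) v)) = image_mset (map_prod id ((+) M)) (mset (zip w v))" for w v :: "nat list"
    by (simp add: zip_map2 map_prod_def id_def case_prod_unfold flip: mset_map)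
  have "inj (image_mset (map_prod id ((+) M) :: nat \<times> nat \<Rightarrow> nat \<times> nat))"
    by (intro multiset.inj_map prod.inj_map) auto
  then show ?thesis unfolding wmono_eq_iff z by (rule inj_eq)
qed

lemma snd_keys_wmono: "snd ` Poly_Mapping.keys (wmono w v) \<subseteq> set v"
  unfolding keys_wmono by (auto dest: set_zip_rightD)

lemma peval_shifted:
  fixes F :: "'k::field entry_poly"
  assumes F: "homogeneous_in e M n F"
  shows "\<And>w v. w \<in> set (words e M) \<Longrightarrow> v \<in> set (words e n) \<Longrightarrow>
      Poly_Mapping.lookup (peval (shifted_mat M n) F) (wmono w (map ((+) M) v)) = Poly_Mapping.lookup F (wmono w v)"
    and "\<And>\<gamma>. \<gamma> \<in> Poly_Mapping.keys (peval (shifted_mat M n) F) \<Longrightarrow> snd ` Poly_Mapping.keys \<gamma> \<subseteq> {M..}"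
proof -
  have mon: "\<exists>u x. u \<in> set (words e M) \<and> x \<in> set (words e n) \<and> \<alpha> = wmono u x \<and>
      monom_eval (shifted_mat M n) \<alpha> = (Poly_Mapping.single (wmono u (map ((+) M) x)) 1 :: 'k entry_poly)"
    if "\<alpha> \<in> Poly_Mapping.keys F" for \<alpha>
  proof -
    have "Poly_Mapping.keys \<alpha> \<subseteq> {..<M} \<times> {..<n}" "degm \<alpha> = e"
      using F that by (auto simp: homogeneous_in_alt)
    then obtain u x where "u \<in> set (words e M)" "x \<in> set (words e n)" "\<alpha> = wmono u x"
      by (rule monomial_eq_wmono)
    then show ?thesis by (auto simp: monom_eval_wmono wprod_shifted wprod_entry_var)
  qed
  show "Poly_Mapping.lookup (peval (shifted_mat M n) F) (wmono w (map ((+) M) v)) = Poly_Mapping.lookup F (wmono w v)"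
    if "w \<in> set (words e M)" "v \<in> set (words e n)" for w v
  proof -
    have "Poly_Mapping.lookup (peval (shifted_mat M n) F) (wmono w (map ((+) M) v)) =
        (\<Sum>\<alpha>\<in>Poly_Mapping.keys F. if \<alpha> = wmono w v then Poly_Mapping.lookup F \<alpha> else 0)"
      unfolding peval_def lookup_sum lookup_cnst_mult
    proof (rule sum.cong[OF refl])
      fix \<alpha> assume "\<alpha> \<in> Poly_Mapping.keys F"
      from mon[OF this] show "Poly_Mapping.lookup F \<alpha> * Poly_Mapping.lookup (monom_eval (shifted_mat M n) \<alpha>) (wmono w (map ((+) M) v)) =
          (if \<alpha> = wmono w v then Poly_Mapping.lookup F \<alpha> else 0)"
        by (auto simp: lookup_single when_def wmono_shift_eq_iff)
    qed
    then show ?thesis by (simp add: in_keys_iff)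
  qed
  show "snd ` Poly_Mapping.keys \<gamma> \<subseteq> {M..}" if \<gamma>: "\<gamma> \<in> Poly_Mapping.keys (peval (shifted_mat M n) F)" for \<gamma>
  proof -
    have "Poly_Mapping.lookup (peval (shifted_mat M n) F) \<gamma> \<noteq> 0" using \<gamma> by (simp add: in_keys_iff)
    then obtain \<alpha> where \<alpha>: "\<alpha> \<in> Poly_Mapping.keys F" "Poly_Mapping.lookup (monom_eval (shifted_mat M n) \<alpha> :: 'k entry_poly) \<gamma> \<noteq> 0"
      unfolding peval_def lookup_sum lookup_cnst_mult by (metis (no_types, lifting) mult_zero_right sum.neutral)
    from mon[OF \<alpha>(1)] \<alpha>(2) obtain u x where "\<gamma> = wmono u (map ((+) M) x)"
      by (auto simp: lookup_single when_def split: if_splits)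
    then show ?thesis using snd_keys_wmono[of u "map ((+) M) x"] by auto
  qed
qed

text \<open>A monomial in the entries of a product is a sum over intermediate words
  \<open>t\<close>; since the two factors have disjoint variables, each term imposes one condition
  per factor.\<close>

lemma lookup_generic_mult_shifted:
  assumes u: "u \<in> set (words e N)" and x: "x \<in> set (words e n)" and w: "w \<in> set (words e M)" and v: "v \<in> set (words e n)"
    and \<beta>: "snd ` Poly_Mapping.keys \<beta> \<subseteq> {..<M}"
  shows "Poly_Mapping.lookup (monom_eval (generic_mat N M * shifted_mat M n) (wmono u x) :: 'k::field entry_poly)
      (wmono w (map ((+) M) v) + \<beta>) =
    (\<Sum>t\<in>set (words e M). (if wmono u t = \<beta> then 1 else 0) * (if wmono t x = wmono w v then 1 else 0))"
proof -
  have B: "generic_mat N M \<in> carrier_mat N M" and A: "shifted_mat M n \<in> carrier_mat M n"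
    by (rule generic_mat_carrier shifted_mat_carrier)+
  have "labelled_mat (words e N) (words e n) (wprod (\<lambda>p. (generic_mat N M * shifted_mat M n) $$ p)) =
      labelled_mat (words e N) (words e n) (\<lambda>u x. \<Sum>t\<in>set (words e M). wprod (\<lambda>p. generic_mat N M $$ p) u t *
        wprod (\<lambda>p. shifted_mat M n $$ p) t x :: 'k entry_poly)"
    using strict_poly_functorD(5)[OF strict_tens B A, of e, unfolded act_tens[OF B] act_tens[OF A] act_tens[OF mult_carrier_mat[OF B A]]]
    by (simp add: labelled_mat_mult[OF distinct_words])
  from labelled_mat_eqD[OF this u x]
  have eq: "wprod (\<lambda>p. (generic_mat N M * shifted_mat M n) $$ p) u x =
      (\<Sum>t\<in>set (words e M). wprod entry_var u t * wprod entry_var t (map ((+) M) x) :: 'k entry_poly)"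
  proof (rule trans, intro sum.cong refl)
    fix t assume t: "t \<in> set (words e M)"
    have "wprod (\<lambda>p. generic_mat N M $$ p) u t = (wprod entry_var u t :: 'k entry_poly)"
    proof (rule wprod_cong)
      fix a c assume "(a, c) \<in> set (zip u t)"
      then have "a \<in> set u" "c \<in> set t" by (auto dest: set_zip_leftD set_zip_rightD)
      then show "generic_mat N M $$ (a, c) = (entry_var (a, c) :: 'k entry_poly)"
        using u t by (simp add: in_words_iff)
    qed
    then show "wprod (\<lambda>p. generic_mat N M $$ p) u t * wprod (\<lambda>p. shifted_mat M n $$ p) t x =
        (wprod entry_var u t * wprod entry_var t (map ((+) M) x) :: 'k entry_poly)"
      by (simp add: wprod_shifted[OF t x])
  qed
  have "Poly_Mapping.lookup (wprod entry_var u t * wprod entry_var t (map ((+) M) x) :: 'k entry_poly) (wmono w (map ((+) M) v) + \<beta>) =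
      (if wmono u t = \<beta> then 1 else 0) * (if wmono t x = wmono w v then 1 else 0)" if t: "t \<in> set (words e M)" for t
  proof -
    have "snd ` Poly_Mapping.keys (wmono u t) \<subseteq> {..<M}"
      using snd_keys_wmono[of u t] t by (auto simp: in_words_iff)
    moreover have "snd ` Poly_Mapping.keys (wmono y (map ((+) M) z)) \<subseteq> {M..}" for y z
      using snd_keys_wmono[of y "map ((+) M) z"] by auto
    ultimately show ?thesis
      by (subst lookup_mult_split_vars[of _ M])
         (auto simp: wprod_entry_var lookup_single when_def wmono_shift_eq_iff \<beta>)
  qed
  then show ?thesis by (simp add: monom_eval_wmono eq lookup_sum)
qed

lemma in_words_half_sorted: "w \<in> half_sorted i e N \<Longrightarrow> w \<in> set (words e N)"
  by (simp add: half_sorted_def)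

lemma gen_word_words: "gen_word i b \<in> set (words (i + b) (Suc i))"
  by (auto simp: gen_word_def in_words_iff)

text \<open>The case of a single monomial in \<open>generator_transfer\<close>. Both sides vanish
  unless the column letters are those of the generator, and then a simultaneous permutation makes
  the column word equal to \<open>gen_word i b\<close>.\<close>

lemma generator_monomial_transfer:
  assumes \<alpha>: "Poly_Mapping.keys \<alpha> \<subseteq> {..<N} \<times> {..<Suc i}" "degm \<alpha> = i + b" and l: "l \<in> set (awords i b (i + b) M)"
    and \<beta>: "snd ` Poly_Mapping.keys \<beta> \<subseteq> {..<M}"
  shows "(\<Sum>w\<in>half_sorted i (i + b) M. aext i b l w *
      Poly_Mapping.lookup (monom_eval (generic_mat N M * shifted_mat M (Suc i)) \<alpha> :: 'k::field entry_poly)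
        (wmono w (map ((+) M) (gen_word i b)) + \<beta>)) =
    (\<Sum>w\<in>half_sorted i (i + b) N. if wmono w (gen_word i b) = \<alpha> then Poly_Mapping.lookup (afun entry_var i b l w) \<beta> else 0)"
    (is "?lhs = ?rhs")
proof -
  let ?c = "gen_word i b"
  obtain u x where u: "u \<in> set (words (i + b) N)" and x: "x \<in> set (words (i + b) (Suc i))" and \<alpha>ux: "\<alpha> = wmono u x"
    using monomial_eq_wmono[OF \<alpha>] .
  note look = lookup_generic_mult_shifted[OF _ _ in_words_half_sorted gen_word_words \<beta>, where ?'k = 'k]
  show ?thesis
  proof (cases "mset x = mset ?c")
    case False
    have ne: "wmono t x \<noteq> wmono w ?c" if "length t = i + b" "length w = i + b" for t w
      using wmono_mset(2)[of t x w ?c] that x False by (auto simp: in_words_iff)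
    have "?lhs = 0"
      unfolding \<alpha>ux by (auto simp: look[OF u x] ne in_words_iff half_sorted_def intro!: sum.neutral)
    moreover have "?rhs = 0"
      using ne[of u] u by (intro sum.neutral) (fastforce simp: \<alpha>ux half_sorted_def in_words_iff)
    ultimately show ?thesis by simp
  next
    case True
    then obtain \<pi> where \<pi>: "\<pi> permutes {..<length x}" "permute_list \<pi> x = ?c"
      using mset_eq_permutation[of ?c x] by metis
    define u' where "u' = permute_list \<pi> u"
    have lx: "length x = i + b" using x by (rule length_in_words)
    have u': "u' \<in> set (words (i + b) N)" using u \<pi> lx by (simp add: u'_def permute_list_in_words)
    have \<alpha>u: "\<alpha> = wmono u' ?c"
      using wmono_permute[of \<pi> u x] \<pi> u lx by (simp add: \<alpha>ux u'_def in_words_iff)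
    have lu: "length u' = i + b" using u' by (rule length_in_words)
    have "?lhs = (\<Sum>w\<in>half_sorted i (i + b) M. \<Sum>t\<in>set (words (i + b) M).
        if wmono t ?c = wmono w ?c then (if wmono u' t = \<beta> then aext i b l w else 0) else 0)"
      unfolding \<alpha>u by (auto simp: look[OF u' gen_word_words] sum_distrib_left intro!: sum.cong)
    also have "\<dots> = (\<Sum>t\<in>set (words (i + b) M). \<Sum>w\<in>{w \<in> half_sorted i (i + b) M. wmono t ?c = wmono w ?c}.
        (if wmono u' t = \<beta> then aext i b l w else 0))"
      by (subst sum.swap) (simp add: sum.inter_filter)
    also have "\<dots> = (\<Sum>t\<in>set (words (i + b) M). if wmono u' t = \<beta> then aext i b l t else 0)"
      by (intro sum.cong refl, subst half_sorted_rep)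
         (simp_all add: altsym_sort[OF altsym_aext[OF l le_refl]] length_in_words)
    also have "\<dots> = Poly_Mapping.lookup (\<Sum>t\<in>set (words (i + b) M). wprod entry_var u' t * aext i b l t) \<beta>"
      by (auto simp: lookup_sum wprod_entry_var lookup_mult_cnst lookup_single when_def
          simp flip: aext_cnst intro!: sum.cong)
    also have "\<dots> = Poly_Mapping.lookup (afun entry_var i b l u') \<beta>"
      using tens_aext[OF l lu le_refl, of "entry_var :: _ \<Rightarrow> 'k entry_poly"] by simp
    also have "\<dots> = (\<Sum>w\<in>{w \<in> half_sorted i (i + b) N. wmono u' ?c = wmono w ?c}. Poly_Mapping.lookup (afun entry_var i b l w) \<beta>)"
      using lu by (simp add: half_sorted_rep[OF u'] altsym_sort[OF altsym_afun[OF length_awords[OF l] le_refl]])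
    also have "\<dots> = ?rhs"
      unfolding \<alpha>u by (subst sum.inter_filter) (auto intro!: sum.cong)
    finally show ?thesis .
  qed
qed

text \<open>The functor law \<open>G (B A) = G B G A\<close> for generic \<open>B\<close> and
  \<open>A\<close> in disjoint variables, applied to \<open>y\<close> and compared at the monomial
  \<open>\<beta>\<close> of \<open>B\<close> and the generator monomials of \<open>A\<close>. It is
  the coefficientwise naturality of \<open>yoneda_nt\<close>.\<close>

lemma generator_transfer:
  fixes G :: "'k::field spf"
  assumes G: "strict_poly_functor (i + b) G" and r: "r < fdim G N" and l: "l \<in> set (awords i b (i + b) M)"
    and \<beta>: "snd ` Poly_Mapping.keys \<beta> \<subseteq> {..<M}"
  shows "(\<Sum>s<fdim G M. Poly_Mapping.lookup (fpoly G M N $$ (r, s)) \<beta> *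
      (\<Sum>w\<in>half_sorted i (i + b) M. aext i b l w * Poly_Mapping.lookup (gpoly G (Suc i) y M s) (wmono w (gen_word i b)))) =
    (\<Sum>w\<in>half_sorted i (i + b) N. Poly_Mapping.lookup (gpoly G (Suc i) y N r) (wmono w (gen_word i b)) *
      Poly_Mapping.lookup (afun entry_var i b l w) \<beta>)"
proof -
  let ?c = "gen_word i b" and ?A = "shifted_mat M (Suc i) :: 'k entry_poly mat"
  let ?C = "\<lambda>N. half_sorted i (i + b) N" and ?F = "gpoly G (Suc i) y N r"
  note D = strict_poly_functorD[OF G]
  have hi: "snd ` Poly_Mapping.keys (wmono w (map ((+) M) ?c)) \<subseteq> {M..}" for w
    using snd_keys_wmono[of w "map ((+) M) ?c"] by auto
  have "Poly_Mapping.lookup (fpoly G M N $$ (r, s)) \<beta> * Poly_Mapping.lookup (gpoly G (Suc i) y M s) (wmono w ?c) =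
      Poly_Mapping.lookup (fpoly G M N $$ (r, s) * peval ?A (gpoly G (Suc i) y M s)) (wmono w (map ((+) M) ?c) + \<beta>)"
    if s: "s < fdim G M" and w: "w \<in> ?C M" for s w
  proof -
    note hom = gpoly_homogeneous[OF G s, of "Suc i" y]
    have low: "snd ` Poly_Mapping.keys \<alpha> \<subseteq> {..<M}" if "\<alpha> \<in> Poly_Mapping.keys (fpoly G M N $$ (r, s))" for \<alpha>
      using D(3)[OF r s] that by (force simp: homogeneous_in_def)
    show ?thesis
      by (simp only: lookup_mult_split_vars[OF low peval_shifted(2)[OF hom] \<beta> hi]
          peval_shifted(1)[OF hom in_words_half_sorted[OF w] gen_word_words])
  qed
  then have "(\<Sum>s<fdim G M. Poly_Mapping.lookup (fpoly G M N $$ (r, s)) \<beta> *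
      (\<Sum>w\<in>?C M. aext i b l w * Poly_Mapping.lookup (gpoly G (Suc i) y M s) (wmono w ?c))) =
    (\<Sum>s<fdim G M. \<Sum>w\<in>?C M. aext i b l w *
      Poly_Mapping.lookup (fpoly G M N $$ (r, s) * peval ?A (gpoly G (Suc i) y M s)) (wmono w (map ((+) M) ?c) + \<beta>))"
    by (auto simp: sum_distrib_left mult.left_commute intro!: sum.cong)
  also have "\<dots> = (\<Sum>w\<in>?C M. aext i b l w * Poly_Mapping.lookup (peval (generic_mat N M * ?A) ?F) (wmono w (map ((+) M) ?c) + \<beta>))"
    unfolding peval_gpoly_mult[OF G r shifted_mat_carrier] lookup_sum sum_distrib_left by (rule sum.swap)
  also have "\<dots> = (\<Sum>\<alpha>\<in>Poly_Mapping.keys ?F. Poly_Mapping.lookup ?F \<alpha> * (\<Sum>w\<in>?C M. aext i b l w *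
      Poly_Mapping.lookup (monom_eval (generic_mat N M * ?A) \<alpha>) (wmono w (map ((+) M) ?c) + \<beta>)))"
    unfolding peval_def lookup_sum lookup_cnst_mult sum_distrib_left by (subst sum.swap) (simp add: mult_ac)
  also have "\<dots> = (\<Sum>\<alpha>\<in>Poly_Mapping.keys ?F. Poly_Mapping.lookup ?F \<alpha> *
      (\<Sum>w\<in>?C N. if wmono w ?c = \<alpha> then Poly_Mapping.lookup (afun entry_var i b l w) \<beta> else 0))"
    using gpoly_homogeneous[OF G r, of "Suc i" y]
    by (intro sum.cong refl arg_cong2[of _ _ _ _ "(*)"] generator_monomial_transfer[OF _ _ l \<beta>]) (auto simp: homogeneous_in_alt)
  also have "\<dots> = (\<Sum>w\<in>?C N. \<Sum>\<alpha>\<in>Poly_Mapping.keys ?F. if \<alpha> = wmono w ?c then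
      Poly_Mapping.lookup ?F \<alpha> * Poly_Mapping.lookup (afun entry_var i b l w) \<beta> else 0)"
    unfolding sum_distrib_left by (subst sum.swap) (auto intro!: sum.cong)
  also have "\<dots> = (\<Sum>w\<in>?C N. Poly_Mapping.lookup ?F (wmono w ?c) * Poly_Mapping.lookup (afun entry_var i b l w) \<beta>)"
    by (intro sum.cong refl) (simp add: in_keys_iff)
  finally show ?thesis .
qed

text \<open>The map sending the generator to the part of \<open>y\<close> that can be its image.
  Reading off the coefficients over \<open>gen_word\<close> projects \<open>y\<close> to the right
  weight, and pairing with \<open>aext\<close> and dividing by \<open>i!\<close> antisymmetrizes it,
  so \<open>y\<close> may be arbitrary.\<close>

definition yoneda_nt :: "'k::field spf \<Rightarrow> nat \<Rightarrow> nat \<Rightarrow> (nat \<Rightarrow> 'k) \<Rightarrow> nat \<Rightarrow> 'k mat" where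
  "yoneda_nt G i b y = (\<lambda>N. mat (fdim G N) (length (awords i b (i + b) N)) (\<lambda>(r, j).
     inverse (of_nat (fact i)) * (\<Sum>w\<in>half_sorted i (i + b) N. aext i b (awords i b (i + b) N ! j) w *
       Poly_Mapping.lookup (gpoly G (Suc i) y N r) (wmono w (gen_word i b)))))"

lemma yoneda_nat_trans:
  fixes G :: "'k::field spf"
  assumes G: "strict_poly_functor (i + b) G"
  shows "yoneda_nt G i b y \<in> nat_trans (aspf i b (i + b)) G"
proof (rule nat_transI)
  let ?P = "aspf i b (i + b) :: 'k spf" and ?h = "yoneda_nt G i b y" and ?L = "\<lambda>N. awords i b (i + b) N"
  note D = strict_poly_functorD[OF G]
  have dP: "fdim ?P N = length (?L N)" for N by (simp add: aspf_def)
  have hc: "?h N \<in> carrier_mat (fdim G N) (fdim ?P N)" for N by (simp add: yoneda_nt_def dP)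
  then show "?h N \<in> carrier_mat (fdim G N) (fdim ?P N)" for N .
  have hcc: "cmat (?h N) \<in> carrier_mat (fdim G N) (fdim ?P N)" for N using hc by simp
  have Pc: "fpoly ?P M N \<in> carrier_mat (fdim ?P N) (fdim ?P M)" for M N by (simp add: aspf_def)
  show "fpoly G M N * cmat (?h M) = cmat (?h N) * fpoly ?P M N" for M N
  proof (rule eq_matI)
    fix r j assume "r < dim_row (cmat (?h N) * fpoly ?P M N)" "j < dim_col (cmat (?h N) * fpoly ?P M N)"
    then have r: "r < fdim G N" and j: "j < fdim ?P M" using hcc[of N] Pc[of M N] by auto
    let ?l = "?L M ! j"
    have l: "?l \<in> set (?L M)" using j by (simp add: dP)
    let ?S = "\<lambda>w. \<Sum>j'<length (?L N). aext i b (?L N ! j') w * (afun entry_var i b ?l (?L N ! j') :: 'k entry_poly)"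
    have S: "?S w = afun entry_var i b ?l w" if "w \<in> half_sorted i (i + b) N" for w
      using altsym_expand[OF altsym_afun[OF length_awords[OF l] le_refl] in_words_half_sorted[OF that] le_refl,
          of "entry_var :: _ \<Rightarrow> 'k entry_poly"]
        sum_nth_distinct[OF distinct_awords[of i b "i + b" N], of "\<lambda>l'. aext i b l' w * (afun entry_var i b ?l l' :: 'k entry_poly)"] by simp
    have "(fpoly G M N * cmat (?h M)) $$ (r, j) = (\<Sum>s<fdim G M. fpoly G M N $$ (r, s) * cnst (?h M $$ (s, j)))"
      unfolding index_mult_mat_sum[OF D(2) hcc r j] using j hc[of M] by (intro sum.cong) auto
    moreover have "(cmat (?h N) * fpoly ?P M N) $$ (r, j) =
        (\<Sum>j'<fdim ?P N. cnst (?h N $$ (r, j')) * afun entry_var i b ?l (?L N ! j'))"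
      unfolding index_mult_mat_sum[OF hcc Pc r j] using r j hc[of N] by (intro sum.cong) (auto simp: aspf_def)
    moreover have "(\<Sum>s<fdim G M. fpoly G M N $$ (r, s) * cnst (?h M $$ (s, j))) =
        (\<Sum>j'<fdim ?P N. cnst (?h N $$ (r, j')) * (afun entry_var i b ?l (?L N ! j') :: 'k entry_poly))"
    proof (rule poly_mapping_eqI)
      fix \<beta>
      let ?c = "inverse (of_nat (fact i)) :: 'k"
      have lhs: "Poly_Mapping.lookup (\<Sum>s<fdim G M. fpoly G M N $$ (r, s) * cnst (?h M $$ (s, j))) \<beta> =
          ?c * (\<Sum>s<fdim G M. Poly_Mapping.lookup (fpoly G M N $$ (r, s)) \<beta> * (\<Sum>w\<in>half_sorted i (i + b) M. aext i b ?l w *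
            Poly_Mapping.lookup (gpoly G (Suc i) y M s) (wmono w (gen_word i b))))"
      proof -
        have "?h M $$ (s, j) = ?c * (\<Sum>w\<in>half_sorted i (i + b) M. aext i b ?l w *
            Poly_Mapping.lookup (gpoly G (Suc i) y M s) (wmono w (gen_word i b)))" if "s < fdim G M" for s
          using that j by (simp add: yoneda_nt_def dP)
        then show ?thesis
          unfolding lookup_sum lookup_mult_cnst
          by (subst sum_distrib_left) (intro sum.cong refl, simp only: mult.left_commute lessThan_iff)
      qed
      have "Poly_Mapping.lookup (\<Sum>j'<fdim ?P N. cnst (?h N $$ (r, j')) * (afun entry_var i b ?l (?L N ! j') :: 'k entry_poly)) \<beta> =
          (\<Sum>j'<length (?L N). \<Sum>w\<in>half_sorted i (i + b) N. ?c * (Poly_Mapping.lookup (gpoly G (Suc i) y N r) (wmono w (gen_word i b)) *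
            (aext i b (?L N ! j') w * Poly_Mapping.lookup (afun entry_var i b ?l (?L N ! j') :: 'k entry_poly) \<beta>)))"
        using r by (auto simp: lookup_sum lookup_cnst_mult lookup_mult_cnst yoneda_nt_def dP sum_distrib_left sum_distrib_right mult_ac
            intro!: sum.cong)
      also have "\<dots> = ?c * (\<Sum>w\<in>half_sorted i (i + b) N. Poly_Mapping.lookup (gpoly G (Suc i) y N r) (wmono w (gen_word i b)) *
            Poly_Mapping.lookup (?S w) \<beta>)"
        by (subst sum.swap) (auto simp: lookup_sum lookup_cnst_mult sum_distrib_left simp flip: aext_cnst intro!: sum.cong)
      also have "\<dots> = ?c * (\<Sum>w\<in>half_sorted i (i + b) N. Poly_Mapping.lookup (gpoly G (Suc i) y N r) (wmono w (gen_word i b)) *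
            Poly_Mapping.lookup (afun entry_var i b ?l w) \<beta>)"
        by (intro arg_cong2[of _ _ _ _ "(*)"] sum.cong refl) (simp only: S)
      finally have rhs: "Poly_Mapping.lookup (\<Sum>j'<fdim ?P N. cnst (?h N $$ (r, j')) * (afun entry_var i b ?l (?L N ! j') :: 'k entry_poly)) \<beta> =
          ?c * (\<Sum>w\<in>half_sorted i (i + b) N. Poly_Mapping.lookup (gpoly G (Suc i) y N r) (wmono w (gen_word i b)) *
            Poly_Mapping.lookup (afun entry_var i b ?l w) \<beta>)" .
      show "Poly_Mapping.lookup (\<Sum>s<fdim G M. fpoly G M N $$ (r, s) * cnst (?h M $$ (s, j))) \<beta> =
        Poly_Mapping.lookup (\<Sum>j'<fdim ?P N. cnst (?h N $$ (r, j')) * (afun entry_var i b ?l (?L N ! j') :: 'k entry_poly)) \<beta>"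
      \<comment> \<open>If \<open>\<beta>\<close> involves a column outside the source
        \<open>k\<^sup>M\<close>, its coefficient is zero on both sides.\<close>
      proof (cases "snd ` Poly_Mapping.keys \<beta> \<subseteq> {..<M}")
        case True
        show ?thesis unfolding lhs rhs generator_transfer[OF G r l True] ..
      next
        case False
        have "Poly_Mapping.lookup (fpoly G M N $$ (r, s)) \<beta> = 0" if "s < fdim G M" for s
        proof (rule ccontr)
          assume "Poly_Mapping.lookup (fpoly G M N $$ (r, s)) \<beta> \<noteq> 0"
          then have "\<beta> \<in> Poly_Mapping.keys (fpoly G M N $$ (r, s))" by (simp add: in_keys_iff)
          then have "Poly_Mapping.keys \<beta> \<subseteq> {..<N} \<times> {..<M}" using D(3)[OF r that] unfolding homogeneous_in_def by blast
          then show False using False by auto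
        qed
        moreover have "Poly_Mapping.lookup (afun entry_var i b ?l w :: 'k entry_poly) \<beta> = 0" if "w \<in> half_sorted i (i + b) N" for w
        proof -
          have "wmono w t \<noteq> \<beta>" if "t \<in> set (words (i + b) M)" for t
            using False snd_keys_wmono[of w t] that by (auto simp: in_words_iff)
          then show ?thesis
            using tens_aext[OF l length_in_words[OF in_words_half_sorted[OF that]] le_refl, of "entry_var :: _ \<Rightarrow> 'k entry_poly", symmetric]
            by (auto simp: lookup_sum wprod_entry_var lookup_mult_cnst lookup_single when_def
                simp flip: aext_cnst intro!: sum.neutral)
        qed
        ultimately show ?thesis unfolding lhs rhs by simp
      qed
    qed
    ultimately show "(fpoly G M N * cmat (?h M)) $$ (r, j) = (cmat (?h N) * fpoly ?P M N) $$ (r, j)" by simp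
  qed (simp_all add: carrier_matD[OF hc] carrier_matD[OF Pc] fpoly_dim[OF D(1)])
qed

text \<open>A map out of the term is the same as the image of its generator, so lifting along an
  epimorphism only needs a preimage of one vector.\<close>

lemma projective_aspf:
  assumes fact: "of_nat (fact i) \<noteq> (0 :: 'k::field)"
  shows "projective_functor (i + Suc k) (aspf i (Suc k) (i + Suc k) :: 'k spf)"
  unfolding projective_functor_def
proof (intro conjI allI impI ballI)
  let ?b = "Suc k" and ?P = "aspf i (Suc k) (i + Suc k) :: 'k spf" and ?L = "\<lambda>N. awords i (Suc k) (i + Suc k) N"
  note [simp del] = add_Suc_right
  show "strict_poly_functor (i + ?b) ?P" by (rule strict_aspf) simp
  fix G H :: "'k spf" and g f
  assume G: "strict_poly_functor (i + ?b) G" and H: "strict_poly_functor (i + ?b) H"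
    and g: "g \<in> nat_trans G H" and epi: "epi_nt g" and f: "f \<in> nat_trans ?P H"
  note Gc = strict_poly_functorD(1)[OF G] and Hc = strict_poly_functorD(1)[OF H]
  obtain j0 where j0: "j0 < length (?L (Suc i))" "?L (Suc i) ! j0 = gen_word i ?b"
    using gen_word_awords[of i k] by (auto simp: in_set_conv_nth)
  have dP: "fdim ?P N = length (?L N)" for N by (simp add: aspf_def)
  have "mat_image (g (Suc i)) = carrier_vec (fdim H (Suc i))"
    using epi nat_transD(2)[OF g] by (simp add: epi_nt_def)
  moreover have "col (f (Suc i)) j0 \<in> carrier_vec (fdim H (Suc i))"
  proof -
    have "j0 < fdim ?P (Suc i)" using j0(1) by (simp only: dP)
    then show ?thesis by (rule col_carrier_vec[OF _ nat_transD(1)[OF f]])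
  qed
  ultimately have "col (f (Suc i)) j0 \<in> mat_image (g (Suc i))" by simp
  \<comment> \<open>This preimage need not have the weight or the signs of the generator;
    \<open>yoneda_nt\<close> takes care of both.\<close>
  then obtain yv where yv: "yv \<in> carrier_vec (fdim G (Suc i))" "col (f (Suc i)) j0 = g (Suc i) *\<^sub>v yv"
    unfolding mat_image_iff[OF nat_transD(1)[OF g]] by blast
  define y where "y q = yv $ q" for q
  have fy: "f (Suc i) $$ (q, j0) = (\<Sum>q'<fdim G (Suc i). g (Suc i) $$ (q, q') * y q')" if "q < fdim H (Suc i)" for q
  proof -
    have "f (Suc i) $$ (q, j0) = col (f (Suc i)) j0 $ q"
    proof -
      have "j0 < fdim ?P (Suc i)" using j0(1) by (simp only: dP)
      then show ?thesis using that by (simp add: nat_transD(2,3)[OF f])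
    qed
    then show ?thesis
      using that yv nat_transD(2,3)[OF g] by (simp add: scalar_prod_def atLeast0LessThan y_def)
  qed
  \<comment> \<open>By naturality \<open>g\<close> takes what a generic matrix makes of
    \<open>y\<close> to what it makes of the image of the generator under \<open>f\<close>.\<close>
  have gp: "(\<Sum>s<fdim G N. cnst (g N $$ (r, s)) * gpoly G (Suc i) y N s) = gpoly H (Suc i) (\<lambda>q. f (Suc i) $$ (q, j0)) N r"
    if r: "r < fdim H N" for N r
  proof -
    have gc: "cmat (g m) \<in> carrier_mat (fdim H m) (fdim G m)" for m using nat_transD(1)[OF g] by simp
    have "(\<Sum>s<fdim G N. cnst (g N $$ (r, s)) * fpoly G (Suc i) N $$ (s, q)) =
        (\<Sum>q'<fdim H (Suc i). fpoly H (Suc i) N $$ (r, q') * cnst (g (Suc i) $$ (q', q)))" if q: "q < fdim G (Suc i)" for q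
    proof -
      have "(cmat (g N) * fpoly G (Suc i) N) $$ (r, q) = (fpoly H (Suc i) N * cmat (g (Suc i))) $$ (r, q)"
        by (simp add: nat_transD(4)[OF g])
      then show ?thesis
        unfolding index_mult_mat_sum[OF gc strict_poly_functorD(2)[OF G] r q] index_mult_mat_sum[OF strict_poly_functorD(2)[OF H] gc r q]
        using r q nat_transD(2,3)[OF g] by simp
    qed
    then have "(\<Sum>q<fdim G (Suc i). (\<Sum>s<fdim G N. cnst (g N $$ (r, s)) * fpoly G (Suc i) N $$ (s, q)) * cnst (y q)) =
        (\<Sum>q<fdim G (Suc i). (\<Sum>q'<fdim H (Suc i). fpoly H (Suc i) N $$ (r, q') * cnst (g (Suc i) $$ (q', q))) * cnst (y q))"
      by (intro sum.cong) auto
    moreover have "(\<Sum>q<fdim G (Suc i). (\<Sum>s<fdim G N. cnst (g N $$ (r, s)) * fpoly G (Suc i) N $$ (s, q)) * cnst (y q)) =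
        (\<Sum>s<fdim G N. cnst (g N $$ (r, s)) * gpoly G (Suc i) y N s)"
      unfolding gpoly_def sum_distrib_left sum_distrib_right by (subst sum.swap) (simp add: mult.assoc)
    moreover have "(\<Sum>q<fdim G (Suc i). (\<Sum>q'<fdim H (Suc i). fpoly H (Suc i) N $$ (r, q') * cnst (g (Suc i) $$ (q', q))) * cnst (y q)) =
        gpoly H (Suc i) (\<lambda>q. f (Suc i) $$ (q, j0)) N r"
    proof -
      interpret c: comm_ring_hom "cnst :: 'k \<Rightarrow> 'k entry_poly" by (rule comm_ring_hom_cnst)
      show ?thesis
        unfolding gpoly_def sum_distrib_right
        by (subst sum.swap) (auto simp: fy c.hom_sum cnst_mult sum_distrib_left mult.assoc intro!: sum.cong)
    qed
    ultimately show ?thesis by simp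
  qed
  let ?h = "yoneda_nt G i ?b y"
  have h: "?h \<in> nat_trans ?P G" by (rule yoneda_nat_trans[OF G])
  have "comp_nt g ?h = f"
  proof (rule nt_eqI[OF nat_trans_comp[OF h g spf_carrier_aspf Gc Hc] f])
    fix N r j assume r: "r < fdim H N" and j: "j < fdim ?P N"
    let ?l = "?L N ! j"
    have l: "?l \<in> set (?L N)" using j by (simp add: dP)
    let ?c = "inverse (of_nat (fact i)) :: 'k"
    have "comp_nt g ?h N $$ (r, j) = (\<Sum>s<fdim G N. g N $$ (r, s) * ?h N $$ (s, j))"
      unfolding comp_nt_def by (rule index_mult_mat_sum[OF nat_transD(1)[OF g] nat_transD(1)[OF h] r j])
    also have "\<dots> = ?c * (\<Sum>w\<in>half_sorted i (i + ?b) N. aext i ?b ?l w *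
        Poly_Mapping.lookup (\<Sum>s<fdim G N. cnst (g N $$ (r, s)) * gpoly G (Suc i) y N s) (wmono w (gen_word i ?b)))"
      unfolding lookup_sum lookup_cnst_mult sum_distrib_left using j
      by (subst sum.swap) (auto simp: yoneda_nt_def dP sum_distrib_left mult_ac intro!: sum.cong)
    also have "\<dots> = ?c * (\<Sum>w\<in>half_sorted i (i + ?b) N. aext i ?b ?l w *
        (\<Sum>j'<length (?L N). f N $$ (r, j') * aext i ?b (?L N ! j') w))"
      unfolding gp[OF r]
      by (intro arg_cong2[of _ _ _ _ "(*)"] sum.cong refl lookup_gpoly_nat_trans[OF f Hc j0 r])
         (simp add: half_sorted_def in_words_iff)
    also have "\<dots> = ?c * (\<Sum>j'<length (?L N). f N $$ (r, j') *
        (\<Sum>w\<in>half_sorted i (i + ?b) N. aext i ?b ?l w * aext i ?b (?L N ! j') w))"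
      unfolding sum_distrib_left by (subst sum.swap) (simp add: mult_ac)
    \<comment> \<open>Basis tensors are orthogonal under the sum over \<open>half_sorted\<close>,
      with square \<open>i!\<close>, which cancels the inverse in \<open>yoneda_nt\<close>.\<close>
    also have "\<dots> = ?c * (\<Sum>j'<length (?L N). if j' = j then f N $$ (r, j') * of_nat (fact i) else 0)"
    proof (intro arg_cong2[of _ _ _ _ "(*)"] sum.cong refl)
      fix j' assume j': "j' \<in> {..<length (?L N)}"
      then have l': "?L N ! j' \<in> set (?L N)" by simp
      show "f N $$ (r, j') * (\<Sum>w\<in>half_sorted i (i + ?b) N. aext i ?b ?l w * aext i ?b (?L N ! j') w) =
          (if j' = j then f N $$ (r, j') * of_nat (fact i) else 0)"
        unfolding sum_half_sorted_aext[OF altsym_aext[OF l' le_refl] l] aext_awords[OF l' l le_refl]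
        using j j' by (auto simp: dP nth_eq_iff_index_eq[OF distinct_awords])
    qed
    also have "\<dots> = f N $$ (r, j)" using j fact by (simp add: dP)
    finally show "comp_nt g ?h N $$ (r, j) = f N $$ (r, j)" .
  qed
  then show "\<exists>h\<in>nat_trans ?P G. comp_nt g h = f" using h by blast
qed

section \<open>Homomorphisms between Koszul terms\<close>

lemma altsym_sum:
  assumes "\<And>j. j \<in> I \<Longrightarrow> altsym a b e (t j)"
  shows "altsym a b e (\<lambda>w. \<Sum>j\<in>I. t j w)"
  unfolding altsym_def
proof (intro conjI allI impI)
  fix J u :: "nat list" and \<sigma> assume *: "length J = a" "length u = e - a" "\<sigma> permutes {..<a}"
  show "(\<Sum>j\<in>I. t j (permute_list \<sigma> J @ u)) = of_int (sign \<sigma>) * (\<Sum>j\<in>I. t j (J @ u))"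
    unfolding sum_distrib_left by (rule sum.cong[OF refl]) (rule altsymD(1)[OF assms *])
next
  fix J u :: "nat list" assume *: "length J = a" "length u = e - a" "\<not> distinct J"
  show "(\<Sum>j\<in>I. t j (J @ u)) = 0" by (rule sum.neutral) (auto intro: altsymD(2)[OF assms *])
next
  fix J K K' u :: "nat list" assume *: "length J = a" "length K = b" "length u = e - a - b" "mset K = mset K'"
  show "(\<Sum>j\<in>I. t j (J @ K @ u)) = (\<Sum>j\<in>I. t j (J @ K' @ u))"
    by (rule sum.cong[OF refl]) (rule altsymD(3)[OF assms *])
qed

lemma mset_gen_word: "mset (gen_word i b) = mset [0..<i] + replicate_mset b i"
  by (simp add: gen_word_def)

lemma count_gen_word: "count (mset (gen_word i b)) a = (if a < i then 1 else if a = i then b else 0)"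
  by (auto simp: mset_gen_word count_mset_set simp flip: mset_set_upto_eq_mset_upto)

lemma take_gen_word: "take i (gen_word i b) = [0..<i]" "drop i (gen_word i b) = replicate b i"
  by (simp_all add: gen_word_def)

text \<open>The vector \<open>x\<close> is the image of the standard generator of \<open>\<Gamma>\<^sup>b \<otimes> \<Lambda>\<^sup>i\<close>: it has the weight
  of \<open>gen_word i b\<close> and is antisymmetric under exchanging two of the first \<open>i\<close> letters. If it is
  also alternating and symmetric in the positions of \<open>\<Gamma>\<^sup>(\<^sup>e\<^sup>-\<^sup>j\<^sup>) \<otimes> \<Lambda>\<^sup>j\<close>, then a word in its support has
  at most one of the first \<open>i\<close> letters among the symmetric positions and letter \<open>i\<close> at most
  once among the alternating ones.\<close>

lemma generator_image_zero:
  fixes x :: "nat list \<Rightarrow> 'k::field"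
  assumes alt: "altsym j (e - j) e x" and je: "j \<le> e" and e: "e = i + b" and ij: "i \<noteq> j"
    and wt: "\<And>w. w \<in> set (words e (Suc i)) \<Longrightarrow> x w \<noteq> 0 \<Longrightarrow> mset w = mset (gen_word i b)"
    and anti: "\<And>a a' w. a < i \<Longrightarrow> a' < i \<Longrightarrow> a \<noteq> a' \<Longrightarrow> w \<in> set (words e (Suc i)) \<Longrightarrow> x (map (transpose a a') w) = - x w"
    and two: "i \<le> 1 \<or> (2 :: 'k) \<noteq> 0"
    and val: "j = Suc i \<or> i = Suc j \<Longrightarrow> x (gen_word i b) = 0"
    and w: "w \<in> set (words e (Suc i))"
  shows "x w = 0"
proof (rule ccontr)
  assume nz: "x w \<noteq> 0"
  have split_distinct: "distinct (take j v)" if "x v \<noteq> 0" "length v = e" for v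
    using altsymD(2)[OF alt, of "take j v" "drop j v"] that je by auto
  have symK: "x (J @ K) = x (J @ K')" if "length J = j" "length K = e - j" "mset K = mset K'" for J K K'
    using altsymD(3)[OF alt that(1,2), of "[]" K'] that(3) by simp
  \<comment> \<open>Whether \<open>x\<close> vanishes at a word depends only on the letters in each
    of the two blocks.\<close>
  have std: "x v = 0 \<longleftrightarrow> x (J0 @ K0) = 0"
    if v: "length v = e" "mset (take j v) = mset J0" "mset (drop j v) = mset K0" for v J0 K0
  proof -
    have l: "length J0 = j" "length K0 = e - j"
      using that je mset_eq_length[OF that(2)] mset_eq_length[OF that(3)] by simp_all
    obtain \<sigma> where \<sigma>: "\<sigma> permutes {..<length J0}" "permute_list \<sigma> J0 = take j v"
      using mset_eq_permutation[OF v(2)] by blast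
    have "x v = x (take j v @ drop j v)" by simp
    also have "\<dots> = x (permute_list \<sigma> J0 @ K0)"
      unfolding \<sigma>(2) using that je by (intro symK) auto
    also have "\<dots> = of_int (sign \<sigma>) * x (J0 @ K0)"
      using \<sigma>(1) l by (intro altsymD(1)[OF alt]) auto
    finally show ?thesis by (auto simp: sign_def)
  qed
  define J K where "J = take j w" and "K = drop j w"
  have len: "length w = e" "length J = j" "length K = e - j" using w je by (auto simp: in_words_iff J_def K_def)
  have wJK: "w = J @ K" by (simp add: J_def K_def)
  have mw: "mset J + mset K = mset (gen_word i b)" using wt[OF w nz] by (simp add: wJK)
  have cnt: "count (mset J) a + count (mset K) a = (if a < i then 1 else if a = i then b else 0)" for a
    using arg_cong[OF mw, of "\<lambda>M. count M a"] by (simp add: count_gen_word)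
  have pos: "count (mset X) y \<ge> 1" if "y \<in> set X" for X and y :: nat
    using that by (simp add: Suc_le_eq)
  have inK: "count (mset K) y = 1 \<and> y \<notin> set J" if "y < i" "y \<in> set K" for y
  proof -
    have c: "count (mset J) y + count (mset K) y = 1" using cnt[of y] that(1) by simp
    have "y \<notin> set J" using c pos[OF that(2)] pos[of y J] by linarith
    moreover have "count (mset K) y = 1" using c pos[OF that(2)] by linarith
    ultimately show ?thesis by simp
  qed
  have dJ: "distinct J" using split_distinct[OF nz len(1)] by (simp add: J_def)
  \<comment> \<open>Exchanging two of the first \<open>i\<close> letters that both sit in symmetric
    positions only permutes those positions, so \<open>x w\<close> equals its own negative.\<close>
  have one: "a = a'" if a: "a < i" "a' < i" "a \<in> set K" "a' \<in> set K" for a a'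
  proof (rule ccontr)
    assume ne: "a \<noteq> a'"
    have ca: "count (mset K) a = 1" "count (mset K) a' = 1" "a \<notin> set J" "a' \<notin> set J"
      using inK[OF a(1,3)] inK[OF a(2,4)] by auto
    have "map (transpose a a') J = J" using ca(3,4) by (intro map_idI) (auto simp: transpose_def)
    moreover have "mset (map (transpose a a') K) = mset K"
    proof -
      obtain M1 where M1: "mset K = add_mset a M1"
        using multi_member_split[of a "mset K"] a(3) by auto
      have "a' \<in># M1" using a(4) ne unfolding set_mset_mset[symmetric] M1 by simp
      then obtain M where M: "M1 = add_mset a' M" using multi_member_split by metis
      have "a \<notin># M" "a' \<notin># M" using ca(1,2) ne by (auto simp: M1 M count_eq_zero_iff)
      then have "image_mset (transpose a a') M = image_mset id M"
        by (intro image_mset_cong) (auto simp: transpose_def)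
      then show ?thesis using ne by (simp add: M1 M transpose_def add_mset_commute)
    qed
    ultimately have "x (map (transpose a a') w) = x w"
      unfolding wJK map_append using symK[OF len(2), of "map (transpose a a') K" K] len(3) by simp
    then have "x w = - x w" using anti[OF a(1,2) ne w] by simp
    then have "2 * x w = 0" by (metis add.right_inverse mult_2)
    moreover have "(2 :: 'k) \<noteq> 0" using two a(1,2) ne by auto
    ultimately show False using nz by simp
  qed
  \<comment> \<open>Each of the first \<open>i\<close> letters occurs once in \<open>w\<close>, so
    those missing from the alternating block are in the symmetric one; by \<open>one\<close> there
    is at most one.\<close>
  define D where "D = {..<i} - set J"
  have DK: "a \<in> set K" if "a \<in> D" for a
  proof (rule ccontr)
    assume "a \<notin> set K"
    then have z: "count (mset K) a = 0" "count (mset J) a = 0" using that by (auto simp: D_def count_eq_zero_iff)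
    have "a < i" using that by (simp add: D_def)
    then show False using cnt[of a] unfolding z by simp
  qed
  have sJ: "set J \<subseteq> {..i}" using w by (auto simp: wJK in_words_iff less_Suc_eq_le)
  have cD: "card D \<le> 1"
  proof (cases "D = {}")
    case False
    then obtain a where a: "a \<in> D" by blast
    then have "D \<subseteq> {a}" using one[of _ a] DK by (auto simp: D_def)
    then show ?thesis by (metis card.empty card_mono finite.emptyI finite.insertI card_insert_disjoint One_nat_def empty_iff)
  qed simp
  have cJ: "card (set J) = j" using dJ len distinct_card by fastforce
  have cI: "card (set J \<inter> {..<i}) + card D = i"
    unfolding D_def using card_Int_Diff[of "{..<i}" "set J"] by (simp add: Int_commute)
  \<comment> \<open>Counting the distinct letters of \<open>J\<close>: with the letter
    \<open>i\<close> there are \<open>i + 1 - card D\<close> of them, without it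
    \<open>i - card D\<close>. As \<open>i \<noteq> j\<close>, this forces \<open>j = i + 1\<close>
    with none missing, or \<open>j = i - 1\<close> with one missing.\<close>
  show False
  proof (cases "i \<in> set J")
    case True
    then have "set J = insert i (set J \<inter> {..<i})" using sJ by (auto simp: less_le)
    then have "card (set J) = Suc (card (set J \<inter> {..<i}))"
      by (metis card_insert_disjoint finite_Int finite_lessThan Int_iff lessThan_iff less_irrefl)
    then have "j = Suc i" "card D = 0" using cJ cI cD ij by linarith+
    then have j: "j = Suc i" "D = {}" by (simp_all add: D_def)
    have "set J = set [0..<Suc i]" using sJ j(2) True by (auto simp: D_def)
    then have mJ: "mset J = mset [0..<Suc i]" using dJ set_eq_iff_mset_eq_distinct distinct_upt by blast
    have "b > 0" using j(1) je e by simp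
    then have g: "gen_word i b = [0..<Suc i] @ replicate (b - 1) i"
      by (cases b) (simp_all add: gen_word_def)
    have "mset K = mset (replicate (b - 1) i)" using mw unfolding g mset_append mJ by simp
    then have "x w = 0 \<longleftrightarrow> x (gen_word i b) = 0"
      unfolding g using std[OF len(1), of "[0..<Suc i]" "replicate (b - 1) i"] mJ by (simp add: J_def K_def del: upt_Suc)
    then show False using val j nz by simp
  next
    case False
    then have "set J \<inter> {..<i} = set J" using sJ by (auto simp: less_le)
    then have j: "i = Suc j" "card D = 1" using cJ cI cD ij by auto
    then obtain a where a: "D = {a}" by (metis card_1_singletonE)
    have ai: "a < i" "a \<notin> set J" using a by (auto simp: D_def)
    \<comment> \<open>Renaming letters makes \<open>j\<close> the one outside the alternating block;
      the renaming changes \<open>x\<close> by a sign at most and leads to the generator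
      word.\<close>
    define w' where "w' = map (transpose a j) w"
    have w'w: "w' \<in> set (words e (Suc i))"
      using w ai j by (auto simp: w'_def in_words_iff transpose_def)
    have nz': "x w' \<noteq> 0"
    proof (cases "a = j")
      case False
      then show ?thesis using anti[OF ai(1) _ False w] j nz by (simp add: w'_def)
    qed (use nz in \<open>simp add: w'_def\<close>)
    have len': "length w' = e" using w'w by (simp add: in_words_iff)
    have "set (take j w') = {..<j}"
    proof -
      have "set J = {..<i} - {a}" using a \<open>set J \<inter> {..<i} = set J\<close> by (auto simp: D_def)
      moreover have "take j w' = map (transpose a j) J" by (simp add: w'_def J_def take_map)
      ultimately have "set (take j w') = transpose a j ` ({..<i} - {a})" by simp
      also have "\<dots> = transpose a j ` {..<i} - transpose a j ` {a}"
        by (rule image_set_diff) (rule inj_transpose)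
      also have "transpose a j ` {..<i} = {..<i}" using ai j by (intro permutes_image permutes_swap_id) auto
      also have "{..<i} - transpose a j ` {a} = {..<j}" unfolding j(1) by (auto simp: less_Suc_eq)
      finally show ?thesis .
    qed
    then have m1: "mset (take j w') = mset [0..<j]"
      using split_distinct[OF nz' len'] set_eq_iff_mset_eq_distinct[of "take j w'" "[0..<j]"] distinct_upt
      by (metis atLeast_upt)
    have g: "gen_word i b = [0..<j] @ j # replicate b i" by (simp add: gen_word_def j(1))
    have "mset (take j w') + mset (drop j w') = mset (gen_word i b)"
      unfolding mset_append[symmetric] append_take_drop_id by (rule wt[OF w'w nz'])
    then have "mset (drop j w') = mset (j # replicate b i)" unfolding g mset_append m1 by simp
    then have "x w' = 0 \<longleftrightarrow> x (gen_word i b) = 0"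
      unfolding g using std[OF len' m1] by blast
    then show False using val j nz' by simp
  qed
qed

definition kos :: "nat \<Rightarrow> nat \<Rightarrow> 'k::field spf" where
  "kos p i = aspf i (p - i) p"

text \<open>The coefficient of the generator word in the image of the generator. It is 1 for the
  Koszul differential and, when its source has index below \<open>p\<close>, for the codifferential;
  between adjacent Koszul terms it determines the map.\<close>

definition gval :: "nat \<Rightarrow> nat \<Rightarrow> (nat \<Rightarrow> 'k::field mat) \<Rightarrow> 'k" where
  "gval p i h = h (Suc i) $$
     (THE r. r < length (words p (Suc i)) \<and> words p (Suc i) ! r = gen_word i (p - i),
      THE j. j < length (awords i (p - i) p (Suc i)) \<and> awords i (p - i) p (Suc i) ! j = gen_word i (p - i))"

lemma the_index:
  assumes "distinct xs" "x \<in> set xs"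
  shows "(THE r. r < length xs \<and> xs ! r = x) < length xs" "xs ! (THE r. r < length xs \<and> xs ! r = x) = x"
proof -
  have "\<exists>!r. r < length xs \<and> xs ! r = x" using assms by (metis in_set_conv_nth nth_eq_iff_index_eq)
  from theI'[OF this] show "(THE r. r < length xs \<and> xs ! r = x) < length xs" "xs ! (THE r. r < length xs \<and> xs ! r = x) = x" by auto
qed

lemma gen_word_mem:
  assumes "i < p"
  shows "gen_word i (p - i) \<in> set (words p (Suc i))" "gen_word i (p - i) \<in> set (awords i (p - i) p (Suc i))"
  using gen_word_awords[of i "p - Suc i"] assms by (auto simp: in_awords_iff Suc_diff_Suc)

lemma gval_labelled:
  assumes "i < p" "h (Suc i) = labelled_mat (words p (Suc i)) (awords i (p - i) p (Suc i)) m"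
  shows "gval p i h = m (gen_word i (p - i)) (gen_word i (p - i))"
  unfolding gval_def assms(2)
  using the_index[OF distinct_words gen_word_mem(1)[OF assms(1)]] the_index[OF distinct_awords gen_word_mem(2)[OF assms(1)]]
  by simp

text \<open>Compares coefficients in \<open>lookup_gpoly_nat_trans\<close> for the tensor power,
  where the entries of the generic action are single monomials.\<close>

lemma generator_column:
  fixes h :: "nat \<Rightarrow> 'k::field mat"
  assumes i: "i < p" and h: "h \<in> nat_trans (kos p i) (tens p)"
    and m: "\<And>N. h N = labelled_mat (words p N) (awords i (p - i) p N) (m N)"
    and w: "w \<in> set (words p N)" and u: "length u = p"
  shows "(\<Sum>v\<in>set (words p (Suc i)). if wmono w v = wmono u (gen_word i (p - i)) then m (Suc i) v (gen_word i (p - i)) else 0) =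
    (\<Sum>l\<in>set (awords i (p - i) p N). m N w l * aext i (p - i) l u)"
proof -
  define b where "b = p - i"
  have p: "p = i + b" using i by (simp add: b_def)
  let ?T = "tens p :: 'k spf" and ?W = "words p (Suc i)"
  obtain j0 where j0: "j0 < length (awords i b (i + b) (Suc i))" "awords i b (i + b) (Suc i) ! j0 = gen_word i b"
    using gen_word_mem(2)[OF i] unfolding b_def[symmetric] p by (auto simp: in_set_conv_nth)
  obtain r where r: "r < length (words p N)" "words p N ! r = w" using w by (auto simp: in_set_conv_nth)
  have "gpoly ?T (Suc i) (\<lambda>q. h (Suc i) $$ (q, j0)) N r =
      (\<Sum>q<length ?W. wprod entry_var w (?W ! q) * cnst (m (Suc i) (?W ! q) (gen_word i b)))"
    unfolding gpoly_def using r j0 by (auto simp: tens_def m p b_def[symmetric] intro!: sum.cong)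
  also have "\<dots> = (\<Sum>v\<in>set ?W. wprod entry_var w v * cnst (m (Suc i) v (gen_word i b)))"
    by (rule sum_nth_distinct[OF distinct_words])
  finally have "Poly_Mapping.lookup (gpoly ?T (Suc i) (\<lambda>q. h (Suc i) $$ (q, j0)) N r) (wmono u (gen_word i b)) =
      (\<Sum>v\<in>set ?W. if wmono w v = wmono u (gen_word i b) then m (Suc i) v (gen_word i b) else 0)"
    by (auto simp: lookup_sum lookup_mult_cnst wprod_entry_var lookup_single when_def intro!: sum.cong)
  moreover have "Poly_Mapping.lookup (gpoly ?T (Suc i) (\<lambda>q. h (Suc i) $$ (q, j0)) N r) (wmono u (gen_word i b)) =
      (\<Sum>j<length (awords i b (i + b) N). h N $$ (r, j) * aext i b (awords i b (i + b) N ! j) u)"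
  proof (rule lookup_gpoly_nat_trans[OF _ spf_carrier_tens j0])
    show "h \<in> nat_trans (aspf i b (i + b)) ?T" using h by (simp add: kos_def b_def i less_imp_le)
  qed (use r u p in \<open>simp_all add: tens_def\<close>)
  moreover have "\<dots> = (\<Sum>j<length (awords i b p N). m N w (awords i b p N ! j) * aext i b (awords i b p N ! j) u)"
    using r by (auto simp: m b_def[symmetric] p intro!: sum.cong)
  ultimately show ?thesis
    unfolding b_def[symmetric] by (simp add: sum_nth_distinct[OF distinct_awords, where h = "\<lambda>l. m N w l * aext i b l u"])
qed

text \<open>The image of the generator inherits its behaviour under diagonal matrices and under
  exchanges of basis vectors. \<open>generator_image_zero\<close> shows that it vanishes, and then
  so does the map, which is determined by it.\<close>

lemma hom_kos_zero:
  fixes f :: "nat \<Rightarrow> 'k::field mat"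
  assumes i: "i < p" and j: "j \<le> p" and ij: "i \<noteq> j" and two: "i \<le> 1 \<or> (2 :: 'k) \<noteq> 0"
    and f: "f \<in> nat_trans (kos p i) (kos p j)"
    and val: "j = Suc i \<or> i = Suc j \<Longrightarrow> gval p i (comp_nt (aemb j (p - j) p) f) = 0"
  shows "f = zero_nt (kos p i) (kos p j)"
proof -
  define b c0 where "b = p - i" and "c0 = gen_word i b"
  have p: "p = i + b" using i by (simp add: b_def)
  have jp: "j + (p - j) \<le> p" using j by simp
  let ?L = "\<lambda>N. awords i b p N"
  define h where "h = comp_nt (aemb j (p - j) p) f"
  have E: "aemb j (p - j) p \<in> nat_trans (kos p j) (tens p :: 'k spf)" unfolding kos_def by (rule aemb_nat_trans[OF jp])
  have h: "h \<in> nat_trans (kos p i) (tens p)"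
    unfolding h_def by (rule nat_trans_comp[OF f E]) (simp_all add: kos_def spf_carrier_aspf spf_carrier_tens)
  have "\<exists>m'. f N = labelled_mat (awords j (p - j) p N) (?L N) m'" for N
    using nat_transD(1)[OF f, of N] by (intro labelled_mat_surj distinct_awords) (simp add: kos_def aspf_def b_def)
  then obtain m' where m': "\<And>N. f N = labelled_mat (awords j (p - j) p N) (?L N) (m' N)" by metis
  define m where "m N w l = (\<Sum>l'\<in>set (awords j (p - j) p N). aext j (p - j) l' w * m' N l' l)" for N w l
  have hm: "h N = labelled_mat (words p N) (?L N) (m N)" for N
    unfolding h_def comp_nt_def m' aemb_def labelled_mat_mult[OF distinct_awords] m_def by simp
  have alt: "altsym j (p - j) p (\<lambda>w. m N w l)" for N l
    unfolding m_def mult.commute[of _ "m' _ _ _"] by (intro altsym_sum altsym_scale altsym_aext jp)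
  note gc = generator_column[OF i h hm[unfolded b_def], folded b_def, folded c0_def]
  have c0: "c0 \<in> set (words p (Suc i))" "c0 \<in> set (?L (Suc i))" "length c0 = p"
    using gen_word_mem[OF i] by (simp_all add: c0_def b_def i less_imp_le)
  define x where "x w = m (Suc i) w c0" for w
  have rhs: "(\<Sum>l\<in>set (?L (Suc i)). m (Suc i) w l * aext i b l (permute_list \<sigma> c0)) = of_int (sign \<sigma>) * x w"
    if \<sigma>: "\<sigma> permutes {..<i}" for w \<sigma>
  proof -
    have "(\<Sum>l\<in>set (?L (Suc i)). m (Suc i) w l * aext i b l (permute_list \<sigma> c0)) =
        (\<Sum>l\<in>set (?L (Suc i)). if l = c0 then of_int (sign \<sigma>) * m (Suc i) w l else 0)"
    proof (rule sum.cong[OF refl])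
      fix l assume l: "l \<in> set (?L (Suc i))"
      have le: "i + b \<le> p" "i \<le> p" using p by simp_all
      have "aext i b l (permute_list \<sigma> c0) = of_int (sign \<sigma>) * (aext i b l c0 :: 'k)"
        by (rule altsym_permute[OF altsym_aext[OF l le(1)] c0(3) \<sigma> le(2)])
      also have "aext i b l c0 = (if l = c0 then 1 else 0 :: 'k)"
        by (rule aext_awords[OF l c0(2) le(1)])
      finally show "m (Suc i) w l * aext i b l (permute_list \<sigma> c0) = (if l = c0 then of_int (sign \<sigma>) * m (Suc i) w l else 0)"
        by simp
    qed
    then show ?thesis using c0(2) by (simp add: x_def)
  qed
  \<comment> \<open>The coefficient at the diagonal monomial \<open>wmono c0 c0\<close> isolates the
    weight of the generator; \<open>x\<close> is its own projection to that weight.\<close>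
  have x1: "(\<Sum>v\<in>set (words p (Suc i)). if wmono w v = wmono c0 c0 then x v else 0) = x w" if "w \<in> set (words p (Suc i))" for w
  proof -
    have "(\<Sum>v\<in>set (words p (Suc i)). if wmono w v = wmono c0 c0 then m (Suc i) v c0 else 0) = m (Suc i) w c0"
      by (rule trans[OF gc[OF that c0(3)] rhs[OF permutes_id, of w, unfolded permute_list_id sign_id of_int_1 mult_1_left x_def]])
    then show ?thesis unfolding x_def .
  qed
  have wt: "mset w = mset c0" if w: "w \<in> set (words p (Suc i))" and nz: "x w \<noteq> 0" for w
  proof -
    have "\<exists>v\<in>set (words p (Suc i)). wmono w v = wmono c0 c0"
    proof (rule ccontr)
      assume "\<not> ?thesis"
      then have "(\<Sum>v\<in>set (words p (Suc i)). if wmono w v = wmono c0 c0 then x v else 0) = 0" by (intro sum.neutral) auto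
      then show False using x1[OF w] nz by simp
    qed
    then obtain v where "v \<in> set (words p (Suc i))" "wmono w v = wmono c0 c0" by blast
    then show ?thesis using wmono_mset(1)[of w v c0 c0] w by (simp add: in_words_iff)
  qed
  \<comment> \<open>Exchanging two of the first \<open>i\<close> basis vectors permutes the wedge
    factors of the generator and so changes its sign.\<close>
  have anti: "x (map (transpose a a') w) = - x w"
    if a: "a < i" "a' < i" "a \<noteq> a'" and w: "w \<in> set (words p (Suc i))" for a a' w
  proof -
    let ?\<rho> = "transpose a a'"
    have \<rho>: "?\<rho> permutes {..<i}" using a by (intro permutes_swap_id) auto
    have mc: "map ?\<rho> c0 = permute_list ?\<rho> c0"
    proof (rule nth_equalityI)
      fix t assume "t < length (map ?\<rho> c0)"
      then show "map ?\<rho> c0 ! t = permute_list ?\<rho> c0 ! t"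
        using a p c0(3) by (auto simp: permute_list_def c0_def gen_word_def nth_append transpose_def)
    qed simp
    have w': "map ?\<rho> w \<in> set (words p (Suc i))" using w a by (auto simp: in_words_iff transpose_def)
    have sw: "wmono (map ?\<rho> w) v = wmono c0 c0 \<longleftrightarrow> wmono w v = wmono (map ?\<rho> c0) c0" for v
    proof -
      have z: "mset (zip (map ?\<rho> w) v) = image_mset (map_prod ?\<rho> id) (mset (zip w v))" for w v :: "nat list"
        by (simp add: zip_map1 map_prod_def id_def case_prod_unfold flip: mset_map)
      have "inj (image_mset (map_prod ?\<rho> id :: nat \<times> nat \<Rightarrow> nat \<times> nat))"
        by (intro multiset.inj_map prod.inj_map) (auto simp: inj_transpose)
      moreover have "mset (zip c0 c0) = image_mset (map_prod ?\<rho> id) (mset (zip (map ?\<rho> c0) c0))"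
        unfolding z[symmetric] by (simp add: map_idI transpose_def)
      ultimately show ?thesis unfolding wmono_eq_iff z by (metis inj_eq)
    qed
    have "x (map ?\<rho> w) = (\<Sum>v\<in>set (words p (Suc i)). if wmono w v = wmono (permute_list ?\<rho> c0) c0 then x v else 0)"
      unfolding x1[OF w', symmetric] sw mc ..
    also have "\<dots> = of_int (sign ?\<rho>) * x w"
      unfolding x_def using c0(3) by (intro trans[OF gc[OF w] rhs[OF \<rho>, unfolded x_def]]) simp
    finally show ?thesis using a by (simp add: sign_swap_id)
  qed
  have "x w = 0" if "w \<in> set (words p (Suc i))" for w
  proof (rule generator_image_zero[OF _ j p ij wt[unfolded c0_def] anti two _ that])
    show "altsym j (p - j) p x" unfolding x_def by (rule alt)
    assume "j = Suc i \<or> i = Suc j"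
    from val[OF this] show "x (gen_word i b) = 0"
      using gval_labelled[of i p h, where m = "m (Suc i)", OF i hm[of "Suc i", unfolded b_def]] by (simp add: h_def x_def c0_def b_def)
  qed
  \<comment> \<open>The generic action spreads the vanishing from the generator to every column of
    \<open>h\<close>.\<close>
  then have "m N w l = 0" if "w \<in> set (words p N)" "l \<in> set (?L N)" for N w l
  proof -
    have "(\<Sum>l'\<in>set (?L N). m N w l' * aext i b l' l) = 0"
      unfolding gc[OF that(1) length_awords[OF that(2)], symmetric]
      using \<open>\<And>w. w \<in> set (words p (Suc i)) \<Longrightarrow> x w = 0\<close> by (auto simp: x_def intro!: sum.neutral)
    also have "(\<Sum>l'\<in>set (?L N). m N w l' * aext i b l' l) = (\<Sum>l'\<in>set (?L N). if l' = l then m N w l' else 0)"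
      using p by (intro sum.cong) (auto simp: aext_awords[OF _ that(2)])
    finally show ?thesis using that(2) by simp
  qed
  then have "h N = labelled_mat (words p N) (?L N) (\<lambda>_ _. 0)" for N
    unfolding hm by (intro labelled_mat_cong) auto
  then have "h = zero_nt (kos p i) (tens p)"
    by (intro ext) (auto simp: zero_nt_def kos_def aspf_def tens_def b_def intro!: eq_matI)
  then have eq: "comp_nt (aemb j (p - j) p) f = comp_nt (aemb j (p - j) p) (zero_nt (kos p i) (kos p j))"
    unfolding h_def comp_zero_right[OF E] .
  show ?thesis
    by (rule mono_nt_cancel[OF E aemb_mono[OF jp] f nat_trans_zero eq]) (simp_all add: kos_def spf_carrier_aspf)
qed

lemma gval_linear:
  assumes i: "i < p" and "g \<in> nat_trans (kos p i) (tens p)" "h \<in> nat_trans (kos p i) (tens p)"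
  shows "gval p i (sub_nt g (smult_nt c h)) = gval p i g - c * gval p i h"
proof -
  note r = the_index(1)[OF distinct_words gen_word_mem(1)[OF i]] and j = the_index(1)[OF distinct_awords gen_word_mem(2)[OF i]]
  have d: "fdim (kos p i) n = length (awords i (p - i) p n)" "fdim (tens p) n = length (words p n)" for n
    by (simp_all add: kos_def aspf_def tens_def)
  show ?thesis
    unfolding gval_def
    using nt_index_sub[OF assms(2) nat_trans_smult[OF assms(3)], of _ "Suc i" _ c] nt_index(2)[OF assms(3), of _ "Suc i" _ c] r j
    by (simp add: d spf_carrier_tens) (simp add: kos_def spf_carrier_aspf)
qed

text \<open>Subtracting the right multiple of \<open>g\<close> makes the generator coefficient zero,
  and then \<open>hom_kos_zero\<close> applies.\<close>

lemma hom_kos_proportional: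
  fixes f g :: "nat \<Rightarrow> 'k::field mat"
  assumes i: "i < p" and j: "j \<le> p" and ij: "i \<noteq> j" and two: "i \<le> 1 \<or> (2 :: 'k) \<noteq> 0"
    and f: "f \<in> nat_trans (kos p i) (kos p j)" and g: "g \<in> nat_trans (kos p i) (kos p j)"
    and gv: "gval p i (comp_nt (aemb j (p - j) p) g) = 1"
  shows "f = smult_nt (gval p i (comp_nt (aemb j (p - j) p) f)) g"
proof -
  let ?e = "aemb j (p - j) p :: nat \<Rightarrow> 'k mat"
  define c where "c = gval p i (comp_nt ?e f)"
  have sc: "spf_carrier (kos p i :: 'k spf)" "spf_carrier (kos p j :: 'k spf)" by (simp_all add: kos_def spf_carrier_aspf)
  have E: "?e \<in> nat_trans (kos p j) (tens p)" unfolding kos_def using j by (intro aemb_nat_trans) simp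
  have cg: "smult_nt c g \<in> nat_trans (kos p i) (kos p j)" by (rule nat_trans_smult[OF g sc])
  have s: "sub_nt f (smult_nt c g) \<in> nat_trans (kos p i) (kos p j)" by (rule nat_trans_sub[OF f cg sc])
  have "comp_nt ?e (sub_nt f (smult_nt c g)) = sub_nt (comp_nt ?e f) (smult_nt c (comp_nt ?e g))"
    unfolding comp_sub_right[OF f cg E sc] comp_smult_right[OF g E] ..
  then have "gval p i (comp_nt ?e (sub_nt f (smult_nt c g))) = 0"
    using gval_linear[OF i nat_trans_comp[OF f E sc spf_carrier_tens] nat_trans_comp[OF g E sc spf_carrier_tens]] gv
    by (simp add: c_def)
  from hom_kos_zero[OF i j ij two s this] show ?thesis
    unfolding c_def[symmetric] using sub_nt_zero_iff[OF f cg sc] by simp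
qed

section \<open>Exactness of the Koszul complex\<close>

lemma permute_list_transpose:
  assumes "a < length w" "b < length w"
  shows "permute_list (transpose a b) w = w[a := w ! b, b := w ! a]"
  using assms by (intro nth_equalityI) (auto simp: permute_list_def transpose_def nth_list_update)

lemma permute_list_swap_middle:
  assumes "length J = a" "b < a"
  shows "permute_list (transpose b a) (J @ x # K) = J[b := x] @ J ! b # K"
  using assms by (subst permute_list_transpose) (auto simp: nth_append list_update_append)

lemma kdiff_split:
  assumes "length J = a"
  shows "kdiff a t (J @ x # K) = t (J @ x # K) - (\<Sum>b<a. t (J[b := x] @ J ! b # K))"
  unfolding kdiff_def using assms by (intro arg_cong2[of _ _ _ _ "(-)"] refl sum.cong) (simp_all add: permute_list_swap_middle)

lemma altsym_swap:
  assumes t: "altsym (Suc a) c e t" and "length J = a" "b < a" "length K = e - Suc a" "Suc a \<le> e"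
  shows "t (J[b := x] @ J ! b # K) = - t (J @ x # K)"
proof -
  have "transpose b a permutes {..<Suc a}" using assms(3) by (intro permutes_swap_id) auto
  from altsym_permute[OF t _ this, of "J @ x # K"] show ?thesis
    using assms by (simp add: permute_list_swap_middle sign_swap_id)
qed

lemma mset_list_update_swap:
  assumes "b < length J" shows "mset (J[b := x] @ J ! b # K) = mset (J @ x # K)"
  using assms by (simp add: mset_update)

text \<open>Up to the factor \<open>i!\<close> the map is a full antisymmetrization, which is
  alternating for free; inverting \<open>i!\<close> transfers this to \<open>kdiff\<close>.\<close>

lemma altsym_kdiff:
  fixes t :: "nat list \<Rightarrow> 'k::field"
  assumes t: "altsym i (p - i) p t" and i: "i < p" and fact: "of_nat (fact i) \<noteq> (0 :: 'k)"
  shows "altsym (Suc i) (p - Suc i) p (kdiff i t)"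
proof -
  have "altsym (Suc i) (p - Suc i) p (asum (Suc i) t)"
  proof (rule altsym_asum)
    fix J K K' u :: "nat list"
    assume *: "length J = Suc i" "length K = p - Suc i" "length u = p - Suc i - (p - Suc i)" "mset K = mset K'"
    have "length K' = length K" using *(4) by (metis size_mset)
    then show "t (J @ K @ u) = t (J @ K' @ u)"
      using altsymD(3)[OF t, of "take i J" "drop i J @ K" "[]" "drop i J @ K'"] * i
      by (simp flip: append_assoc)
  qed (use i in simp)
  from altsym_scale[OF this, of "inverse (of_nat (fact i))"]
  show ?thesis
    by (rule altsym_cong) (use i fact in \<open>simp_all add: asum_eq_kdiff[OF t] flip: mult.assoc\<close>)
qed

text \<open>The Koszul codifferential in coordinates: the last alternating position \<open>a\<close>
  is exchanged in turn with itself and with each symmetric position.\<close>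

definition codiff :: "nat \<Rightarrow> nat \<Rightarrow> (nat list \<Rightarrow> 'r::comm_ring_1) \<Rightarrow> nat list \<Rightarrow> 'r" where
  "codiff a p t w = (\<Sum>j\<in>{a..<p}. t (permute_list (transpose a j) w))"

text \<open>The transpositions scramble the tail, but \<open>t\<close> is symmetric there, so the
  tail may be replaced by the sorted list of its multiset. In this form the dependence on
  \<open>K\<close> is visibly symmetric.\<close>

lemma codiff_split:
  assumes t: "altsym (Suc a) (p - Suc a) p t" and J: "length J = a" and K: "length K = p - a" and a: "a < p"
  shows "codiff a p t (J @ K) = (\<Sum>y\<in>#mset K. t (J @ y # sorted_list_of_multiset (mset K - {#y#})))"
proof -
  have "codiff a p t (J @ K) = (\<Sum>i<length K. t (permute_list (transpose a (a + i)) (J @ K)))"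
    unfolding codiff_def by (rule sum.reindex_bij_witness[of _ "\<lambda>i. a + i" "\<lambda>j. j - a"]) (use K a in auto)
  also have "\<dots> = (\<Sum>i<length K. t (J @ K ! i # sorted_list_of_multiset (mset K - {#K ! i#})))"
  proof (rule sum.cong[OF refl])
    fix i assume i: "i \<in> {..<length K}"
    then obtain x K' where K': "K = x # K'" by (cases K) auto
    define R where "R = tl (K[0 := K ! i, i := K ! 0])"
    have "K[0 := K ! i, i := K ! 0] = K ! i # R"
      using i by (cases i) (auto simp: R_def K')
    moreover have "mset (K[0 := K ! i, i := K ! 0]) = mset K" using i by (intro mset_swap) (auto simp: K')
    ultimately have "mset K = add_mset (K ! i) (mset R)" by simp
    then have mR: "mset R = mset K - {#K ! i#}" by simp
    have "permute_list (transpose a (a + i)) (J @ K) = J @ K[0 := K ! i, i := K ! 0]"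
      using i J by (simp add: permute_list_transpose list_update_append nth_append K')
    then have R: "permute_list (transpose a (a + i)) (J @ K) = J @ K ! i # R" "mset R = mset K - {#K ! i#}"
      unfolding \<open>K[0 := K ! i, i := K ! 0] = K ! i # R\<close> by (simp_all add: mR)
    have "length R = p - Suc a" using R(2) i K by (metis Suc_diff_Suc a diff_Suc_1 lessThan_iff nth_mem set_mset_mset size_Diff_singleton size_mset)
    then show "t (permute_list (transpose a (a + i)) (J @ K)) = t (J @ K ! i # sorted_list_of_multiset (mset K - {#K ! i#}))"
      unfolding R(1) using altsymD(3)[OF t, of "J @ [K ! i]" R "[]" "sorted_list_of_multiset (mset K - {#K ! i#})"] J R(2) by simp
  qed
  also have "\<dots> = (\<Sum>y\<in>#mset K. t (J @ y # sorted_list_of_multiset (mset K - {#y#})))"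
    using sum_list_sum_nth[of "map (\<lambda>y. t (J @ y # sorted_list_of_multiset (mset K - {#y#}))) K"]
    by (simp add: atLeast0LessThan flip: sum_mset_sum_list)
  finally show ?thesis .
qed

lemma altsym_codiff:
  assumes t: "altsym (Suc a) (p - Suc a) p t" and a: "a < p"
  shows "altsym a (p - a) p (codiff a p t)"
  unfolding altsym_def
proof (intro conjI allI impI)
  have len: "length (sorted_list_of_multiset (mset u - {#y#})) = p - Suc a" if "length u = p - a" "y \<in># mset u" for u :: "nat list" and y
    using that by (simp add: size_Diff_singleton flip: size_mset)
  show "codiff a p t (permute_list \<sigma> J @ u) = of_int (sign \<sigma>) * codiff a p t (J @ u)"
    if J: "length J = a" and u: "length u = p - a" and \<sigma>: "\<sigma> permutes {..<a}" for J u :: "nat list" and \<sigma>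
  proof -
    have \<sigma>': "\<sigma> permutes {..<Suc a}" using \<sigma> by (rule permutes_subset) auto
    have "t (permute_list \<sigma> J @ y # sorted_list_of_multiset (mset u - {#y#})) =
        of_int (sign \<sigma>) * t (J @ y # sorted_list_of_multiset (mset u - {#y#}))" if "y \<in># mset u" for y
      using altsymD(1)[OF t _ len[OF u that] \<sigma>', of "J @ [y]"] J permute_list_append_left[of \<sigma> J "[y]"] \<sigma> by simp
    then have "(\<Sum>y\<in>#mset u. t (permute_list \<sigma> J @ y # sorted_list_of_multiset (mset u - {#y#}))) =
        (\<Sum>y\<in>#mset u. of_int (sign \<sigma>) * t (J @ y # sorted_list_of_multiset (mset u - {#y#})))"
      by (intro arg_cong[of _ _ sum_mset] image_mset_cong)
    then show ?thesis using J u by (simp add: codiff_split[OF t _ _ a] sum_mset_distrib_left image_mset.compositionality comp_def)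
  qed
  show "codiff a p t (J @ u) = 0" if "length J = a" "length u = p - a" "\<not> distinct J" for J u :: "nat list"
  proof -
    have "t (J @ y # sorted_list_of_multiset (mset u - {#y#})) = 0" if "y \<in># mset u" for y
      using altsymD(2)[OF t _ len[OF \<open>length u = p - a\<close> that], of "J @ [y]"] \<open>length J = a\<close> \<open>\<not> distinct J\<close> by simp
    then have "(\<Sum>y\<in>#mset u. t (J @ y # sorted_list_of_multiset (mset u - {#y#}))) = (\<Sum>y\<in>#mset u. 0)"
      by (intro arg_cong[of _ _ sum_mset] image_mset_cong)
    then show ?thesis using that by (simp add: codiff_split[OF t _ _ a])
  qed
  show "codiff a p t (J @ K @ u) = codiff a p t (J @ K' @ u)"
    if "length J = a" "length K = p - a" "length u = p - a - (p - a)" "mset K = mset K'" for J K K' u :: "nat list"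
  proof -
    have "length K' = p - a" using that by (metis size_mset)
    then show ?thesis using that by (simp add: codiff_split[OF t _ _ a])
  qed
qed

text \<open>The least letter \<open>r\<close> of the word depends only on its set of letters, which
  place permutations preserve; so all terms of a Koszul differential use the same \<open>r\<close>.
  If \<open>r\<close> occurs only among the alternating letters, a second copy would be a
  repetition, hence the value 0.\<close>

definition hshift :: "nat \<Rightarrow> (nat list \<Rightarrow> 'r::zero) \<Rightarrow> nat list \<Rightarrow> 'r" where
  "hshift a t w = (let r = Min (set w) in
     if r \<in> set (drop a w) then t (take a w @ r # remove1 r (drop a w)) else 0)"

lemma hshift_append:
  "length J = a \<Longrightarrow> hshift a t (J @ K) =
     (if Min (set J \<union> set K) \<in> set K then t (J @ Min (set J \<union> set K) # remove1 (Min (set J \<union> set K)) K) else 0)"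
  by (simp add: hshift_def Let_def)

lemma altsym_hshift:
  assumes t: "altsym (Suc a) (p - Suc a) p t" and a: "a < p"
  shows "altsym a (p - a) p (hshift a t)"
  unfolding altsym_def
proof (intro conjI allI impI)
  have len: "length (remove1 y u) = p - Suc a" if "length u = p - a" "y \<in> set u" for u :: "nat list" and y
    using that by (simp add: length_remove1)
  show "hshift a t (permute_list \<sigma> J @ u) = of_int (sign \<sigma>) * hshift a t (J @ u)"
    if J: "length J = a" and u: "length u = p - a" and \<sigma>: "\<sigma> permutes {..<a}" for J u :: "nat list" and \<sigma>
  proof -
    have \<sigma>': "\<sigma> permutes {..<Suc a}" using \<sigma> by (rule permutes_subset) auto
    show ?thesis
      using altsymD(1)[OF t _ len[OF u] \<sigma>', of "J @ [_]"] J permute_list_append_left[of \<sigma> J "[_]"] \<sigma>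
      by (simp add: hshift_append)
  qed
  show "hshift a t (J @ u) = 0" if "length J = a" "length u = p - a" "\<not> distinct J" for J u :: "nat list"
    using altsymD(2)[OF t _ len[OF that(2)], of "J @ [_]"] that by (simp add: hshift_append)
  show "hshift a t (J @ K @ u) = hshift a t (J @ K' @ u)"
    if *: "length J = a" "length K = p - a" "length u = p - a - (p - a)" "mset K = mset K'" for J K K' u :: "nat list"
  proof -
    have s: "set K' = set K" using *(4) by (metis set_mset_mset)
    show ?thesis
      using * altsymD(3)[OF t _ len[OF *(2)], of "J @ [_]" _ "[]" "remove1 _ K'"]
      by (simp add: hshift_append s)
  qed
qed

text \<open>Moving a smallest letter of a word from the symmetric to the alternating positions is a
  contracting homotopy of the Koszul complex.\<close>

lemma hshift_homotopy:
  fixes t :: "nat list \<Rightarrow> 'k::field"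
  assumes t: "altsym (Suc a) (p - Suc a) p t" and a: "Suc a < p" and fact: "of_nat (fact a) \<noteq> (0 :: 'k)"
    and ker: "\<And>v. v \<in> set (words p N) \<Longrightarrow> kdiff (Suc a) t v = 0" and w: "w \<in> set (words p N)"
  shows "kdiff a (hshift a t) w = t w"
proof -
  have len: "length w = p" using w by (simp add: in_words_iff)
  have s: "altsym (Suc a) (p - Suc a) p (kdiff a (hshift a t))"
    using a by (intro altsym_kdiff altsym_hshift t fact) auto
  define r where "r = Min (set w)"
  have ne: "w \<noteq> []" using len a by auto
  have rw: "r \<in> set w" using ne by (simp add: r_def)
  consider (rep) "\<not> distinct (take (Suc a) w)" | (alt) "distinct (take (Suc a) w)" "r \<in> set (take (Suc a) w)" |
    (sym) "r \<notin> set (take (Suc a) w)" by blast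
  then show ?thesis
  proof cases
    case rep
    then show ?thesis
      using altsymD(2)[OF s, of "take (Suc a) w" "drop (Suc a) w"] altsymD(2)[OF t, of "take (Suc a) w" "drop (Suc a) w"] len a
      by simp
  next
    case alt
    then obtain b where b: "b < Suc a" "w ! b = r" using len a by (auto simp: in_set_conv_nth)
    \<comment> \<open>A permutation inside the alternating block brings \<open>r\<close> to position
      \<open>a\<close> and changes both sides by the same sign.\<close>
    have \<tau>: "transpose b a permutes {..<Suc a}" using b by (intro permutes_swap_id) auto
    have \<tau>': "transpose b a permutes {..<length w}" using len a b by (intro permutes_swap_id) auto
    define w' where "w' = permute_list (transpose b a) w"
    define J K where "J = take a w'" and "K = drop (Suc a) w'"
    have w': "length w' = p" "set w' = set w" using len \<tau>' by (simp_all add: w'_def)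
    have "w' ! a = r" using b a len by (auto simp: w'_def permute_list_transpose nth_list_update)
    then have wJ: "w' = J @ r # K" using id_take_nth_drop[of a w'] w'(1) a by (simp add: J_def K_def)
    have lJ: "length J = a" "length K = p - Suc a" using w' a by (simp_all add: J_def K_def)
    have "w' = permute_list (transpose b a) (take (Suc a) w) @ drop (Suc a) w"
      unfolding w'_def using permute_list_append_left[of "transpose b a" "take (Suc a) w" "drop (Suc a) w"] \<tau> len a by simp
    then have "take (Suc a) w' = permute_list (transpose b a) (take (Suc a) w)" using len a by simp
    moreover have "distinct (permute_list (transpose b a) (take (Suc a) w))"
      using alt(1) \<tau> len a by (subst distinct_permute_list) auto
    moreover have "take (Suc a) w' = J @ [r]" using lJ by (simp add: wJ)
    ultimately have "distinct (J @ [r])" by (simp only:)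
    then have dist: "distinct J" "r \<notin> set J" by auto
    have min: "Min (set (J[b := r]) \<union> set (J ! b # K)) = r" if "b < a" for b
    proof -
      have "set (J[b := r]) \<union> set (J ! b # K) = set (J @ r # K)"
        using mset_eq_setD[OF mset_list_update_swap[of b J r K]] that lJ by simp
      then show ?thesis using w'(2) wJ by (simp add: r_def)
    qed
    \<comment> \<open>Here the alternating block already contains \<open>r\<close>, so inserting
      another copy repeats a letter.\<close>
    have "hshift a t (J[b := r] @ J ! b # K) = 0" if "b < a" for b
    proof -
      have d: "J ! b \<noteq> r" using dist that lJ by auto
      have "t ((J[b := r] @ [r]) @ remove1 r (J ! b # K)) = 0" if "r \<in> set (J ! b # K)"
        by (rule altsymD(2)[OF t]) (use that lJ d a \<open>b < a\<close> in \<open>auto simp: length_remove1 set_update_memI\<close>)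
      then show ?thesis using min[OF that] lJ by (simp add: hshift_append)
    qed
    moreover have "hshift a t (J @ r # K) = t (J @ r # K)"
    proof -
      have "Min (set J \<union> set (r # K)) = r" using w'(2) wJ by (simp add: r_def)
      then show ?thesis using lJ by (simp add: hshift_append)
    qed
    ultimately have "kdiff a (hshift a t) w' = t w'" unfolding wJ kdiff_split[OF lJ(1)] by simp
    then show ?thesis
      using altsym_permute[OF s len \<tau>] altsym_permute[OF t len \<tau>] a by (auto simp: w'_def sign_def split: if_splits)
  next
    case sym
    define J x K where "J = take a w" and "x = w ! a" and "K = drop (Suc a) w"
    have wJ: "w = J @ x # K" using id_take_nth_drop[of a w] len a by (simp add: J_def K_def x_def)
    have lJ: "length J = a" "length K = p - Suc a" using len a by (simp_all add: J_def K_def)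
    have r: "r \<notin> set J" "r \<noteq> x" "r \<in> set K" using sym rw lJ by (auto simp: wJ)
    define R where "R = remove1 r K"
    have mK: "mset K = mset (r # R)" "length R = p - Suc (Suc a)" using r(3) lJ by (simp_all add: R_def length_remove1)
    have h: "hshift a t (J' @ y # K) = t (J' @ r # y # R)"
      if "mset (J' @ y # K) = mset w" "length J' = a" "y \<noteq> r" for J' y
    proof -
      have "Min (set J' \<union> set (y # K)) = r" using mset_eq_setD[OF that(1)] by (simp add: r_def)
      then show ?thesis using that r(3) by (simp add: hshift_append R_def)
    qed
    have h1: "hshift a t (J @ x # K) = t (J @ r # x # R)" using r lJ by (intro h) (auto simp: wJ)
    have h2: "hshift a t (J[b := x] @ J ! b # K) = t (J[b := x] @ r # J ! b # R)" if "b < a" for b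
      using r lJ that mset_list_update_swap[of b J x K] by (intro h) (auto simp: wJ)
    have h3: "t (J[b := x] @ r # J ! b # R) = - t (J[b := r] @ x # J ! b # R)" if "b < a" for b
      using altsym_swap[OF t, of "J[b := r]" b "J ! b # R" x] that lJ a mK(2) by simp
    \<comment> \<open>The kernel condition at the word with \<open>r\<close> moved to position
      \<open>a + 1\<close> expands \<open>t w\<close> into exactly the terms of the differential of
      \<open>hshift a t\<close>.\<close>
    have "(J @ [x]) @ r # R \<in> set (words p N)"
      using w mK lJ a by (auto simp: in_words_iff wJ R_def dest: notin_set_remove1 set_remove1_subset[THEN subsetD])
    from ker[OF this] have "t ((J @ [x]) @ r # R) = (\<Sum>b<Suc a. t ((J @ [x])[b := r] @ (J @ [x]) ! b # R))"
      using kdiff_split[of "J @ [x]" "Suc a" t r R] lJ by simp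
    also have "\<dots> = t (J @ r # x # R) + (\<Sum>b<a. t (J[b := r] @ x # J ! b # R))"
      using lJ by (simp add: list_update_append nth_append add.commute)
    also have "t ((J @ [x]) @ r # R) = t w"
      using altsymD(3)[OF t, of "J @ [x]" K "[]" "r # R"] lJ mK by (simp add: wJ)
    finally show ?thesis
      unfolding wJ kdiff_split[OF lJ(1)] h1 using h2 h3 by (simp add: sum_negf)
  qed
qed

section \<open>The Koszul maps as natural transformations\<close>

definition kpos :: "nat \<Rightarrow> nat \<Rightarrow> nat \<Rightarrow> 'k::field mat" where
  "kpos p i = posmat p {..i} (\<lambda>j. transpose j i) (\<lambda>j. if j = i then 1 else - 1)"

definition cpos :: "nat \<Rightarrow> nat \<Rightarrow> nat \<Rightarrow> 'k::field mat" where
  "cpos p a = posmat p {a..<p} (\<lambda>j. transpose a j) (\<lambda>_. 1)"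

lemma kpos_nat_trans: "i < p \<Longrightarrow> kpos p i \<in> nat_trans (tens p) (tens p :: 'k::field spf)"
  unfolding kpos_def by (intro posmat_nat_trans permutes_swap_id) auto

lemma cpos_nat_trans: "a < p \<Longrightarrow> cpos p a \<in> nat_trans (tens p) (tens p :: 'k::field spf)"
  unfolding cpos_def by (intro posmat_nat_trans permutes_swap_id) auto

lemma kpos_mult:
  assumes "i < p"
  shows "kpos p i n * labelled_mat (words p n) L m = labelled_mat (words p n) L (\<lambda>w l. kdiff i (\<lambda>w. m w l) w :: 'k::field)"
proof -
  have "kpos p i n * labelled_mat (words p n) L m = labelled_mat (words p n) L
      (\<lambda>w l. \<Sum>j\<in>{..i}. (if j = i then 1 else - 1) * m (permute_list (transpose j i) w) l)"
    unfolding kpos_def using assms by (intro posmat_mult permutes_swap_id) auto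
  \<comment> \<open>The summand \<open>j = i\<close> is the identity term of \<open>kdiff\<close>,
    since \<open>transpose i i\<close> is the identity.\<close>
  also have "\<dots> = labelled_mat (words p n) L (\<lambda>w l. kdiff i (\<lambda>w. m w l) w)"
    by (rule labelled_mat_cong) (simp add: kdiff_def sum_negf flip: lessThan_Suc_atMost)
  finally show ?thesis .
qed

lemma cpos_mult:
  assumes "a < p"
  shows "cpos p a n * labelled_mat (words p n) L m = labelled_mat (words p n) L (\<lambda>w l. codiff a p (\<lambda>w. m w l) w :: 'k::field)"
proof -
  have "cpos p a n * labelled_mat (words p n) L m = labelled_mat (words p n) L
      (\<lambda>w l. \<Sum>j\<in>{a..<p}. 1 * m (permute_list (transpose a j) w) l)"
    unfolding cpos_def using assms by (intro posmat_mult permutes_swap_id) auto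
  then show ?thesis by (simp add: codiff_def)
qed

definition kemb :: "nat \<Rightarrow> nat \<Rightarrow> nat \<Rightarrow> 'k::field mat" where
  "kemb p i = aemb i (p - i) p"

text \<open>The Koszul differential with the whole tensor power as target; \<open>kdd\<close> is its
  factorization through the next Koszul term.\<close>

definition kdn :: "nat \<Rightarrow> nat \<Rightarrow> nat \<Rightarrow> 'k::field mat" where
  "kdn p i = comp_nt (kpos p i) (kemb p i)"

definition cdn :: "nat \<Rightarrow> nat \<Rightarrow> nat \<Rightarrow> 'k::field mat" where
  "cdn p a = comp_nt (cpos p a) (kemb p (Suc a))"

lemma kemb_nat_trans: "i \<le> p \<Longrightarrow> kemb p i \<in> nat_trans (kos p i) (tens p)"
  unfolding kemb_def kos_def by (rule aemb_nat_trans) simp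

lemma kemb_mono: "i \<le> p \<Longrightarrow> mono_nt (kemb p i)"
  unfolding kemb_def by (rule aemb_mono) simp

lemma kemb_labelled: "kemb p i n = labelled_mat (words p n) (awords i (p - i) p n) (\<lambda>w l. aext i (p - i) l w)"
  by (simp add: kemb_def aemb_def)

lemma spf_carrier_kos: "spf_carrier (kos p i)"
  by (simp add: kos_def spf_carrier_aspf)

lemma strict_kos: "i \<le> p \<Longrightarrow> strict_poly_functor p (kos p i)"
  unfolding kos_def by (rule strict_aspf) simp

lemma fdim_kos: "fdim (kos p i) n = length (awords i (p - i) p n)"
  by (simp add: kos_def aspf_def)

lemma kdn_labelled:
  "i < p \<Longrightarrow> kdn p i n = labelled_mat (words p n) (awords i (p - i) p n) (\<lambda>w l. kdiff i (aext i (p - i) l) w)"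
  unfolding kdn_def comp_nt_def kemb_labelled by (rule kpos_mult)

lemma cdn_labelled:
  "a < p \<Longrightarrow> cdn p a n = labelled_mat (words p n) (awords (Suc a) (p - Suc a) p n) (\<lambda>w l. codiff a p (aext (Suc a) (p - Suc a) l) w)"
  unfolding cdn_def comp_nt_def kemb_labelled by (rule cpos_mult)

lemma kdn_nat_trans: "i < p \<Longrightarrow> kdn p i \<in> nat_trans (kos p i) (tens p)"
  unfolding kdn_def
  by (rule nat_trans_comp[OF kemb_nat_trans kpos_nat_trans]) (simp_all add: spf_carrier_kos spf_carrier_tens)

lemma cdn_nat_trans: "a < p \<Longrightarrow> cdn p a \<in> nat_trans (kos p (Suc a)) (tens p)"
  unfolding cdn_def
  by (rule nat_trans_comp[OF kemb_nat_trans cpos_nat_trans]) (simp_all add: spf_carrier_kos spf_carrier_tens)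

lemma koszul_differential:
  assumes i: "i < p" and fact: "of_nat (fact i) \<noteq> (0 :: 'k::field)"
  shows "\<exists>d\<in>nat_trans (kos p i) (kos p (Suc i) :: 'k spf). comp_nt (kemb p (Suc i)) d = kdn p i"
  unfolding kemb_def kos_def[of p "Suc i"]
proof (rule lift_to_aspf[OF kdn_nat_trans[OF i] spf_carrier_kos _ kdn_labelled[OF i]])
  show "altsym (Suc i) (p - Suc i) p (\<lambda>w. kdiff i (aext i (p - i) l) w :: 'k)" if "l \<in> set (awords i (p - i) p n)" for n l
    using that i by (intro altsym_kdiff altsym_aext fact) auto
qed (use i in simp)

lemma koszul_codifferential:
  assumes a: "a < p"
  shows "\<exists>d\<in>nat_trans (kos p (Suc a)) (kos p a :: 'k::field spf). comp_nt (kemb p a) d = cdn p a"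
  unfolding kemb_def kos_def[of p a]
proof (rule lift_to_aspf[OF cdn_nat_trans[OF a] spf_carrier_kos _ cdn_labelled[OF a]])
  show "altsym a (p - a) p (\<lambda>w. codiff a p (aext (Suc a) (p - Suc a) l) w :: 'k)" if "l \<in> set (awords (Suc a) (p - Suc a) p n)" for n l
    using that a by (intro altsym_codiff altsym_aext) auto
qed (use a in simp)

lemma kdiff_sum: "kdiff i (\<lambda>w. \<Sum>l\<in>S. f l w * c l) w = (\<Sum>l\<in>S. kdiff i (f l) w * c l)"
  unfolding kdiff_def left_diff_distrib sum_subtractf sum_distrib_right by (subst sum.swap) simp

lemma kernel_subset_image:
  assumes A: "A \<in> carrier_mat n m" and B: "B \<in> carrier_mat k n"
    and ex: "\<And>X. X \<in> carrier_mat n 1 \<Longrightarrow> B * X = 0\<^sub>m k 1 \<Longrightarrow> \<exists>Y\<in>carrier_mat m 1. A * Y = X"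
  shows "mat_kernel B \<subseteq> mat_image A"
proof
  fix v assume "v \<in> mat_kernel B"
  then have v: "v \<in> carrier_vec n" "B *\<^sub>v v = 0\<^sub>v k" using B by (auto simp: mat_kernel_def)
  define X where "X = mat_of_cols n [v]"
  have X: "X \<in> carrier_mat n 1" "col X 0 = v" using v mat_of_cols_carrier(1)[of n "[v]"] by (simp_all add: X_def)
  have "B * X = 0\<^sub>m k 1"
  proof (rule mat_col_eqI)
    fix j assume "j < dim_col (0\<^sub>m k 1 :: 'a mat)"
    then have j: "j = 0" by simp
    show "col (B * X) j = col (0\<^sub>m k 1) j" unfolding j using col_mult2[OF B X(1), of 0] X(2) v by simp
  qed (use B X in auto)
  from ex[OF X(1) this] obtain Y where Y: "Y \<in> carrier_mat m 1" "A * Y = X" by blast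
  then have "v = A *\<^sub>v col Y 0" using col_mult2[OF A Y(1), of 0] X(2) by simp
  moreover have "col Y 0 \<in> carrier_vec (dim_col A)" using A Y by (auto simp: carrier_vecI)
  ultimately show "v \<in> mat_image A" by (auto simp: mat_image_def)
qed

text \<open>Stated for any \<open>g\<close> that becomes the Koszul differential after a map into
  the tensor power. It serves both for the next differential and for the augmentation onto the Weyl
  functor.\<close>

lemma koszul_exact:
  fixes d g \<iota> :: "nat \<Rightarrow> 'k::field mat"
  assumes a: "Suc a < p" and fact: "of_nat (fact a) \<noteq> (0 :: 'k)"
    and d: "d \<in> nat_trans (kos p a) (kos p (Suc a))" "comp_nt (kemb p (Suc a)) d = kdn p a"
    and g: "g \<in> nat_trans (kos p (Suc a)) W" and \<iota>: "\<iota> \<in> nat_trans W (tens p)" and g': "comp_nt \<iota> g = kdn p (Suc a)"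
  shows "mat_kernel (g N) \<subseteq> mat_image (d N)"
proof (rule kernel_subset_image[OF nat_transD(1)[OF d(1)] nat_transD(1)[OF g]])
  let ?L = "awords (Suc a) (p - Suc a) p N" and ?L' = "awords a (p - a) p N" and ?w = "words p N"
  fix X assume X: "X \<in> carrier_mat (fdim (kos p (Suc a) :: 'k spf) N) 1" and gX: "g N * X = 0\<^sub>m (fdim W N) 1"
  have sa: "Suc a + (p - Suc a) \<le> p" "a + (p - a) \<le> p" using a by simp_all
  \<comment> \<open>A vector is treated as a matrix with the single column label \<open>()\<close>,
    so that it has coordinates on words like everything else.\<close>
  obtain x where x: "X = labelled_mat ?L [()] x"
    using labelled_mat_surj[of X ?L "[()]"] X distinct_awords by (auto simp: fdim_kos)
  define t where "t w = (\<Sum>l\<in>set ?L. aext (Suc a) (p - Suc a) l w * x l ())" for w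
  have t: "altsym (Suc a) (p - Suc a) p t"
    unfolding t_def mult.commute[of "aext _ _ _ _"] by (intro altsym_sum altsym_scale altsym_aext) (use a in auto)
  have eX: "kemb p (Suc a) N * X = labelled_mat ?w [()] (\<lambda>w _. t w)"
    unfolding x kemb_labelled labelled_mat_mult[OF distinct_awords] by (rule labelled_mat_cong) (simp add: t_def)
  have "kdn p (Suc a) N * X = \<iota> N * (g N * X)"
    unfolding g'[symmetric] comp_nt_def by (rule assoc_mult_mat[OF nat_transD(1)[OF \<iota>] nat_transD(1)[OF g] X])
  also have "\<dots> = 0\<^sub>m (length ?w) 1" unfolding gX using nat_transD(1)[OF \<iota>, of N] by (simp add: tens_def)
  also have "\<dots> = labelled_mat ?w [()] (\<lambda>_ _. 0)" by (intro eq_matI) auto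
  finally have "labelled_mat ?w [()] (\<lambda>w _. \<Sum>l\<in>set ?L. kdiff (Suc a) (aext (Suc a) (p - Suc a) l) w * x l ()) = labelled_mat ?w [()] (\<lambda>_ _. 0)"
    unfolding kdn_labelled[OF a] x labelled_mat_mult[OF distinct_awords]
    by (subst labelled_mat_cong[where g = "\<lambda>w d. \<Sum>l\<in>set ?L. kdiff (Suc a) (aext (Suc a) (p - Suc a) l) w * x l d"]) auto
  from labelled_mat_eqD[OF this] have ker: "kdiff (Suc a) t w = 0" if "w \<in> set ?w" for w
    unfolding t_def kdiff_sum using that by simp
  \<comment> \<open>The contracting homotopy supplies the preimage.\<close>
  define Y where "Y = labelled_mat ?L' [()] (\<lambda>l _. hshift a t l)"
  have Y: "Y \<in> carrier_mat (fdim (kos p a :: 'k spf) N) 1" unfolding Y_def fdim_kos using labelled_mat_carrier[of ?L' "[()]"] by simp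
  have h: "altsym a (p - a) p (hshift a t)" using a by (intro altsym_hshift t) simp
  have "kemb p (Suc a) N * (d N * Y) = kdn p a N * Y"
    unfolding d(2)[symmetric] comp_nt_def
    by (rule assoc_mult_mat[OF nat_transD(1)[OF kemb_nat_trans] nat_transD(1)[OF d(1)] Y, symmetric]) (use a in simp)
  also have "\<dots> = kpos p a N * (kemb p a N * Y)"
    unfolding kdn_def comp_nt_def
    by (rule assoc_mult_mat[OF nat_transD(1)[OF kpos_nat_trans] nat_transD(1)[OF kemb_nat_trans] Y]) (use a in simp_all)
  also have "kemb p a N * Y = labelled_mat ?w [()] (\<lambda>w _. hshift a t w)"
    unfolding Y_def kemb_def by (rule aemb_arestr_mult[OF h]) (use a in simp)
  also have "kpos p a N * \<dots> = labelled_mat ?w [()] (\<lambda>w _. kdiff a (hshift a t) w)"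
    using a by (intro kpos_mult) simp
  also have "\<dots> = kemb p (Suc a) N * X"
    unfolding eX by (rule labelled_mat_cong) (rule hshift_homotopy[OF t a fact ker])
  finally have eq: "kemb p (Suc a) N * (d N * Y) = kemb p (Suc a) N * X" .
  have "\<exists>e'\<in>carrier_mat (fdim (kos p (Suc a) :: 'k spf) N) (fdim (tens p :: 'k spf) N).
      e' * kemb p (Suc a) N = (1\<^sub>m (fdim (kos p (Suc a) :: 'k spf) N) :: 'k mat)"
  proof (rule mono_nt_left_inverse[where f = "kemb p (Suc a)" and F = "kos p (Suc a)" and G = "tens p" and n = N])
    show "kemb p (Suc a) \<in> nat_trans (kos p (Suc a)) (tens p :: 'k spf)" using a by (intro kemb_nat_trans) simp
    show "mono_nt (kemb p (Suc a) :: nat \<Rightarrow> 'k mat)" using a by (intro kemb_mono) simp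
  qed
  then obtain e' where e': "e' \<in> carrier_mat (fdim (kos p (Suc a) :: 'k spf) N) (fdim (tens p :: 'k spf) N)"
    "e' * kemb p (Suc a) N = (1\<^sub>m (fdim (kos p (Suc a) :: 'k spf) N) :: 'k mat)"
    by blast
  have E: "(kemb p (Suc a) N :: 'k mat) \<in> carrier_mat (fdim (tens p :: 'k spf) N) (fdim (kos p (Suc a) :: 'k spf) N)"
    using a by (intro nat_transD(1)[OF kemb_nat_trans]) simp
  have canc: "e' * (kemb p (Suc a) N * Z) = Z" if "Z \<in> carrier_mat (fdim (kos p (Suc a) :: 'k spf) N) 1" for Z
    using assoc_mult_mat[OF e'(1) E that] e'(2) that by simp
  have dY: "d N * Y \<in> carrier_mat (fdim (kos p (Suc a) :: 'k spf) N) 1" by (rule mult_carrier_mat[OF nat_transD(1)[OF d(1)] Y])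
  have "d N * Y = X" using arg_cong[OF eq, of "\<lambda>Z. e' * Z"] canc[OF dY] canc[OF X] by simp
  with Y show "\<exists>Y\<in>carrier_mat (fdim (kos p a :: 'k spf) N) 1. d N * Y = X" by blast
qed

section \<open>Ext between hook Weyl functors\<close>

lemma gval_zero:
  assumes i: "i < p"
  shows "gval p i (zero_nt (kos p i) (tens p :: 'k::field spf)) = 0"
  unfolding gval_def zero_nt_def
  using the_index(1)[OF distinct_words gen_word_mem(1)[OF i]] the_index(1)[OF distinct_awords gen_word_mem(2)[OF i]]
  by (simp add: tens_def fdim_kos)

lemma gen_word_split:
  assumes "i < p"
  shows "gen_word i (p - i) = [0..<i] @ i # replicate (p - Suc i) i"
proof -
  have "p - i = Suc (p - Suc i)" using assms by simp
  then show ?thesis by (simp add: gen_word_def)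
qed

lemma aext_gen_word_self: "i < p \<Longrightarrow> aext i (p - i) (gen_word i (p - i)) (gen_word i (p - i)) = 1"
  using aext_awords[OF gen_word_mem(2) gen_word_mem(2)] by simp

text \<open>A word in the support of this basis tensor has a rearrangement of \<open>[0..<i]\<close>
  in its alternating positions, so a letter \<open>i\<close> or larger there gives zero.\<close>

lemma aext_gen_word_zero:
  assumes "k < i" "k < length w" "i \<le> w ! k"
  shows "aext i b (gen_word i b') w = 0"
proof -
  have "w ! k \<in> set (take i w)" using assms by (auto simp: in_set_conv_nth intro!: exI[of _ k])
  moreover have "w ! k \<notin> set [0..<i]" using assms(3) by simp
  ultimately have "mset (take i w) \<noteq> mset [0..<i]" by (metis mset_eq_setD)
  then show ?thesis using perm_sgn_nonzero(2)[of "[0..<i]" "take i w"] by (auto simp: aext_def take_gen_word)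
qed

lemma kdiff_gen_word:
  assumes i: "i < p"
  shows "kdiff i (aext i (p - i) (gen_word i (p - i))) (gen_word i (p - i)) = 1"
proof -
  let ?t = "aext i (p - i) (gen_word i (p - i)) :: nat list \<Rightarrow> 'a"
  have "kdiff i ?t (gen_word i (p - i)) = ?t (gen_word i (p - i)) - (\<Sum>b<i. ?t ([0..<i][b := i] @ [0..<i] ! b # replicate (p - Suc i) i))"
    using kdiff_split[of "[0..<i]" i ?t i "replicate (p - Suc i) i"] by (simp flip: gen_word_split[OF i])
  also have "(\<Sum>b<i. ?t ([0..<i][b := i] @ [0..<i] ! b # replicate (p - Suc i) i)) = 0"
  proof (rule sum.neutral, rule ballI)
    fix b assume "b \<in> {..<i}"
    then show "?t ([0..<i][b := i] @ [0..<i] ! b # replicate (p - Suc i) i) = 0"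
      by (intro aext_gen_word_zero[of b]) (auto simp: nth_append)
  qed
  finally show ?thesis by (simp add: aext_gen_word_self[OF i])
qed

lemma codiff_gen_word:
  assumes a: "Suc a < p"
  shows "codiff a p (aext (Suc a) (p - Suc a) (gen_word (Suc a) (p - Suc a))) (gen_word (Suc a) (p - Suc a)) = 1"
proof -
  let ?c = "gen_word (Suc a) (p - Suc a)"
  let ?t = "aext (Suc a) (p - Suc a) ?c :: nat list \<Rightarrow> 'a"
  have len: "length ?c = p" using a by simp
  have "?t (permute_list (transpose a j) ?c) = (if j = a then 1 else 0)" if j: "j \<in> {a..<p}" for j
  proof (cases "j = a")
    case False
    have "?c ! j = Suc a" using False j a by (auto simp: gen_word_def nth_append intro!: nth_replicate)
    then have "permute_list (transpose a j) ?c ! a = Suc a"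
      using False j len a by (simp add: permute_list_transpose)
    then show ?thesis using False len a by (simp add: aext_gen_word_zero[of a])
  qed (use aext_gen_word_self[OF a] in simp)
  then have "codiff a p ?t ?c = (\<Sum>j\<in>{a..<p}. if j = a then 1 else 0)" unfolding codiff_def by (rule sum.cong[OF refl])
  then show ?thesis using a by simp
qed

text \<open>The generator word of index \<open>n + 1\<close> with its letters at positions
  \<open>n\<close> and \<open>n + 1\<close> exchanged. There the codifferential followed by the
  differential has the value 1, independent of \<open>n\<close>.\<close>

definition test_word :: "nat \<Rightarrow> nat \<Rightarrow> nat list" where
  "test_word p n = [0..<n] @ Suc n # n # replicate (p - Suc (Suc n)) (Suc n)"

text \<open>Only the exchange of positions \<open>n\<close> and \<open>n + 1\<close> restores the
  generator word; every other term keeps a letter \<open>n + 1\<close> in an alternating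
  position.\<close>

lemma kdiff_codiff_test_word:
  assumes n: "Suc n < p"
  shows "kdiff n (codiff n p (aext (Suc n) (p - Suc n) (gen_word (Suc n) (p - Suc n)))) (test_word p n) = 1"
proof -
  let ?c = "gen_word (Suc n) (p - Suc n)" and ?R = "n # replicate (p - Suc (Suc n)) (Suc n)"
  let ?t = "aext (Suc n) (p - Suc n) ?c :: nat list \<Rightarrow> 'a"
  have "?t (permute_list (transpose n j) (test_word p n)) = (if j = Suc n then 1 else 0)" if j: "j \<in> {n..<p}" for j
  proof -
    have len: "length (test_word p n) = p" using n by (simp add: test_word_def)
    consider "j = n" | "j = Suc n" | "j > Suc n" using j by fastforce
    then show ?thesis
    proof cases
      case 1
      have "?t (test_word p n) = 0" by (rule aext_gen_word_zero[of n]) (use len n in \<open>auto simp: test_word_def nth_append\<close>)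
      then show ?thesis using 1 by simp
    next
      case 2
      have g: "?c = [0..<n] @ n # Suc n # replicate (p - Suc (Suc n)) (Suc n)" using gen_word_split[OF n] by simp
      have "permute_list (transpose n (Suc n)) (test_word p n) = ?c"
        unfolding g using n len by (subst permute_list_transpose) (auto simp: test_word_def nth_append list_update_append)
      then show ?thesis using 2 aext_gen_word_self[OF n] by simp
    next
      case 3
      then have "test_word p n ! j = Suc n" using j by (auto simp: test_word_def nth_append nth_Cons split: nat.splits)
      then have "permute_list (transpose n j) (test_word p n) ! n = Suc n"
        using 3 j len n by (simp add: permute_list_transpose)
      then show ?thesis using 3 len n by (simp add: aext_gen_word_zero[of n])
    qed
  qed
  then have "codiff n p ?t (test_word p n) = (\<Sum>j\<in>{n..<p}. if j = Suc n then 1 else 0)" unfolding codiff_def by (rule sum.cong[OF refl])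
  then have 1: "codiff n p ?t ([0..<n] @ Suc n # ?R) = 1" using n by (simp add: test_word_def)
  have 2: "codiff n p ?t ([0..<n][b := Suc n] @ [0..<n] ! b # ?R) = 0" if b: "b < n" for b
    unfolding codiff_def
  proof (rule sum.neutral, rule ballI)
    fix j assume j: "j \<in> {n..<p}"
    let ?w = "[0..<n][b := Suc n] @ [0..<n] ! b # ?R"
    have len: "length ?w = p" using n by simp
    then have "permute_list (transpose n j) ?w ! b = Suc n"
      using j b n by (subst permute_list_transpose) (auto simp: nth_append nth_list_update)
    then show "?t (permute_list (transpose n j) ?w) = 0"
      using len b n by (intro aext_gen_word_zero[of b]) auto
  qed
  show ?thesis
    unfolding test_word_def using 1 2 by (simp add: kdiff_split)
qed

text \<open>The \<open>p - n\<close> exchanges of the codifferential fix the generator word, as all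
  letters involved equal \<open>n\<close>. Each of the \<open>n\<close> subtracted terms of the
  outer differential is -1, since there only the trivial exchange avoids a repeated letter. The
  total is \<open>(p - n) + n\<close>.\<close>

lemma kdiff_codiff_kdiff_gen_word:
  assumes n: "n < p" and fact: "of_nat (fact n) \<noteq> (0 :: 'k::field)"
  shows "kdiff n (codiff n p (kdiff n (aext n (p - n) (gen_word n (p - n))))) (gen_word n (p - n)) = (of_nat p :: 'k)"
proof -
  let ?c = "gen_word n (p - n)" and ?R = "replicate (p - Suc n) n"
  define d :: "nat list \<Rightarrow> 'k" where "d = kdiff n (aext n (p - n) ?c)"
  have c: "?c = [0..<n] @ n # ?R" by (rule gen_word_split[OF n])
  have d: "altsym (Suc n) (p - Suc n) p d"
    unfolding d_def using n by (intro altsym_kdiff altsym_aext[OF gen_word_mem(2)] fact) auto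
  have dc: "d ?c = 1" unfolding d_def by (rule kdiff_gen_word[OF n])
  have "permute_list (transpose n j) ?c = ?c" if j: "j \<in> {n..<p}" for j
  proof -
    have "?c ! j = n" "?c ! n = n" using j n by (auto simp: gen_word_def nth_append)
    then have "permute_list (transpose n j) ?c = ?c[n := ?c ! n, j := ?c ! j]"
      using j n by (simp add: permute_list_transpose)
    then show ?thesis by simp
  qed
  then have "codiff n p d ?c = (\<Sum>j\<in>{n..<p}. 1)" unfolding codiff_def using dc by (intro sum.cong) simp_all
  then have 1: "codiff n p d ([0..<n] @ n # ?R) = of_nat (p - n)" by (simp flip: c)
  have 2: "codiff n p d ([0..<n][b := n] @ [0..<n] ! b # ?R) = - 1" if b: "b < n" for b
  proof -
    let ?w = "[0..<n][b := n] @ [0..<n] ! b # ?R"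
    have len: "length ?w = p" using n by simp
    have "d (permute_list (transpose n j) ?w) = (if j = n then - 1 else 0)" if j: "j \<in> {n..<p}" for j
    proof (cases "j = n")
      case True
      have "d ?w = - d ([0..<n] @ n # ?R)" using n b by (intro altsym_swap[OF d]) auto
      then show ?thesis using True dc by (simp flip: c)
    next
      case False
      define v where "v = permute_list (transpose n j) ?w"
      have lv: "length v = p" using len by (simp add: v_def)
      have "?w ! j = n" using False j by (auto simp: nth_append nth_Cons split: nat.splits)
      then have "v ! n = n" "v ! b = n"
        using False j b n len by (auto simp: v_def permute_list_transpose nth_append nth_list_update)
      then have "\<not> distinct (take (Suc n) v)"
        using nth_eq_iff_index_eq[of "take (Suc n) v" b n] \<open>v ! n = n\<close> \<open>v ! b = n\<close> b n lv by auto
      then have "d (take (Suc n) v @ drop (Suc n) v) = 0" using lv n by (intro altsymD(2)[OF d]) auto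
      then show ?thesis using False by (simp add: v_def)
    qed
    then have "codiff n p d ?w = (\<Sum>j\<in>{n..<p}. if j = n then - 1 else 0)" unfolding codiff_def by (rule sum.cong[OF refl])
    then show ?thesis using n by simp
  qed
  have "kdiff n (codiff n p d) ?c = of_nat (p - n) + of_nat n"
    unfolding c using 1 2 by (simp add: kdiff_split)
  then show ?thesis using n by (simp add: d_def of_nat_diff)
qed

definition kdd :: "nat \<Rightarrow> nat \<Rightarrow> nat \<Rightarrow> 'k::field mat" where
  "kdd p i = (SOME d. d \<in> nat_trans (kos p i) (kos p (Suc i)) \<and> comp_nt (kemb p (Suc i)) d = kdn p i)"

definition cdd :: "nat \<Rightarrow> nat \<Rightarrow> nat \<Rightarrow> 'k::field mat" where
  "cdd p a = (SOME d. d \<in> nat_trans (kos p (Suc a)) (kos p a) \<and> comp_nt (kemb p a) d = cdn p a)"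

lemma kdd:
  assumes "i < p" "of_nat (fact i) \<noteq> (0 :: 'k::field)"
  shows "kdd p i \<in> nat_trans (kos p i) (kos p (Suc i) :: 'k spf)" "comp_nt (kemb p (Suc i)) (kdd p i) = (kdn p i :: nat \<Rightarrow> 'k mat)"
  using someI_ex[of "\<lambda>d. d \<in> nat_trans (kos p i) (kos p (Suc i) :: 'k spf) \<and> comp_nt (kemb p (Suc i)) d = kdn p i"]
    koszul_differential[OF assms] unfolding kdd_def by blast+

lemma cdd:
  assumes "a < p"
  shows "cdd p a \<in> nat_trans (kos p (Suc a)) (kos p a :: 'k::field spf)" "comp_nt (kemb p a) (cdd p a) = (cdn p a :: nat \<Rightarrow> 'k mat)"
  using someI_ex[of "\<lambda>d. d \<in> nat_trans (kos p (Suc a)) (kos p a :: 'k spf) \<and> comp_nt (kemb p a) d = cdn p a"]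
    koszul_codifferential[OF assms, where ?'k = 'k] unfolding cdd_def by blast+

lemma gval_kdn: "i < p \<Longrightarrow> gval p i (kdn p i) = 1"
  using gval_labelled[of i p "kdn p i", OF _ kdn_labelled] by (simp add: kdiff_gen_word)

lemma gval_cdn: "Suc a < p \<Longrightarrow> gval p (Suc a) (cdn p a) = 1"
  using gval_labelled[of "Suc a" p "cdn p a", OF _ cdn_labelled] by (simp add: codiff_gen_word)

lemma comp_kdn:
  assumes "f \<in> nat_trans P (kos p i :: 'k::field spf)" "i < p"
  shows "comp_nt (kdn p i) f = comp_nt (kpos p i) (comp_nt (kemb p i) f)"
  unfolding kdn_def using assms by (intro comp_nt_assoc[OF _ kemb_nat_trans kpos_nat_trans]) auto

lemma comp_kdn_kdd:
  assumes "f \<in> nat_trans P (kos p i :: 'k::field spf)" "i < p" "of_nat (fact i) \<noteq> (0 :: 'k)"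
  shows "comp_nt (kdn p i) f = comp_nt (kemb p (Suc i)) (comp_nt (kdd p i) f)"
  using comp_nt_assoc[OF assms(1) kdd(1)[OF assms(2,3)] kemb_nat_trans] kdd(2)[OF assms(2,3)] assms(2) by simp

lemma smult_zero_nt: "smult_nt c (zero_nt F G) = zero_nt F G"
  by (simp add: smult_nt_def zero_nt_def)

lemma smult_nt_0: "f \<in> nat_trans F G \<Longrightarrow> smult_nt 0 f = zero_nt F G"
  by (auto simp: smult_nt_def zero_nt_def fun_eq_iff nat_transD(2,3)[of f F G] intro!: eq_matI)

lemma zero_mat_mult_vec:
  "v \<in> carrier_vec m \<Longrightarrow> 0\<^sub>m n m *\<^sub>v v = (0\<^sub>v n :: 'a::semiring_0 vec)"
  by (auto intro!: eq_vecI sum.neutral simp: scalar_prod_def)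

lemma comp_zero_image:
  assumes f: "f \<in> nat_trans A B" and g: "g \<in> nat_trans B C" and z: "comp_nt g f = zero_nt A C"
  shows "mat_image (f n) \<subseteq> mat_kernel (g n)"
proof
  fix v assume "v \<in> mat_image (f n)"
  then obtain u where u: "u \<in> carrier_vec (fdim A n)" "v = f n *\<^sub>v u"
    using nat_transD(3)[OF f] by (auto simp: mat_image_def)
  have "g n *\<^sub>v v = (g n * f n) *\<^sub>v u"
    unfolding u(2) by (rule assoc_mult_mat_vec[OF nat_transD(1)[OF g] nat_transD(1)[OF f] u(1), symmetric])
  also have "g n * f n = 0\<^sub>m (fdim C n) (fdim A n)" using fun_cong[OF z, of n] by (simp add: comp_nt_def zero_nt_def)
  finally have "g n *\<^sub>v v = 0\<^sub>v (fdim C n)" using u(1) by (simp add: zero_mat_mult_vec)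
  moreover have "v \<in> carrier_vec (fdim B n)" unfolding u(2) by (rule mult_mat_vec_carrier[OF nat_transD(1)[OF f] u(1)])
  ultimately show "v \<in> mat_kernel (g n)" using nat_transD(2,3)[OF g] by (simp add: mat_kernel_def)
qed

lemma zero_exact:
  assumes g: "g \<in> nat_trans B C" "mono_nt g"
  shows "exact_nt (zero_nt A B) g"
proof -
  have "mat_image (0\<^sub>m b a :: 'a mat) = {0\<^sub>v b}" for a b
    by (auto simp: mat_image_def zero_mat_mult_vec image_iff intro!: exI[of _ "0\<^sub>v a"])
  then show ?thesis
    using g(2) nat_transD(3)[OF g(1)] by (simp add: exact_nt_def mono_nt_def zero_nt_def)
qed

lemma mono_nt_of_comp:
  assumes f: "f \<in> nat_trans A B" and g: "g \<in> nat_trans B C" and m: "mono_nt (comp_nt g f)"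
  shows "mono_nt f"
  unfolding mono_nt_def
proof
  fix n
  have "v = 0\<^sub>v (fdim A n)" if "v \<in> mat_kernel (f n)" for v
  proof -
    have v: "v \<in> carrier_vec (fdim A n)" "f n *\<^sub>v v = 0\<^sub>v (fdim B n)"
      using that nat_transD(2,3)[OF f] by (auto simp: mat_kernel_def)
    have "(g n * f n) *\<^sub>v v = g n *\<^sub>v (f n *\<^sub>v v)" by (rule assoc_mult_mat_vec[OF nat_transD(1)[OF g] nat_transD(1)[OF f] v(1)])
    also have "\<dots> = 0\<^sub>v (fdim C n)" unfolding v(2) by (rule mat_zero_vec[OF nat_transD(1)[OF g]])
    finally have "v \<in> mat_kernel (comp_nt g f n)"
      using v(1) nat_transD(2)[OF g] nat_transD(3)[OF f] by (simp add: mat_kernel_def comp_nt_def)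
    then show ?thesis using m nat_transD(3)[OF f] by (simp add: mono_nt_def comp_nt_def)
  qed
  moreover have "0\<^sub>v (fdim A n) \<in> mat_kernel (f n)" unfolding mat_kernel_def nat_transD(2,3)[OF f] by (simp add: mat_zero_vec[OF nat_transD(1)[OF f]])
  ultimately show "mat_kernel (f n) = {0\<^sub>v (dim_col (f n))}" unfolding nat_transD(3)[OF f] by blast
qed

lemma kdn_0: "0 < p \<Longrightarrow> kdn p 0 = kemb p 0"
  by (rule ext) (simp add: kdn_labelled kemb_labelled kdiff_def)

section \<open>The truncated Koszul complex\<close>

definition zspf :: "'k::field spf" where
  "zspf = \<lparr>fdim = (\<lambda>_. 0), fpoly = (\<lambda>_ _. 0\<^sub>m 0 0)\<rparr>"

lemma strict_zspf: "strict_poly_functor e zspf"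
  by (auto simp: strict_poly_functor_def zspf_def act_def intro!: eq_matI)

lemma projective_zspf: "projective_functor e (zspf :: 'k::field spf)"
  unfolding projective_functor_def
proof (intro conjI allI impI ballI strict_zspf)
  fix G H :: "'k spf" and g f
  assume G: "strict_poly_functor e G" and g: "g \<in> nat_trans G H" and f: "f \<in> nat_trans zspf H"
  have "comp_nt g (zero_nt zspf G) = f"
    unfolding comp_zero_right[OF g] using nat_transD(2,3)[OF f]
    by (auto simp: zero_nt_def zspf_def fun_eq_iff intro!: eq_matI)
  then show "\<exists>h\<in>nat_trans zspf G. comp_nt g h = f"
    using nat_trans_zero[OF strict_poly_functorD(1)[OF strict_zspf] strict_poly_functorD(1)[OF G]] by blast
qed

lemma mono_zspf:
  assumes "f \<in> nat_trans zspf G" shows "mono_nt f"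
proof -
  have "dim_col (f n) = 0" for n using nat_transD(3)[OF assms] by (simp add: zspf_def)
  then show ?thesis by (auto simp: mono_nt_def mat_kernel_def intro!: eq_vecI)
qed

text \<open>Homological degree runs against the Koszul index: degree 0 is the term of index
  \<open>n\<close>, degree \<open>n\<close> that of index 0, and beyond it the complex is
  zero.\<close>

definition kres :: "nat \<Rightarrow> nat \<Rightarrow> nat \<Rightarrow> 'k::field spf" where
  "kres p n q = (if q \<le> n then kos p (n - q) else zspf)"

definition krd :: "nat \<Rightarrow> nat \<Rightarrow> nat \<Rightarrow> nat \<Rightarrow> 'k::field mat" where
  "krd p n q = (if q < n then kdd p (n - Suc q) else zero_nt (kres p n (Suc q)) (kres p n q))"

text \<open>All that is known of a hook Weyl functor, itself defined through a choice: a cover and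
  an embedding with the Koszul differential as composite. Questions on maps into \<open>W\<close>
  are lifted along \<open>\<epsilon>\<close> and tested after \<open>\<iota>\<close>.\<close>

locale hook_cover =
  fixes p n :: nat and W :: "'k::field spf" and \<epsilon> \<iota> :: "nat \<Rightarrow> 'k mat"
  assumes np: "n < p" and fact: "\<And>i. i < p \<Longrightarrow> of_nat (fact i) \<noteq> (0 :: 'k)"
    and two: "\<And>i. i < p \<Longrightarrow> i \<le> 1 \<or> (2 :: 'k) \<noteq> 0" and pz: "of_nat p = (0 :: 'k)"
    and W: "strict_poly_functor p W"
    and \<epsilon>: "\<epsilon> \<in> nat_trans (kos p n) W" "epi_nt \<epsilon>" and \<iota>: "\<iota> \<in> nat_trans W (tens p)" "mono_nt \<iota>"
    and \<iota>\<epsilon>: "comp_nt \<iota> \<epsilon> = kdn p n"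
begin

lemma cW: "spf_carrier W" by (rule strict_poly_functorD(1)[OF W])

lemma projective_kos:
  assumes i: "i < p" shows "projective_functor p (kos p i :: 'k spf)"
proof -
  have e: "Suc (p - Suc i) = p - i" "i + (p - i) = p" using i by simp_all
  show ?thesis unfolding kos_def using projective_aspf[OF fact[OF i], where k = "p - Suc i"] unfolding e .
qed

lemma cancel:
  assumes "f \<in> nat_trans P W" "g \<in> nat_trans P W" "comp_nt \<iota> f = comp_nt \<iota> g"
  shows "f = g"
  by (rule mono_nt_cancel[OF \<iota> assms(1,2,3)])

lemma embed_comp:
  "g \<in> nat_trans P (kos p n) \<Longrightarrow> comp_nt \<iota> (comp_nt \<epsilon> g) = comp_nt (kdn p n) g"
  unfolding \<iota>\<epsilon>[symmetric] by (rule comp_nt_assoc[OF _ \<epsilon>(1) \<iota>(1), symmetric])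

lemma lift:
  assumes "i < p" "f \<in> nat_trans (kos p i) W"
  shows "\<exists>g\<in>nat_trans (kos p i) (kos p n). f = comp_nt \<epsilon> g"
proof -
  have "\<exists>g\<in>nat_trans (kos p i) (kos p n). comp_nt \<epsilon> g = f"
    using projective_kos[OF assms(1)] strict_kos[of n p, where ?'a = 'k] W \<epsilon> assms(2) np
    unfolding projective_functor_def by simp
  then show ?thesis by blast
qed

lemma comp_nat_trans: "f \<in> nat_trans (kos p i) (kos p j) \<Longrightarrow> comp_nt \<epsilon>' f \<in> nat_trans (kos p i) W"
  if "\<epsilon>' \<in> nat_trans (kos p j) W"
  by (rule nat_trans_comp[OF _ that spf_carrier_kos spf_carrier_kos cW])

text \<open>A lift of \<open>f\<close> is a map to the term of index \<open>n\<close>. For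
  \<open>i = n + 2\<close> it is already zero; otherwise its composite with the Koszul differential
  goes to index \<open>n + 1\<close>, which is at least two away from \<open>i\<close>.\<close>

lemma hom_zero:
  assumes i: "i < p" "i \<noteq> n" "i \<noteq> Suc n" and f: "f \<in> nat_trans (kos p i) W"
  shows "f = zero_nt (kos p i) W"
proof -
  obtain g where g: "g \<in> nat_trans (kos p i) (kos p n)" "f = comp_nt \<epsilon> g" using lift[OF i(1) f] by blast
  show ?thesis
  proof (cases "i = Suc (Suc n)")
    case True
    then have "g = zero_nt (kos p i) (kos p n)"
      using np by (intro hom_kos_zero[OF i(1) _ i(2) two[OF i(1)] g(1)]) auto
    then show ?thesis by (simp add: g(2) comp_zero_right[OF \<epsilon>(1)])
  next
    case False
    have "comp_nt (kdd p n) g \<in> nat_trans (kos p i) (kos p (Suc n))"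
      by (rule nat_trans_comp[OF g(1) kdd(1)[OF np fact[OF np]]]) (simp_all add: spf_carrier_kos)
    then have z: "comp_nt (kdd p n) g = zero_nt (kos p i) (kos p (Suc n))"
      using np i False by (intro hom_kos_zero[OF i(1) _ i(3) two[OF i(1)]]) auto
    have "comp_nt \<iota> f = zero_nt (kos p i) (tens p)"
      unfolding g(2) embed_comp[OF g(1)] comp_kdn_kdd[OF g(1) np fact[OF np]] z
      using np by (intro comp_zero_right[OF kemb_nat_trans]) simp
    also have "\<dots> = comp_nt \<iota> (zero_nt (kos p i) W)" by (rule comp_zero_right[OF \<iota>(1), symmetric])
    finally show ?thesis by (intro cancel[OF f] nat_trans_zero spf_carrier_kos cW)
  qed
qed

text \<open>The weight argument compares distinct Koszul terms, so endomorphisms of the term of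
  index \<open>n\<close> are followed by the differential. Maps from index \<open>n\<close> to
  \<open>n + 1\<close> are multiples of it, and \<open>\<iota>\<close> cancels.\<close>

lemma hom_same:
  assumes f: "f \<in> nat_trans (kos p n) W"
  shows "f = smult_nt (gval p n (comp_nt \<iota> f)) \<epsilon>"
proof -
  obtain g where g: "g \<in> nat_trans (kos p n) (kos p n)" "f = comp_nt \<epsilon> g" using lift[OF np f] by blast
  define h where "h = comp_nt (kdd p n) g"
  note d = kdd[OF np fact[OF np]]
  have h: "h \<in> nat_trans (kos p n) (kos p (Suc n))"
    unfolding h_def by (rule nat_trans_comp[OF g(1) d(1)]) (simp_all add: spf_carrier_kos)
  have E: "kemb p (Suc n) \<in> nat_trans (kos p (Suc n)) (tens p :: 'k spf)" using np by (intro kemb_nat_trans) simp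
  have \<iota>f: "comp_nt \<iota> f = comp_nt (kemb p (Suc n)) h"
    unfolding g(2) embed_comp[OF g(1)] comp_kdn_kdd[OF g(1) np fact[OF np]] h_def ..
  have "gval p n (comp_nt (aemb (Suc n) (p - Suc n) p) (kdd p n :: nat \<Rightarrow> 'k mat)) = 1"
    using d(2) gval_kdn[OF np, where ?'a = 'k] by (simp add: kemb_def)
  then have "h = smult_nt (gval p n (comp_nt (aemb (Suc n) (p - Suc n) p) h)) (kdd p n)"
    using np by (intro hom_kos_proportional[OF np _ _ two[OF np] h d(1)]) auto
  then have h': "h = smult_nt (gval p n (comp_nt \<iota> f)) (kdd p n)" unfolding \<iota>f kemb_def .
  have "comp_nt \<iota> f = smult_nt (gval p n (comp_nt \<iota> f)) (comp_nt \<iota> \<epsilon>)"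
    unfolding \<iota>\<epsilon> d(2)[symmetric] comp_smult_right[OF d(1) E, symmetric] h'[symmetric] by (rule \<iota>f)
  also have "\<dots> = comp_nt \<iota> (smult_nt (gval p n (comp_nt \<iota> f)) \<epsilon>)" by (rule comp_smult_right[OF \<epsilon>(1) \<iota>(1), symmetric])
  finally show ?thesis by (rule cancel[OF f nat_trans_smult[OF \<epsilon>(1) spf_carrier_kos cW]])
qed

text \<open>The Koszul codifferential followed by the cover; it spans the maps from the term of
  index \<open>n + 1\<close>.\<close>

definition \<delta> where "\<delta> = comp_nt \<epsilon> (cdd p n)"

lemma \<delta>_nat_trans: "\<delta> \<in> nat_trans (kos p (Suc n)) W"
  unfolding \<delta>_def by (rule comp_nat_trans[OF \<epsilon>(1) cdd(1)[OF np]])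

lemma hom_next:
  assumes n: "Suc n < p" and f: "f \<in> nat_trans (kos p (Suc n)) W"
  shows "\<exists>c. f = smult_nt c \<delta>"
proof -
  obtain g where g: "g \<in> nat_trans (kos p (Suc n)) (kos p n)" "f = comp_nt \<epsilon> g" using lift[OF n f] by blast
  have "gval p (Suc n) (comp_nt (aemb n (p - n) p) (cdd p n :: nat \<Rightarrow> 'k mat)) = 1"
    using cdd(2)[OF np, where ?'k = 'k] gval_cdn[OF n, where ?'a = 'k] by (simp add: kemb_def)
  then have "g = smult_nt (gval p (Suc n) (comp_nt (aemb n (p - n) p) g)) (cdd p n)"
    using np by (intro hom_kos_proportional[OF n _ _ two[OF n] g(1) cdd(1)]) auto
  then show ?thesis unfolding \<delta>_def g(2) comp_smult_right[OF cdd(1)[OF np] \<epsilon>(1), symmetric] by metis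
qed

lemma \<epsilon>_nonzero: "\<epsilon> \<noteq> zero_nt (kos p n) W"
proof
  assume "\<epsilon> = zero_nt (kos p n) W"
  then have "kdn p n = zero_nt (kos p n) (tens p :: 'k spf)" unfolding \<iota>\<epsilon>[symmetric] using comp_zero_right[OF \<iota>(1)] by simp
  then show False using gval_kdn[OF np, where ?'a = 'k] gval_zero[OF np, where ?'k = 'k] by simp
qed

lemma embed_\<delta>: "comp_nt \<iota> \<delta> = comp_nt (kpos p n) (cdn p n)"
  unfolding \<delta>_def embed_comp[OF cdd(1)[OF np]] comp_kdn[OF cdd(1)[OF np] np] cdd(2)[OF np] ..

lemma \<delta>_nonzero:
  assumes n: "Suc n < p" shows "\<delta> \<noteq> zero_nt (kos p (Suc n)) W"
proof
  let ?N = "Suc (Suc n)" and ?c = "gen_word (Suc n) (p - Suc n)"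
  let ?L = "awords (Suc n) (p - Suc n) p ?N"
  assume "\<delta> = zero_nt (kos p (Suc n)) W"
  then have "comp_nt (kpos p n) (cdn p n) = zero_nt (kos p (Suc n)) (tens p :: 'k spf)"
    unfolding embed_\<delta>[symmetric] using comp_zero_right[OF \<iota>(1)] by simp
  from fun_cong[OF this, of ?N]
  have "labelled_mat (words p ?N) ?L (\<lambda>w l. kdiff n (codiff n p (aext (Suc n) (p - Suc n) l)) w) =
      (0\<^sub>m (length (words p ?N)) (length ?L) :: 'k mat)"
    unfolding comp_nt_def cdn_labelled[OF np] kpos_mult[OF np] zero_nt_def fdim_kos by (simp add: tens_def)
  also have "\<dots> = labelled_mat (words p ?N) ?L (\<lambda>_ _. 0)" by (intro eq_matI) auto
  finally have "kdiff n (codiff n p (aext (Suc n) (p - Suc n) ?c)) (test_word p n) = (0 :: 'k)"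
  proof (rule labelled_mat_eqD)
    show "test_word p n \<in> set (words p ?N)" using n by (auto simp: in_words_iff test_word_def)
    show "?c \<in> set ?L" by (rule gen_word_mem(2)[OF n])
  qed
  then show False by (simp add: kdiff_codiff_test_word[OF n])
qed

text \<open>By \<open>hom_same\<close> the composite is a multiple of \<open>\<epsilon>\<close>, and
  the multiple can be read off at the generator, where it is \<open>p\<close>.\<close>

lemma \<delta>_kdd: "comp_nt \<delta> (kdd p n) = zero_nt (kos p n) W"
proof -
  note d = kdd[OF np fact[OF np]]
  have E: "kemb p (Suc n) \<in> nat_trans (kos p (Suc n)) (tens p :: 'k spf)" using np by (intro kemb_nat_trans) simp
  define f where "f = comp_nt \<delta> (kdd p n)"
  have f: "f \<in> nat_trans (kos p n) W" unfolding f_def by (rule comp_nat_trans[OF \<delta>_nat_trans d(1)])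
  have "comp_nt \<iota> f = comp_nt (comp_nt \<iota> \<delta>) (kdd p n)"
    unfolding f_def by (rule comp_nt_assoc[OF d(1) \<delta>_nat_trans \<iota>(1), symmetric])
  also have "\<dots> = comp_nt (kpos p n) (comp_nt (cdn p n) (kdd p n))"
    unfolding embed_\<delta> by (rule comp_nt_assoc[OF d(1) cdn_nat_trans[OF np] kpos_nat_trans[OF np]])
  also have "comp_nt (cdn p n) (kdd p n :: nat \<Rightarrow> 'k mat) = comp_nt (cpos p n) (kdn p n)"
    unfolding cdn_def d(2)[symmetric] by (rule comp_nt_assoc[OF d(1) E cpos_nat_trans[OF np]])
  finally have \<iota>f: "comp_nt \<iota> f = comp_nt (kpos p n) (comp_nt (cpos p n) (kdn p n))" .
  have "comp_nt \<iota> f N = labelled_mat (words p N) (awords n (p - n) p N)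
      (\<lambda>w l. kdiff n (codiff n p (kdiff n (aext n (p - n) l))) w)" for N
    unfolding \<iota>f by (simp add: comp_nt_def kdn_labelled[OF np] cpos_mult[OF np] kpos_mult[OF np])
  from gval_labelled[of n p "comp_nt \<iota> f", OF np this]
  have "gval p n (comp_nt \<iota> f) = 0" by (simp add: kdiff_codiff_kdiff_gen_word[OF np fact[OF np]] pz)
  with hom_same[OF f] show ?thesis unfolding f_def[symmetric] using smult_nt_0[OF \<epsilon>(1)] by simp
qed

text \<open>All differentials of the Hom complex vanish: two adjacent terms are both nonzero only
  for \<open>j = n\<close>, where \<open>\<delta>_kdd\<close> applies.\<close>

lemma comp_kdd_zero:
  assumes j: "Suc j < p" and f: "f \<in> nat_trans (kos p (Suc j)) W"
  shows "comp_nt f (kdd p j) = zero_nt (kos p j) W"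
proof -
  have jp: "j < p" using j by simp
  note d = kdd(1)[OF jp fact[OF jp]]
  consider "j = n" | "Suc j = n" | "j \<noteq> n" "Suc j \<noteq> n" by blast
  then show ?thesis
  proof cases
    case 1
    obtain c where "f = smult_nt c \<delta>" using hom_next f j unfolding 1 by blast
    then show ?thesis
      using comp_smult_left[OF d[unfolded 1] \<delta>_nat_trans] \<delta>_kdd by (simp add: 1 smult_zero_nt)
  next
    case 2
    then show ?thesis by (intro hom_zero[OF jp _ _ comp_nat_trans[OF f d]]) auto
  next
    case 3
    then have "f = zero_nt (kos p (Suc j)) W" by (intro hom_zero[OF j _ _ f]) auto
    then show ?thesis by (simp add: comp_zero_left[OF d])
  qed
qed

text \<open>That the square of the differential is zero needs no computation, because maps between
  Koszul terms two apart vanish.\<close>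

lemma kdd_kdd:
  assumes "Suc i < p"
  shows "comp_nt (kdd p (Suc i)) (kdd p i) = zero_nt (kos p i) (kos p (Suc (Suc i)) :: 'k spf)"
proof -
  have i: "i < p" using assms by simp
  have "comp_nt (kdd p (Suc i)) (kdd p i) \<in> nat_trans (kos p i) (kos p (Suc (Suc i)) :: 'k spf)"
    by (rule nat_trans_comp[OF kdd(1)[OF i fact[OF i]] kdd(1)[OF assms fact[OF assms]]]) (simp_all add: spf_carrier_kos)
  then show ?thesis using assms by (intro hom_kos_zero[OF i _ _ two[OF i]]) auto
qed

text \<open>\<open>kdiff 0\<close> is the identity, so the first differential is the inclusion of
  symmetric tensors; this closes the resolution at its far end.\<close>

lemma kdd_0_mono: "mono_nt (kdd p 0 :: nat \<Rightarrow> 'k mat)"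
proof -
  have p: "0 < p" using np by simp
  have E: "kemb p (Suc 0) \<in> nat_trans (kos p (Suc 0)) (tens p :: 'k spf)" using p by (intro kemb_nat_trans) simp
  have "mono_nt (comp_nt (kemb p (Suc 0)) (kdd p 0 :: nat \<Rightarrow> 'k mat))"
    unfolding kdd(2)[OF p fact[OF p]] kdn_0[OF p] by (rule kemb_mono) simp
  then show ?thesis by (rule mono_nt_of_comp[OF kdd(1)[OF p fact[OF p]] E])
qed

lemma resolution: "projective_resolution p (kres p n) (krd p n) \<epsilon> W"
  unfolding projective_resolution_def
proof (intro conjI allI)
  have carr: "spf_carrier (kres p n i :: 'k spf)" for i
    by (simp add: kres_def spf_carrier_kos strict_poly_functorD(1)[OF strict_zspf])
  show "projective_functor p (kres p n i :: 'k spf)" for i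
    using np by (simp add: kres_def projective_kos projective_zspf)
  show d: "krd p n i \<in> nat_trans (kres p n (Suc i)) (kres p n i :: 'k spf)" for i
  proof (cases "i < n")
    case True
    then have "Suc (n - Suc i) = n - i" "n - Suc i < p" using np by simp_all
    then show ?thesis using True kdd(1)[OF _ fact, of "n - Suc i"] by (simp add: krd_def kres_def)
  next
    case False
    then show ?thesis using nat_trans_zero[OF carr carr] by (simp add: krd_def)
  qed
  show "\<epsilon> \<in> nat_trans (kres p n 0) W" using \<epsilon>(1) by (simp add: kres_def)
  show "epi_nt \<epsilon>" by (rule \<epsilon>(2))
  show "exact_nt (krd p n 0) \<epsilon>"
  proof (cases n)
    case 0
    have p: "0 < p" using np by simp
    have "mono_nt (comp_nt \<iota> \<epsilon>)" unfolding \<iota>\<epsilon> 0 kdn_0[OF p] by (rule kemb_mono) simp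
    then have "mono_nt \<epsilon>" by (rule mono_nt_of_comp[OF \<epsilon>(1) \<iota>(1)])
    then show ?thesis using zero_exact[OF \<epsilon>(1)] 0 by (simp add: krd_def kres_def)
  next
    case (Suc a)
    have a: "a < p" "Suc a < p" using Suc np by simp_all
    note d = kdd[OF a(1) fact[OF a(1)]]
    have "comp_nt \<epsilon> (kdd p a) = zero_nt (kos p a) W"
      by (rule hom_zero[OF a(1) _ _ comp_nat_trans[OF \<epsilon>(1)]]) (use d(1) Suc in auto)
    then have "mat_image (kdd p a N) \<subseteq> mat_kernel (\<epsilon> N)" for N
      by (rule comp_zero_image[OF d(1) \<epsilon>(1)[unfolded Suc]])
    moreover have "mat_kernel (\<epsilon> N) \<subseteq> mat_image (kdd p a N)" for N
      by (rule koszul_exact[OF a(2) fact[OF a(1)] d \<epsilon>(1)[unfolded Suc] \<iota>(1) \<iota>\<epsilon>[unfolded Suc]])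
    ultimately show ?thesis by (auto simp: exact_nt_def krd_def Suc)
  qed
  show "exact_nt (krd p n (Suc i)) (krd p n i :: nat \<Rightarrow> 'k mat)" for i
  proof -
    consider "Suc i < n" | "Suc i = n" | "n \<le> i" by linarith
    then show ?thesis
    proof cases
      case 1
      define a where "a = n - Suc (Suc i)"
      have e: "n - Suc i = Suc a" "Suc a < p" "a < p" using 1 np by (simp_all add: a_def)
      note d = kdd[OF e(3) fact[OF e(3)]] and d' = kdd[OF e(2) fact[OF e(2)]]
      have E: "kemb p (Suc (Suc a)) \<in> nat_trans (kos p (Suc (Suc a))) (tens p :: 'k spf)" using e by (intro kemb_nat_trans) simp
      have "mat_image (kdd p a N) \<subseteq> mat_kernel (kdd p (Suc a) N :: 'k mat)" for N
        by (rule comp_zero_image[OF d(1) d'(1) kdd_kdd[OF e(2)]])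
      moreover have "mat_kernel (kdd p (Suc a) N) \<subseteq> mat_image (kdd p a N :: 'k mat)" for N
        by (rule koszul_exact[OF e(2) fact[OF e(3)] d d'(1) E d'(2)])
      ultimately show ?thesis using 1 by (auto simp: exact_nt_def krd_def e(1) simp flip: a_def)
    next
      case 2
      have p: "0 < p" using np by simp
      have e: "(krd p n i :: nat \<Rightarrow> 'k mat) = kdd p 0"
        "(krd p n (Suc i) :: nat \<Rightarrow> 'k mat) = zero_nt (kres p n (Suc (Suc i))) (kos p 0)"
        using 2 by (auto simp: krd_def kres_def)
      show ?thesis unfolding e by (rule zero_exact[OF kdd(1)[OF p fact[OF p]] kdd_0_mono])
    next
      case 3
      have "kres p n (Suc i) = (zspf :: 'k spf)" using 3 by (simp add: kres_def)
      then have "mono_nt (krd p n i :: nat \<Rightarrow> 'k mat)" using d[of i] mono_zspf by simp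
      then show ?thesis using zero_exact[OF d[of i]] 3 by (simp add: krd_def[of p n "Suc i"])
    qed
  qed
qed

end

text \<open>With zero differentials every map is a cocycle and only zero is a coboundary, so the Ext
  group is the Hom space itself.\<close>

lemma Ext_eq_Hom:
  fixes M N :: "'k::field spf"
  assumes Q: "projective_resolution e Q d \<epsilon> M" and M: "strict_poly_functor e M" and N: "spf_carrier N"
    and van: "\<And>q f. f \<in> nat_trans (Q q) N \<Longrightarrow> comp_nt f (d q) = zero_nt (Q (Suc q)) N"
  shows "(\<And>f. f \<in> nat_trans (Q q) N \<Longrightarrow> f = zero_nt (Q q) N) \<Longrightarrow> isomorphic_spaces (Ext e q M N) zero_space"
    "h \<in> nat_trans (Q q) N \<Longrightarrow> h \<noteq> zero_nt (Q q) N \<Longrightarrow> (\<And>f. f \<in> nat_trans (Q q) N \<Longrightarrow> \<exists>c. f = smult_nt c h) \<Longrightarrow>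
      isomorphic_spaces (Ext e q M N) ground_field"
proof -
  note Q' = projective_resolutionD[OF Q]
  have coc: "cocycles Q d N q = nat_trans (Q q) N" using van by (auto simp: cocycles_def)
  have cob: "coboundaries Q d N q = {zero_nt (Q q) N}"
  proof (cases q)
    case (Suc q')
    have "zero_nt (Q q') N \<in> nat_trans (Q q') N" by (rule nat_trans_zero[OF Q'(3) N])
    then show ?thesis using van[of _ q'] unfolding Suc by (auto simp: image_iff)
  qed simp
  have z: "zero_nt (Q q) N \<in> nat_trans (Q q) N" by (rule nat_trans_zero[OF Q'(3) N])
  show "isomorphic_spaces (Ext e q M N) zero_space" if "\<And>f. f \<in> nat_trans (Q q) N \<Longrightarrow> f = zero_nt (Q q) N"
  proof -
    have one: "nat_trans (Q q) N = {zero_nt (Q q) N}" using that z by blast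
    show ?thesis
      by (rule Ext_by_resolution[OF Q M N vectorspace_zero_space, of "\<lambda>_. ()"])
         (auto simp: coc cob one LinearCombinations.module_hom_def zero_space_def)
  qed
  show "isomorphic_spaces (Ext e q M N) ground_field"
    if h: "h \<in> nat_trans (Q q) N" "h \<noteq> zero_nt (Q q) N" and ex: "\<And>f. f \<in> nat_trans (Q q) N \<Longrightarrow> \<exists>c. f = smult_nt c h"
  proof -
    \<comment> \<open>The isomorphism with the field is the ratio to \<open>h\<close> of a fixed
      matrix entry at which \<open>h\<close> is nonzero.\<close>
    obtain n i j where ij: "i < fdim N n" "j < fdim (Q q) n" "h n $$ (i, j) \<noteq> 0"
      using nt_eqI[OF h(1) z] h(2) nt_index(1)[OF h(1)] by metis
    define \<psi> where "\<psi> f = f n $$ (i, j) / h n $$ (i, j)" for f :: "nat \<Rightarrow> 'k mat"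
    have add: "\<psi> (add_nt f g) = \<psi> f + \<psi> g" if "f \<in> nat_trans (Q q) N" "g \<in> nat_trans (Q q) N" for f g
      using nt_index(3)[OF that(1) ij(1,2) that(2)] by (simp add: \<psi>_def add_divide_distrib)
    have smult: "\<psi> (smult_nt c f) = c * \<psi> f" if "f \<in> nat_trans (Q q) N" for f c
      using nt_index(2)[OF that ij(1,2)] by (simp add: \<psi>_def)
    have \<psi>h: "\<psi> h = 1" using ij(3) by (simp add: \<psi>_def)
    show ?thesis
    proof (rule Ext_by_resolution[OF Q M N vectorspace_ground_field, of \<psi>])
      show "\<psi> \<in> LinearCombinations.module_hom class_ring (hom_space (Q q) N\<lparr>carrier := cocycles Q d N q\<rparr>) ground_field"
        using add smult by (auto simp: LinearCombinations.module_hom_def coc ground_field_def)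
      have "c \<in> \<psi> ` nat_trans (Q q) N" for c
        using nat_trans_smult[OF h(1) Q'(3) N, of c] smult[OF h(1), of c] \<psi>h by (intro image_eqI[of _ _ "smult_nt c h"]) simp_all
      then show "\<psi> ` cocycles Q d N q = carrier ground_field" by (auto simp: coc ground_field_def)
      have "f = zero_nt (Q q) N" if f: "f \<in> nat_trans (Q q) N" "\<psi> f = 0" for f
      proof -
        obtain c where c: "f = smult_nt c h" using ex[OF f(1)] by blast
        then have "c = 0" using f(2) smult[OF h(1), of c] \<psi>h by simp
        then show ?thesis using smult_nt_0[OF h(1)] c by simp
      qed
      moreover have "\<psi> (zero_nt (Q q) N) = 0" using nt_index(1)[OF h(1) ij(1,2)] by (simp add: \<psi>_def)
      ultimately have "{f \<in> nat_trans (Q q) N. \<psi> f = 0} = {zero_nt (Q q) N}" using z by blast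
      then show "coboundaries Q d N q = {f \<in> cocycles Q d N q. \<psi> f = \<zero>\<^bsub>ground_field\<^esub>}"
        by (simp add: coc cob ground_field_def)
    qed
  qed
qed

lemma hook_cover_exists:
  assumes char: "CHAR('k::field) = p" and n: "n < p"
  shows "\<exists>\<epsilon> \<iota>. hook_cover p n (hook_weyl p n :: 'k spf) \<epsilon> \<iota>"
proof -
  have "prime CHAR('k)" by (rule prime_CHAR_semidom) (use char n in simp)
  then have p: "prime p" by (simp add: char)
  have z: "of_nat c = (0 :: 'k) \<longleftrightarrow> p dvd c" for c using of_nat_eq_0_iff_char_dvd[of c, where ?'a = 'k] by (simp add: char)
  have fact: "of_nat (fact i) \<noteq> (0 :: 'k)" if "i < p" for i
    unfolding z using prime_dvd_fact_iff[OF p, of i] that by simp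
  \<comment> \<open>If 2 vanishes in the field, then \<open>p\<close> divides 2, so
    \<open>i < p\<close> leaves only \<open>i \<le> 1\<close>, where there are no two letters to
    exchange.\<close>
  have two: "i \<le> 1 \<or> (2 :: 'k) \<noteq> 0" if "i < p" for i
  proof (rule ccontr)
    assume "\<not> ?thesis"
    then have "of_nat 2 = (0 :: 'k)" "2 < p" using that by simp_all
    then show False unfolding z by (auto dest: dvd_imp_le)
  qed
  have e: "Suc (p - Suc n) = p - n" "p = Suc n + (p - Suc n)" using n by simp_all
  obtain \<epsilon> \<iota> where c: "\<epsilon> \<in> nat_trans (aspf n (p - n) p) (hook_weyl p n :: 'k spf)" "epi_nt \<epsilon>"
      "\<iota> \<in> nat_trans (hook_weyl p n) (tens p)" "mono_nt \<iota>"
      "\<And>N. \<iota> N * \<epsilon> N = labelled_mat (words p N) (awords n (p - n) p N) (\<lambda>w l. kdiff n (aext n (p - n) l) w)"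
    and s: "strict_poly_functor p (hook_weyl p n :: 'k spf)"
    using hook_weyl_cover[OF e(2) fact[OF n]] unfolding e(1) by blast
  have "hook_cover p n (hook_weyl p n) \<epsilon> \<iota>"
  proof
    show "of_nat p = (0 :: 'k)" by (simp add: z)
    show "\<epsilon> \<in> nat_trans (kos p n) (hook_weyl p n)" using c(1) by (simp add: kos_def)
    show "comp_nt \<iota> \<epsilon> = kdn p n" by (rule ext) (simp add: comp_nt_def c(5) kdn_labelled[OF n])
  qed (use n c s fact two in auto)
  then show ?thesis by blast
qed

theorem corollary2p7:
  fixes p m n q :: nat
  assumes "CHAR('k::field) = p" and "p > 0"
    and "m \<le> p - 1" and "n \<le> p - 1"
  shows "if (n = m \<and> q = 0) \<or> (n < m \<and> (q = m - n - 1 \<or> q = m - n))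
         then isomorphic_spaces (Ext p q (hook_weyl p m :: 'k spf) (hook_weyl p n)) ground_field
         else isomorphic_spaces (Ext p q (hook_weyl p m :: 'k spf) (hook_weyl p n)) zero_space"
proof -
  have mn: "m < p" "n < p" using assms(2-4) by simp_all
  obtain \<epsilon> \<iota> where "hook_cover p m (hook_weyl p m :: 'k spf) \<epsilon> \<iota>" using hook_cover_exists[OF assms(1) mn(1)] by blast
  then interpret M: hook_cover p m "hook_weyl p m :: 'k spf" \<epsilon> \<iota> .
  obtain \<epsilon>' \<iota>' where "hook_cover p n (hook_weyl p n :: 'k spf) \<epsilon>' \<iota>'" using hook_cover_exists[OF assms(1) mn(2)] by blast
  then interpret N: hook_cover p n "hook_weyl p n :: 'k spf" \<epsilon>' \<iota>' .
  let ?N = "hook_weyl p n :: 'k spf"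
  have cz: "spf_carrier (zspf :: 'k spf)" by (rule strict_poly_functorD(1)[OF strict_zspf])
  have from_zero: "f = zero_nt zspf G" if "f \<in> nat_trans zspf G" for f and G :: "'k spf"
    using nat_transD(2,3)[OF that] by (auto simp: zero_nt_def zspf_def fun_eq_iff intro!: eq_matI)
  \<comment> \<open>In degrees below \<open>m\<close> this is \<open>comp_kdd_zero\<close> for the
    target; from \<open>m\<close> on the resolution has zero differentials.\<close>
  have van: "comp_nt f (krd p m r) = zero_nt (kres p m (Suc r)) ?N" if f: "f \<in> nat_trans (kres p m r) ?N" for r f
  proof (cases "r < m")
    case True
    define j where "j = m - Suc r"
    have j: "m - r = Suc j" "Suc j < p" using True mn by (simp_all add: j_def)
    show ?thesis
      using N.comp_kdd_zero[OF j(2), of f] f True by (simp add: krd_def kres_def j(1) flip: j_def)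
  next
    case False
    then show ?thesis using comp_zero_right[OF f] by (simp add: krd_def)
  qed
  note Ext = Ext_eq_Hom[OF M.resolution M.W N.cW van, where q = q]
  show ?thesis
  proof (cases "q \<le> m")
    case True
    \<comment> \<open>The degrees with a nonzero Hom space are those with \<open>m - q\<close> equal
      to \<open>n\<close> or \<open>n + 1\<close>, that is, \<open>q = m - n\<close> and, if
      \<open>n < m\<close>, also \<open>q = m - n - 1\<close>.\<close>
    have Q: "kres p m q = kos p (m - q)" using True by (simp add: kres_def)
    consider "m - q = n" | "m - q = Suc n" | "m - q \<noteq> n" "m - q \<noteq> Suc n" by blast
    then show ?thesis
    proof cases
      case 1
      have "isomorphic_spaces (Ext p q (hook_weyl p m) ?N) ground_field"
        by (rule Ext(2)[of \<epsilon>']) (use N.\<epsilon>(1) N.\<epsilon>_nonzero N.hom_same in \<open>auto simp: Q 1\<close>)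
      moreover have "(n = m \<and> q = 0) \<or> (n < m \<and> (q = m - n - 1 \<or> q = m - n))" using 1 True by auto
      ultimately show ?thesis by (simp only: if_P if_not_P if_True if_False)
    next
      case 2
      then have n: "Suc n < p" using mn by simp
      have "isomorphic_spaces (Ext p q (hook_weyl p m) ?N) ground_field"
        by (rule Ext(2)[of N.\<delta>]) (use N.\<delta>_nat_trans N.\<delta>_nonzero[OF n] N.hom_next[OF n] in \<open>auto simp: Q 2\<close>)
      moreover have "(n = m \<and> q = 0) \<or> (n < m \<and> (q = m - n - 1 \<or> q = m - n))" using 2 True by auto
      ultimately show ?thesis by (simp only: if_P if_not_P if_True if_False)
    next
      case 3
      have "isomorphic_spaces (Ext p q (hook_weyl p m) ?N) zero_space"
        by (rule Ext(1)) (use N.hom_zero[OF _ 3] mn in \<open>auto simp: Q\<close>)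
      moreover have "\<not> ((n = m \<and> q = 0) \<or> (n < m \<and> (q = m - n - 1 \<or> q = m - n)))" using 3 True by auto
      ultimately show ?thesis by (simp only: if_P if_not_P if_True if_False)
    qed
  next
    case False
    then have "kres p m q = (zspf :: 'k spf)" by (simp add: kres_def)
    then have "isomorphic_spaces (Ext p q (hook_weyl p m) ?N) zero_space"
      by (intro Ext(1)) (use from_zero in auto)
    moreover have "\<not> ((n = m \<and> q = 0) \<or> (n < m \<and> (q = m - n - 1 \<or> q = m - n)))" using False by auto
    ultimately show ?thesis by (simp only: if_P if_not_P if_True if_False)
  qed
qed

end
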